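(* Let $m,n\in\mathbf N$, $A_0,\dots,A_{m-1}\in\mathbb G^\infty_{n\times n}$, $t_0\in I$, $X_0,\dots,X_{m-1}\in\mathbf C^{n\times n}$, and let $F\in\mathcal R^{n\times n\prime}$ satisfy $F=0$ for $t<t_0$. Consider the Cauchy problem $$(\ast)\qquad X^{(m)}-A_{m-1}X^{(m-1)}-\dots-A_0X=F,\qquad X^{(k)}=X_k\ \text{ for } t<t_0,\quad 0\le k\le m-1,$$ whose solution is by definition the unique solution $Z\in\mathcal R^{n\times n\prime}$ of $$(\ast\ast)\qquad Z^{(m)}-\sum_{j=0}^{m-1}X_j\delta_{t_0}^{(m-j-1)\alpha}-\sum_{k=0}^{m-1}A_k\Bigl(Z^{(k)}-\sum_{j=0}^{k-1}X_j\delta_{t_0}^{(k-j-1)\alpha}\Bigr)=F,\qquad Z^{(k)}=0\ \text{ for } t<t_0,\ 0\le k\le m-1,$$ where $\alpha\in\mathbf C$ is arbitrary. Then: 1) The solution of the Cauchy problem $(\ast)$ does not depend on $\alpha$ in $(\ast\ast)$. 2) If $F$ is a regular distribution, then the solution of the Cauchy problem $(\ast)$ coincides for $t>t_0$ with the solution of the corresponding ordinary Cauchy problem $$X^{(m)}-A_{m-1}X^{(m-1)}-\dots-A_0X=F,\qquad X^{(k)}(t_0+)=X_k,\quad 0\le k\le m-1 .$$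
   Context: $I=(a,b)\subset\mathbf R$ is an open interval (e.g. $I=\mathbf R$), $\mathbf N_0=\mathbf N\cup\{0\}$; functions are identified when equal almost everywhere. $\mathbb G$ is the algebra of essentially bounded $g:I\to\mathbf C$ possessing both limits $g(t\pm)=\operatorname{ess\,lim}_{s\to t\pm}g(s)$ at every $t\in I$; $\sigma_t(g):=g(t+)-g(t-)$. $\mathbb G^\infty$ is the algebra of $g\in\mathbb G$ such that for every $k\in\mathbf N$ there is $g^{(k)}\in\mathbb G$ with $g^{(k)}(t\pm)=\operatorname{ess\,lim}_{s\to t\pm}\frac{g^{(k-1)}(s)-g^{(k-1)}(t\pm)}{s-t}$ for all $t\in I$ ($g^{(0)}=g$), with the norms $\|g\|_k=\max_{0\le i\le k}\|g^{(i)}\|_{L_\infty}$, $k\in\mathbf N_0$. For $g\in\mathbb G$, $\operatorname{supp}(g)$ is the closure in $I$ of $\{t: g(t-)\ne0\text{ or }g(t+)\ne0\}$. $\mathcal R$ is the space of $\varphi\in\mathbb G^\infty$ with compact support in $I$, with the locally convex inductive limit topology of the countably normed spaces $\{\varphi\in\mathbb G^\infty:\varphi=0\text{ outside }J\}$ (norms $\|\cdot\|_k$), $J$ running over bounded subintervals with $\bar J\subset I$. $\mathcal R'$ is the space of continuous linear functionals $f:\mathcal R\to\mathbf C$, $\varphi\mapsto(f,\varphi)$. A locally summable function $f$ on $I$ is identified with the (regular) distribution $(f,\varphi)=\int_I f\varphi\,dt$. For $g\in\mathbb G^\infty$, $f\in\mathcal R'$: $(gf,\varphi):=(f,g\varphi)$.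 For $\alpha\in\mathbf C$, $k\in\mathbf N_0$: $(\delta_{t_0}^{(k)\alpha},\varphi):=(-1)^k\bigl(\alpha\varphi^{(k)}(t_0+)+(1-\alpha)\varphi^{(k)}(t_0-)\bigr)$. Derivative: let $\mathbb C$ be the bounded continuous functions on $I$; $\mathbb F_k\subset\mathbb G^\infty$ is the set of $g$ with $g^{(i)}\in\mathbb C$ for all $i\ne k$ and $g^{(k)}$ piecewise continuous (locally finitely many discontinuities); $\mathbb F$ is the linear span of all $\mathbb F_k$, $k\in\mathbf N_0$; $\mathcal R_F=\mathcal R\cap\mathbb F$. $\Delta\subset\mathcal R'$ is the set of $g\in\mathcal R'$ for which there is $c:I\to\mathbf C$ with $(g,\varphi)=\sum_{t\in I}c(t)\sigma_t(\varphi)$ for all $\varphi\in\mathcal R_F$ (a finite sum). For $f\in\mathcal R'$ let $(\frac{df}{dt},\varphi):=-(f,\varphi')$; a derivative of $f$ is any element $f'$ of $D(f):=\frac{df}{dt}+\Delta$ (differentiation is multivalued). Higher derivatives are defined inductively: $f^{(0)}=f$, $f^{(k+1)}\in D(f^{(k)})$; $f$ and a given $m$-th derivative $f^{(m)}$ determine the intermediate derivatives uniquely. $\mathcal R^{n\times n\prime}$ is the space of $n\times n$ matrices of elements of $\mathcal R'$, $\mathbb G^\infty_{n\times n}$ the $n\times n$ matrices with entries in $\mathbb G^\infty$; operations are entrywise, with matrix products as usual. "$F=0$ for $t<t_0$" means $(F,\varphi)=0$ for all $\varphi\in\mathcal R$ with $\operatorname{supp}(\varphi)\subset(a,t_0)$.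 A solution of an $m$-th order equation $Z^{(m)}-\sum_{k<m}A_kZ^{(k)}=H$ is $Z\in\mathcal R^{n\times n\prime}$ possessing an $m$-th derivative $Z^{(m)}$ (with intermediate derivatives $Z',\dots,Z^{(m-1)}$) such that the equation holds as an identity on all $\varphi\in\mathcal R$; the initial conditions refer to these derivatives. With homogeneous initial conditions and right-hand side vanishing for $t<t_0$ the solution exists and is unique. The ordinary Cauchy problem is understood on $(t_0,b)$ in the sense of functions with locally absolutely continuous $(m-1)$-th derivative satisfying the equation a.e. *)

theory Defs
  imports
    "HOL-Analysis.Analysis"
    "HOL-Probability.Essential_Supremum"
    "HOL-Library.Function_Algebras"
begin

text \<open>
  Throughout, \<open>I\<close> is the open interval. Functions on \<open>I\<close> are represented by total functions
  on the reals whose values outside \<open>I\<close> are irrelevant. The identification of functions that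
  agree almost everywhere is not made by a quotient: all notions below are invariant under
  changing a representative on a null set.
\<close>

section \<open>Dynamic test functions\<close>

text \<open>\<open>(g \<longlongrightarrow> l) (ess_at_right t)\<close> says that \<open>l\<close> is the essential limit of \<open>g\<close> at \<open>t+\<close>: for every
  neighbourhood \<open>V\<close> of \<open>l\<close> there is \<open>d > 0\<close> with \<open>g s \<in> V\<close> for almost all \<open>s\<close> in \<open>{t<..<t+d}\<close>.\<close>

definition ess_at_right :: "real \<Rightarrow> real filter" where
  "ess_at_right t = inf (at_right t) (ae_filter lebesgue)"

definition ess_at_left :: "real \<Rightarrow> real filter" where
  "ess_at_left t = inf (at_left t) (ae_filter lebesgue)"

definition rlim :: "(real \<Rightarrow> complex) \<Rightarrow> real \<Rightarrow> complex" where
  "rlim g t = Lim (ess_at_right t) g"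

definition llim :: "(real \<Rightarrow> complex) \<Rightarrow> real \<Rightarrow> complex" where
  "llim g t = Lim (ess_at_left t) g"

definition jump :: "real \<Rightarrow> (real \<Rightarrow> complex) \<Rightarrow> complex" where
  "jump t g = rlim g t - llim g t"

definition GG :: "real set \<Rightarrow> (real \<Rightarrow> complex) set" where
  "GG I = {g. g \<in> borel_measurable (lebesgue_on I)
            \<and> (\<exists>B. AE t in lebesgue_on I. norm (g t) \<le> B)
            \<and> (\<forall>t\<in>I. (\<exists>l. (g \<longlongrightarrow> l) (ess_at_right t)) \<and> (\<exists>l. (g \<longlongrightarrow> l) (ess_at_left t)))}"

definition is_gderiv :: "real set \<Rightarrow> (real \<Rightarrow> complex) \<Rightarrow> (real \<Rightarrow> complex) \<Rightarrow> bool" where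
  "is_gderiv I g h \<longleftrightarrow> h \<in> GG I
     \<and> (\<forall>t\<in>I. ((\<lambda>s. (g s - rlim g t) / of_real (s - t)) \<longlongrightarrow> rlim h t) (ess_at_right t)
            \<and> ((\<lambda>s. (g s - llim g t) / of_real (s - t)) \<longlongrightarrow> llim h t) (ess_at_left t))"

definition Ginf :: "real set \<Rightarrow> (real \<Rightarrow> complex) set" where
  "Ginf I = {g \<in> GG I. \<exists>d. d 0 = g \<and> (\<forall>k. is_gderiv I (d k) (d (Suc k)))}"

text \<open>An element \<open>h\<close> of \<open>GG I\<close> is determined almost everywhere by its one-sided limits, so the
  choice made here is unique up to null sets.\<close>

definition gderiv :: "real set \<Rightarrow> (real \<Rightarrow> complex) \<Rightarrow> real \<Rightarrow> complex" where
  "gderiv I g = (SOME h. is_gderiv I g h)"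

definition gderivs :: "real set \<Rightarrow> nat \<Rightarrow> (real \<Rightarrow> complex) \<Rightarrow> real \<Rightarrow> complex" where
  "gderivs I k g = (gderiv I ^^ k) g"

definition Linf_norm :: "real set \<Rightarrow> (real \<Rightarrow> complex) \<Rightarrow> real" where
  "Linf_norm I g = real_of_ereal (esssup (lebesgue_on I) (\<lambda>t. ereal (norm (g t))))"

definition Gnorm :: "real set \<Rightarrow> nat \<Rightarrow> (real \<Rightarrow> complex) \<Rightarrow> real" where
  "Gnorm I k g = Max ((\<lambda>i. Linf_norm I (gderivs I i g)) ` {..k})"

definition gsupp :: "real set \<Rightarrow> (real \<Rightarrow> complex) \<Rightarrow> real set" where
  "gsupp I g = closure {t \<in> I. llim g t \<noteq> 0 \<or> rlim g t \<noteq> 0} \<inter> I"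

definition RR :: "real set \<Rightarrow> (real \<Rightarrow> complex) set" where
  "RR I = {\<phi> \<in> Ginf I. compact (gsupp I \<phi>)}"


section \<open>The inductive limit topology and the dual space\<close>

definition steps :: "real set \<Rightarrow> real set set" where
  "steps I = {J. is_interval J \<and> bounded J \<and> closure J \<subseteq> I}"

definition Rstep :: "real set \<Rightarrow> real set \<Rightarrow> (real \<Rightarrow> complex) set" where
  "Rstep I J = {\<phi> \<in> Ginf I. AE t in lebesgue_on I. t \<notin> J \<longrightarrow> \<phi> t = 0}"

text \<open>Basic neighbourhoods of zero of the locally convex inductive limit: the absolutely convex
  sets whose trace on every step is a neighbourhood of zero there. (In a step, the sets
  \<open>Gnorm I k \<phi> < e\<close> form a base at zero, since the norms increase with \<open>k\<close>.)\<close>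

definition abs_convex :: "(real \<Rightarrow> complex) set \<Rightarrow> bool" where
  "abs_convex U \<longleftrightarrow> (\<forall>\<phi>\<in>U. \<forall>\<psi>\<in>U. \<forall>c d :: complex. norm c + norm d \<le> 1 \<longrightarrow>
     (\<lambda>t. c * \<phi> t + d * \<psi> t) \<in> U)"

definition zero_nbhd :: "real set \<Rightarrow> (real \<Rightarrow> complex) set \<Rightarrow> bool" where
  "zero_nbhd I U \<longleftrightarrow> U \<subseteq> RR I \<and> abs_convex U
     \<and> (\<forall>J\<in>steps I. \<exists>k. \<exists>e>0. {\<phi> \<in> Rstep I J. Gnorm I k \<phi> < e} \<subseteq> U)"

definition RR_open :: "real set \<Rightarrow> (real \<Rightarrow> complex) set \<Rightarrow> bool" where
  "RR_open I W \<longleftrightarrow> W \<subseteq> RR I \<and> (\<forall>\<phi>\<in>W. \<exists>U. zero_nbhd I U \<and> (\<lambda>\<psi>. \<phi> + \<psi>) ` U \<subseteq> W)"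

definition RR_topology :: "real set \<Rightarrow> (real \<Rightarrow> complex) topology" where
  "RR_topology I = topology (RR_open I)"

lemma Gnorm_mono: "k \<le> l \<Longrightarrow> Gnorm I k g \<le> Gnorm I l g"
  unfolding Gnorm_def by (intro Max_mono image_mono) auto

lemma zero_nbhd_Int:
  assumes U: "zero_nbhd I U" and V: "zero_nbhd I V"
  shows "zero_nbhd I (U \<inter> V)"
  unfolding zero_nbhd_def
proof (intro conjI ballI)
  show "U \<inter> V \<subseteq> RR I" using U by (auto simp: zero_nbhd_def)
  show "abs_convex (U \<inter> V)" using U V unfolding zero_nbhd_def abs_convex_def by simp
  fix J assume J: "J \<in> steps I"
  obtain k e where 1: "e > 0" "{\<phi> \<in> Rstep I J. Gnorm I k \<phi> < e} \<subseteq> U"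
    using U J unfolding zero_nbhd_def by meson
  obtain l e' where 2: "e' > 0" "{\<phi> \<in> Rstep I J. Gnorm I l \<phi> < e'} \<subseteq> V"
    using V J unfolding zero_nbhd_def by meson
  have "{\<phi> \<in> Rstep I J. Gnorm I (max k l) \<phi> < min e e'} \<subseteq> U \<inter> V"
  proof
    fix \<phi> assume \<phi>: "\<phi> \<in> {\<phi> \<in> Rstep I J. Gnorm I (max k l) \<phi> < min e e'}"
    have "Gnorm I k \<phi> \<le> Gnorm I (max k l) \<phi>" "Gnorm I l \<phi> \<le> Gnorm I (max k l) \<phi>"
      by (simp_all add: Gnorm_mono)
    then show "\<phi> \<in> U \<inter> V" using \<phi> 1(2) 2(2) by fastforce
  qed
  then show "\<exists>k. \<exists>e>0. {\<phi> \<in> Rstep I J. Gnorm I k \<phi> < e} \<subseteq> U \<inter> V"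
    using 1(1) 2(1) by (metis min_less_iff_conj)
qed

lemma istopology_RR_open: "istopology (RR_open I)"
  unfolding istopology_def
proof (intro conjI allI impI)
  fix S T assume S: "RR_open I S" and T: "RR_open I T"
  show "RR_open I (S \<inter> T)"
    unfolding RR_open_def
  proof (intro conjI ballI)
    show "S \<inter> T \<subseteq> RR I" using S by (auto simp: RR_open_def)
    fix \<phi> assume "\<phi> \<in> S \<inter> T"
    then obtain U V where "zero_nbhd I U" "(\<lambda>\<psi>. \<phi> + \<psi>) ` U \<subseteq> S"
      "zero_nbhd I V" "(\<lambda>\<psi>. \<phi> + \<psi>) ` V \<subseteq> T"
      using S T unfolding RR_open_def by (meson IntD1 IntD2)
    then show "\<exists>U. zero_nbhd I U \<and> (\<lambda>\<psi>. \<phi> + \<psi>) ` U \<subseteq> S \<inter> T"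
      by (intro exI[of _ "U \<inter> V"]) (auto intro: zero_nbhd_Int)
  qed
next
  fix K :: "(real \<Rightarrow> complex) set set" assume K: "\<forall>W\<in>K. RR_open I W"
  show "RR_open I (\<Union>K)"
    unfolding RR_open_def
  proof (intro conjI ballI)
    show "\<Union>K \<subseteq> RR I" using K by (auto simp: RR_open_def)
    fix \<phi> assume "\<phi> \<in> \<Union>K"
    then obtain W where W: "W \<in> K" "\<phi> \<in> W" by blast
    then obtain U where "zero_nbhd I U" "(\<lambda>\<psi>. \<phi> + \<psi>) ` U \<subseteq> W"
      using K unfolding RR_open_def by meson
    then show "\<exists>U. zero_nbhd I U \<and> (\<lambda>\<psi>. \<phi> + \<psi>) ` U \<subseteq> \<Union>K"
      using W by blast
  qed
qed

lemma openin_RR_topology: "openin (RR_topology I) W \<longleftrightarrow> RR_open I W"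
  by (simp add: RR_topology_def istopology_RR_open topology_inverse')

type_synonym functional = "(real \<Rightarrow> complex) \<Rightarrow> complex"

text \<open>Continuity forces a functional to agree on test functions that are equal almost everywhere.
  The values of a functional outside \<open>RR I\<close> are irrelevant; equality in the dual space is
  agreement on \<open>RR I\<close>.\<close>

definition RR_dual :: "real set \<Rightarrow> functional set" where
  "RR_dual I = {f. (\<forall>\<phi>\<in>RR I. \<forall>\<psi>\<in>RR I. f (\<phi> + \<psi>) = f \<phi> + f \<psi>)
                 \<and> (\<forall>c. \<forall>\<phi>\<in>RR I. f (\<lambda>t. c * \<phi> t) = c * f \<phi>)
                 \<and> continuous_map (RR_topology I) euclidean f}"

definition locally_summable :: "real set \<Rightarrow> (real \<Rightarrow> complex) \<Rightarrow> bool" where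
  "locally_summable I f \<longleftrightarrow> (\<forall>K. compact K \<and> K \<subseteq> I \<longrightarrow> set_integrable lebesgue K f)"

definition regular_dist :: "real set \<Rightarrow> (real \<Rightarrow> complex) \<Rightarrow> functional" where
  "regular_dist I f \<phi> = (LINT t:I|lebesgue. f t * \<phi> t)"

definition gmult :: "(real \<Rightarrow> complex) \<Rightarrow> functional \<Rightarrow> functional" where
  "gmult g f \<phi> = f (g * \<phi>)"

definition delta :: "real set \<Rightarrow> real \<Rightarrow> nat \<Rightarrow> complex \<Rightarrow> functional" where
  "delta I t0 k \<alpha> \<phi> =
     (-1) ^ k * (\<alpha> * rlim (gderivs I k \<phi>) t0 + (1 - \<alpha>) * llim (gderivs I k \<phi>) t0)"


section \<open>Multivalued differentiation\<close>

definition bdd_continuous :: "real set \<Rightarrow> (real \<Rightarrow> complex) \<Rightarrow> bool" where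
  "bdd_continuous I g \<longleftrightarrow>
     (\<exists>h. (AE t in lebesgue_on I. g t = h t) \<and> continuous_on I h \<and> bounded (h ` I))"

definition pw_continuous :: "real set \<Rightarrow> (real \<Rightarrow> complex) \<Rightarrow> bool" where
  "pw_continuous I g \<longleftrightarrow>
     (\<exists>h. (AE t in lebesgue_on I. g t = h t)
        \<and> (\<forall>K. compact K \<and> K \<subseteq> I \<longrightarrow> finite {t \<in> K. \<not> isCont h t}))"

definition FFk :: "real set \<Rightarrow> nat \<Rightarrow> (real \<Rightarrow> complex) set" where
  "FFk I k = {g \<in> Ginf I. (\<forall>i. i \<noteq> k \<longrightarrow> bdd_continuous I (gderivs I i g))
                        \<and> pw_continuous I (gderivs I k g)}"

definition FF :: "real set \<Rightarrow> (real \<Rightarrow> complex) set" where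
  "FF I = {g. \<exists>(N::nat) c h. (\<forall>i<N. h i \<in> (\<Union>k. FFk I k)) \<and> g = (\<lambda>t. \<Sum>i<N. c i * h i t)}"

definition RRF :: "real set \<Rightarrow> (real \<Rightarrow> complex) set" where
  "RRF I = RR I \<inter> FF I"

text \<open>For \<open>\<phi> \<in> RRF I\<close> only finitely many jumps are nonzero, so the sum is a genuine finite sum.\<close>

definition jump_dists :: "real set \<Rightarrow> functional set" where
  "jump_dists I = {g \<in> RR_dual I. \<exists>c :: real \<Rightarrow> complex. \<forall>\<phi>\<in>RRF I.
     g \<phi> = (\<Sum>t | t \<in> I \<and> jump t \<phi> \<noteq> 0. c t * jump t \<phi>)}"

definition base_deriv :: "real set \<Rightarrow> functional \<Rightarrow> functional" where
  "base_deriv I f \<phi> = - f (gderiv I \<phi>)"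

definition derivs :: "real set \<Rightarrow> functional \<Rightarrow> functional set" where
  "derivs I f = {f' \<in> RR_dual I. \<exists>d\<in>jump_dists I. \<forall>\<phi>\<in>RR I. f' \<phi> = base_deriv I f \<phi> + d \<phi>}"


section \<open>Matrices of distributions\<close>

type_synonym 'n dist_mat = "functional ^ 'n ^ 'n"

definition RR_dual_mat :: "real set \<Rightarrow> 'n::finite dist_mat set" where
  "RR_dual_mat I = {Z. \<forall>i j. Z $ i $ j \<in> RR_dual I}"

definition Ginf_mat :: "real set \<Rightarrow> (real \<Rightarrow> complex ^ 'n ^ 'n::finite) set" where
  "Ginf_mat I = {A. \<forall>i j. (\<lambda>t. A t $ i $ j) \<in> Ginf I}"

definition dist_mat_eq :: "real set \<Rightarrow> 'n::finite dist_mat \<Rightarrow> 'n dist_mat \<Rightarrow> bool" where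
  "dist_mat_eq I Z W \<longleftrightarrow> (\<forall>i j. \<forall>\<phi>\<in>RR I. (Z $ i $ j) \<phi> = (W $ i $ j) \<phi>)"

definition derivs_mat :: "real set \<Rightarrow> 'n::finite dist_mat \<Rightarrow> 'n dist_mat set" where
  "derivs_mat I Z = {Z'. \<forall>i j. Z' $ i $ j \<in> derivs I (Z $ i $ j)}"

definition gmult_mat :: "(real \<Rightarrow> complex ^ 'n ^ 'n) \<Rightarrow> 'n::finite dist_mat \<Rightarrow> 'n dist_mat" where
  "gmult_mat A Z = (\<chi> i j. \<Sum>p\<in>UNIV. gmult (\<lambda>t. A t $ i $ p) (Z $ p $ j))"

definition const_mult_dist :: "complex ^ 'n ^ 'n \<Rightarrow> functional \<Rightarrow> 'n::finite dist_mat" where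
  "const_mult_dist X f = (\<chi> i j. (\<lambda>\<phi>. X $ i $ j * f \<phi>))"

definition vanishes_before :: "real set \<Rightarrow> real \<Rightarrow> 'n::finite dist_mat \<Rightarrow> bool" where
  "vanishes_before I t0 Z \<longleftrightarrow>
     (\<forall>i j. \<forall>\<phi>\<in>RR I. gsupp I \<phi> \<subseteq> {..<t0} \<longrightarrow> (Z $ i $ j) \<phi> = 0)"

definition regular_mat :: "real set \<Rightarrow> (real \<Rightarrow> complex ^ 'n ^ 'n) \<Rightarrow> 'n::finite dist_mat \<Rightarrow> bool" where
  "regular_mat I f F \<longleftrightarrow> (\<forall>i j. locally_summable I (\<lambda>t. f t $ i $ j)
     \<and> (\<forall>\<phi>\<in>RR I. (F $ i $ j) \<phi> = regular_dist I (\<lambda>t. f t $ i $ j) \<phi>))"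

definition coincides_after ::
    "real set \<Rightarrow> real \<Rightarrow> 'n::finite dist_mat \<Rightarrow> (real \<Rightarrow> complex ^ 'n ^ 'n) \<Rightarrow> bool" where
  "coincides_after I t0 Z x \<longleftrightarrow> (\<forall>i j. \<forall>\<phi>\<in>RR I. gsupp I \<phi> \<subseteq> {t0<..} \<longrightarrow>
     (Z $ i $ j) \<phi> = regular_dist (I \<inter> {t0<..}) (\<lambda>t. x t $ i $ j) \<phi>)"


section \<open>The Cauchy problems\<close>

text \<open>\<open>Zd k\<close> is the \<open>k\<close>-th derivative of \<open>Z\<close>; differences and sums of matrices of distributions are
  pointwise. The intermediate derivatives are determined by \<open>Z\<close> and its \<open>m\<close>-th derivative.\<close>

definition cauchy_solution ::
    "real set \<Rightarrow> nat \<Rightarrow> (nat \<Rightarrow> real \<Rightarrow> complex ^ 'n ^ 'n) \<Rightarrow> real \<Rightarrow> (nat \<Rightarrow> complex ^ 'n ^ 'n)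
      \<Rightarrow> 'n::finite dist_mat \<Rightarrow> complex \<Rightarrow> 'n dist_mat \<Rightarrow> bool" where
  "cauchy_solution I m A t0 X F \<alpha> Z \<longleftrightarrow> Z \<in> RR_dual_mat I \<and>
     (\<exists>Zd. Zd 0 = Z
       \<and> (\<forall>k<m. Zd (Suc k) \<in> derivs_mat I (Zd k))
       \<and> dist_mat_eq I
           (Zd m - (\<Sum>j<m. const_mult_dist (X j) (delta I t0 (m - j - 1) \<alpha>))
             - (\<Sum>k<m. gmult_mat (A k)
                 (Zd k - (\<Sum>j<k. const_mult_dist (X j) (delta I t0 (k - j - 1) \<alpha>)))))
           F
       \<and> (\<forall>k<m. vanishes_before I t0 (Zd k)))"

definition abs_continuous_on :: "real set \<Rightarrow> (real \<Rightarrow> 'a::real_normed_vector) \<Rightarrow> bool" where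
  "abs_continuous_on S f \<longleftrightarrow> (\<forall>e>0. \<exists>d>0. \<forall>\<D>. \<D> division_of \<Union>\<D> \<and> \<Union>\<D> \<subseteq> S
     \<and> (\<Sum>K\<in>\<D>. Sup K - Inf K) < d \<longrightarrow> (\<Sum>K\<in>\<D>. norm (f (Sup K) - f (Inf K))) < e)"

definition ordinary_solution ::
    "ereal \<Rightarrow> nat \<Rightarrow> (nat \<Rightarrow> real \<Rightarrow> complex ^ 'n ^ 'n) \<Rightarrow> real \<Rightarrow> (nat \<Rightarrow> complex ^ 'n ^ 'n)
      \<Rightarrow> (real \<Rightarrow> complex ^ 'n ^ 'n) \<Rightarrow> (real \<Rightarrow> complex ^ 'n ^ 'n::finite) \<Rightarrow> bool" where
  "ordinary_solution b m A t0 X f x \<longleftrightarrow>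
     (\<exists>y. y 0 = x
       \<and> (\<forall>k. Suc k < m \<longrightarrow>
            (\<forall>t\<in>einterval (ereal t0) b. (y k has_vector_derivative y (Suc k) t) (at t)))
       \<and> (\<forall>c d. {c..d} \<subseteq> einterval (ereal t0) b \<longrightarrow> abs_continuous_on {c..d} (y (m - 1)))
       \<and> (AE t in lebesgue_on (einterval (ereal t0) b).
            (y (m - 1) has_vector_derivative y m t) (at t)
            \<and> y m t - (\<Sum>k<m. A k t ** y k t) = f t)
       \<and> (\<forall>k<m. (y k \<longlongrightarrow> X k) (at_right t0)))"

end

theory Submission
  imports Defs
begin

text \<open>Every test function without jumps is a limit of antiderivatives of piecewise polynomials, and these lie in
  \<open>FF I\<close>. Hence \<open>jump_dists I\<close> consists exactly of the functionals that vanish on test functions without jumps, and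
  \<open>h\<close> is a derivative of \<open>w\<close> if and only if \<open>h \<phi> = - w \<phi>'\<close> for all \<open>\<phi>\<close> without jumps. On such \<open>\<phi>\<close> the distribution
  \<open>\<delta>\<^sup>\<alpha>\<close> does not see \<open>\<alpha>\<close>, so after subtracting the deltas from the derivatives of \<open>Z\<close> one gets a first order system
  \<open>y' = B y + G\<close> without \<open>\<alpha>\<close>, for distributions vanishing before \<open>t0\<close>.

  If \<open>B\<close> is cut off to the left of some \<open>c < t0\<close>, fundamental matrices \<open>V' = B V\<close>, \<open>U' = - U B\<close>, \<open>V U = 1\<close> turn this
  system into \<open>(U y)' = U G\<close>. A distribution \<open>h\<close> vanishing before \<open>t0\<close> has exactly one antiderivative vanishing
  before \<open>t0\<close>, namely \<open>\<psi> \<mapsto> h (\<eta> \<Psi>)\<close>, where \<open>\<Psi> t\<close> is the integral of \<open>\<psi>\<close> from \<open>t\<close> to the right end of \<open>I\<close> and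
  \<open>\<eta>\<close> is a continuous ramp which is \<open>0\<close> to the left of \<open>c\<close> and \<open>1\<close> near \<open>[t0, \<infinity>)\<close>.

  For regular \<open>F\<close>, integration by parts shows that the solutions of the ordinary problem, extended by zero, solve the
  same first order system; uniqueness identifies them with \<open>Z\<close>.\<close>

section \<open>Absolute continuity and Volterra equations\<close>

text \<open>The obstacle is that a derivative is fixed only on test functions without jumps, while a
  solution has to be determined on all of \<open>RR I\<close>. Uniqueness survives because to the
  right of any point before \<open>t0\<close> every test function is the derivative of one without
  jumps, and a distribution vanishing before \<open>t0\<close> sees nothing else. Fundamental
  matrices fit for the same reason: their entries have no jumps, so multiplying by them stays in the
  class of test functions on which derivatives are known. Iteration takes place on the side of the
  coefficients, where sup norm estimates are at hand, and not among distributions. The coefficients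
  may jump, so \<open>V\<close> and \<open>U\<close> solve integral equations; and \<open>V\<close>
  and \<open>U\<close> may grow towards the ends of \<open>I\<close>, which is why multipliers
  belong to \<open>Ginf I\<close> only locally. Since \<open>jump_dists I\<close> is defined by
  values on \<open>RRF I\<close>, the step to all test functions without jumps is an approximation
  in an arbitrary norm \<open>Gnorm I k\<close>. Its difficulty is that the approximating derivative
  must have integral exactly zero, for otherwise its antiderivative has no compact support.\<close>

text \<open>Tags outside \<open>N\<close> are handled by the straddle estimate of differentiability;
  tags in \<open>N\<close> belong to intervals of small total length, where absolute continuity
  alone bounds the increments. It serves integration by parts and the ordinary problem, whose top
  derivative exists only almost everywhere.\<close>

lemma abs_continuous_on_has_integral_deriv:
  fixes f :: "real \<Rightarrow> 'a::banach"
  assumes ac: "abs_continuous_on {a..b} f" and ab: "a \<le> b" and N: "negligible N"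
    and der: "\<And>x. x \<in> {a..b} - N \<Longrightarrow> (f has_vector_derivative g x) (at x within {a..b})"
  shows "(g has_integral f b - f a) {a..b}"
proof -
  define h where "h x = (if x \<in> N then 0 else g x)" for x
  have "(h has_integral f b - f a) {a..b}"
    unfolding has_integral_real
  proof (intro allI impI)
    fix e :: real assume e: "e > 0"
    \<comment> \<open>The \<open>+ 1\<close> avoids a zero denominator when \<open>a = b\<close> and
      makes the sum of the errors strictly smaller than \<open>e / 2\<close>.\<close>
    define e1 where "e1 = e / (2 * (b - a + 1))"
    have e1: "e1 > 0" using e ab by (simp add: e1_def)
    have e1b: "e1 * (b - a) < e / 2"
    proof -
      have "e1 * (b - a) < e1 * (b - a + 1)" using e1 by simp
      also have "\<dots> = e / 2" using ab by (simp add: e1_def field_simps)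
      finally show ?thesis .
    qed
    have "\<exists>d>0. \<forall>y\<in>{a..b}. \<bar>y - x\<bar> < d \<longrightarrow> norm (f y - f x - (y - x) *\<^sub>R g x) \<le> e1 * \<bar>y - x\<bar>"
      if x: "x \<in> {a..b} - N" for x
    proof -
      have "(f has_derivative (\<lambda>h. h *\<^sub>R g x)) (at x within {a..b})"
        using der[OF x] by (simp add: has_vector_derivative_def)
      from this[unfolded has_derivative_within_alt, THEN conjunct2, rule_format, OF e1]
      show ?thesis by (simp only: real_norm_def)
    qed
    then obtain dd where dd: "\<And>x. x \<in> {a..b} - N \<Longrightarrow> dd x > 0"
      "\<And>x y. x \<in> {a..b} - N \<Longrightarrow> y \<in> {a..b} \<Longrightarrow> \<bar>y - x\<bar> < dd x \<Longrightarrow>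
         norm (f y - f x - (y - x) *\<^sub>R g x) \<le> e1 * \<bar>y - x\<bar>"
      by metis
    obtain \<delta> where \<delta>: "\<delta> > 0" and acd: "\<And>\<D>. \<D> division_of \<Union>\<D> \<Longrightarrow> \<Union>\<D> \<subseteq> {a..b} \<Longrightarrow>
        (\<Sum>K\<in>\<D>. Sup K - Inf K) < \<delta> \<Longrightarrow> (\<Sum>K\<in>\<D>. norm (f (Sup K) - f (Inf K))) < e / 2"
      using ac[unfolded abs_continuous_on_def, THEN spec, THEN mp, OF half_gt_zero[OF e]] by blast
    obtain T where T: "open T" "N \<subseteq> T" "T - N \<in> lmeasurable" "emeasure lebesgue (T - N) < ennreal \<delta>"
      using sets_lebesgue_outer_open[OF negligible_imp_sets[OF N] \<delta>] by metis
    have Tm: "T \<in> lmeasurable" "measure lebesgue T < \<delta>"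
    proof -
      have eq: "T = (T - N) \<union> N" using T(2) by blast
      show "T \<in> lmeasurable" by (subst eq) (intro fmeasurable.Un T(3) negligible_imp_measurable N)
      have "measure lebesgue T \<le> measure lebesgue (T - N) + measure lebesgue N"
        by (subst eq) (intro measure_Un_le fmeasurableD T(3) negligible_imp_measurable N)
      also have "\<dots> = measure lebesgue (T - N)" by (simp add: negligible_imp_measure0[OF N])
      also have "\<dots> < \<delta>"
        using T(3,4) \<delta> by (simp add: emeasure_eq_measure2 ennreal_less_iff)
      finally show "measure lebesgue T < \<delta>" .
    qed
    \<comment> \<open>Tags always lie in \<open>{a..b}\<close>; the last branch only makes
      \<open>\<gamma>\<close> a gauge on the whole line.\<close>
    define \<gamma> where "\<gamma> x = (if x \<in> N then T else if x \<in> {a..b} then ball x (dd x) else UNIV - {a..b})" for x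
    have gg: "gauge \<gamma>"
      unfolding gauge_def \<gamma>_def using T dd(1) by (auto simp: open_Diff)
    have est: "norm ((\<Sum>(x,k)\<in>\<D>. measure lborel k *\<^sub>R h x) - (f b - f a)) < e"
      if D: "\<D> tagged_division_of {a..b}" and fine: "\<gamma> fine \<D>" for \<D>
    proof -
      have fin: "finite \<D>" using D by auto
      have K: "\<exists>u v. K = {u..v} \<and> u \<le> v \<and> x \<in> {u..v} \<and> {u..v} \<subseteq> {a..b}" if "(x, K) \<in> \<D>" for x K
        using tagged_division_ofD(2,3,4)[OF D that] by (force simp: box_real)
      define DN where "DN = {p \<in> \<D>. fst p \<in> N}"
      have DNsub: "DN \<subseteq> \<D>" by (auto simp: DN_def)
      have pDN: "DN tagged_partial_division_of {a..b}"
        using D DNsub tagged_partial_division_subset tagged_division_of_def by blast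
      have tDN: "DN tagged_division_of \<Union>(snd ` DN)"
        by (rule tagged_partial_division_of_Union_self[OF pDN])
      have dDN: "snd ` DN division_of \<Union>(snd ` DN)"
        by (rule division_of_tagged_division[OF tDN])
      have KDN: "K \<subseteq> T \<inter> {a..b} \<and> (\<exists>u v. K = {u..v} \<and> u \<le> v)" if KK: "K \<in> snd ` DN" for K
      proof -
        obtain x where x: "(x, K) \<in> \<D>" "x \<in> N" using KK by (auto simp: DN_def)
        have "K \<subseteq> \<gamma> x" using fine x by (auto simp: fine_def)
        then have "K \<subseteq> T" using x by (simp add: \<gamma>_def)
        then show ?thesis using K[OF x(1)] by auto
      qed
      have sN: "(\<Sum>(x,K)\<in>DN. norm (f (Sup K) - f (Inf K))) < e / 2"
      proof -
        \<comment> \<open>\<open>Sup\<close> and \<open>Inf\<close> of the empty set are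
          unspecified, while the lemma on tagged divisions wants a function that vanishes on
          degenerate boxes.\<close>
        define D where "D K = (if K = {} then 0 else norm (f (Sup K) - f (Inf K)))" for K
        have "(\<Sum>(x,K)\<in>DN. D K) = (\<Sum>K\<in>snd ` DN. D K)"
        proof (rule sum.over_tagged_division_lemma[OF tDN])
          fix u v :: real assume "box u v = {}"
          then have "v \<le> u" by (simp add: box_real)
          then show "D (cbox u v) = 0"
            by (cases "u = v") (auto simp: D_def)
        qed
        moreover have "K \<noteq> {}" if "K \<in> snd ` DN" for K using KDN[OF that] by auto
        then have "(\<Sum>K\<in>snd ` DN. D K) = (\<Sum>K\<in>snd ` DN. norm (f (Sup K) - f (Inf K)))"
          and "(\<Sum>(x,K)\<in>DN. D K) = (\<Sum>(x,K)\<in>DN. norm (f (Sup K) - f (Inf K)))"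
          by (force simp: D_def intro!: sum.cong)+
        ultimately have "(\<Sum>(x,K)\<in>DN. norm (f (Sup K) - f (Inf K))) = (\<Sum>K\<in>snd ` DN. norm (f (Sup K) - f (Inf K)))"
          by simp
        also have "\<dots> < e / 2"
        proof (rule acd[OF dDN])
          show "\<Union>(snd ` DN) \<subseteq> {a..b}" using KDN by blast
          have "(\<Sum>K\<in>snd ` DN. Sup K - Inf K) = (\<Sum>K\<in>snd ` DN. measure lebesgue K)"
          proof (rule sum.cong[OF refl])
            fix K assume "K \<in> snd ` DN"
            from KDN[OF this] show "Sup K - Inf K = measure lebesgue K" by auto
          qed
          also have "\<dots> = measure lebesgue (\<Union>(snd ` DN))"
            by (rule content_division[OF dDN])
          also have "\<dots> \<le> measure lebesgue T"
            by (rule measure_mono_fmeasurable) (use KDN Tm(1) fmeasurableD[OF lmeasurable_division[OF dDN]] in auto)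
          finally show "(\<Sum>K\<in>snd ` DN. Sup K - Inf K) < \<delta>" using Tm(2) by simp
        qed
        finally show ?thesis .
      qed
      have each: "norm (measure lborel k *\<^sub>R h x - (f (Sup k) - f (Inf k)))
            \<le> e1 * measure lborel k + (if x \<in> N then norm (f (Sup k) - f (Inf k)) else 0)"
        if xk: "(x, k) \<in> \<D>" for x k
      proof -
        obtain u v where k: "k = {u..v}" "u \<le> v" "x \<in> {u..v}" "{u..v} \<subseteq> {a..b}" using K[OF xk] by blast
        show ?thesis
        proof (cases "x \<in> N")
          case True
          then show ?thesis using k e1 by (simp add: h_def norm_minus_commute)
        next
          case False
          have xab: "x \<in> {a..b} - N" using False k by auto
          have "k \<subseteq> \<gamma> x" using fine xk by (auto simp: fine_def)
          then have "{u..v} \<subseteq> ball x (dd x)" using False xab k by (auto simp: \<gamma>_def)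
          then have "\<bar>u - x\<bar> < dd x" "\<bar>v - x\<bar> < dd x"
            using subsetD[of "{u..v}" "ball x (dd x)" u] subsetD[of "{u..v}" "ball x (dd x)" v] k
            by (auto simp: dist_real_def abs_minus_commute)
          then have 1: "norm (f u - f x - (u - x) *\<^sub>R g x) \<le> e1 * \<bar>u - x\<bar>"
            and 2: "norm (f v - f x - (v - x) *\<^sub>R g x) \<le> e1 * \<bar>v - x\<bar>"
            by (intro dd(2)[OF xab]; use k in simp)+
          have "measure lborel k *\<^sub>R h x - (f (Sup k) - f (Inf k))
             = (f u - f x - (u - x) *\<^sub>R g x) - (f v - f x - (v - x) *\<^sub>R g x)"
            using k False by (simp add: h_def algebra_simps)
          also have "norm \<dots> \<le> e1 * \<bar>u - x\<bar> + e1 * \<bar>v - x\<bar>"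
            using 1 2 norm_triangle_ineq4 by (smt (verit))
          also have "\<dots> = e1 * (v - u)" using k by (simp add: algebra_simps)
          finally show ?thesis using k False by simp
        qed
      qed
      have "(\<Sum>(x,k)\<in>\<D>. measure lborel k *\<^sub>R h x) - (f b - f a)
         = (\<Sum>(x,k)\<in>\<D>. measure lborel k *\<^sub>R h x - (f (Sup k) - f (Inf k)))"
        by (simp add: additive_tagged_division_1[OF ab D, of f, symmetric] sum_subtractf split_def)
      also have "norm \<dots> \<le> (\<Sum>(x,k)\<in>\<D>. e1 * measure lborel k + (if x \<in> N then norm (f (Sup k) - f (Inf k)) else 0))"
        by (rule sum_norm_le) (use each in auto)
      also have "\<dots> = e1 * (\<Sum>(x,k)\<in>\<D>. measure lborel k) + (\<Sum>(x,k)\<in>\<D>. if x \<in> N then norm (f (Sup k) - f (Inf k)) else 0)"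
        by (simp add: sum.distrib sum_distrib_left split_def)
      also have "(\<Sum>(x,k)\<in>\<D>. measure lborel k) = b - a"
        using additive_content_tagged_division[of \<D> a b] D ab by (simp add: box_real)
      also have "(\<Sum>(x,k)\<in>\<D>. if x \<in> N then norm (f (Sup k) - f (Inf k)) else 0)
          = (\<Sum>(x,K)\<in>DN. norm (f (Sup K) - f (Inf K)))"
        unfolding DN_def by (subst sum.inter_filter[OF fin]) (auto simp: split_def intro!: sum.cong)
      finally show ?thesis using sN e1b by linarith
    qed
    show "\<exists>\<gamma>. gauge \<gamma> \<and> (\<forall>\<D>. \<D> tagged_division_of {a..b} \<and> \<gamma> fine \<D> \<longrightarrow>
        norm ((\<Sum>(x,k)\<in>\<D>. measure lborel k *\<^sub>R h x) - (f b - f a)) < e)"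
      by (intro exI[of _ \<gamma>] conjI allI impI gg; elim conjE; rule est)
  qed
  from has_integral_spike[OF N _ this, of g] show ?thesis by (simp add: h_def)
qed

text \<open>Lebesgue's differentiation theorem by way of gauges. A point of \<open>E e\<close> lies
  in arbitrarily short intervals on which the increment of \<open>F\<close> misses the expected
  value by more than \<open>e\<close> times the length. Henstock's lemma bounds the total length of
  disjoint such intervals, and a Vitali covering turns this into a bound for the outer measure of
  \<open>E e\<close>.\<close>

lemma indefinite_integral_has_vector_derivative_AE:
  fixes f :: "real \<Rightarrow> 'a::euclidean_space"
  assumes f: "f integrable_on {a..b}"
  shows "negligible {x \<in> {a<..<b}. \<not> ((\<lambda>t. integral {a..t} f) has_vector_derivative f x) (at x)}"
proof -
  define F where "F t = integral {a..t} f" for t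
  define E where "E e = {x \<in> {a<..<b}. \<forall>d>0. \<exists>u v. x \<in> {u..v} \<and> u < v \<and> {u..v} \<subseteq> {a..b} \<inter> ball x d \<and>
      norm (F v - F u - (v - u) *\<^sub>R f x) > e * (v - u)}" for e
  have negE: "negligible (E e)" if e: "e > 0" for e
    unfolding negligible_outer_le
  proof (intro allI impI)
    fix \<eta> :: real assume \<eta>: "\<eta> > 0"
    have f': "f integrable_on cbox a b" using f by (simp add: box_real)
    \<comment> \<open>The factor 5 pays for the enlargement of the balls in the Vitali
      covering.\<close>
    have \<eta>': "e * \<eta> / 5 > 0" using e \<eta> by simp
    obtain \<gamma> where \<gamma>: "gauge \<gamma>"
      and hen: "\<And>p. \<lbrakk>p tagged_partial_division_of (cbox a b); \<gamma> fine p\<rbrakk> \<Longrightarrow>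
             sum (\<lambda>(x,k). norm(measure lborel k *\<^sub>R f x - integral k f)) p < e * \<eta> / 5"
      by (rule Henstock_lemma[OF f' \<eta>']) blast
    have "\<exists>u v. x \<in> {u..v} \<and> u < v \<and> {u..v} \<subseteq> {a..b} \<inter> \<gamma> x \<and> norm (F v - F u - (v - u) *\<^sub>R f x) > e * (v - u)"
      if x: "x \<in> E e" for x
    proof -
      obtain d where d: "d > 0" "ball x d \<subseteq> \<gamma> x"
        using \<gamma> unfolding gauge_def by (metis openE)
      have "\<forall>d>0. \<exists>u v. x \<in> {u..v} \<and> u < v \<and> {u..v} \<subseteq> {a..b} \<inter> ball x d \<and>
          norm (F v - F u - (v - u) *\<^sub>R f x) > e * (v - u)"
        using x unfolding E_def mem_Collect_eq by (rule conjunct2)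
      then obtain u v where uv: "x \<in> {u..v}" "u < v" "{u..v} \<subseteq> {a..b} \<inter> ball x d"
          "norm (F v - F u - (v - u) *\<^sub>R f x) > e * (v - u)"
        using d(1) by meson
      have "{u..v} \<subseteq> {a..b} \<inter> \<gamma> x" using uv(3) d(2) by (meson Int_mono order_refl order_trans)
      then show ?thesis using uv(1,2,4) by metis
    qed
    then obtain u v where uv: "\<And>x. x \<in> E e \<Longrightarrow> x \<in> {u x..v x} \<and> u x < v x \<and> {u x..v x} \<subseteq> {a..b} \<inter> \<gamma> x \<and>
        norm (F (v x) - F (u x) - (v x - u x) *\<^sub>R f x) > e * (v x - u x)"
      by metis
    define c r where "c x = (u x + v x) / 2" and "r x = (v x - u x) / 2" for x
    have cb: "cball (c x) (r x) = {u x..v x}" for x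
      by (auto simp: c_def r_def cball_eq_atLeastAtMost field_simps)
    have r: "0 < r x \<and> r x \<le> (b - a) / 2" if "x \<in> E e" for x
    proof -
      have "a \<le> u x" "v x \<le> b" using uv[OF that] by auto
      then show ?thesis using uv[OF that] by (simp add: r_def)
    qed
    obtain C where C: "countable C" "C \<subseteq> E e"
      and disj: "pairwise (\<lambda>i j. disjnt (cball (c i) (r i)) (cball (c j) (r j))) C"
      and cov: "\<And>i. i \<in> E e \<Longrightarrow> \<exists>j. j \<in> C \<and> \<not> disjnt (cball (c i) (r i)) (cball (c j) (r j)) \<and>
                        cball (c i) (r i) \<subseteq> ball (c j) (5 * r j)"
      by (rule Vitali_covering_lemma_cballs_balls[of "E e" r "(b - a) / 2" c, OF r]) blast+
    have fin: "(\<Sum>x\<in>D. 2 * r x) \<le> \<eta> / 5" if D: "D \<subseteq> C" "finite D" for D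
    proof -
      define p where "p = (\<lambda>x. (x, {u x..v x})) ` D"
      have part: "p tagged_partial_division_of cbox a b"
        unfolding tagged_partial_division_of_def
      proof (intro conjI allI impI)
        show "finite p" using D by (simp add: p_def)
        fix x K assume "(x, K) \<in> p"
        then have "x \<in> E e" "K = {u x..v x}" using D C by (auto simp: p_def)
        moreover from this have "K = cbox (u x) (v x)" by (simp add: box_real)
        ultimately show "x \<in> K" "K \<subseteq> cbox a b" "\<exists>a b. K = cbox a b"
          using uv[of x] by (auto simp: box_real)
      next
        fix x1 K1 x2 K2 assume *: "(x1, K1) \<in> p \<and> (x2, K2) \<in> p \<and> (x1, K1) \<noteq> (x2, K2)"
        then have "x1 \<in> C" "x2 \<in> C" "x1 \<noteq> x2" "K1 = {u x1..v x1}" "K2 = {u x2..v x2}"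
          using D by (auto simp: p_def)
        then have "K1 \<inter> K2 = {}" using disj by (simp add: pairwise_def disjnt_def cb)
        then show "interior K1 \<inter> interior K2 = {}" using interior_subset by blast
      qed
      have fine: "\<gamma> fine p"
        using uv D C by (auto simp: fine_def p_def)
      have "(\<Sum>x\<in>D. e * (2 * r x)) \<le> (\<Sum>x\<in>D. norm (measure lborel {u x..v x} *\<^sub>R f x - integral {u x..v x} f))"
      proof (rule sum_mono)
        fix x assume "x \<in> D"
        then have x: "x \<in> E e" using D C by auto
        note U = uv[OF x]
        have au: "a \<le> u x" "v x \<le> b" using U by auto
        have r2: "2 * r x = v x - u x" by (simp add: r_def)
        have "f integrable_on {a..v x}" using f au by (rule_tac integrable_on_subinterval[of f "{a..b}"]) auto
        then have "F (u x) + integral {u x..v x} f = F (v x)"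
          unfolding F_def using Henstock_Kurzweil_Integration.integral_combine[of a "u x" "v x" f] U au by auto
        then have "integral {u x..v x} f = F (v x) - F (u x)" by (simp add: algebra_simps)
        then show "e * (2 * r x) \<le> norm (measure lborel {u x..v x} *\<^sub>R f x - integral {u x..v x} f)"
          using U norm_minus_commute[of "F (v x) - F (u x)"] r2 by simp
      qed
      also have "\<dots> = sum (\<lambda>(x,k). norm(measure lborel k *\<^sub>R f x - integral k f)) p"
        unfolding p_def by (subst sum.reindex) (auto simp: inj_on_def)
      also have "\<dots> < e * \<eta> / 5" by (rule hen[OF part fine])
      finally show ?thesis using e by (simp add: sum_distrib_left[symmetric] field_simps)
    qed
    define T where "T = (\<Union>x\<in>C. ball (c x) (5 * r x))"
    have bnd: "(\<Sum>x\<in>D. measure lebesgue (ball (c x) (5 * r x))) \<le> \<eta>" if D: "D \<subseteq> C" "finite D" for D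
    proof -
      have "(\<Sum>x\<in>D. measure lebesgue (ball (c x) (5 * r x))) = (\<Sum>x\<in>D. 5 * (2 * r x))"
      proof (rule sum.cong[OF refl])
        fix x assume "x \<in> D"
        then have "0 < r x" using D C r by auto
        then show "measure lebesgue (ball (c x) (5 * r x)) = 5 * (2 * r x)"
          by (simp add: ball_eq_greaterThanLessThan)
      qed
      also have "\<dots> \<le> \<eta>" using fin[OF D] by (simp add: sum_distrib_left[symmetric])
      finally show ?thesis .
    qed
    have mb: "measure lebesgue (\<Union>x\<in>D. ball (c x) (5 * r x)) \<le> \<eta>" if D: "D \<subseteq> C" "finite D" for D
    proof -
      have "measure lebesgue (\<Union>x\<in>D. ball (c x) (5 * r x)) \<le> (\<Sum>x\<in>D. measure lebesgue (ball (c x) (5 * r x)))"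
        by (rule measure_UNION_le) (use D in auto)
      then show ?thesis using bnd[OF D] by simp
    qed
    have "T \<in> lmeasurable" unfolding T_def
      by (rule fmeasurable_UN_bound[OF C(1) _ mb]) auto
    moreover have "measure lebesgue T \<le> \<eta>" unfolding T_def
      by (rule measure_UN_bound[OF C(1) _ mb]) auto
    moreover have "E e \<subseteq> T"
    proof
      fix x assume x: "x \<in> E e"
      then have "x \<in> cball (c x) (r x)" using uv cb by blast
      then show "x \<in> T" using cov[OF x] unfolding T_def by blast
    qed
    ultimately show "\<exists>T. E e \<subseteq> T \<and> T \<in> lmeasurable \<and> measure lebesgue T \<le> \<eta>" by blast
  qed
  have "{x \<in> {a<..<b}. \<not> (F has_vector_derivative f x) (at x)} \<subseteq> (\<Union>n::nat. E (1 / (real n + 1)))"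
  proof
    fix x assume x: "x \<in> {x \<in> {a<..<b}. \<not> (F has_vector_derivative f x) (at x)}"
    show "x \<in> (\<Union>n::nat. E (1 / (real n + 1)))"
    proof (rule ccontr)
      assume nx: "x \<notin> (\<Union>n::nat. E (1 / (real n + 1)))"
      have "(F has_vector_derivative f x) (at x)"
        unfolding has_vector_derivative_def has_derivative_at_alt
      proof (intro conjI allI impI)
        show "bounded_linear (\<lambda>h. h *\<^sub>R f x)" by (rule bounded_linear_scaleR_left)
        fix e :: real assume e: "e > 0"
        obtain n :: nat where n: "1 / (real n + 1) < e" by (metis e nat_approx_posE of_nat_Suc add.commute)
        have "x \<notin> E (1 / (real n + 1))" using nx by blast
        then have "\<not> (\<forall>d>0. \<exists>u v. x \<in> {u..v} \<and> u < v \<and> {u..v} \<subseteq> {a..b} \<inter> ball x d \<and>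
            norm (F v - F u - (v - u) *\<^sub>R f x) > 1 / (real n + 1) * (v - u))"
          using x unfolding E_def by blast
        then obtain d where d: "d > 0" and D': "\<not> (\<exists>u v. x \<in> {u..v} \<and> u < v \<and> {u..v} \<subseteq> {a..b} \<inter> ball x d \<and>
            norm (F v - F u - (v - u) *\<^sub>R f x) > 1 / (real n + 1) * (v - u))"
          by blast
        have D: "norm (F v - F u - (v - u) *\<^sub>R f x) \<le> 1 / (real n + 1) * (v - u)"
          if "x \<in> {u..v}" "u < v" "{u..v} \<subseteq> {a..b} \<inter> ball x d" for u v
          using D' that by (meson not_less)
        define d' where "d' = min d (min (x - a) (b - x))"
        have "d' > 0" using d x by (auto simp: d'_def)
        moreover have "norm (F y - F x - (y - x) *\<^sub>R f x) \<le> e * norm (y - x)" if y: "norm (y - x) < d'" for y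
        proof -
          have *: "1 / (real n + 1) * \<bar>y - x\<bar> \<le> e * \<bar>y - x\<bar>" using n by (intro mult_right_mono) auto
          consider "y = x" | "x < y" | "y < x" by linarith
          then show ?thesis
          proof cases
            case 1 then show ?thesis by simp
          next
            case 2
            have "norm (F y - F x - (y - x) *\<^sub>R f x) \<le> 1 / (real n + 1) * (y - x)"
              by (rule D) (use 2 y x in \<open>auto simp: d'_def dist_real_def\<close>)
            then show ?thesis using * 2 by simp
          next
            case 3
            have "norm (F x - F y - (x - y) *\<^sub>R f x) \<le> 1 / (real n + 1) * (x - y)"
              by (rule D) (use 3 y x in \<open>auto simp: d'_def dist_real_def\<close>)
            moreover have "F x - F y - (x - y) *\<^sub>R f x = - (F y - F x - (y - x) *\<^sub>R f x)"
              by (simp add: algebra_simps)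
            ultimately have "norm (F y - F x - (y - x) *\<^sub>R f x) \<le> 1 / (real n + 1) * (x - y)"
              by (metis norm_minus_cancel)
            then show ?thesis using * 3 by simp
          qed
        qed
        ultimately show "\<exists>d>0. \<forall>y. norm (y - x) < d \<longrightarrow> norm (F y - F x - (y - x) *\<^sub>R f x) \<le> e * norm (y - x)"
          by blast
      qed
      then show False using x by blast
    qed
  qed
  moreover have "negligible (\<Union>n::nat. E (1 / (real n + 1)))"
    by (rule negligible_countable_Union) (auto intro!: negE)
  ultimately show ?thesis unfolding F_def using negligible_subset by blast
qed

lemma division_memE:
  assumes "\<D> division_of \<Union>\<D>" "\<Union>\<D> \<subseteq> {a..b::real}" "K \<in> \<D>"
  obtains u v where "K = {u..v}" "u \<le> v" "a \<le> u" "v \<le> b"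
proof -
  obtain u v where uv: "K = {u..v}" using division_ofD(4)[OF assms(1,3)] by (auto simp: box_real)
  have "K \<noteq> {}" using division_ofD(3)[OF assms(1,3)] .
  moreover have "K \<subseteq> {a..b}" using assms(2,3) by blast
  ultimately show thesis using uv by (intro that[of u v]) auto
qed

text \<open>Truncating \<open>norm (f x)\<close> at height \<open>n\<close> bounds every increment
  by \<open>n\<close> times the length plus the integral of the remainder \<open>k\<close>, and for
  large \<open>n\<close> the whole integral of \<open>k\<close> is below
  \<open>e / 2\<close>.\<close>

lemma abs_continuous_on_indefinite_integral:
  fixes f :: "real \<Rightarrow> 'a::euclidean_space"
  assumes f: "f absolutely_integrable_on {a..b}"
    and F: "\<And>t. t \<in> {a..b} \<Longrightarrow> F t = F0 + integral {a..t} f"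
  shows "abs_continuous_on {a..b} F"
  unfolding abs_continuous_on_def
proof (intro allI impI)
  fix e :: real assume e: "e > 0"
  define h where "h n x = min (norm (f x)) (real n)" for n x
  have nf: "(\<lambda>x. norm (f x)) absolutely_integrable_on {a..b}"
    using f by (rule absolutely_integrable_norm[unfolded o_def])
  have nfi: "(\<lambda>x. norm (f x)) integrable_on {a..b}"
    using nf set_lebesgue_integral_eq_integral(1) by blast
  have hi: "h n integrable_on {a..b}" for n
  proof -
    have "(\<lambda>x. real n) absolutely_integrable_on {a..b}"
      by (rule absolutely_integrable_on_const) auto
    from absolutely_integrable_min_1[OF nf this] show ?thesis
      unfolding h_def using set_lebesgue_integral_eq_integral(1) by blast
  qed
  have "(\<lambda>n. integral {a..b} (h n)) \<longlonglongrightarrow> integral {a..b} (\<lambda>x. norm (f x))"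
  proof (rule dominated_convergence(2)[OF hi nfi])
    fix x show "(\<lambda>n. h n x) \<longlonglongrightarrow> norm (f x)"
    proof (rule tendsto_eventually)
      obtain N :: nat where "norm (f x) \<le> real N" using real_arch_simple by blast
      then show "\<forall>\<^sub>F n in sequentially. h n x = norm (f x)"
        by (intro eventually_sequentiallyI[of N]) (simp add: h_def)
    qed
  qed (auto simp: h_def)
  then have "\<forall>\<^sub>F n in sequentially. dist (integral {a..b} (h n)) (integral {a..b} (\<lambda>x. norm (f x))) < e / 2"
    by (rule tendstoD) (use e in simp)
  then obtain n where "dist (integral {a..b} (h n)) (integral {a..b} (\<lambda>x. norm (f x))) < e / 2"
    by (auto simp: eventually_sequentially)
  then have n: "integral {a..b} (\<lambda>x. norm (f x)) - integral {a..b} (h n) < e / 2"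
    unfolding dist_real_def by linarith
  define k where "k x = norm (f x) - h n x" for x
  have k0: "k x \<ge> 0" for x by (simp add: k_def h_def)
  have ki: "k integrable_on {a..b}" unfolding k_def using nfi hi by (rule integrable_diff)
  have ik: "integral {a..b} k < e / 2"
    unfolding k_def using n nfi hi by (simp add: Henstock_Kurzweil_Integration.integral_diff)
  show "\<exists>d>0. \<forall>\<D>. \<D> division_of \<Union> \<D> \<and> \<Union> \<D> \<subseteq> {a..b} \<and> (\<Sum>K\<in>\<D>. Sup K - Inf K) < d \<longrightarrow>
             (\<Sum>K\<in>\<D>. norm (F (Sup K) - F (Inf K))) < e"
  proof (intro exI conjI allI impI)
    show "e / (2 * (real n + 1)) > 0" using e by simp
    fix \<D> :: "real set set" assume *: "\<D> division_of \<Union> \<D> \<and> \<Union> \<D> \<subseteq> {a..b} \<and> (\<Sum>K\<in>\<D>. Sup K - Inf K) < e / (2 * (real n + 1))"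
    have "norm (F (Sup K) - F (Inf K)) \<le> real n * (Sup K - Inf K) + integral K k" if K: "K \<in> \<D>" for K
    proof -
      obtain u v where uv: "K = {u..v}" and le: "u \<le> v" "a \<le> u" "v \<le> b"
        using division_memE[OF conjunct1[OF *] _ K] * by metis
      have uv3: "{u..v} \<subseteq> {a..b}" using le by auto
      have sub: "g integrable_on {u..v}" if "g integrable_on {a..b}" for g :: "real \<Rightarrow> real"
        using that uv3 by (rule integrable_on_subinterval)
      have fi: "f integrable_on {a..b}" using f set_lebesgue_integral_eq_integral(1) by blast
      have fi': "f integrable_on {a..v}" using fi by (rule integrable_on_subinterval) (use le in auto)
      have fi'': "f integrable_on {u..v}" using fi uv3 by (rule integrable_on_subinterval)
      have "F u + integral {u..v} f = F v"
        using Henstock_Kurzweil_Integration.integral_combine[of a u v f] le fi' F[of u] F[of v] by (simp add: algebra_simps)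
      then have "F (Sup K) - F (Inf K) = integral {u..v} f" using uv le by (simp add: algebra_simps)
      also have "norm \<dots> \<le> integral {u..v} (\<lambda>x. norm (f x))"
        by (rule integral_norm_bound_integral[OF fi'' sub[OF nfi]]) simp
      also have "\<dots> = integral {u..v} (\<lambda>x. h n x + k x)" by (simp add: k_def)
      also have "\<dots> = integral {u..v} (h n) + integral {u..v} k"
        by (rule Henstock_Kurzweil_Integration.integral_add[OF sub[OF hi] sub[OF ki]])
      also have "integral {u..v} (h n) \<le> integral {u..v} (\<lambda>x. real n)"
        by (rule integral_le[OF sub[OF hi]]) (auto simp: h_def)
      finally show ?thesis using uv le by (simp add: mult.commute)
    qed
    then have "(\<Sum>K\<in>\<D>. norm (F (Sup K) - F (Inf K))) \<le> (\<Sum>K\<in>\<D>. real n * (Sup K - Inf K) + integral K k)"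
      by (rule sum_mono)
    also have "\<dots> = real n * (\<Sum>K\<in>\<D>. Sup K - Inf K) + (\<Sum>K\<in>\<D>. integral K k)"
      by (simp add: sum.distrib sum_distrib_left)
    also have "(\<Sum>K\<in>\<D>. integral K k) = integral (\<Union>\<D>) k"
      using has_integral_combine_division_topdown[OF ki, of \<D> "\<Union>\<D>"] * by (simp add: integral_unique)
    also have "integral (\<Union>\<D>) k \<le> integral {a..b} k"
      using * integrable_on_subdivision[of \<D> "\<Union>\<D>" k "{a..b}"] ki k0 by (intro integral_subset_le) auto
    also have "real n * (\<Sum>K\<in>\<D>. Sup K - Inf K) \<le> real n * (e / (2 * (real n + 1)))"
      using * by (intro mult_left_mono) auto
    also have "\<dots> \<le> e / 2" using e by (simp add: field_simps)
    finally show "(\<Sum>K\<in>\<D>. norm (F (Sup K) - F (Inf K))) < e" using ik by simp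
  qed
qed

lemma abs_continuous_on_mult:
  fixes f g :: "real \<Rightarrow> complex"
  assumes f: "abs_continuous_on {a..b} f" and g: "abs_continuous_on {a..b} g"
    and cf: "continuous_on {a..b} f" and cg: "continuous_on {a..b} g"
  shows "abs_continuous_on {a..b} (\<lambda>t. f t * g t)"
proof -
  have "\<exists>M. \<forall>t\<in>{a..b}. norm (w t) \<le> M" if "continuous_on {a..b} w" for w :: "real \<Rightarrow> complex"
    using compact_imp_bounded[OF compact_continuous_image[OF that compact_Icc]] by (simp add: bounded_iff)
  from this[OF cf] this[OF cg]
  obtain M1 M2 where M: "\<And>t. t \<in> {a..b} \<Longrightarrow> norm (f t) \<le> M1" "\<And>t. t \<in> {a..b} \<Longrightarrow> norm (g t) \<le> M2"
    by metis
  define M where "M = \<bar>M1\<bar> + \<bar>M2\<bar> + 1"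
  have MM: "norm (f t) \<le> M" "norm (g t) \<le> M" if "t \<in> {a..b}" for t
    using M[OF that] by (auto simp: M_def)
  have M0: "M > 0" by (simp add: M_def)
  show ?thesis unfolding abs_continuous_on_def
  proof (intro allI impI)
    fix e :: real assume e: "e > 0"
    then have e': "e / (2 * M) > 0" using M0 by simp
    obtain d1 where d1: "d1 > 0" "\<And>\<D>. \<D> division_of \<Union>\<D> \<and> \<Union>\<D> \<subseteq> {a..b}
     \<and> (\<Sum>K\<in>\<D>. Sup K - Inf K) < d1 \<Longrightarrow> (\<Sum>K\<in>\<D>. norm (f (Sup K) - f (Inf K))) < e / (2 * M)"
      using f[unfolded abs_continuous_on_def, THEN spec, THEN mp, OF e'] by blast
    obtain d2 where d2: "d2 > 0" "\<And>\<D>. \<D> division_of \<Union>\<D> \<and> \<Union>\<D> \<subseteq> {a..b}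
     \<and> (\<Sum>K\<in>\<D>. Sup K - Inf K) < d2 \<Longrightarrow> (\<Sum>K\<in>\<D>. norm (g (Sup K) - g (Inf K))) < e / (2 * M)"
      using g[unfolded abs_continuous_on_def, THEN spec, THEN mp, OF e'] by blast
    show "\<exists>d>0. \<forall>\<D>. \<D> division_of \<Union> \<D> \<and> \<Union> \<D> \<subseteq> {a..b} \<and> (\<Sum>K\<in>\<D>. Sup K - Inf K) < d \<longrightarrow>
             (\<Sum>K\<in>\<D>. norm (f (Sup K) * g (Sup K) - f (Inf K) * g (Inf K))) < e"
    proof (intro exI[of _ "min d1 d2"] conjI allI impI)
      show "min d1 d2 > 0" using d1 d2 by simp
      fix \<D> :: "real set set" assume *: "\<D> division_of \<Union> \<D> \<and> \<Union> \<D> \<subseteq> {a..b} \<and> (\<Sum>K\<in>\<D>. Sup K - Inf K) < min d1 d2"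
      have "norm (f (Sup K) * g (Sup K) - f (Inf K) * g (Inf K)) \<le>
          M * norm (f (Sup K) - f (Inf K)) + M * norm (g (Sup K) - g (Inf K))" if K: "K \<in> \<D>" for K
      proof -
        obtain u v where uv: "K = {u..v}" and le': "u \<le> v" "a \<le> u" "v \<le> b"
          using division_memE[OF conjunct1[OF *] _ K] * by metis
        then have le: "u \<le> v" "u \<in> {a..b}" "v \<in> {a..b}" by auto
        have "f v * g v - f u * g u = g v * (f v - f u) + f u * (g v - g u)" by (simp add: algebra_simps)
        also have "norm \<dots> \<le> norm (g v) * norm (f v - f u) + norm (f u) * norm (g v - g u)"
          by (metis norm_mult norm_triangle_ineq)
        also have "\<dots> \<le> M * norm (f v - f u) + M * norm (g v - g u)"
          using MM le by (intro add_mono mult_right_mono) auto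
        finally show ?thesis using uv le by simp
      qed
      then have "(\<Sum>K\<in>\<D>. norm (f (Sup K) * g (Sup K) - f (Inf K) * g (Inf K))) \<le>
         (\<Sum>K\<in>\<D>. M * norm (f (Sup K) - f (Inf K)) + M * norm (g (Sup K) - g (Inf K)))" by (rule sum_mono)
      also have "\<dots> = M * (\<Sum>K\<in>\<D>. norm (f (Sup K) - f (Inf K))) + M * (\<Sum>K\<in>\<D>. norm (g (Sup K) - g (Inf K)))"
        by (simp add: sum.distrib sum_distrib_left)
      also have "\<dots> < M * (e / (2 * M)) + M * (e / (2 * M))"
        using * M0 by (intro add_strict_mono mult_strict_left_mono d1(2) d2(2)) auto
      also have "\<dots> = e" using M0 by simp
      finally show "(\<Sum>K\<in>\<D>. norm (f (Sup K) * g (Sup K) - f (Inf K) * g (Inf K))) < e" .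
    qed
  qed
qed

text \<open>Both factors are absolutely continuous and differentiable outside a null set, so the
  product meets the hypotheses of \<open>abs_continuous_on_has_integral_deriv\<close>.\<close>

lemma integration_by_parts_indefinite:
  fixes h1 h2 :: "real \<Rightarrow> complex"
  assumes ab: "a \<le> b"
    and h1: "h1 absolutely_integrable_on {a..b}" and h2: "h2 absolutely_integrable_on {a..b}"
    and u: "\<And>t. t \<in> {a..b} \<Longrightarrow> u t = u0 + integral {a..t} h1"
    and v: "\<And>t. t \<in> {a..b} \<Longrightarrow> v t = v0 + integral {a..t} h2"
  shows "((\<lambda>t. h1 t * v t + u t * h2 t) has_integral (u b * v b - u a * v a)) {a..b}"
proof -
  have i: "h1 integrable_on {a..b}" "h2 integrable_on {a..b}"
    using h1 h2 set_lebesgue_integral_eq_integral(1) by blast+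
  have c: "continuous_on {a..b} u" "continuous_on {a..b} v"
    by (subst continuous_on_cong[OF refl u], assumption,
        intro continuous_intros indefinite_integral_continuous_1 i,
        subst continuous_on_cong[OF refl v], assumption,
        intro continuous_intros indefinite_integral_continuous_1 i)
  define N where "N = {x \<in> {a<..<b}. \<not> ((\<lambda>t. integral {a..t} h1) has_vector_derivative h1 x) (at x)}
     \<union> {x \<in> {a<..<b}. \<not> ((\<lambda>t. integral {a..t} h2) has_vector_derivative h2 x) (at x)} \<union> {a, b}"
  have N: "negligible N" unfolding N_def
    by (intro negligible_Un indefinite_integral_has_vector_derivative_AE i) simp
  have d: "(w has_vector_derivative h x) (at x)"
    if "((\<lambda>t. integral {a..t} h) has_vector_derivative h x) (at x)" "x \<in> {a<..<b}"
       "\<And>t. t \<in> {a..b} \<Longrightarrow> w t = w0 + integral {a..t} h" for w h w0 x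
  proof -
    have "((\<lambda>t. w0 + integral {a..t} h) has_vector_derivative h x) (at x)"
      using that(1) by (auto intro!: derivative_eq_intros)
    then show ?thesis
      by (rule has_vector_derivative_transform_within_open[of _ _ _ "{a<..<b}"]) (use that(2,3) in auto)
  qed
  show ?thesis
  proof (rule abs_continuous_on_has_integral_deriv[OF _ ab N])
    show "abs_continuous_on {a..b} (\<lambda>t. u t * v t)"
      by (rule abs_continuous_on_mult[OF abs_continuous_on_indefinite_integral[OF h1 u]
            abs_continuous_on_indefinite_integral[OF h2 v] c])
    fix x assume "x \<in> {a..b} - N"
    then have "(u has_vector_derivative h1 x) (at x)" "(v has_vector_derivative h2 x) (at x)"
      using d[OF _ _ u] d[OF _ _ v] by (auto simp: N_def)
    from has_vector_derivative_mult[OF this]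
    show "((\<lambda>t. u t * v t) has_vector_derivative (h1 x * v x + u x * h2 x)) (at x within {a..b})"
      by (simp add: add.commute has_vector_derivative_at_within)
  qed
qed

section \<open>Gronwall's inequality and linear Volterra equations\<close>

text \<open>The induction behind Picard's method: each integration raises the power of
  \<open>t - c\<close> by one and divides by the new exponent.\<close>

lemma iterated_integral_bound:
  fixes e :: "nat \<Rightarrow> real \<Rightarrow> real"
  assumes e0: "\<And>t. t \<in> {c..q} \<Longrightarrow> e 0 t \<le> C"
    and eS: "\<And>n t. t \<in> {c..q} \<Longrightarrow> e (Suc n) t \<le> L * integral {c..t} (e n)"
    and int: "\<And>n. e n integrable_on {c..q}" and L: "L \<ge> 0" and t: "t \<in> {c..q}"
  shows "e n t \<le> C * (L * (t - c)) ^ n / fact n"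
  using t
proof (induction n arbitrary: t)
  case 0 then show ?case using e0 by simp
next
  case (Suc n)
  define P where "P s = C * (L * (s - c)) ^ n / fact n" for s
  define Q where "Q s = C * L ^ n / fact n * ((s - c) ^ Suc n / real (Suc n))" for s
  have "(P has_integral Q t - Q c) {c..t}"
  proof (rule fundamental_theorem_of_calculus)
    show "c \<le> t" using Suc.prems by simp
    fix x
    have "(Q has_real_derivative P x) (at x within {c..t})"
    proof -
      have "((\<lambda>s. (s - c) ^ Suc n) has_real_derivative real (Suc n) * (x - c) ^ n) (at x within {c..t})"
        by (auto intro!: derivative_eq_intros simp del: power_Suc)
      from DERIV_cmult[OF DERIV_cdivide[OF this, of "real (Suc n)"], of "C * L ^ n / fact n"]
      show ?thesis unfolding Q_def P_def by (simp add: power_mult_distrib mult.assoc del: power_Suc of_nat_Suc)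
    qed
    then show "(Q has_vector_derivative P x) (at x within {c..t})"
      by (simp add: has_real_derivative_iff_has_vector_derivative)
  qed
  then have P: "(P has_integral Q t) {c..t}" by (simp add: Q_def)
  have "integral {c..t} (e n) \<le> integral {c..t} P"
  proof (rule integral_le)
    show "e n integrable_on {c..t}" using int by (rule integrable_on_subinterval) (use Suc.prems in auto)
    show "P integrable_on {c..t}" using P by blast
    fix x assume "x \<in> {c..t}" then show "e n x \<le> P x" unfolding P_def using Suc by simp
  qed
  also have "\<dots> = Q t" using P by (rule integral_unique)
  finally have "L * integral {c..t} (e n) \<le> L * Q t" using L by (rule mult_left_mono)
  also have "L * Q t = C * (L * (t - c)) ^ Suc n / fact (Suc n)"
    by (simp add: Q_def power_mult_distrib fact_Suc mult_ac)
  finally show ?case using eS[OF Suc.prems, of n] by linarith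
qed

text \<open>The hypothesis reproduces itself, so the bound for iterated integrals applies to the
  constant sequence with value \<open>e\<close>; its right-hand side is a multiple of the general
  term of an exponential series.\<close>

lemma gronwall_zero:
  fixes e :: "real \<Rightarrow> real"
  assumes ce: "continuous_on {c..q} e" and e: "\<And>t. t \<in> {c..q} \<Longrightarrow> e t \<le> L * integral {c..t} e"
    and L: "L \<ge> 0" and t: "t \<in> {c..q}"
  shows "e t \<le> 0"
proof -
  obtain C where C: "\<And>t. t \<in> {c..q} \<Longrightarrow> \<bar>e t\<bar> \<le> C"
    using compact_imp_bounded[OF compact_continuous_image[OF ce compact_Icc]]
    unfolding bounded_iff real_norm_def by blast
  have "e t \<le> C * (L * (t - c)) ^ n / fact n" for n
    by (rule iterated_integral_bound[of c q "\<lambda>_. e"]) (use C e L t ce integrable_continuous_real abs_le_D1[OF C] in auto)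
  moreover have "(\<lambda>n. C * ((L * (t - c)) ^ n / fact n)) \<longlonglongrightarrow> C * 0"
    using summable_LIMSEQ_zero[OF summable_exp[of "L * (t - c)"]]
    by (intro tendsto_mult tendsto_const) (simp add: field_simps)
  ultimately show ?thesis by (intro LIMSEQ_le_const) auto
qed

lemma bounded_measurable_mult_continuous_absolutely_integrable:
  fixes k w :: "real \<Rightarrow> complex"
  assumes k: "k \<in> borel_measurable (lebesgue_on {c..q})" and M: "\<And>t. t \<in> {c..q} \<Longrightarrow> norm (k t) \<le> M"
    and w: "continuous_on {c..q} w"
  shows "(\<lambda>t. k t * w t) absolutely_integrable_on {c..q}"
proof -
  obtain B where B: "\<And>t. t \<in> {c..q} \<Longrightarrow> norm (w t) \<le> B"
    using compact_imp_bounded[OF compact_continuous_image[OF w compact_Icc]]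
    unfolding bounded_iff by blast
  show ?thesis
  proof (rule measurable_bounded_by_integrable_imp_absolutely_integrable)
    show "(\<lambda>t. k t * w t) \<in> borel_measurable (lebesgue_on {c..q})"
      using k continuous_imp_measurable_on_sets_lebesgue[OF w] by simp
    show "(\<lambda>_. M * B) integrable_on {c..q}" by (rule integrable_const_ivl)
    fix t assume "t \<in> {c..q}"
    then show "norm (k t * w t) \<le> M * B"
      using M[of t] B[of t] order_trans[OF norm_ge_zero M[of t]] unfolding norm_mult
      by (intro mult_mono) auto
  qed simp
qed

text \<open>Picard iteration for kernels that are merely measurable and bounded. The successive
  differences are dominated by a summable sequence \<open>B q\<close> on each \<open>{c..q}\<close>
  separately, so \<open>J\<close> may be unbounded. Dominated convergence passes to the limit in the
  integrals, and continuity of the limit is then read off the limiting equation.\<close>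

lemma linear_Volterra_solution:
  fixes K :: "'s \<Rightarrow> 's \<Rightarrow> real \<Rightarrow> complex"
  assumes S: "finite S" and J: "\<And>t. t \<in> J \<Longrightarrow> {c..t} \<subseteq> J"
    and Km: "\<And>s r q. s \<in> S \<Longrightarrow> r \<in> S \<Longrightarrow> q \<in> J \<Longrightarrow> K s r \<in> borel_measurable (lebesgue_on {c..q})"
    and KM: "\<And>s r t. s \<in> S \<Longrightarrow> r \<in> S \<Longrightarrow> t \<in> J \<Longrightarrow> c \<le> t \<Longrightarrow> norm (K s r t) \<le> M"
    and g: "\<And>s q. s \<in> S \<Longrightarrow> q \<in> J \<Longrightarrow> continuous_on {c..q} (g s)"
  shows "\<exists>u. \<forall>s\<in>S. (\<forall>q\<in>J. continuous_on {c..q} (u s)) \<and>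
     (\<forall>t\<in>J. u s t = g s t + integral {c..t} (\<lambda>x. \<Sum>r\<in>S. K s r x * u r x))"
proof -
  define u where "u = rec_nat g (\<lambda>n w s t. g s t + integral {c..t} (\<lambda>x. \<Sum>r\<in>S. K s r x * w r x))"
  have u0: "u 0 = g" by (simp add: u_def)
  have uS: "u (Suc n) s t = g s t + integral {c..t} (\<lambda>x. \<Sum>r\<in>S. K s r x * u n r x)" for n s t
    by (simp add: u_def)
  have KM': "norm (K s r t) \<le> M" if "s \<in> S" "r \<in> S" "q \<in> J" "t \<in> {c..q}" for s r t q
    using KM J that by (meson atLeastAtMost_iff subsetD)
  have ai: "(\<lambda>x. K s r x * w x) absolutely_integrable_on {c..q}"
    if "s \<in> S" "r \<in> S" "q \<in> J" "continuous_on {c..q} w" for s r q w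
    by (rule bounded_measurable_mult_continuous_absolutely_integrable[where M = M]) (use Km KM' that in auto)
  have ii: "(\<lambda>x. \<Sum>r\<in>S. K s r x * w r x) integrable_on {c..q}"
    if "s \<in> S" "q \<in> J" "\<And>r. r \<in> S \<Longrightarrow> continuous_on {c..q} (w r)" for s q w
    using ai[OF that(1) _ that(2) that(3)] S
    by (intro integrable_sum) (auto simp: absolutely_integrable_on_def)
  have cont: "continuous_on {c..q} (u n s)" if "s \<in> S" "q \<in> J" for n s q
    using that
  proof (induction n arbitrary: s q)
    case 0 then show ?case using g by (simp add: u0)
  next
    case (Suc n)
    have "continuous_on {c..q} (\<lambda>t. g s t + integral {c..t} (\<lambda>x. \<Sum>r\<in>S. K s r x * u n r x))"
      using Suc by (intro continuous_intros g indefinite_integral_continuous_1 ii) auto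
    then show ?case by (simp add: uS[abs_def])
  qed
  \<comment> \<open>One scalar quantity for all components: it satisfies the inequality of
    \<open>iterated_integral_bound\<close> with the factor
    \<open>\<bar>M\<bar> * real (card S)\<close>.\<close>
  define D where "D n t = (\<Sum>s\<in>S. norm (u (Suc n) s t - u n s t))" for n t
  have "\<exists>M0. \<forall>s\<in>S. \<forall>t\<in>{c..q}. norm (u 0 s t) \<le> M0 \<and> (\<forall>n. norm (u (Suc n) s t - u n s t) \<le> M0 * (inverse (fact n) * (\<bar>M\<bar> * real (card S) * (q - c)) ^ n))"
    if q: "q \<in> J" for q
  proof -
    define L where "L = \<bar>M\<bar> * real (card S)"
    have L: "L \<ge> 0" by (simp add: L_def)
    have cD: "continuous_on {c..q} (D n)" for n
      unfolding D_def by (intro continuous_intros cont q)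
    have eS: "D (Suc n) t \<le> L * integral {c..t} (D n)" if t: "t \<in> {c..q}" for n t
    proof -
      have tJ: "t \<in> J" using J[OF q] t by blast
      have cDt: "continuous_on {c..t} (D n)" by (rule continuous_on_subset[OF cD]) (use t in auto)
      have "norm (u (Suc (Suc n)) s t - u (Suc n) s t) \<le> \<bar>M\<bar> * integral {c..t} (D n)" if s: "s \<in> S" for s
      proof -
        have "u (Suc (Suc n)) s t - u (Suc n) s t =
            integral {c..t} (\<lambda>x. \<Sum>r\<in>S. K s r x * u (Suc n) r x) - integral {c..t} (\<lambda>x. \<Sum>r\<in>S. K s r x * u n r x)"
          by (simp add: uS[of "Suc n"] uS[of n s])
        also have "\<dots> = integral {c..t} (\<lambda>x. (\<Sum>r\<in>S. K s r x * u (Suc n) r x) - (\<Sum>r\<in>S. K s r x * u n r x))"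
          using ii[OF s tJ, of "u (Suc n)"] ii[OF s tJ, of "u n"] cont[OF _ tJ]
          by (subst Henstock_Kurzweil_Integration.integral_diff) auto
        also have "norm \<dots> \<le> integral {c..t} (\<lambda>x. \<bar>M\<bar> * D n x)"
        proof (rule integral_norm_bound_integral)
          show "(\<lambda>x. (\<Sum>r\<in>S. K s r x * u (Suc n) r x) - (\<Sum>r\<in>S. K s r x * u n r x)) integrable_on {c..t}"
            using ii[OF s tJ, of "u (Suc n)"] ii[OF s tJ, of "u n"] cont[OF _ tJ]
            by (intro integrable_diff) auto
          show "(\<lambda>x. \<bar>M\<bar> * D n x) integrable_on {c..t}"
            by (intro integrable_continuous_real continuous_intros cDt)
          fix x assume x: "x \<in> {c..t}"
          have "(\<Sum>r\<in>S. K s r x * u (Suc n) r x) - (\<Sum>r\<in>S. K s r x * u n r x) = (\<Sum>r\<in>S. K s r x * (u (Suc n) r x - u n r x))"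
            by (simp add: sum_subtractf algebra_simps)
          also have "norm \<dots> \<le> (\<Sum>r\<in>S. \<bar>M\<bar> * norm (u (Suc n) r x - u n r x))"
          proof (rule sum_norm_le)
            fix r assume "r \<in> S"
            then have "norm (K s r x) \<le> \<bar>M\<bar>" using KM'[OF s _ tJ x, of r] by simp
            then show "norm (K s r x * (u (Suc n) r x - u n r x)) \<le> \<bar>M\<bar> * norm (u (Suc n) r x - u n r x)"
              by (simp add: norm_mult mult_right_mono)
          qed
          finally show "norm ((\<Sum>r\<in>S. K s r x * u (Suc n) r x) - (\<Sum>r\<in>S. K s r x * u n r x)) \<le> \<bar>M\<bar> * D n x"
            by (simp add: D_def sum_distrib_left)
        qed
        finally show ?thesis by simp
      qed
      then have "D (Suc n) t \<le> (\<Sum>s\<in>S. \<bar>M\<bar> * integral {c..t} (D n))"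
        unfolding D_def[of "Suc n"] by (rule sum_mono)
      then show ?thesis by (simp add: L_def mult_ac)
    qed
    have "\<exists>C. \<forall>t\<in>{c..q}. norm (w t) \<le> C" if "continuous_on {c..q} w" for w :: "real \<Rightarrow> real"
      using compact_imp_bounded[OF compact_continuous_image[OF that compact_Icc]] by (simp add: bounded_iff)
    from this[OF cD[of 0]] this[of "\<lambda>t. \<Sum>s\<in>S. norm (u 0 s t)"]
    obtain C1 C2 where C: "\<forall>t\<in>{c..q}. norm (D 0 t) \<le> C1" "\<forall>t\<in>{c..q}. norm (\<Sum>s\<in>S. norm (u 0 s t)) \<le> C2"
      using continuous_on_sum[of S "{c..q}" "\<lambda>s t. norm (u 0 s t)"] cont[OF _ q] continuous_on_norm by metis
    define C where "C = \<bar>C1\<bar> + \<bar>C2\<bar>"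
    have D0: "D 0 t \<le> C" if "t \<in> {c..q}" for t
    proof -
      have "\<bar>D 0 t\<bar> \<le> C1" using bspec[OF C(1) that] by simp
      then show ?thesis by (simp add: C_def)
    qed
    have Db: "D n t \<le> C * (L * (t - c)) ^ n / fact n" if "t \<in> {c..q}" for n t
      by (rule iterated_integral_bound[where e = D, OF D0 eS integrable_continuous_real[OF cD] L that])
    have "norm (u 0 s t) \<le> C \<and> (\<forall>n. norm (u (Suc n) s t - u n s t) \<le> C * (inverse (fact n) * (L * (q - c)) ^ n))"
      if s: "s \<in> S" and t: "t \<in> {c..q}" for s t
    proof (intro conjI allI)
      have "norm (u 0 s t) \<le> (\<Sum>s\<in>S. norm (u 0 s t))" using s S by (intro member_le_sum) auto
      also have "\<dots> \<le> C" using bspec[OF C(2) t] by (simp add: C_def)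
      finally show "norm (u 0 s t) \<le> C" .
      fix n
      have "norm (u (Suc n) s t - u n s t) \<le> D n t" unfolding D_def using s S by (intro member_le_sum) auto
      also have "\<dots> \<le> C * (L * (t - c)) ^ n / fact n" by (rule Db[OF t])
      also have "\<dots> \<le> C * (L * (q - c)) ^ n / fact n"
        using t L by (intro divide_right_mono mult_left_mono power_mono) (auto simp: C_def)
      finally show "norm (u (Suc n) s t - u n s t) \<le> C * (inverse (fact n) * (L * (q - c)) ^ n)"
        by (simp add: field_simps)
    qed
    then show ?thesis unfolding L_def by blast
  qed
  then obtain M0 where M0: "\<And>q s t. q \<in> J \<Longrightarrow> s \<in> S \<Longrightarrow> t \<in> {c..q} \<Longrightarrow> norm (u 0 s t) \<le> M0 q"
    "\<And>q s t n. q \<in> J \<Longrightarrow> s \<in> S \<Longrightarrow> t \<in> {c..q} \<Longrightarrow>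
       norm (u (Suc n) s t - u n s t) \<le> M0 q * (inverse (fact n) * (\<bar>M\<bar> * real (card S) * (q - c)) ^ n)"
    by metis
  define B where "B q n = M0 q * (inverse (fact n) * (\<bar>M\<bar> * real (card S) * (q - c)) ^ n)" for q n
  have sB: "summable (B q)" for q
    unfolding B_def by (intro summable_mult summable_exp)
  have tel: "u n s t = u 0 s t + (\<Sum>i<n. u (Suc i) s t - u i s t)" for n s t
    by (induction n) auto
  have ub: "norm (u n s t) \<le> M0 q + suminf (B q)" if "q \<in> J" "s \<in> S" "t \<in> {c..q}" for n s t q
  proof -
    have B0: "B q i \<ge> 0" for i using M0(2)[OF that, of i] norm_ge_zero order_trans unfolding B_def by blast
    have "norm (u n s t) \<le> norm (u 0 s t) + norm (\<Sum>i<n. u (Suc i) s t - u i s t)"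
      by (subst tel) (rule norm_triangle_ineq)
    also have "norm (\<Sum>i<n. u (Suc i) s t - u i s t) \<le> (\<Sum>i<n. B q i)"
      by (rule sum_norm_le) (use M0(2)[OF that] in \<open>simp add: B_def\<close>)
    also have "\<dots> \<le> suminf (B q)" by (rule sum_le_suminf[OF sB]) (use B0 in auto)
    finally show ?thesis using M0(1)[OF that] by simp
  qed
  define U where "U s t = lim (\<lambda>n. u n s t)" for s t
  have lim: "(\<lambda>n. u n s t) \<longlonglongrightarrow> U s t" if "q \<in> J" "s \<in> S" "t \<in> {c..q}" for s t q
  proof -
    have "summable (\<lambda>i. u (Suc i) s t - u i s t)"
      by (rule summable_comparison_test[OF _ sB[of q]]) (use M0(2)[OF that] in \<open>auto simp: B_def\<close>)
    then have "(\<lambda>n. u 0 s t + (\<Sum>i<n. u (Suc i) s t - u i s t)) \<longlonglongrightarrow> u 0 s t + (\<Sum>i. u (Suc i) s t - u i s t)"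
      by (intro tendsto_intros summable_LIMSEQ)
    then show ?thesis unfolding U_def tel[of _ s t, symmetric] by (metis limI)
  qed
  have conv: "(\<lambda>x. \<Sum>r\<in>S. K s r x * U r x) integrable_on {c..q} \<and>
      (\<lambda>n. integral {c..q} (\<lambda>x. \<Sum>r\<in>S. K s r x * u n r x)) \<longlonglongrightarrow> integral {c..q} (\<lambda>x. \<Sum>r\<in>S. K s r x * U r x)"
    if s: "s \<in> S" and q: "q \<in> J" for s q
  proof -
    have 1: "(\<lambda>x. \<Sum>r\<in>S. K s r x * u n r x) integrable_on {c..q}" for n
      by (intro ii s q cont)
    have 2: "(\<lambda>x. \<Sum>r\<in>S. \<bar>M\<bar> * (M0 q + suminf (B q))) integrable_on {c..q}" by (rule integrable_const_ivl)
    have 3: "norm (\<Sum>r\<in>S. K s r x * u n r x) \<le> (\<Sum>r\<in>S. \<bar>M\<bar> * (M0 q + suminf (B q)))"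
      if x: "x \<in> {c..q}" for n x
    proof (rule sum_norm_le)
      fix r assume r: "r \<in> S"
      show "norm (K s r x * u n r x) \<le> \<bar>M\<bar> * (M0 q + suminf (B q))"
        unfolding norm_mult using KM'[OF s r q x] ub[OF q r x, of n] by (intro mult_mono) auto
    qed
    have 4: "(\<lambda>n. \<Sum>r\<in>S. K s r x * u n r x) \<longlonglongrightarrow> (\<Sum>r\<in>S. K s r x * U r x)" if x: "x \<in> {c..q}" for x
      by (intro tendsto_intros lim[OF q _ x])
    show ?thesis using dominated_convergence[OF 1 2 3 4] by blast
  qed
  have eq: "U s t = g s t + integral {c..t} (\<lambda>x. \<Sum>r\<in>S. K s r x * U r x)" if s: "s \<in> S" and t: "t \<in> J" for s t
  proof (cases "c \<le> t")
    case True
    have "(\<lambda>n. u (Suc n) s t) \<longlonglongrightarrow> g s t + integral {c..t} (\<lambda>x. \<Sum>r\<in>S. K s r x * U r x)"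
      unfolding uS by (intro tendsto_intros conv[THEN conjunct2] s t)
    moreover have "(\<lambda>n. u (Suc n) s t) \<longlonglongrightarrow> U s t"
      using lim[OF t s] True by (intro LIMSEQ_Suc) auto
    ultimately show ?thesis using LIMSEQ_unique by blast
  next
    case False
    \<comment> \<open>Left of \<open>c\<close> the interval of integration is empty, so the iterates
      do not move.\<close>
    have "u n s t = g s t" for n using False by (cases n) (auto simp: u0 uS)
    then show ?thesis using False by (simp add: U_def)
  qed
  have "continuous_on {c..q} (U s)" if s: "s \<in> S" and q: "q \<in> J" for s q
  proof (subst continuous_on_cong[OF refl])
    show "continuous_on {c..q} (\<lambda>t. g s t + integral {c..t} (\<lambda>x. \<Sum>r\<in>S. K s r x * U r x))"
      by (intro continuous_intros g s q indefinite_integral_continuous_1 conv[THEN conjunct1])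
    fix x assume "x \<in> {c..q}"
    then have "x \<in> J" using J[OF q] by blast
    then show "U s x = g s x + integral {c..x} (\<lambda>x. \<Sum>r\<in>S. K s r x * U r x)" by (rule eq[OF s])
  qed
  then show ?thesis using eq by (intro exI[of _ U]) auto
qed

section \<open>Smooth functions and cutoffs\<close>

text \<open>The derivatives of the flat function \<open>exp (- 1 / x)\<close> all have this form.\<close>

definition flat_poly :: "real poly \<Rightarrow> real \<Rightarrow> real" where
  "flat_poly P x = (if x > 0 then poly P (1 / x) * exp (- 1 / x) else 0)"

lemma flat_poly_tendsto_0: "((\<lambda>y. poly P y * exp (- y)) \<longlongrightarrow> (0::real)) at_top"
proof -
  have "((\<lambda>y. y ^ i * exp (- y)) \<longlongrightarrow> (0::real)) at_top" for i
    using tendsto_power_div_exp_0[of i] by (simp add: exp_minus field_simps)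
  then have "((\<lambda>y. \<Sum>i\<le>degree P. coeff P i * (y ^ i * exp (- y))) \<longlongrightarrow>
     (\<Sum>i\<le>degree P. coeff P i * 0)) at_top"
    by (intro tendsto_intros)
  then show ?thesis by (simp add: poly_altdef sum_distrib_right mult.assoc)
qed

text \<open>With \<open>y = 1 / x\<close> the chain rule contributes the factor
  \<open>- y^2\<close>, and differentiating \<open>P\<close> times \<open>exp (- y)\<close> gives
  \<open>pderiv P - P\<close>. At \<open>0\<close> the difference quotient is again flat, with one
  more factor \<open>y\<close>, so it tends to \<open>0\<close>.\<close>

lemma flat_poly_has_derivative:
  "(flat_poly P has_real_derivative flat_poly ([:0, 0, 1:] * (P - pderiv P)) x) (at x)"
proof -
  consider "x > 0" | "x < 0" | "x = 0" by linarith
  then show ?thesis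
  proof cases
    case 1
    have "((\<lambda>x. poly P (1 / x) * exp (- 1 / x)) has_real_derivative
        flat_poly ([:0, 0, 1:] * (P - pderiv P)) x) (at x)"
      using 1 by (auto intro!: derivative_eq_intros DERIV_chain2[OF poly_DERIV]
         simp: flat_poly_def field_simps power2_eq_square)
    then show ?thesis
      by (rule has_field_derivative_transform_within_open[of _ _ _ "{0<..}"]) (use 1 in \<open>auto simp: flat_poly_def\<close>)
  next
    case 2
    have "((\<lambda>x. 0) has_real_derivative 0) (at x)" by simp
    then have "(flat_poly P has_real_derivative 0) (at x)"
      by (rule has_field_derivative_transform_within_open[of _ _ _ "{..<0}"]) (use 2 in \<open>auto simp: flat_poly_def\<close>)
    then show ?thesis using 2 by (simp add: flat_poly_def)
  next
    case 3
    have "((\<lambda>y. flat_poly P y / y) \<longlongrightarrow> 0) (at 0)"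
    proof (rule filterlim_split_at)
      show "((\<lambda>y. flat_poly P y / y) \<longlongrightarrow> 0) (at_left 0)"
        by (rule tendsto_eventually, rule eventually_at_leftI[of "-1"]) (auto simp: flat_poly_def)
      have "((\<lambda>y. poly (pCons 0 P) (inverse y) * exp (- inverse y)) \<longlongrightarrow> 0) (at_right 0)"
        by (rule filterlim_compose[OF flat_poly_tendsto_0 filterlim_inverse_at_top_right])
      then show "((\<lambda>y. flat_poly P y / y) \<longlongrightarrow> 0) (at_right 0)"
        by (rule Lim_transform_eventually)
           (auto simp: eventually_at_right_less flat_poly_def field_simps intro!: eventually_at_rightI[of 0 1])
    qed
    then have "(flat_poly P has_real_derivative 0) (at 0)"
      by (simp add: has_field_derivative_iff flat_poly_def)
    then show ?thesis using 3 by (simp add: flat_poly_def)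
  qed
qed

text \<open>Infinite differentiability on the whole line without naming the sequence of derivatives:
  to prove smoothness it is enough to exhibit a class of functions closed under
  differentiation.\<close>

coinductive smooth :: "(real \<Rightarrow> complex) \<Rightarrow> bool" where
  "(\<And>t. (g has_vector_derivative g' t) (at t)) \<Longrightarrow> smooth g' \<Longrightarrow> smooth g"

text \<open>The derivative of a product is a sum of products, so coinduction needs the class closed
  under both operations.\<close>

inductive smooth_alg :: "(real \<Rightarrow> complex) \<Rightarrow> bool" where
  base: "smooth g \<Longrightarrow> smooth_alg g"
| add: "smooth_alg g \<Longrightarrow> smooth_alg h \<Longrightarrow> smooth_alg (\<lambda>t. g t + h t)"
| mult: "smooth_alg g \<Longrightarrow> smooth_alg h \<Longrightarrow> smooth_alg (\<lambda>t. g t * h t)"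

lemma smooth_alg_deriv: "smooth_alg g \<Longrightarrow> \<exists>g'. (\<forall>t. (g has_vector_derivative g' t) (at t)) \<and> smooth_alg g'"
proof (induction rule: smooth_alg.induct)
  case (base g)
  then show ?case by (cases rule: smooth.cases) (blast intro: smooth_alg.base)
next
  case (add g h)
  then obtain g' h' where "\<forall>t. (g has_vector_derivative g' t) (at t)" "smooth_alg g'"
    "\<forall>t. (h has_vector_derivative h' t) (at t)" "smooth_alg h'" by blast
  then show ?case
    by (intro exI[of _ "\<lambda>t. g' t + h' t"]) (auto intro: smooth_alg.add has_vector_derivative_add)
next
  case (mult g h)
  then obtain g' h' where "\<forall>t. (g has_vector_derivative g' t) (at t)" "smooth_alg g'"
    "\<forall>t. (h has_vector_derivative h' t) (at t)" "smooth_alg h'" by blast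
  then show ?case using mult
    by (intro exI[of _ "\<lambda>t. g t * h' t + g' t * h t"])
       (auto intro!: smooth_alg.add smooth_alg.mult has_vector_derivative_mult)
qed

lemma smooth_alg_smooth: "smooth_alg g \<Longrightarrow> smooth g"
  by (erule smooth.coinduct) (use smooth_alg_deriv in blast)

lemma smooth_mult: "smooth g \<Longrightarrow> smooth h \<Longrightarrow> smooth (\<lambda>t. g t * h t)"
  by (rule smooth_alg_smooth) (intro smooth_alg.intros)

lemma smooth_add: "smooth g \<Longrightarrow> smooth h \<Longrightarrow> smooth (\<lambda>t. g t + h t)"
  by (rule smooth_alg_smooth) (intro smooth_alg.intros)

lemma smooth_poly: "smooth (\<lambda>t. poly P (complex_of_real t))"
proof -
  have "\<exists>P. g = (\<lambda>t. poly P (complex_of_real t)) \<Longrightarrow> smooth g" for g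
  proof (erule smooth.coinduct)
    fix g assume "\<exists>P. g = (\<lambda>t. poly P (complex_of_real t))"
    then obtain P where g: "g = (\<lambda>t. poly P (complex_of_real t))" by blast
    have "(g has_vector_derivative poly (pderiv P) (complex_of_real t)) (at t)" for t
      unfolding g by (rule has_vector_derivative_real_field) (rule poly_DERIV)
    then show "\<exists>ga g'. g = ga \<and> (\<forall>t. (ga has_vector_derivative g' t) (at t)) \<and>
       ((\<exists>P. g' = (\<lambda>t. poly P (complex_of_real t))) \<or> smooth g')"
      by (rule_tac exI[of _ g], rule_tac exI[of _ "\<lambda>t. poly (pderiv P) (complex_of_real t)"]) blast
  qed
  then show ?thesis by blast
qed

lemma smooth_flat_poly: "smooth (\<lambda>t. complex_of_real (c * flat_poly P (a * t + b)))"
proof -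
  have "\<exists>c P. g = (\<lambda>t. complex_of_real (c * flat_poly P (a * t + b))) \<Longrightarrow> smooth g" for g
  proof (erule smooth.coinduct)
    fix g assume "\<exists>c P. g = (\<lambda>t. complex_of_real (c * flat_poly P (a * t + b)))"
    then obtain c P where g: "g = (\<lambda>t. complex_of_real (c * flat_poly P (a * t + b)))" by blast
    define Q where "Q = [:0, 0, 1:] * (P - pderiv P)"
    have "((\<lambda>t. c * flat_poly P (a * t + b)) has_real_derivative (c * a) * flat_poly Q (a * t + b)) (at t)" for t
      unfolding Q_def
      by (auto intro!: derivative_eq_intros DERIV_chain2[OF flat_poly_has_derivative] simp del: mult_pCons_left)
    then have "(g has_vector_derivative complex_of_real (c * a * flat_poly Q (a * t + b))) (at t)" for t
      unfolding g by (intro has_vector_derivative_of_real) (simp add: has_real_derivative_iff_has_vector_derivative)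
    then show "\<exists>ga g'. g = ga \<and> (\<forall>t. (ga has_vector_derivative g' t) (at t)) \<and>
       ((\<exists>c P. g' = (\<lambda>t. complex_of_real (c * flat_poly P (a * t + b)))) \<or> smooth g')"
      by (rule_tac exI[of _ g], rule_tac exI[of _ "\<lambda>t. complex_of_real (c * a * flat_poly Q (a * t + b))"]) blast
  qed
  then show ?thesis by blast
qed

lemma smooth_continuous: "smooth g \<Longrightarrow> continuous_on A g"
  by (erule smooth.cases) (meson continuous_at_imp_continuous_on has_vector_derivative_continuous)

text \<open>The bump \<open>h\<close> is positive exactly between \<open>p\<close> and
  \<open>q\<close>, and the cutoff is one minus its normalised integral. The integral starts at
  \<open>p - 1\<close>, so that \<open>p\<close> is an interior point when \<open>F\<close> is
  differentiated there.\<close>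

lemma smooth_cutoff:
  assumes pq: "p < (q::real)"
  shows "\<exists>\<kappa>. smooth \<kappa> \<and> (\<forall>t\<le>p. \<kappa> t = 1) \<and> (\<forall>t\<ge>q. \<kappa> t = 0)"
proof -
  define h where "h t = flat_poly 1 (t - p) * flat_poly 1 (q - t)" for t
  have hs: "smooth (\<lambda>t. complex_of_real (h t))"
    using smooth_mult[OF smooth_flat_poly[of 1 1 1 "-p"] smooth_flat_poly[of 1 1 "-1" q]]
    by (simp add: h_def add.commute)
  have hc: "continuous_on A h" for A
    using continuous_on_Re[OF smooth_continuous[OF hs, of A]] by simp
  define F where "F t = integral {p-1..t} h" for t
  have F: "(F has_real_derivative h t) (at t)" for t
  proof (cases "t < p")
    case True
    have "F s = 0" if "s < p" for s
      unfolding F_def by (rule integral_unique, rule has_integral_is_0) (use that in \<open>auto simp: h_def flat_poly_def\<close>)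
    then have "((\<lambda>s. 0) has_real_derivative h t) (at t) \<Longrightarrow> ?thesis"
      by (rule_tac has_field_derivative_transform_within_open[of "\<lambda>_. 0" _ _ "{..<p}"]) (use True in auto)
    then show ?thesis using True by (simp add: h_def flat_poly_def)
  next
    case False
    have "(F has_vector_derivative h t) (at t within {p-1..t+1})"
      unfolding F_def by (rule integral_has_vector_derivative[OF hc]) (use False in auto)
    moreover have "at t within {p-1..t+1} = at t" by (rule at_within_Icc_at) (use False in auto)
    ultimately show ?thesis
      by (simp add: has_real_derivative_iff_has_vector_derivative)
  qed
  have "F p < F q"
  proof (rule DERIV_pos_imp_increasing_open[OF pq])
    show "\<And>x. p < x \<Longrightarrow> x < q \<Longrightarrow> \<exists>y. (F has_real_derivative y) (at x) \<and> 0 < y"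
      using F by (intro exI conjI) (auto simp: h_def flat_poly_def)
    show "continuous_on {p..q} F" using F by (meson DERIV_continuous continuous_at_imp_continuous_on)
  qed
  moreover have Fp: "F t = 0" if "t \<le> p" for t
    unfolding F_def by (rule integral_unique, rule has_integral_is_0) (use that in \<open>auto simp: h_def flat_poly_def\<close>)
  ultimately have Z: "F q > 0" by simp
  have Fq: "F t = F q" if "t \<ge> q" for t
  proof -
    have "h integrable_on {p-1..t}" by (rule integrable_continuous_real[OF hc])
    then have "F q + integral {q..t} h = F t"
      unfolding F_def by (intro Henstock_Kurzweil_Integration.integral_combine) (use that pq in auto)
    moreover have "integral {q..t} h = 0"
      by (rule integral_unique, rule has_integral_is_0) (auto simp: h_def flat_poly_def)
    ultimately show ?thesis by simp
  qed
  define \<kappa> where "\<kappa> t = complex_of_real (1 - F t / F q)" for t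
  have "(\<kappa> has_vector_derivative complex_of_real (- 1 / F q) * complex_of_real (h t)) (at t)" for t
  proof -
    have "((\<lambda>t. 1 - F t / F q) has_real_derivative - 1 / F q * h t) (at t)"
      using Z by (auto intro!: derivative_eq_intros F)
    then have "(\<kappa> has_vector_derivative complex_of_real (- 1 / F q * h t)) (at t)"
      unfolding \<kappa>_def by (intro has_vector_derivative_of_real) (simp add: has_real_derivative_iff_has_vector_derivative)
    then show ?thesis by simp
  qed
  moreover have "smooth (\<lambda>t. complex_of_real (- 1 / F q) * complex_of_real (h t))"
    using smooth_mult[OF smooth_poly[of "[:complex_of_real (- 1 / F q):]"] hs] by simp
  ultimately have "smooth \<kappa>" by (rule smooth.intros)
  moreover have "\<kappa> t = 1" if "t \<le> p" for t using Fp[OF that] by (simp add: \<kappa>_def)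
  moreover have "\<kappa> t = 0" if "t \<ge> q" for t using Fq[OF that] Z by (simp add: \<kappa>_def)
  ultimately show ?thesis by blast
qed

section \<open>The algebra of dynamic test functions\<close>

text \<open>The Boolean selects the side: \<open>True\<close> for \<open>t+\<close>, \<open>False\<close> for \<open>t-\<close>.\<close>

definition ess_at :: "bool \<Rightarrow> real \<Rightarrow> real filter" where
  "ess_at \<sigma> t = (if \<sigma> then ess_at_right t else ess_at_left t)"

definition slim :: "bool \<Rightarrow> (real \<Rightarrow> complex) \<Rightarrow> real \<Rightarrow> complex" where
  "slim \<sigma> g t = (if \<sigma> then rlim g t else llim g t)"

definition side :: "bool \<Rightarrow> real \<Rightarrow> real \<Rightarrow> real set" where
  "side \<sigma> t d = (if \<sigma> then {t<..<t+d} else {t-d<..<t})"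

lemma open_side: "open (side \<sigma> t d)" and side_mono: "d \<le> d' \<Longrightarrow> side \<sigma> t d \<subseteq> side \<sigma> t d'"
  by (auto simp: side_def)

lemma side_not_null: "d > 0 \<Longrightarrow> \<not> (AE s in lebesgue. s \<notin> side \<sigma> t d)"
proof
  assume d: "d > 0" and "AE s in lebesgue. s \<notin> side \<sigma> t d"
  then have "negligible (side \<sigma> t d)"
    unfolding negligible_iff_null_sets using AE_iff_null_sets[of "side \<sigma> t d" lebesgue]
    by (simp add: open_side borel_open)
  moreover have "(if \<sigma> then t + d / 2 else t - d / 2) \<in> side \<sigma> t d" using d by (simp add: side_def)
  ultimately show False using open_not_negligible[OF open_side, of \<sigma> t d] by blast
qed

lemma eventually_ess_at:
  "eventually P (ess_at \<sigma> t) \<longleftrightarrow> (\<exists>d>0. AE s in lebesgue. s \<in> side \<sigma> t d \<longrightarrow> P s)"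
proof
  have ev: "eventually Q (if \<sigma> then at_right t else at_left t) \<longleftrightarrow> (\<exists>d>0. \<forall>s\<in>side \<sigma> t d. Q s)" for Q
  proof (cases \<sigma>)
    case True
    have "(\<exists>b>t. \<forall>y>t. y < b \<longrightarrow> Q y) \<longleftrightarrow> (\<exists>d>0. \<forall>s\<in>{t<..<t+d}. Q s)"
    proof
      assume "\<exists>b>t. \<forall>y>t. y < b \<longrightarrow> Q y"
      then obtain b where "b > t" "\<forall>y>t. y < b \<longrightarrow> Q y" by blast
      then show "\<exists>d>0. \<forall>s\<in>{t<..<t+d}. Q s" by (intro exI[of _ "b - t"]) auto
    next
      assume "\<exists>d>0. \<forall>s\<in>{t<..<t+d}. Q s"
      then obtain d where "d > 0" "\<forall>s\<in>{t<..<t+d}. Q s" by blast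
      then show "\<exists>b>t. \<forall>y>t. y < b \<longrightarrow> Q y" by (intro exI[of _ "t + d"]) auto
    qed
    then show ?thesis using True by (simp add: side_def eventually_at_right_field)
  next
    case False
    have "(\<exists>b<t. \<forall>y>b. y < t \<longrightarrow> Q y) \<longleftrightarrow> (\<exists>d>0. \<forall>s\<in>{t-d<..<t}. Q s)"
    proof
      assume "\<exists>b<t. \<forall>y>b. y < t \<longrightarrow> Q y"
      then obtain b where "b < t" "\<forall>y>b. y < t \<longrightarrow> Q y" by blast
      then show "\<exists>d>0. \<forall>s\<in>{t-d<..<t}. Q s" by (intro exI[of _ "t - b"]) auto
    next
      assume "\<exists>d>0. \<forall>s\<in>{t-d<..<t}. Q s"
      then obtain d where "d > 0" "\<forall>s\<in>{t-d<..<t}. Q s" by blast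
      then show "\<exists>b<t. \<forall>y>b. y < t \<longrightarrow> Q y" by (intro exI[of _ "t - d"]) auto
    qed
    then show ?thesis using False by (simp add: side_def eventually_at_left_field)
  qed
  have eq: "ess_at \<sigma> t = inf (if \<sigma> then at_right t else at_left t) (ae_filter lebesgue)"
    by (simp add: ess_at_def ess_at_right_def ess_at_left_def)
  {
    assume "eventually P (ess_at \<sigma> t)"
    then obtain Q R where Q: "eventually Q (if \<sigma> then at_right t else at_left t)" and R: "AE s in lebesgue. R s"
      and P: "\<forall>s. Q s \<and> R s \<longrightarrow> P s"
      unfolding eq eventually_inf by blast
    obtain d where d: "d > 0" "\<forall>s\<in>side \<sigma> t d. Q s" using Q ev by blast
    have "AE s in lebesgue. s \<in> side \<sigma> t d \<longrightarrow> P s"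
      using R by eventually_elim (use P d in blast)
    then show "\<exists>d>0. AE s in lebesgue. s \<in> side \<sigma> t d \<longrightarrow> P s" using d(1) by blast
  }
  {
    assume "\<exists>d>0. AE s in lebesgue. s \<in> side \<sigma> t d \<longrightarrow> P s"
    then obtain d where d: "d > 0" "AE s in lebesgue. s \<in> side \<sigma> t d \<longrightarrow> P s" by blast
    have "eventually (\<lambda>s. s \<in> side \<sigma> t d) (if \<sigma> then at_right t else at_left t)"
      unfolding ev using d(1) by blast
    then show "eventually P (ess_at \<sigma> t)"
      unfolding eq eventually_inf using d(2) by blast
  }
qed

text \<open>One-sided neighbourhoods have positive measure; hence essential limits are unique and
  \<open>Lim\<close> returns them.\<close>

lemma ess_at_neq_bot [simp]: "ess_at \<sigma> t \<noteq> bot"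
proof
  assume "ess_at \<sigma> t = bot"
  then have "eventually (\<lambda>_. False) (ess_at \<sigma> t)" by simp
  then show False unfolding eventually_ess_at using side_not_null[of _ \<sigma> t] by auto
qed

lemma eventually_ess_at_side: "d > 0 \<Longrightarrow> eventually (\<lambda>s. s \<in> side \<sigma> t d) (ess_at \<sigma> t)"
  unfolding eventually_ess_at by auto

lemma eventually_ess_at_open:
  assumes "open U" "t \<in> U"
  shows "eventually (\<lambda>s. s \<in> U \<and> s \<noteq> t) (ess_at \<sigma> t)"
proof -
  obtain d where d: "d > 0" "ball t d \<subseteq> U" using assms openE by blast
  have "side \<sigma> t d \<subseteq> ball t d" "t \<notin> side \<sigma> t d" by (auto simp: side_def dist_real_def)
  then show ?thesis
    using d by (intro eventually_mono[OF eventually_ess_at_side[OF d(1)]]) blast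
qed

lemma eventually_ess_at_at: "eventually P (at t) \<Longrightarrow> eventually P (ess_at \<sigma> t)"
proof -
  assume "eventually P (at t)"
  then obtain U where "open U" "t \<in> U" "\<forall>s\<in>U. s \<noteq> t \<longrightarrow> P s" unfolding eventually_at_topological by blast
  then show ?thesis by (intro eventually_mono[OF eventually_ess_at_open[of U t]]) auto
qed

lemma tendsto_ess_at_at: "(g \<longlongrightarrow> l) (at t) \<Longrightarrow> (g \<longlongrightarrow> l) (ess_at \<sigma> t)"
  unfolding tendsto_def using eventually_ess_at_at by blast

lemma slim_eq_Lim: "slim \<sigma> g t = Lim (ess_at \<sigma> t) g"
  by (simp add: slim_def ess_at_def rlim_def llim_def)

lemma slim_ae_eq: "(g \<longlongrightarrow> l) (ess_at \<sigma> t) \<Longrightarrow> slim \<sigma> g t = l"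
  unfolding slim_eq_Lim by (rule tendsto_Lim) simp_all

lemma slim_continuous: "isCont g t \<Longrightarrow> slim \<sigma> g t = g t"
  by (intro slim_ae_eq tendsto_ess_at_at) (simp add: isCont_def)

lemma slim_cong: "eventually (\<lambda>s. g s = h s) (ess_at \<sigma> t) \<Longrightarrow> slim \<sigma> g t = slim \<sigma> h t"
  unfolding slim_eq_Lim by (rule Lim_cong) simp_all

lemma GG_iff: "g \<in> GG I \<longleftrightarrow> g \<in> borel_measurable (lebesgue_on I) \<and> (\<exists>B. AE t in lebesgue_on I. norm (g t) \<le> B)
    \<and> (\<forall>t\<in>I. \<forall>\<sigma>. \<exists>l. (g \<longlongrightarrow> l) (ess_at \<sigma> t))"
  unfolding GG_def ess_at_def by (auto simp: all_bool_eq)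

lemma GG_tendsto: "g \<in> GG I \<Longrightarrow> t \<in> I \<Longrightarrow> (g \<longlongrightarrow> slim \<sigma> g t) (ess_at \<sigma> t)"
  unfolding GG_iff using slim_ae_eq by blast

lemma is_gderiv_iff: "is_gderiv I g h \<longleftrightarrow> h \<in> GG I \<and>
   (\<forall>t\<in>I. \<forall>\<sigma>. ((\<lambda>s. (g s - slim \<sigma> g t) / of_real (s - t)) \<longlongrightarrow> slim \<sigma> h t) (ess_at \<sigma> t))"
  unfolding is_gderiv_def ess_at_def slim_def by (auto simp: all_bool_eq)

lemma is_gderiv_GG: "is_gderiv I g h \<Longrightarrow> h \<in> GG I"
  by (simp add: is_gderiv_iff)

lemma is_gderivD: "is_gderiv I g h \<Longrightarrow> t \<in> I \<Longrightarrow>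
    ((\<lambda>s. (g s - slim \<sigma> g t) / of_real (s - t)) \<longlongrightarrow> slim \<sigma> h t) (ess_at \<sigma> t)"
  unfolding is_gderiv_iff by blast

section \<open>Almost everywhere equality, one-sided limits and chains of derivatives\<close>

text \<open>The end points do not appear, so infinite ones need no separate treatment.\<close>

locale dyn_interval =
  fixes I :: "real set"
  assumes open_I: "open I" and ivl_I: "\<And>x y z. x \<in> I \<Longrightarrow> z \<in> I \<Longrightarrow> x \<le> y \<Longrightarrow> y \<le> z \<Longrightarrow> y \<in> I"
    and I_nonempty: "I \<noteq> {}"
begin

definition ae_eq :: "(real \<Rightarrow> complex) \<Rightarrow> (real \<Rightarrow> complex) \<Rightarrow> bool" where
  "ae_eq g h \<longleftrightarrow> (AE t in lebesgue_on I. g t = h t)"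

lemma I_sets [simp]: "I \<in> sets lebesgue" using open_I by (simp add: borel_open)

lemma AE_I: "(AE t in lebesgue_on I. P t) \<longleftrightarrow> (AE t in lebesgue. t \<in> I \<longrightarrow> P t)"
  by (rule AE_restrict_space_iff) simp

lemma AE_I_not_False: "\<not> (AE t in lebesgue_on I. False)"
proof
  assume "AE t in lebesgue_on I. False"
  then have "AE t in lebesgue. t \<notin> I" unfolding AE_I by simp
  then have "negligible I" unfolding negligible_iff_null_sets using AE_iff_null_sets[of I lebesgue] by simp
  then show False using open_not_negligible[OF open_I I_nonempty] by simp
qed

lemma ess_at_AE_I:
  assumes "t \<in> I" and P: "AE t in lebesgue_on I. P t"
  shows "eventually P (ess_at \<sigma> t)"
proof -
  obtain d where d: "d > 0" "ball t d \<subseteq> I" using open_I assms(1) openE by blast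
  have "side \<sigma> t d \<subseteq> I" using d(2) by (auto simp: side_def dist_real_def subset_iff)
  then show ?thesis unfolding eventually_ess_at using P d(1) unfolding AE_I
    by (intro exI[of _ d]) (auto elim!: eventually_mono)
qed

lemma ae_eq_refl [simp]: "ae_eq g g" by (simp add: ae_eq_def)
lemma ae_eq_sym: "ae_eq g h \<Longrightarrow> ae_eq h g" unfolding ae_eq_def by (auto elim!: eventually_mono)
lemma ae_eq_trans: "ae_eq g h \<Longrightarrow> ae_eq h k \<Longrightarrow> ae_eq g k" unfolding ae_eq_def by (auto elim: eventually_elim2)
lemma ae_eq_add: "ae_eq g g' \<Longrightarrow> ae_eq h h' \<Longrightarrow> ae_eq (\<lambda>t. g t + h t) (\<lambda>t. g' t + h' t)"
  unfolding ae_eq_def by (auto elim: eventually_elim2)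
lemma ae_eq_mult: "ae_eq g g' \<Longrightarrow> ae_eq h h' \<Longrightarrow> ae_eq (\<lambda>t. g t * h t) (\<lambda>t. g' t * h' t)"
  unfolding ae_eq_def by (auto elim: eventually_elim2)
lemma ae_eq_I: "(\<And>t. t \<in> I \<Longrightarrow> g t = h t) \<Longrightarrow> ae_eq g h" unfolding ae_eq_def AE_I by simp

lemma slim_ae_eq_cong: "ae_eq g h \<Longrightarrow> t \<in> I \<Longrightarrow> slim \<sigma> g t = slim \<sigma> h t"
  unfolding ae_eq_def by (intro slim_cong ess_at_AE_I)

lemma tendsto_ae_eq_cong: "ae_eq g h \<Longrightarrow> t \<in> I \<Longrightarrow> (g \<longlongrightarrow> l) (ess_at \<sigma> t) \<Longrightarrow> (h \<longlongrightarrow> l) (ess_at \<sigma> t)"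
  using tendsto_cong[OF ess_at_AE_I[of t "\<lambda>s. g s = h s"]] by (simp add: ae_eq_def)

lemma GG_ae_eq: 
  assumes g: "g \<in> GG I" and gh: "ae_eq g h"
  shows "h \<in> GG I"
  unfolding GG_iff
proof (intro conjI ballI allI)
  have "(\<lambda>t. if t \<in> I then g t else 0) \<in> borel_measurable lebesgue"
    using g unfolding GG_iff by (subst borel_measurable_if) auto
  moreover have "AE t in lebesgue. (if t \<in> I then g t else 0) = (if t \<in> I then h t else 0)"
    using gh unfolding ae_eq_def AE_I by eventually_elim simp
  ultimately have "(\<lambda>t. if t \<in> I then h t else 0) \<in> borel_measurable lebesgue" by (rule borel_measurable_AE)
  then show "h \<in> borel_measurable (lebesgue_on I)" by (subst (asm) borel_measurable_if) auto
  obtain B where "AE t in lebesgue_on I. norm (g t) \<le> B" using g unfolding GG_iff by blast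
  then have "AE t in lebesgue_on I. norm (h t) \<le> B" using gh unfolding ae_eq_def by eventually_elim simp
  then show "\<exists>B. AE t in lebesgue_on I. norm (h t) \<le> B" by blast
  show "\<exists>l. (h \<longlongrightarrow> l) (ess_at \<sigma> t)" if "t \<in> I" for t \<sigma>
    using tendsto_ae_eq_cong[OF gh that GG_tendsto[OF g that]] by blast
qed

lemma is_gderiv_ae_eq:
  assumes "is_gderiv I g h" "ae_eq g g'" "ae_eq h h'"
  shows "is_gderiv I g' h'"
  unfolding is_gderiv_iff
proof (intro conjI ballI allI)
  show "h' \<in> GG I" using GG_ae_eq assms is_gderiv_iff by blast
  fix t \<sigma> assume t: "t \<in> I"
  have "ae_eq (\<lambda>s. (g s - slim \<sigma> g t) / of_real (s - t)) (\<lambda>s. (g' s - slim \<sigma> g' t) / of_real (s - t))"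
    using assms(2) slim_ae_eq_cong[OF assms(2) t, of \<sigma>] unfolding ae_eq_def by (auto elim!: eventually_mono)
  then show "((\<lambda>s. (g' s - slim \<sigma> g' t) / of_real (s - t)) \<longlongrightarrow> slim \<sigma> h' t) (ess_at \<sigma> t)"
    using is_gderivD[OF assms(1) t, of \<sigma>] unfolding slim_ae_eq_cong[OF assms(3) t] by (rule tendsto_ae_eq_cong[OF _ t])
qed

lemma slim_norm_le:
  assumes "g \<in> GG I" "t \<in> I" "AE t in lebesgue_on I. norm (g t) \<le> C"
  shows "norm (slim \<sigma> g t) \<le> C"
  by (rule tendsto_upperbound[OF tendsto_norm[OF GG_tendsto[OF assms(1,2)]] ess_at_AE_I[OF assms(2,3)]]) simp

text \<open>Negligibility is a local property, and almost everywhere on a punctured neighbourhood of \<open>x\<close> both \<open>g\<close> and its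
  one-sided limits are close to \<open>g(x-)\<close> resp. \<open>g(x+)\<close>.\<close>

lemma GG_ae_slim:
  assumes g: "g \<in> GG I"
  shows "AE t in lebesgue_on I. g t = slim \<sigma> g t"
proof -
  have neg: "negligible {t \<in> I. \<not> norm (g t - slim \<sigma> g t) \<le> 2 * e}" (is "negligible ?S") if e: "e > 0" for e :: real
  proof (subst locally_negligible_alt, rule ballI)
    fix x assume x: "x \<in> ?S"
    then have xI: "x \<in> I" by blast
    have "\<exists>d>0. AE s in lebesgue. s \<in> side \<tau> x d \<longrightarrow> dist (g s) (slim \<tau> g x) < e" for \<tau>
      using tendstoD[OF GG_tendsto[OF g xI] e, of \<tau>] unfolding eventually_ess_at .
    then obtain d where d: "\<And>\<tau>. d \<tau> > 0" "\<And>\<tau>. AE s in lebesgue. s \<in> side \<tau> x (d \<tau>) \<longrightarrow> dist (g s) (slim \<tau> g x) < e"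
      by metis
    have st: "dist (slim \<sigma> g s) (slim \<tau> g x) \<le> e" if s: "s \<in> I" "s \<in> side \<tau> x (d \<tau>)" for s \<tau>
    proof -
      obtain r where r: "r > 0" "ball s r \<subseteq> side \<tau> x (d \<tau>)" using open_side s(2) openE by blast
      have "side \<sigma> s r \<subseteq> ball s r" by (auto simp: side_def dist_real_def)
      then have "eventually (\<lambda>s. dist (g s) (slim \<tau> g x) \<le> e) (ess_at \<sigma> s)"
        unfolding eventually_ess_at using d(2)[of \<tau>] r
      proof (intro exI[of _ r] conjI)
        show "AE z in lebesgue. z \<in> side \<sigma> s r \<longrightarrow> dist (g z) (slim \<tau> g x) \<le> e"
          using d(2)[of \<tau>] by (rule eventually_mono) (use r(2) \<open>side \<sigma> s r \<subseteq> ball s r\<close> in fastforce)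
      qed (rule r(1))
      then show ?thesis
        by (intro tendsto_upperbound[OF tendsto_dist[OF GG_tendsto[OF g s(1)] tendsto_const]]) auto
    qed
    define N where "N = {s. \<exists>\<tau>. \<not> (s \<in> side \<tau> x (d \<tau>) \<longrightarrow> dist (g s) (slim \<tau> g x) < e)}"
    have "AE s in lebesgue. \<forall>\<tau>. s \<in> side \<tau> x (d \<tau>) \<longrightarrow> dist (g s) (slim \<tau> g x) < e"
      using d(2) by (simp add: all_bool_eq)
    then obtain N' where N': "N' \<in> null_sets lebesgue" "N \<subseteq> N'"
      unfolding N_def eventually_ae_filter by auto
    define U where "U = ?S \<inter> {x - d False<..<x + d True}"
    have "U \<subseteq> insert x N'"
    proof
      fix s assume s: "s \<in> U"
      show "s \<in> insert x N'"
      proof (rule ccontr)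
        assume ns: "s \<notin> insert x N'"
        define \<tau> where "\<tau> = (s > x)"
        have sd: "s \<in> side \<tau> x (d \<tau>)" using s ns by (auto simp: U_def side_def \<tau>_def)
        have "dist (g s) (slim \<tau> g x) < e" using ns N'(2) sd by (auto simp: N_def)
        moreover have "dist (slim \<sigma> g s) (slim \<tau> g x) \<le> e" using s by (intro st sd) (auto simp: U_def)
        ultimately have "dist (g s) (slim \<sigma> g s) \<le> 2 * e"
          using dist_triangle2[of "g s" "slim \<sigma> g s" "slim \<tau> g x"] by linarith
        then show False using s by (auto simp: U_def dist_norm)
      qed
    qed
    then have "negligible U"
      using N'(1) by (meson negligible_iff_null_sets negligible_insert negligible_subset)
    moreover have "openin (top_of_set ?S) U" unfolding U_def by (intro openin_open_Int) simp
    moreover have "x \<in> U" using x d(1) by (auto simp: U_def)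
    ultimately show "\<exists>U. openin (top_of_set ?S) U \<and> x \<in> U \<and> negligible U" by blast
  qed
  have "{t \<in> I. g t \<noteq> slim \<sigma> g t} \<subseteq> (\<Union>n::nat. {t \<in> I. \<not> norm (g t - slim \<sigma> g t) \<le> 2 * (1 / (real n + 1))})"
  proof
    fix t assume t: "t \<in> {t \<in> I. g t \<noteq> slim \<sigma> g t}"
    then have "norm (g t - slim \<sigma> g t) / 2 > 0" by simp
    then obtain n where "1 / (real n + 1) < norm (g t - slim \<sigma> g t) / 2"
      by (metis nat_approx_posE of_nat_Suc add.commute)
    then show "t \<in> (\<Union>n::nat. {t \<in> I. \<not> norm (g t - slim \<sigma> g t) \<le> 2 * (1 / (real n + 1))})"
      using t by (auto intro!: exI[of _ n])
  qed
  moreover have "negligible (\<Union>n::nat. {t \<in> I. \<not> norm (g t - slim \<sigma> g t) \<le> 2 * (1 / (real n + 1))})"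
    by (rule negligible_countable_Union, simp, erule imageE, simp only:, rule neg, simp)
  ultimately have "{t \<in> I. g t \<noteq> slim \<sigma> g t} \<in> null_sets lebesgue"
    unfolding negligible_iff_null_sets[symmetric] by (rule negligible_subset[rotated])
  then show ?thesis unfolding AE_I by (rule AE_I') auto
qed

lemma ae_eq_slimI:
  assumes "g \<in> GG I" "h \<in> GG I" "\<And>t. t \<in> I \<Longrightarrow> slim \<sigma> g t = slim \<sigma> h t"
  shows "ae_eq g h"
  using GG_ae_slim[OF assms(1), of \<sigma>] GG_ae_slim[OF assms(2), of \<sigma>] assms(3) unfolding ae_eq_def AE_I
  by (auto elim: eventually_elim2)

lemma is_gderiv_unique: "is_gderiv I g h \<Longrightarrow> is_gderiv I g h' \<Longrightarrow> ae_eq h h'"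
  by (rule ae_eq_slimI[of _ _ True]) (auto intro: is_gderiv_GG tendsto_unique[OF ess_at_neq_bot is_gderivD is_gderivD])

lemma is_gderiv_gderiv: "is_gderiv I g h \<Longrightarrow> is_gderiv I g (gderiv I g)"
  unfolding gderiv_def by (rule someI[of "is_gderiv I g"])

lemma gderiv_ae_eq: "is_gderiv I g h \<Longrightarrow> ae_eq (gderiv I g) h"
  using is_gderiv_gderiv is_gderiv_unique by blast

text \<open>Choosing a derivative inside \<open>X\<close> again and again produces the chain that
  \<open>Ginf\<close> asks for. Membership thus reduces to finding a class closed under some
  derivative.\<close>

lemma Ginf_coinduct:
  assumes X: "X g" and step: "\<And>g. X g \<Longrightarrow> g \<in> GG I \<and> (\<exists>h. is_gderiv I g h \<and> X h)"
  shows "g \<in> Ginf I"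
proof -
  define next_deriv where "next_deriv g = (SOME h. is_gderiv I g h \<and> X h)" for g
  have nd: "is_gderiv I g (next_deriv g) \<and> X (next_deriv g)" if "X g" for g
    unfolding next_deriv_def using step[OF that] by (intro someI_ex[of "\<lambda>h. is_gderiv I g h \<and> X h"]) blast
  define d where "d k = (next_deriv ^^ k) g" for k
  have Xd: "X (d k)" for k by (induction k) (use X nd in \<open>auto simp: d_def\<close>)
  have "d 0 = g" "\<forall>k. is_gderiv I (d k) (d (Suc k))" using nd[OF Xd] by (simp_all add: d_def)
  then show ?thesis unfolding Ginf_def using step[OF X] by blast
qed

lemma Ginf_GG: "g \<in> Ginf I \<Longrightarrow> g \<in> GG I" by (simp add: Ginf_def)

lemma Ginf_ex_deriv:
  assumes "g \<in> Ginf I" shows "\<exists>h\<in>Ginf I. is_gderiv I g h"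
proof -
  obtain d where d: "d 0 = g" "\<And>k. is_gderiv I (d k) (d (Suc k))" using assms by (auto simp: Ginf_def)
  have "d 1 \<in> Ginf I" unfolding Ginf_def
    using is_gderiv_GG[OF d(2)[of 0]] d(2) by (auto intro!: exI[of _ "\<lambda>k. d (Suc k)"])
  then show ?thesis using d(2)[of 0] d(1) by auto
qed

lemma Ginf_ae_eq:
  assumes "g \<in> Ginf I" "ae_eq g h" shows "h \<in> Ginf I"
proof (rule Ginf_coinduct[where X = "\<lambda>h. \<exists>g\<in>Ginf I. ae_eq g h"])
  show "\<exists>g\<in>Ginf I. ae_eq g h" using assms by blast
  fix h assume "\<exists>g\<in>Ginf I. ae_eq g h"
  then obtain g where g: "g \<in> Ginf I" "ae_eq g h" by blast
  obtain g' where g': "g' \<in> Ginf I" "is_gderiv I g g'" using Ginf_ex_deriv[OF g(1)] by blast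
  have "is_gderiv I h g'" by (rule is_gderiv_ae_eq[OF g'(2) g(2) ae_eq_refl])
  moreover have "h \<in> GG I" by (rule GG_ae_eq[OF Ginf_GG[OF g(1)] g(2)])
  ultimately show "h \<in> GG I \<and> (\<exists>h'. is_gderiv I h h' \<and> (\<exists>g\<in>Ginf I. ae_eq g h'))"
    using g'(1) ae_eq_refl by (intro conjI exI[of _ g'] bexI[of _ g'])
qed

lemma Ginf_gderiv:
  assumes "g \<in> Ginf I" shows "gderiv I g \<in> Ginf I" "is_gderiv I g (gderiv I g)"
  using Ginf_ex_deriv[OF assms] is_gderiv_gderiv Ginf_ae_eq ae_eq_sym gderiv_ae_eq by blast+

lemma Ginf_gderivs: "g \<in> Ginf I \<Longrightarrow> gderivs I k g \<in> Ginf I"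
  by (induction k) (auto simp: gderivs_def Ginf_gderiv)

lemma Ginf_I: "g \<in> GG I \<Longrightarrow> is_gderiv I g h \<Longrightarrow> h \<in> Ginf I \<Longrightarrow> g \<in> Ginf I"
  by (rule Ginf_coinduct[where X = "\<lambda>f. f \<in> Ginf I \<or> f = g"]) (use Ginf_ex_deriv Ginf_GG in blast)+

lemma gderivs_0 [simp]: "gderivs I 0 g = g" by (simp add: gderivs_def)
lemma gderivs_Suc: "gderivs I (Suc k) g = gderivs I k (gderiv I g)" by (simp add: gderivs_def funpow_swap1)
lemma gderivs_Suc': "gderivs I (Suc k) g = gderiv I (gderivs I k g)" by (simp add: gderivs_def)

lemma gderiv_cong: "g \<in> Ginf I \<Longrightarrow> ae_eq g h \<Longrightarrow> ae_eq (gderiv I g) (gderiv I h)"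
  by (rule ae_eq_sym[OF gderiv_ae_eq[OF is_gderiv_ae_eq[OF Ginf_gderiv(2) _ ae_eq_refl]]])

lemma gderivs_cong: "g \<in> Ginf I \<Longrightarrow> ae_eq g h \<Longrightarrow> ae_eq (gderivs I k g) (gderivs I k h)"
  by (induction k) (auto simp: gderivs_Suc' Ginf_gderivs intro: gderiv_cong)

text \<open>\<open>gderiv\<close> is a Hilbert choice, so an explicitly known sequence of
  derivatives can agree with it only almost everywhere. The derivatives of concrete functions are
  identified in this way.\<close>

lemma gderivs_chain:
  assumes d: "\<And>k. is_gderiv I (d k) (d (Suc k))" and d0: "d 0 \<in> GG I"
  shows "d 0 \<in> Ginf I" "ae_eq (gderivs I k (d 0)) (d k)"
proof -
  show *: "d 0 \<in> Ginf I" using assms unfolding Ginf_def by blast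
  show "ae_eq (gderivs I k (d 0)) (d k)"
  proof (induction k)
    case (Suc k)
    then show ?case
      using ae_eq_trans[OF gderiv_cong[OF Ginf_gderivs[OF *] Suc] gderiv_ae_eq[OF d]] by (simp add: gderivs_Suc')
  qed simp
qed

section \<open>Sums and products in \<open>Ginf I\<close>\<close>

lemma GG_const [simp]: "(\<lambda>_. c) \<in> GG I"
  unfolding GG_iff by (auto intro: tendsto_const)

lemma GG_add: assumes g: "g \<in> GG I" and h: "h \<in> GG I" shows "(\<lambda>t. g t + h t) \<in> GG I"
  unfolding GG_iff
proof (intro conjI ballI allI)
  show "(\<lambda>t. g t + h t) \<in> borel_measurable (lebesgue_on I)" using g h by (auto simp: GG_iff)
  obtain B C where "AE t in lebesgue_on I. norm (g t) \<le> B" "AE t in lebesgue_on I. norm (h t) \<le> C"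
    using g h unfolding GG_iff by blast
  then have "AE t in lebesgue_on I. norm (g t + h t) \<le> B + C" by eventually_elim (rule norm_triangle_mono)
  then show "\<exists>B. AE t in lebesgue_on I. norm (g t + h t) \<le> B" by blast
qed (use GG_tendsto[OF g] GG_tendsto[OF h] tendsto_add in blast)

lemma GG_mult: assumes g: "g \<in> GG I" and h: "h \<in> GG I" shows "(\<lambda>t. g t * h t) \<in> GG I"
  unfolding GG_iff
proof (intro conjI ballI allI)
  show "(\<lambda>t. g t * h t) \<in> borel_measurable (lebesgue_on I)" using g h by (auto simp: GG_iff)
  obtain B C where "AE t in lebesgue_on I. norm (g t) \<le> B" "AE t in lebesgue_on I. norm (h t) \<le> C"
    using g h unfolding GG_iff by blast
  then have "AE t in lebesgue_on I. norm (g t * h t) \<le> \<bar>B\<bar> * \<bar>C\<bar>"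
    by eventually_elim (auto simp: norm_mult intro!: mult_mono)
  then show "\<exists>B. AE t in lebesgue_on I. norm (g t * h t) \<le> B" by blast
qed (use GG_tendsto[OF g] GG_tendsto[OF h] tendsto_mult in blast)

lemma slim_add: "g \<in> GG I \<Longrightarrow> h \<in> GG I \<Longrightarrow> t \<in> I \<Longrightarrow> slim \<sigma> (\<lambda>t. g t + h t) t = slim \<sigma> g t + slim \<sigma> h t"
  by (intro slim_ae_eq tendsto_add GG_tendsto)

lemma slim_mult: "g \<in> GG I \<Longrightarrow> h \<in> GG I \<Longrightarrow> t \<in> I \<Longrightarrow> slim \<sigma> (\<lambda>t. g t * h t) t = slim \<sigma> g t * slim \<sigma> h t"
  by (intro slim_ae_eq tendsto_mult GG_tendsto)

lemma slim_const [simp]: "slim \<sigma> (\<lambda>_. c) t = c"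
  by (intro slim_ae_eq tendsto_const)

lemma is_gderiv_const: "is_gderiv I (\<lambda>_. c) (\<lambda>_. 0)"
  unfolding is_gderiv_iff by simp

lemma is_gderiv_add:
  assumes g: "g \<in> GG I" "is_gderiv I g g'" and h: "h \<in> GG I" "is_gderiv I h h'"
  shows "is_gderiv I (\<lambda>t. g t + h t) (\<lambda>t. g' t + h' t)"
  unfolding is_gderiv_iff
proof (intro conjI ballI allI)
  show "(\<lambda>t. g' t + h' t) \<in> GG I" using g h by (auto simp: is_gderiv_iff intro: GG_add)
  fix t \<sigma> assume t: "t \<in> I"
  have "((\<lambda>s. (g s - slim \<sigma> g t) / of_real (s - t) + (h s - slim \<sigma> h t) / of_real (s - t)) \<longlongrightarrow> slim \<sigma> g' t + slim \<sigma> h' t) (ess_at \<sigma> t)"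
    using g h t unfolding is_gderiv_iff by (intro tendsto_add) auto
  then show "((\<lambda>s. (g s + h s - slim \<sigma> (\<lambda>t. g t + h t) t) / of_real (s - t)) \<longlongrightarrow> slim \<sigma> (\<lambda>t. g' t + h' t) t) (ess_at \<sigma> t)"
    using g h t by (simp add: slim_add is_gderiv_iff add_divide_distrib diff_divide_distrib algebra_simps)
qed

lemma is_gderiv_mult:
  assumes g: "g \<in> GG I" "is_gderiv I g g'" and h: "h \<in> GG I" "is_gderiv I h h'"
  shows "is_gderiv I (\<lambda>t. g t * h t) (\<lambda>t. g' t * h t + g t * h' t)"
  unfolding is_gderiv_iff
proof (intro conjI ballI allI)
  have G: "g' \<in> GG I" "h' \<in> GG I" using g h by (auto simp: is_gderiv_iff)
  show "(\<lambda>t. g' t * h t + g t * h' t) \<in> GG I" using g h G by (intro GG_add GG_mult)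
  fix t \<sigma> assume t: "t \<in> I"
  have "((\<lambda>s. (g s - slim \<sigma> g t) / of_real (s - t) * h s + slim \<sigma> g t * ((h s - slim \<sigma> h t) / of_real (s - t)))
      \<longlongrightarrow> slim \<sigma> g' t * slim \<sigma> h t + slim \<sigma> g t * slim \<sigma> h' t) (ess_at \<sigma> t)"
    using g h t unfolding is_gderiv_iff by (intro tendsto_intros GG_tendsto) auto
  moreover have "slim \<sigma> (\<lambda>t. g' t * h t + g t * h' t) t = slim \<sigma> g' t * slim \<sigma> h t + slim \<sigma> g t * slim \<sigma> h' t"
    using g(1) h(1) G t by (simp add: slim_add slim_mult GG_mult)
  ultimately show "((\<lambda>s. (g s * h s - slim \<sigma> (\<lambda>t. g t * h t) t) / of_real (s - t)) \<longlongrightarrow> slim \<sigma> (\<lambda>t. g' t * h t + g t * h' t) t) (ess_at \<sigma> t)"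
    using g h t by (simp add: slim_mult add_divide_distrib diff_divide_distrib algebra_simps)
qed

text \<open>As for smooth functions, the Leibniz rule leads out of products but not out of sums of
  products.\<close>

inductive galg :: "(real \<Rightarrow> complex) \<Rightarrow> bool" where
  base: "g \<in> Ginf I \<Longrightarrow> galg g"
| add: "galg g \<Longrightarrow> galg h \<Longrightarrow> galg (\<lambda>t. g t + h t)"
| mult: "galg g \<Longrightarrow> galg h \<Longrightarrow> galg (\<lambda>t. g t * h t)"

lemma galg_step: "galg g \<Longrightarrow> g \<in> GG I \<and> (\<exists>h. is_gderiv I g h \<and> galg h)"
proof (induction rule: galg.induct)
  case (base g) then show ?case using Ginf_ex_deriv Ginf_GG galg.base by blast
next
  case (add g h)
  then obtain g' h' where *: "is_gderiv I g g'" "galg g'" "is_gderiv I h h'" "galg h'" by blast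
  have "is_gderiv I (\<lambda>t. g t + h t) (\<lambda>t. g' t + h' t)" using add * by (intro is_gderiv_add) auto
  then show ?case using add * GG_add galg.add by blast
next
  case (mult g h)
  then obtain g' h' where *: "is_gderiv I g g'" "galg g'" "is_gderiv I h h'" "galg h'" by blast
  have "is_gderiv I (\<lambda>t. g t * h t) (\<lambda>t. g' t * h t + g t * h' t)" using mult * by (intro is_gderiv_mult) auto
  moreover have "galg (\<lambda>t. g' t * h t + g t * h' t)" using mult * by (intro galg.add galg.mult)
  ultimately show ?case using mult GG_mult by blast
qed

lemma galg_Ginf: "galg g \<Longrightarrow> g \<in> Ginf I"
  by (erule Ginf_coinduct) (rule galg_step)

lemma Ginf_add: "g \<in> Ginf I \<Longrightarrow> h \<in> Ginf I \<Longrightarrow> (\<lambda>t. g t + h t) \<in> Ginf I"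
  by (rule galg_Ginf) (intro galg.intros)

lemma Ginf_mult: "g \<in> Ginf I \<Longrightarrow> h \<in> Ginf I \<Longrightarrow> (\<lambda>t. g t * h t) \<in> Ginf I"
  by (rule galg_Ginf) (intro galg.intros)

lemma Ginf_const [simp]: "(\<lambda>_. c) \<in> Ginf I"
  by (rule Ginf_coinduct[where X = "\<lambda>g. \<exists>c. g = (\<lambda>_. c)"]) (use is_gderiv_const in auto)

lemma Ginf_cmult: "g \<in> Ginf I \<Longrightarrow> (\<lambda>t. c * g t) \<in> Ginf I"
  by (intro Ginf_mult Ginf_const)

lemma Ginf_diff: "g \<in> Ginf I \<Longrightarrow> h \<in> Ginf I \<Longrightarrow> (\<lambda>t. g t - h t) \<in> Ginf I"
  using Ginf_add[of g "\<lambda>t. -1 * h t"] Ginf_cmult[of h "-1"] by simp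

lemma Ginf_sum: "(\<And>i. i \<in> S \<Longrightarrow> g i \<in> Ginf I) \<Longrightarrow> (\<lambda>t. \<Sum>i\<in>S. g i t) \<in> Ginf I"
  by (induction S rule: infinite_finite_induct) (auto intro: Ginf_add)

lemma gderiv_add: "g \<in> Ginf I \<Longrightarrow> h \<in> Ginf I \<Longrightarrow> ae_eq (gderiv I (\<lambda>t. g t + h t)) (\<lambda>t. gderiv I g t + gderiv I h t)"
  by (intro gderiv_ae_eq is_gderiv_add Ginf_gderiv Ginf_GG)

lemma gderiv_mult: "g \<in> Ginf I \<Longrightarrow> h \<in> Ginf I \<Longrightarrow>
    ae_eq (gderiv I (\<lambda>t. g t * h t)) (\<lambda>t. gderiv I g t * h t + g t * gderiv I h t)"
  by (intro gderiv_ae_eq is_gderiv_mult Ginf_gderiv Ginf_GG)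

lemma is_gderiv_cmult: "g \<in> GG I \<Longrightarrow> is_gderiv I g g' \<Longrightarrow> is_gderiv I (\<lambda>t. c * g t) (\<lambda>t. c * g' t)"
  using is_gderiv_mult[of "\<lambda>_. c" "\<lambda>_. 0" g g'] is_gderiv_const by simp

lemma gderiv_cmult: "g \<in> Ginf I \<Longrightarrow> ae_eq (gderiv I (\<lambda>t. c * g t)) (\<lambda>t. c * gderiv I g t)"
  by (intro gderiv_ae_eq is_gderiv_cmult Ginf_gderiv Ginf_GG)

section \<open>The norms and their behaviour under the algebra operations\<close>

text \<open>\<open>real_of_ereal\<close> is harmless here, because the essential supremum is finite
  and, as \<open>I\<close> is not a null set, nonnegative.\<close>

lemma Linf_norm_AE:
  assumes g: "g \<in> GG I" shows "AE t in lebesgue_on I. norm (g t) \<le> Linf_norm I g"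
    and "(AE t in lebesgue_on I. norm (g t) \<le> C) \<Longrightarrow> Linf_norm I g \<le> C" and "0 \<le> Linf_norm I g"
proof -
  define E where "E = esssup (lebesgue_on I) (\<lambda>t. ereal (norm (g t)))"
  have m: "(\<lambda>t. ereal (norm (g t))) \<in> borel_measurable (lebesgue_on I)" using g by (auto simp: GG_iff)
  have AE: "AE t in lebesgue_on I. ereal (norm (g t)) \<le> E"
    unfolding E_def by (rule esssup_AE)
  have le: "E \<le> ereal C" if "AE t in lebesgue_on I. norm (g t) \<le> C" for C
    unfolding E_def by (rule esssup_I[OF m]) (use that in simp)
  have E0: "E \<ge> 0"
  proof (rule ccontr)
    assume "\<not> E \<ge> 0"
    then have "AE t in lebesgue_on I. False" using AE
      by (auto elim!: eventually_mono simp: not_le) (metis ereal_less_eq(5) leD norm_ge_zero order_le_less_trans)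
    then show False using AE_I_not_False by blast
  qed
  obtain B where "AE t in lebesgue_on I. norm (g t) \<le> B" using g unfolding GG_iff by blast
  from le[OF this] E0 obtain r where r: "E = ereal r" by (cases E) auto
  have L: "Linf_norm I g = r" unfolding Linf_norm_def E_def[symmetric] r by simp
  show "AE t in lebesgue_on I. norm (g t) \<le> Linf_norm I g" using AE unfolding L r by simp
  show "Linf_norm I g \<le> C" if "AE t in lebesgue_on I. norm (g t) \<le> C" using le[OF that] unfolding L r by simp
  show "0 \<le> Linf_norm I g" using E0 unfolding L r by simp
qed

lemma Gnorm_le_iff:
  assumes g: "g \<in> Ginf I"
  shows "Gnorm I k g \<le> C \<longleftrightarrow> (\<forall>i\<le>k. AE t in lebesgue_on I. norm (gderivs I i g t) \<le> C)"
proof -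
  have "Linf_norm I (gderivs I i g) \<le> C \<longleftrightarrow> (AE t in lebesgue_on I. norm (gderivs I i g t) \<le> C)" for i
  proof
    assume "Linf_norm I (gderivs I i g) \<le> C"
    then show "AE t in lebesgue_on I. norm (gderivs I i g t) \<le> C"
      using Linf_norm_AE(1)[OF Ginf_GG[OF Ginf_gderivs[OF g]], of i] by (auto elim!: eventually_mono)
  qed (rule Linf_norm_AE(2)[OF Ginf_GG[OF Ginf_gderivs[OF g]]])
  then show ?thesis unfolding Gnorm_def by (subst Max_le_iff) auto
qed

lemma Gnorm_AE: "g \<in> Ginf I \<Longrightarrow> i \<le> k \<Longrightarrow> AE t in lebesgue_on I. norm (gderivs I i g t) \<le> Gnorm I k g"
  using Gnorm_le_iff by blast

lemma Gnorm_nonneg: "g \<in> Ginf I \<Longrightarrow> 0 \<le> Gnorm I k g"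
  using Gnorm_mono[of 0 k I g] Linf_norm_AE(3)[OF Ginf_GG] by (force simp: Gnorm_def)

text \<open>Splits off the function itself instead of the top derivative. In this form the Leibniz
  rule can be used once per induction step.\<close>

lemma Gnorm_Suc_le:
  assumes g: "g \<in> Ginf I"
  shows "Gnorm I (Suc k) g \<le> C \<longleftrightarrow> (AE t in lebesgue_on I. norm (g t) \<le> C) \<and> Gnorm I k (gderiv I g) \<le> C"
proof -
  have "(\<forall>i\<le>Suc k. P i) \<longleftrightarrow> P 0 \<and> (\<forall>i\<le>k. P (Suc i))" for P
    by (metis Suc_le_mono le0 not0_implies_Suc)
  from this[of "\<lambda>i. AE t in lebesgue_on I. norm (gderivs I i g t) \<le> C"] show ?thesis
    using Gnorm_le_iff[OF g, of "Suc k"] Gnorm_le_iff[OF Ginf_gderiv(1)[OF g], of k] by (simp add: gderivs_Suc)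
qed

lemma Gnorm_cong: 
  assumes "g \<in> Ginf I" "ae_eq g h" shows "Gnorm I k g = Gnorm I k h"
proof -
  have "Gnorm I k g \<le> Gnorm I k h" if "g \<in> Ginf I" "h \<in> Ginf I" "ae_eq g h" for g h
    unfolding Gnorm_le_iff[OF that(1)]
  proof (intro allI impI)
    fix i assume "i \<le> k"
    from Gnorm_AE[OF that(2) this] gderivs_cong[OF that(1,3), of i]
    show "AE t in lebesgue_on I. norm (gderivs I i g t) \<le> Gnorm I k h"
      unfolding ae_eq_def by eventually_elim simp
  qed
  then show ?thesis using assms Ginf_ae_eq ae_eq_sym by (meson order_antisym)
qed

lemma gderiv_Gnorm: "g \<in> Ginf I \<Longrightarrow> Gnorm I k (gderiv I g) \<le> Gnorm I (Suc k) g"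
  using Gnorm_Suc_le by blast

lemma Gnorm_add:
  assumes "g \<in> Ginf I" "h \<in> Ginf I"
  shows "Gnorm I k (\<lambda>t. g t + h t) \<le> Gnorm I k g + Gnorm I k h"
  using assms
proof (induction k arbitrary: g h)
  case 0
  have "AE t in lebesgue_on I. norm (g t + h t) \<le> Gnorm I 0 g + Gnorm I 0 h"
    using Gnorm_AE[OF 0(1) le0, of 0] Gnorm_AE[OF 0(2) le0, of 0] by eventually_elim (simp add: norm_triangle_mono)
  then show ?case using 0 by (simp add: Gnorm_le_iff[OF Ginf_add])
next
  case (Suc k)
  have "Gnorm I k (gderiv I (\<lambda>t. g t + h t)) = Gnorm I k (\<lambda>t. gderiv I g t + gderiv I h t)"
    using Suc.prems by (intro Gnorm_cong Ginf_gderiv Ginf_add gderiv_add)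
  also have "\<dots> \<le> Gnorm I k (gderiv I g) + Gnorm I k (gderiv I h)" using Suc by (simp add: Ginf_gderiv)
  also have "\<dots> \<le> Gnorm I (Suc k) g + Gnorm I (Suc k) h" using Suc.prems by (intro add_mono gderiv_Gnorm)
  finally have 1: "Gnorm I k (gderiv I (\<lambda>t. g t + h t)) \<le> Gnorm I (Suc k) g + Gnorm I (Suc k) h" .
  have "AE t in lebesgue_on I. norm (g t + h t) \<le> Gnorm I (Suc k) g + Gnorm I (Suc k) h"
    using Gnorm_AE[OF Suc.prems(1) le0, of "Suc k"] Gnorm_AE[OF Suc.prems(2) le0, of "Suc k"]
    by eventually_elim (simp add: norm_triangle_mono)
  then show ?case using 1 Suc.prems by (simp add: Gnorm_Suc_le[OF Ginf_add])
qed

text \<open>Continuity of multiplication by \<open>u\<close>. The Leibniz rule asks for the claim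
  both for \<open>u\<close> and for its derivative, so the induction generalises over
  \<open>u\<close>.\<close>

lemma Gnorm_mult:
  assumes "u \<in> Ginf I"
  shows "\<exists>C\<ge>0. \<forall>\<phi>\<in>Ginf I. Gnorm I k (\<lambda>t. u t * \<phi> t) \<le> C * Gnorm I k \<phi>"
  using assms
proof (induction k arbitrary: u)
  case 0
  show ?case
  proof (intro exI conjI ballI)
    show "0 \<le> Gnorm I 0 u" using 0 by (rule Gnorm_nonneg)
    fix \<phi> assume p: "\<phi> \<in> Ginf I"
    have "AE t in lebesgue_on I. norm (u t * \<phi> t) \<le> Gnorm I 0 u * Gnorm I 0 \<phi>"
      using Gnorm_AE[OF 0 le0, of 0] Gnorm_AE[OF p le0, of 0]
      by eventually_elim (auto simp: norm_mult intro!: mult_mono Gnorm_nonneg 0)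
    then show "Gnorm I 0 (\<lambda>t. u t * \<phi> t) \<le> Gnorm I 0 u * Gnorm I 0 \<phi>"
      using 0 p by (simp add: Gnorm_le_iff[OF Ginf_mult])
  qed
next
  case (Suc k)
  obtain C1 where C1: "C1 \<ge> 0" "\<And>\<phi>. \<phi> \<in> Ginf I \<Longrightarrow> Gnorm I k (\<lambda>t. gderiv I u t * \<phi> t) \<le> C1 * Gnorm I k \<phi>"
    using Suc.IH[OF Ginf_gderiv(1)[OF Suc.prems]] by blast
  obtain C2 where C2: "C2 \<ge> 0" "\<And>\<phi>. \<phi> \<in> Ginf I \<Longrightarrow> Gnorm I k (\<lambda>t. u t * \<phi> t) \<le> C2 * Gnorm I k \<phi>"
    using Suc.IH[OF Suc.prems] by blast
  show ?case
  proof (intro exI conjI ballI)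
    show C: "0 \<le> C1 + C2 + Gnorm I 0 u" using C1 C2 Gnorm_nonneg[OF Suc.prems] by simp
    fix \<phi> assume p: "\<phi> \<in> Ginf I"
    note u = Suc.prems
    have "Gnorm I k (gderiv I (\<lambda>t. u t * \<phi> t)) = Gnorm I k (\<lambda>t. gderiv I u t * \<phi> t + u t * gderiv I \<phi> t)"
      using u p by (intro Gnorm_cong Ginf_gderiv Ginf_mult gderiv_mult)
    also have "\<dots> \<le> Gnorm I k (\<lambda>t. gderiv I u t * \<phi> t) + Gnorm I k (\<lambda>t. u t * gderiv I \<phi> t)"
      using u p by (intro Gnorm_add Ginf_mult Ginf_gderiv)
    also have "\<dots> \<le> C1 * Gnorm I k \<phi> + C2 * Gnorm I k (gderiv I \<phi>)"
      using u p by (intro add_mono C1 C2 Ginf_gderiv)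
    also have "\<dots> \<le> C1 * Gnorm I (Suc k) \<phi> + C2 * Gnorm I (Suc k) \<phi>"
      using p C1 C2 by (intro add_mono mult_left_mono gderiv_Gnorm Gnorm_mono) auto
    also have "\<dots> \<le> (C1 + C2 + Gnorm I 0 u) * Gnorm I (Suc k) \<phi>"
      using Gnorm_nonneg[OF u, of 0] Gnorm_nonneg[OF p, of "Suc k"] by (simp add: algebra_simps)
    finally have 1: "Gnorm I k (gderiv I (\<lambda>t. u t * \<phi> t)) \<le> (C1 + C2 + Gnorm I 0 u) * Gnorm I (Suc k) \<phi>" .
    have "AE t in lebesgue_on I. norm (u t * \<phi> t) \<le> (C1 + C2 + Gnorm I 0 u) * Gnorm I (Suc k) \<phi>"
      using Gnorm_AE[OF u le0, of 0] Gnorm_AE[OF p le0, of "Suc k"]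
    proof eventually_elim
      case (elim t)
      then have "norm (u t) \<le> C1 + C2 + Gnorm I 0 u" using C1 C2 by simp
      then show ?case unfolding norm_mult using elim(2) C by (intro mult_mono) auto
    qed
    then show "Gnorm I (Suc k) (\<lambda>t. u t * \<phi> t) \<le> (C1 + C2 + Gnorm I 0 u) * Gnorm I (Suc k) \<phi>"
      using 1 u p by (simp add: Gnorm_Suc_le[OF Ginf_mult])
  qed
qed

lemma Gnorm_const: "Gnorm I k (\<lambda>_. c) \<le> norm c"
proof -
  have eq: "ae_eq (gderivs I i (\<lambda>_. c)) (if i = 0 then (\<lambda>_. c) else (\<lambda>_. 0))" for i
    using gderivs_chain(2)[of "\<lambda>i. if i = 0 then (\<lambda>_. c) else (\<lambda>_. 0)" i] by (simp add: is_gderiv_const)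
  have "AE t in lebesgue_on I. norm (gderivs I i (\<lambda>_. c) t) \<le> norm c" for i
    using eq[of i] unfolding ae_eq_def by (rule eventually_mono) auto
  then show ?thesis unfolding Gnorm_le_iff[OF Ginf_const] by blast
qed

lemma gderivs_cmult: "g \<in> Ginf I \<Longrightarrow> ae_eq (gderivs I k (\<lambda>t. c * g t)) (\<lambda>t. c * gderivs I k g t)"
proof (induction k)
  case (Suc k)
  then have "ae_eq (gderiv I (gderivs I k (\<lambda>t. c * g t))) (gderiv I (\<lambda>t. c * gderivs I k g t))"
    by (intro gderiv_cong Ginf_gderivs Ginf_cmult) auto
  then show ?case using Suc ae_eq_trans gderiv_cmult Ginf_gderivs unfolding gderivs_Suc' by blast
qed simp

lemma Gnorm_cmult_le: "g \<in> Ginf I \<Longrightarrow> Gnorm I k (\<lambda>t. c * g t) \<le> norm c * Gnorm I k g"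
proof (subst Gnorm_le_iff[OF Ginf_cmult], assumption, intro allI impI)
  fix i assume g: "g \<in> Ginf I" and i: "i \<le> k"
  show "AE t in lebesgue_on I. norm (gderivs I i (\<lambda>t. c * g t) t) \<le> norm c * Gnorm I k g"
    using gderivs_cmult[OF g, of i c] Gnorm_AE[OF g i] unfolding ae_eq_def
    by eventually_elim (simp add: norm_mult mult_left_mono)
qed

section \<open>Supports and the steps of the inductive limit\<close>

text \<open>An almost everywhere condition in place of a support: it passes to sums, products and
  intersections without topology, and for closed \<open>K\<close> it is equivalent to a bound on the
  support by \<open>gsupp_subset_iff\<close>.\<close>

definition zero_off :: "real set \<Rightarrow> (real \<Rightarrow> complex) \<Rightarrow> bool" where
  "zero_off K \<phi> \<longleftrightarrow> (AE t in lebesgue_on I. t \<notin> K \<longrightarrow> \<phi> t = 0)"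

lemma Rstep_iff: "\<phi> \<in> Rstep I K \<longleftrightarrow> \<phi> \<in> Ginf I \<and> zero_off K \<phi>"
  by (auto simp: Rstep_def zero_off_def)

lemma zero_off_mono: "zero_off K \<phi> \<Longrightarrow> K \<subseteq> L \<Longrightarrow> zero_off L \<phi>"
  unfolding zero_off_def by (erule eventually_mono) blast

lemma zero_off_I: "(\<And>t. t \<in> I \<Longrightarrow> t \<notin> K \<Longrightarrow> \<phi> t = 0) \<Longrightarrow> zero_off K \<phi>"
  unfolding zero_off_def AE_I by simp

lemma zero_off_add: "zero_off K \<phi> \<Longrightarrow> zero_off K \<psi> \<Longrightarrow> zero_off K (\<lambda>t. \<phi> t + \<psi> t)"
  unfolding zero_off_def by (erule (1) eventually_elim2) simp

lemma zero_off_mult: "zero_off K \<phi> \<Longrightarrow> zero_off K (\<lambda>t. u t * \<phi> t)"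
  unfolding zero_off_def by (erule eventually_mono) simp

lemma zero_off_ae_eq: "zero_off K \<phi> \<Longrightarrow> ae_eq \<phi> \<psi> \<Longrightarrow> zero_off K \<psi>"
  unfolding zero_off_def ae_eq_def by (erule (1) eventually_elim2) simp

lemma zero_off_slim:
  assumes "zero_off K \<phi>" "closed K" "t \<in> I" "t \<notin> K"
  shows "slim \<sigma> \<phi> t = 0"
proof -
  have "eventually (\<lambda>s. s \<in> - K \<and> s \<noteq> t) (ess_at \<sigma> t)"
    by (rule eventually_ess_at_open) (use assms in auto)
  moreover have "eventually (\<lambda>s. s \<notin> K \<longrightarrow> \<phi> s = 0) (ess_at \<sigma> t)"
    using assms(1) unfolding zero_off_def by (rule ess_at_AE_I[OF assms(3)])
  ultimately have "eventually (\<lambda>s. \<phi> s = 0) (ess_at \<sigma> t)" by (rule eventually_elim2) auto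
  then show ?thesis using slim_cong[of \<phi> "\<lambda>_. 0"] by simp
qed

lemma zero_off_slimI:
  assumes "\<phi> \<in> GG I" "\<And>t. t \<in> I \<Longrightarrow> t \<notin> K \<Longrightarrow> slim \<sigma> \<phi> t = 0"
  shows "zero_off K \<phi>"
  using GG_ae_slim[OF assms(1), of \<sigma>] unfolding zero_off_def AE_I by (rule eventually_mono) (use assms(2) in auto)

lemma gsupp_subset_iff:
  assumes g: "\<phi> \<in> GG I" and K: "closed K"
  shows "gsupp I \<phi> \<subseteq> K \<longleftrightarrow> zero_off K \<phi>"
proof
  assume "gsupp I \<phi> \<subseteq> K"
  moreover have "{t \<in> I. llim \<phi> t \<noteq> 0 \<or> rlim \<phi> t \<noteq> 0} \<subseteq> gsupp I \<phi>"
    unfolding gsupp_def by (intro Int_greatest closure_subset) blast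
  ultimately have "slim True \<phi> t = 0" if "t \<in> I" "t \<notin> K" for t
    using that unfolding slim_def by auto
  then show "zero_off K \<phi>" by (rule zero_off_slimI[OF g])
next
  assume z: "zero_off K \<phi>"
  have "{t \<in> I. llim \<phi> t \<noteq> 0 \<or> rlim \<phi> t \<noteq> 0} \<subseteq> K"
    using zero_off_slim[OF z K, of _ True] zero_off_slim[OF z K, of _ False] by (auto simp: slim_def)
  then show "gsupp I \<phi> \<subseteq> K" unfolding gsupp_def using closure_minimal[OF _ K] by blast
qed

lemma Icc_subset_I: "p \<in> I \<Longrightarrow> q \<in> I \<Longrightarrow> {p..q} \<subseteq> I"
  using ivl_I[of p q] by (intro subsetI) simp

text \<open>\<open>gsupp\<close> is a closure relative to \<open>I\<close>. It is compact because
  the closure on the line already stays in \<open>{p..q}\<close>, which lies inside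
  \<open>I\<close>.\<close>

lemma Rstep_RR:
  assumes "p \<in> I" "q \<in> I" shows "Rstep I {p..q} \<subseteq> RR I"
proof
  fix \<phi> assume f: "\<phi> \<in> Rstep I {p..q}"
  then have g: "gsupp I \<phi> \<subseteq> {p..q}" by (subst gsupp_subset_iff) (auto simp: Rstep_iff Ginf_GG)
  have "{p..q} \<subseteq> I" using Icc_subset_I assms by blast
  define S where "S = {t \<in> I. llim \<phi> t \<noteq> 0 \<or> rlim \<phi> t \<noteq> 0}"
  have "S \<subseteq> gsupp I \<phi>" unfolding gsupp_def S_def by (intro Int_greatest closure_subset) blast
  then have "closure S \<subseteq> {p..q}" using g by (intro closure_minimal) auto
  then have "closure S \<subseteq> I" using \<open>{p..q} \<subseteq> I\<close> by (rule order_trans)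
  then have "gsupp I \<phi> = closure S" unfolding gsupp_def S_def by (rule Int_absorb2)
  moreover have "compact (closure S)"
    using compact_Int_closed[OF compact_Icc closed_closure, of p q S] \<open>closure S \<subseteq> {p..q}\<close> by (simp add: Int_absorb1)
  ultimately show "\<phi> \<in> RR I" using f by (simp add: RR_def Rstep_iff)
qed

lemma compact_I_bounds:
  assumes "compact K" "K \<subseteq> I"
  obtains p q where "p \<in> I" "q \<in> I" "p < q" "K \<subseteq> {p<..<q}"
proof -
  obtain x where x: "x \<in> I" using I_nonempty by blast
  have c: "compact (insert x K)" "insert x K \<subseteq> I" "insert x K \<noteq> {}" using assms x by auto
  obtain m where m: "m \<in> insert x K" "\<And>y. y \<in> insert x K \<Longrightarrow> m \<le> y" using compact_attains_inf[OF c(1,3)] by blast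
  obtain M where M: "M \<in> insert x K" "\<And>y. y \<in> insert x K \<Longrightarrow> y \<le> M" using compact_attains_sup[OF c(1,3)] by blast
  obtain e where e: "e > 0" "ball m e \<subseteq> I" using open_I c(2) m(1) openE by blast
  obtain e' where e': "e' > 0" "ball M e' \<subseteq> I" using open_I c(2) M(1) openE by blast
  have "m - e / 2 \<in> I" "M + e' / 2 \<in> I" using e e' by (auto simp: dist_real_def subset_iff)
  moreover have "m - e / 2 < M + e' / 2" using m(2)[OF M(1)] e(1) e'(1) by simp
  moreover have "K \<subseteq> {m - e / 2<..<M + e' / 2}"
  proof
    fix y assume "y \<in> K"
    then have "m \<le> y" "y \<le> M" using m(2) M(2) by blast+
    then show "y \<in> {m - e / 2<..<M + e' / 2}" using e(1) e'(1) by simp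
  qed
  ultimately show thesis by (rule that)
qed

lemma RR_ex_step:
  assumes "\<phi> \<in> RR I"
  obtains p q where "p \<in> I" "q \<in> I" "p < q" "\<phi> \<in> Rstep I {p..q}"
proof -
  have c: "compact (gsupp I \<phi>)" "gsupp I \<phi> \<subseteq> I" "\<phi> \<in> Ginf I" using assms by (auto simp: RR_def gsupp_def)
  obtain p q where pq: "p \<in> I" "q \<in> I" "p < q" "gsupp I \<phi> \<subseteq> {p<..<q}" by (rule compact_I_bounds[OF c(1,2)])
  have "gsupp I \<phi> \<subseteq> {p..q}" using pq(4) by (rule order_trans) auto
  then have "zero_off {p..q} \<phi>" using gsupp_subset_iff[OF Ginf_GG[OF c(3)], of "{p..q}"] by simp
  then show thesis using that pq c(3) by (simp add: Rstep_iff)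
qed

lemma RR_Ginf: "\<phi> \<in> RR I \<Longrightarrow> \<phi> \<in> Ginf I" by (simp add: RR_def)

lemma Rstep_mono: "\<phi> \<in> Rstep I {p..q} \<Longrightarrow> p' \<le> p \<Longrightarrow> q \<le> q' \<Longrightarrow> \<phi> \<in> Rstep I {p'..q'}"
  unfolding Rstep_iff using zero_off_mono[of "{p..q}" \<phi> "{p'..q'}"] by auto

lemma RR_common_step:
  assumes "\<phi> \<in> RR I" "\<psi> \<in> RR I"
  obtains p q where "p \<in> I" "q \<in> I" "p < q" "\<phi> \<in> Rstep I {p..q}" "\<psi> \<in> Rstep I {p..q}"
proof -
  obtain p q where 1: "p \<in> I" "q \<in> I" "p < q" "\<phi> \<in> Rstep I {p..q}" using RR_ex_step[OF assms(1)] .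
  obtain p' q' where 2: "p' \<in> I" "q' \<in> I" "p' < q'" "\<psi> \<in> Rstep I {p'..q'}" using RR_ex_step[OF assms(2)] .
  show thesis
    by (rule that[of "min p p'" "max q q'"]) (use 1 2 Rstep_mono in \<open>auto simp: min_def max_def\<close>)
qed

lemma Rstep_add: "\<phi> \<in> Rstep I K \<Longrightarrow> \<psi> \<in> Rstep I K \<Longrightarrow> (\<lambda>t. \<phi> t + \<psi> t) \<in> Rstep I K"
  by (simp add: Rstep_iff Ginf_add zero_off_add)

lemma Rstep_mult: "u \<in> Ginf I \<Longrightarrow> \<phi> \<in> Rstep I K \<Longrightarrow> (\<lambda>t. u t * \<phi> t) \<in> Rstep I K"
  by (simp add: Rstep_iff Ginf_mult zero_off_mult)

lemma Rstep_ae_eq: "\<phi> \<in> Rstep I K \<Longrightarrow> ae_eq \<phi> \<psi> \<Longrightarrow> \<psi> \<in> Rstep I K"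
  using Ginf_ae_eq zero_off_ae_eq by (auto simp: Rstep_iff)

lemma Rstep_gderiv:
  assumes "\<phi> \<in> Rstep I K" "closed K" shows "gderiv I \<phi> \<in> Rstep I K"
proof -
  have f: "\<phi> \<in> Ginf I" "zero_off K \<phi>" using assms by (auto simp: Rstep_iff)
  have "slim True (gderiv I \<phi>) t = 0" if t: "t \<in> I" "t \<notin> K" for t
  proof -
    have "eventually (\<lambda>s. s \<in> - K \<and> s \<noteq> t) (ess_at True t)"
      by (rule eventually_ess_at_open) (use assms t in auto)
    moreover have "eventually (\<lambda>s. s \<notin> K \<longrightarrow> \<phi> s = 0) (ess_at True t)"
      using f(2) unfolding zero_off_def by (rule ess_at_AE_I[OF t(1)])
    ultimately have "eventually (\<lambda>s. (\<phi> s - slim True \<phi> t) / of_real (s - t) = 0) (ess_at True t)"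
      by eventually_elim (use zero_off_slim[OF f(2) assms(2) t] in auto)
    then have "((\<lambda>s. (\<phi> s - slim True \<phi> t) / of_real (s - t)) \<longlongrightarrow> 0) (ess_at True t)" by (rule tendsto_eventually)
    from tendsto_unique[OF ess_at_neq_bot this is_gderivD[OF Ginf_gderiv(2)[OF f(1)] t(1)]] show ?thesis by simp
  qed
  then have "zero_off K (gderiv I \<phi>)" by (rule zero_off_slimI[OF Ginf_GG[OF Ginf_gderiv(1)[OF f(1)]]])
  then show ?thesis using Ginf_gderiv(1)[OF f(1)] by (simp add: Rstep_iff)
qed

lemma RR_add: "\<phi> \<in> RR I \<Longrightarrow> \<psi> \<in> RR I \<Longrightarrow> (\<lambda>t. \<phi> t + \<psi> t) \<in> RR I"
  by (erule (1) RR_common_step) (use Rstep_RR Rstep_add in blast)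

lemma RR_mult: "u \<in> Ginf I \<Longrightarrow> \<phi> \<in> RR I \<Longrightarrow> (\<lambda>t. u t * \<phi> t) \<in> RR I"
  by (erule RR_ex_step) (use Rstep_RR Rstep_mult in blast)

lemma RR_cmult: "\<phi> \<in> RR I \<Longrightarrow> (\<lambda>t. c * \<phi> t) \<in> RR I"
  by (rule RR_mult) auto

lemma RR_diff: "\<phi> \<in> RR I \<Longrightarrow> \<psi> \<in> RR I \<Longrightarrow> (\<lambda>t. \<phi> t - \<psi> t) \<in> RR I"
  using RR_add[of \<phi> "\<lambda>t. - 1 * \<psi> t"] RR_cmult[of \<psi> "- 1"] by simp

lemma RR_ae_eq: "\<phi> \<in> RR I \<Longrightarrow> ae_eq \<phi> \<psi> \<Longrightarrow> \<psi> \<in> RR I"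
  by (erule RR_ex_step) (use Rstep_RR Rstep_ae_eq in blast)

lemma RR_gderiv: "\<phi> \<in> RR I \<Longrightarrow> gderiv I \<phi> \<in> RR I"
  by (erule RR_ex_step) (use Rstep_RR Rstep_gderiv in blast)

lemma RR_zero [simp]: "(\<lambda>_. 0) \<in> RR I"
proof -
  obtain x where "x \<in> I" using I_nonempty by blast
  then show ?thesis using Rstep_RR[of x x] by (auto simp: Rstep_iff zero_off_def)
qed

lemma RR_sum: "(\<And>i. i \<in> S \<Longrightarrow> \<phi> i \<in> RR I) \<Longrightarrow> (\<lambda>t. \<Sum>i\<in>S. \<phi> i t) \<in> RR I"
  by (induction S rule: infinite_finite_induct) (auto intro: RR_add)

section \<open>The topology and continuous functionals\<close>

lemma steps_bounds:
  assumes "J \<in> steps I"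
  obtains p q where "p \<in> I" "q \<in> I" "Rstep I J \<subseteq> Rstep I {p..q}"
proof -
  have "compact (closure J)" "closure J \<subseteq> I" using assms by (auto simp: steps_def compact_eq_bounded_closed)
  from compact_I_bounds[OF this] obtain p q where pq: "p \<in> I" "q \<in> I" "p < q" "closure J \<subseteq> {p<..<q}" .
  have "J \<subseteq> {p..q}" using closure_subset[of J] pq(4) by force
  then have "Rstep I J \<subseteq> Rstep I {p..q}" using zero_off_mono[OF _ \<open>J \<subseteq> {p..q}\<close>] by (auto simp: Rstep_iff)
  then show thesis by (rule that[OF pq(1,2)])
qed

lemma Icc_steps: "p \<in> I \<Longrightarrow> q \<in> I \<Longrightarrow> {p..q} \<in> steps I"
  using Icc_subset_I by (simp add: steps_def is_interval_cc)

text \<open>The whole space has to be shown open, which comes down to \<open>RR I\<close> being a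
  basic neighbourhood of zero.\<close>

lemma topspace_RR: "topspace (RR_topology I) = RR I"
proof -
  have "zero_nbhd I (RR I)"
    unfolding zero_nbhd_def
  proof (intro conjI ballI)
    show "abs_convex (RR I)" unfolding abs_convex_def by (auto intro!: RR_add RR_cmult)
    fix J assume "J \<in> steps I"
    then obtain p q where "p \<in> I" "q \<in> I" "Rstep I J \<subseteq> Rstep I {p..q}" by (rule steps_bounds)
    then have "Rstep I J \<subseteq> RR I" using Rstep_RR by blast
    then show "\<exists>k. \<exists>e>0. {\<phi> \<in> Rstep I J. Gnorm I k \<phi> < e} \<subseteq> RR I"
      by (intro exI[of _ 0] exI[of _ 1]) auto
  qed simp
  moreover have "(\<lambda>\<psi>. \<phi> + \<psi>) ` RR I \<subseteq> RR I" if "\<phi> \<in> RR I" for \<phi>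
    using RR_add[OF that] by (auto simp: plus_fun_def)
  ultimately have "RR_open I (RR I)" unfolding RR_open_def by blast
  then have "openin (RR_topology I) (RR I)" by (simp add: openin_RR_topology)
  moreover have "topspace (RR_topology I) \<subseteq> RR I"
    using openin_topspace[of "RR_topology I"] unfolding openin_RR_topology RR_open_def by blast
  ultimately show ?thesis using openin_subset by blast
qed

lemma dual_add: "f \<in> RR_dual I \<Longrightarrow> \<phi> \<in> RR I \<Longrightarrow> \<psi> \<in> RR I \<Longrightarrow> f (\<lambda>t. \<phi> t + \<psi> t) = f \<phi> + f \<psi>"
  unfolding RR_dual_def by (auto simp: plus_fun_def)

lemma dual_cmult: "f \<in> RR_dual I \<Longrightarrow> \<phi> \<in> RR I \<Longrightarrow> f (\<lambda>t. c * \<phi> t) = c * f \<phi>"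
  unfolding RR_dual_def by auto

lemma dual_zero: "f \<in> RR_dual I \<Longrightarrow> f (\<lambda>_. 0) = 0"
  using dual_cmult[of f "\<lambda>_. 0" 0] by simp

lemma dual_diff: "f \<in> RR_dual I \<Longrightarrow> \<phi> \<in> RR I \<Longrightarrow> \<psi> \<in> RR I \<Longrightarrow> f (\<lambda>t. \<phi> t - \<psi> t) = f \<phi> - f \<psi>"
  using dual_add[of f \<phi> "\<lambda>t. - 1 * \<psi> t"] dual_cmult[of f \<psi> "- 1"] RR_cmult[of \<psi> "- 1"] by simp

lemma dual_sum: "f \<in> RR_dual I \<Longrightarrow> (\<And>i. i \<in> S \<Longrightarrow> \<phi> i \<in> RR I) \<Longrightarrow> f (\<lambda>t. \<Sum>i\<in>S. \<phi> i t) = (\<Sum>i\<in>S. f (\<phi> i))"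
proof (induction S rule: infinite_finite_induct)
  case (insert x F)
  then have "f (\<lambda>t. \<phi> x t + (\<Sum>i\<in>F. \<phi> i t)) = f (\<phi> x) + f (\<lambda>t. \<Sum>i\<in>F. \<phi> i t)"
    by (intro dual_add RR_sum) auto
  then show ?case using insert by simp
qed (auto simp: dual_zero)

text \<open>Scaling: a neighbourhood on which \<open>norm (f \<phi>) < 1\<close> contains, within
  the step, a ball of some norm \<open>Gnorm I k\<close>, and a suitable multiple of any
  \<open>\<phi>\<close> of the step falls into it. Together with \<open>RR_dualI\<close> this
  replaces the topology by estimates on compact intervals.\<close>

lemma dual_bound:
  assumes f: "f \<in> RR_dual I" and pq: "p \<in> I" "q \<in> I"
  obtains k C where "C \<ge> 0" "\<And>\<phi>. \<phi> \<in> Rstep I {p..q} \<Longrightarrow> norm (f \<phi>) \<le> C * Gnorm I k \<phi>"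
proof -
  define W where "W = {\<phi> \<in> topspace (RR_topology I). f \<phi> \<in> ball 0 1}"
  have "openin (RR_topology I) W"
    unfolding W_def by (rule openin_continuous_map_preimage[of _ euclidean]) (use f in \<open>auto simp: RR_dual_def\<close>)
  then have "RR_open I W" by (simp add: openin_RR_topology)
  moreover have "(\<lambda>_. 0) \<in> W" by (simp add: W_def topspace_RR dual_zero[OF f])
  ultimately obtain U where U: "zero_nbhd I U" "(\<lambda>\<psi>. (\<lambda>_. 0) + \<psi>) ` U \<subseteq> W" unfolding RR_open_def by blast
  obtain k e where e: "e > 0" "{\<phi> \<in> Rstep I {p..q}. Gnorm I k \<phi> < e} \<subseteq> U"
    using U(1) Icc_steps[OF pq] unfolding zero_nbhd_def by meson
  have small: "norm (f \<phi>) < 1" if "\<phi> \<in> Rstep I {p..q}" "Gnorm I k \<phi> < e" for \<phi>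
  proof -
    have "(\<lambda>_. 0) + \<phi> \<in> W" using that e(2) U(2) by blast
    then show ?thesis by (simp add: W_def plus_fun_def)
  qed
  have "norm (f \<phi>) \<le> 2 / e * Gnorm I k \<phi>" if p: "\<phi> \<in> Rstep I {p..q}" for \<phi>
  proof (rule field_le_epsilon)
    fix x :: real assume x: "x > 0"
    have g: "\<phi> \<in> Ginf I" "\<phi> \<in> RR I" using p Rstep_RR[OF pq] by (auto simp: Rstep_iff)
    \<comment> \<open>The norm may vanish, so a positive term is added; it is chosen so that
      \<open>2 * N / e\<close> is the desired bound with error exactly \<open>x\<close>.\<close>
    define N where "N = Gnorm I k \<phi> + x * e / 2"
    have N: "N > 0" "Gnorm I k \<phi> < N" using Gnorm_nonneg[OF g(1), of k] x e(1) by (auto simp: N_def add_nonneg_pos)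
    define c where "c = e / (2 * N)"
    have c: "c > 0" using e(1) N by (simp add: c_def)
    have "Gnorm I k (\<lambda>t. of_real c * \<phi> t) \<le> c * Gnorm I k \<phi>"
      using Gnorm_cmult_le[OF g(1), of k "of_real c"] c by simp
    also have "\<dots> < c * N" using N c by simp
    also have "\<dots> = e / 2" using N by (simp add: c_def)
    also have "\<dots> < e" using e(1) by simp
    finally have "norm (f (\<lambda>t. of_real c * \<phi> t)) < 1"
      by (intro small Rstep_mult p Ginf_const)
    then have "c * norm (f \<phi>) < 1" using c by (simp add: dual_cmult[OF f g(2)] norm_mult)
    then have "norm (f \<phi>) < 1 / c" using c by (simp add: field_simps)
    also have "\<dots> = 2 / e * Gnorm I k \<phi> + x" using e(1) N by (simp add: c_def N_def field_simps)
    finally show "norm (f \<phi>) \<le> 2 / e * Gnorm I k \<phi> + x" by simp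
  qed
  then show thesis using that[of "2 / e" k] e(1) by simp
qed

text \<open>The sets \<open>norm (f \<psi>) < e\<close> are absolutely convex, and the estimates
  \<open>bd\<close> say that their trace on every step is a neighbourhood of zero.\<close>

lemma RR_dualI:
  assumes add: "\<And>\<phi> \<psi>. \<phi> \<in> RR I \<Longrightarrow> \<psi> \<in> RR I \<Longrightarrow> f (\<lambda>t. \<phi> t + \<psi> t) = f \<phi> + f \<psi>"
    and cm: "\<And>c \<phi>. \<phi> \<in> RR I \<Longrightarrow> f (\<lambda>t. c * \<phi> t) = c * f \<phi>"
    and bd: "\<And>p q. p \<in> I \<Longrightarrow> q \<in> I \<Longrightarrow> \<exists>k C. \<forall>\<phi>\<in>Rstep I {p..q}. norm (f \<phi>) \<le> C * Gnorm I k \<phi>"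
  shows "f \<in> RR_dual I"
proof -
  have "continuous_map (RR_topology I) euclidean f"
    unfolding continuous_map_def
  proof (intro conjI allI impI)
    fix U :: "complex set" assume "openin euclidean U"
    then have oU: "open U" by simp
    have "RR_open I {\<phi> \<in> RR I. f \<phi> \<in> U}"
      unfolding RR_open_def
    proof (intro conjI ballI)
      fix \<phi> assume p: "\<phi> \<in> {\<phi> \<in> RR I. f \<phi> \<in> U}"
      then obtain e where e: "e > 0" "ball (f \<phi>) e \<subseteq> U" using oU openE by blast
      define V where "V = {\<psi> \<in> RR I. norm (f \<psi>) < e}"
      have "zero_nbhd I V" unfolding zero_nbhd_def
      proof (intro conjI ballI)
        show "V \<subseteq> RR I" by (auto simp: V_def)
        show "abs_convex V" unfolding abs_convex_def
        proof (intro ballI allI impI)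
          fix \<xi>1 \<xi>2 and c d :: complex assume x: "\<xi>1 \<in> V" "\<xi>2 \<in> V" and cd: "norm c + norm d \<le> 1"
          define m where "m = max (norm (f \<xi>1)) (norm (f \<xi>2))"
          have m: "m < e" "m \<ge> 0" "norm (f \<xi>1) \<le> m" "norm (f \<xi>2) \<le> m" using x by (auto simp: m_def V_def le_max_iff_disj)
          have "f (\<lambda>t. c * \<xi>1 t + d * \<xi>2 t) = c * f \<xi>1 + d * f \<xi>2"
            using x by (simp add: V_def add cm RR_cmult)
          also have "norm \<dots> \<le> norm c * norm (f \<xi>1) + norm d * norm (f \<xi>2)"
            by (metis norm_mult norm_triangle_ineq)
          also have "\<dots> \<le> norm c * m + norm d * m" using m by (intro add_mono mult_left_mono) auto
          also have "\<dots> = (norm c + norm d) * m" by (simp add: algebra_simps)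
          also have "\<dots> \<le> 1 * m" using cd m by (intro mult_right_mono) auto
          finally show "(\<lambda>t. c * \<xi>1 t + d * \<xi>2 t) \<in> V"
            using x m by (simp add: V_def RR_add RR_cmult)
        qed
        fix J assume "J \<in> steps I"
        then obtain p q where pq: "p \<in> I" "q \<in> I" "Rstep I J \<subseteq> Rstep I {p..q}" by (rule steps_bounds)
        obtain k C where C: "\<And>\<phi>. \<phi> \<in> Rstep I {p..q} \<Longrightarrow> norm (f \<phi>) \<le> C * Gnorm I k \<phi>" using bd[OF pq(1,2)] by blast
        have "{\<phi> \<in> Rstep I J. Gnorm I k \<phi> < e / (\<bar>C\<bar> + 1)} \<subseteq> V"
        proof
          fix \<psi> assume ps: "\<psi> \<in> {\<phi> \<in> Rstep I J. Gnorm I k \<phi> < e / (\<bar>C\<bar> + 1)}"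
          then have R: "\<psi> \<in> Rstep I {p..q}" "\<psi> \<in> RR I" "\<psi> \<in> Ginf I" using pq Rstep_RR[OF pq(1,2)] by (auto simp: Rstep_iff)
          have "norm (f \<psi>) \<le> C * Gnorm I k \<psi>" by (rule C[OF R(1)])
          also have "\<dots> \<le> (\<bar>C\<bar> + 1) * Gnorm I k \<psi>" using Gnorm_nonneg[OF R(3)] by (intro mult_right_mono) auto
          also have "\<dots> < (\<bar>C\<bar> + 1) * (e / (\<bar>C\<bar> + 1))" using ps by (intro mult_strict_left_mono) auto
          also have "\<dots> = e" by (simp add: add_eq_0_iff)
          finally show "\<psi> \<in> V" using R by (simp add: V_def)
        qed
        then show "\<exists>k. \<exists>e>0. {\<phi> \<in> Rstep I J. Gnorm I k \<phi> < e} \<subseteq> V"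
          using e(1) by (intro exI[of _ k] exI[of _ "e / (\<bar>C\<bar> + 1)"]) auto
      qed
      moreover have "(\<lambda>\<psi>. \<phi> + \<psi>) ` V \<subseteq> {\<phi> \<in> RR I. f \<phi> \<in> U}"
      proof
        fix \<xi> assume "\<xi> \<in> (\<lambda>\<psi>. \<phi> + \<psi>) ` V"
        then obtain \<psi> where q: "\<psi> \<in> V" "\<xi> = (\<lambda>t. \<phi> t + \<psi> t)" by (auto simp: plus_fun_def)
        then have "f \<xi> \<in> ball (f \<phi>) e" using p by (simp add: V_def add dist_norm)
        then show "\<xi> \<in> {\<phi> \<in> RR I. f \<phi> \<in> U}" using q p e(2) by (auto simp: V_def intro: RR_add)
      qed
      ultimately show "\<exists>V. zero_nbhd I V \<and> (\<lambda>\<psi>. \<phi> + \<psi>) ` V \<subseteq> {\<phi> \<in> RR I. f \<phi> \<in> U}" by blast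
    qed auto
    then show "openin (RR_topology I) {x \<in> topspace (RR_topology I). f x \<in> U}"
      by (simp add: openin_RR_topology topspace_RR)
  qed auto
  then show ?thesis using add cm unfolding RR_dual_def by (auto simp: plus_fun_def)
qed

text \<open>The difference of the two test functions vanishes in every norm and is killed by
  continuity. This makes functionals insensitive to the choice hidden in
  \<open>gderiv\<close>.\<close>

lemma dual_ae_eq:
  assumes f: "f \<in> RR_dual I" and p: "\<phi> \<in> RR I" and e: "ae_eq \<phi> \<psi>"
  shows "f \<phi> = f \<psi>"
proof -
  have q: "\<psi> \<in> RR I" using RR_ae_eq p e by blast
  define \<theta> where "\<theta> t = \<phi> t - \<psi> t" for t
  have th: "\<theta> \<in> RR I" unfolding \<theta>_def using p q by (rule RR_diff)
  obtain p' q' where pq: "p' \<in> I" "q' \<in> I" "\<theta> \<in> Rstep I {p'..q'}" using RR_ex_step[OF th] by metis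
  obtain k C where C: "C \<ge> 0" "\<And>\<phi>. \<phi> \<in> Rstep I {p'..q'} \<Longrightarrow> norm (f \<phi>) \<le> C * Gnorm I k \<phi>"
    by (rule dual_bound[OF f pq(1,2)]) blast
  have "ae_eq \<theta> (\<lambda>_. 0)" using e unfolding ae_eq_def \<theta>_def by (rule eventually_mono) simp
  then have "Gnorm I k \<theta> = Gnorm I k (\<lambda>_. 0)" using th by (intro Gnorm_cong RR_Ginf)
  then have "Gnorm I k \<theta> \<le> 0" using Gnorm_const[of k 0] by simp
  then have "norm (f \<theta>) \<le> 0" using C(2)[OF pq(3)] C(1) by (meson mult_nonneg_nonpos order_trans)
  then show ?thesis using dual_diff[OF f p q] unfolding \<theta>_def by simp
qed

lemma dual_plus: 
  assumes "f \<in> RR_dual I" "g \<in> RR_dual I"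
  shows "(\<lambda>\<phi>. f \<phi> + g \<phi>) \<in> RR_dual I"
proof (rule RR_dualI)
  fix p q assume pq: "p \<in> I" "q \<in> I"
  obtain k C where 1: "C \<ge> 0" "\<And>\<phi>. \<phi> \<in> Rstep I {p..q} \<Longrightarrow> norm (f \<phi>) \<le> C * Gnorm I k \<phi>"
    by (rule dual_bound[OF assms(1) pq]) blast
  obtain l D where 2: "D \<ge> 0" "\<And>\<phi>. \<phi> \<in> Rstep I {p..q} \<Longrightarrow> norm (g \<phi>) \<le> D * Gnorm I l \<phi>"
    by (rule dual_bound[OF assms(2) pq]) blast
  show "\<exists>k C. \<forall>\<phi>\<in>Rstep I {p..q}. norm (f \<phi> + g \<phi>) \<le> C * Gnorm I k \<phi>"
  proof (intro exI ballI)
    fix \<phi> assume p: "\<phi> \<in> Rstep I {p..q}"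
    have "norm (f \<phi> + g \<phi>) \<le> C * Gnorm I k \<phi> + D * Gnorm I l \<phi>" using 1(2)[OF p] 2(2)[OF p] by (rule norm_triangle_mono)
    also have "\<dots> \<le> C * Gnorm I (max k l) \<phi> + D * Gnorm I (max k l) \<phi>"
      using 1(1) 2(1) by (intro add_mono mult_left_mono Gnorm_mono) auto
    finally show "norm (f \<phi> + g \<phi>) \<le> (C + D) * Gnorm I (max k l) \<phi>" by (simp add: algebra_simps)
  qed
qed (auto simp: dual_add[OF assms(1)] dual_add[OF assms(2)] dual_cmult[OF assms(1)] dual_cmult[OF assms(2)] algebra_simps)

lemma dual_scale: 
  assumes f: "f \<in> RR_dual I" shows "(\<lambda>\<phi>. c * f \<phi>) \<in> RR_dual I"
proof (rule RR_dualI)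
  fix p q assume pq: "p \<in> I" "q \<in> I"
  obtain k C where 1: "C \<ge> 0" "\<And>\<phi>. \<phi> \<in> Rstep I {p..q} \<Longrightarrow> norm (f \<phi>) \<le> C * Gnorm I k \<phi>"
    by (rule dual_bound[OF f pq]) blast
  then show "\<exists>k C. \<forall>\<phi>\<in>Rstep I {p..q}. norm (c * f \<phi>) \<le> C * Gnorm I k \<phi>"
    by (intro exI[of _ k] exI[of _ "norm c * C"]) (auto simp: norm_mult mult.assoc intro!: mult_left_mono)
qed (auto simp: dual_add[OF f] dual_cmult[OF f] algebra_simps)

lemma dual_zero_fun: "(\<lambda>_. 0) \<in> RR_dual I"
proof (rule RR_dualI)
  fix p q show "\<exists>k C. \<forall>\<phi>\<in>Rstep I {p..q}. norm (0::complex) \<le> C * Gnorm I k \<phi>"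
    by (intro exI[of _ 0]) auto
qed auto

lemma dual_finsum: "(\<And>i. i \<in> S \<Longrightarrow> f i \<in> RR_dual I) \<Longrightarrow> (\<lambda>\<phi>. \<Sum>i\<in>S. f i \<phi>) \<in> RR_dual I"
  by (induction S rule: infinite_finite_induct) (auto simp: dual_zero_fun dual_plus)

lemma dual_minus: "f \<in> RR_dual I \<Longrightarrow> g \<in> RR_dual I \<Longrightarrow> (\<lambda>\<phi>. f \<phi> - g \<phi>) \<in> RR_dual I"
  using dual_plus[of f "\<lambda>\<phi>. - 1 * g \<phi>"] dual_scale[of g "- 1"] by simp

lemma dual_cong:
  assumes f: "f \<in> RR_dual I" and fg: "\<And>\<phi>. \<phi> \<in> RR I \<Longrightarrow> f \<phi> = g \<phi>" shows "g \<in> RR_dual I"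
proof (rule RR_dualI)
  fix p q assume pq: "p \<in> I" "q \<in> I"
  obtain k C where 1: "C \<ge> 0" "\<And>\<phi>. \<phi> \<in> Rstep I {p..q} \<Longrightarrow> norm (f \<phi>) \<le> C * Gnorm I k \<phi>"
    by (rule dual_bound[OF f pq]) blast
  then show "\<exists>k C. \<forall>\<phi>\<in>Rstep I {p..q}. norm (g \<phi>) \<le> C * Gnorm I k \<phi>"
    using fg Rstep_RR[OF pq] by (intro exI[of _ k] exI[of _ C]) (metis subsetD)
qed (use dual_add[OF f] dual_cmult[OF f] RR_add RR_cmult in \<open>auto simp: fg[symmetric]\<close>)

text \<open>Differentiation costs one order in the norm, and \<open>RR_dualI\<close> accepts bounds
  of any order.\<close>

lemma dual_base_deriv:
  assumes f: "f \<in> RR_dual I" shows "base_deriv I f \<in> RR_dual I"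
proof (rule RR_dualI)
  fix \<phi> \<psi> assume p: "\<phi> \<in> RR I" "\<psi> \<in> RR I"
  have "f (gderiv I (\<lambda>t. \<phi> t + \<psi> t)) = f (\<lambda>t. gderiv I \<phi> t + gderiv I \<psi> t)"
    using p by (intro dual_ae_eq[OF f] RR_gderiv RR_add gderiv_add RR_Ginf)
  then show "base_deriv I f (\<lambda>t. \<phi> t + \<psi> t) = base_deriv I f \<phi> + base_deriv I f \<psi>"
    using p by (simp add: base_deriv_def dual_add[OF f] RR_gderiv)
next
  fix c \<phi> assume p: "\<phi> \<in> RR I"
  have "f (gderiv I (\<lambda>t. c * \<phi> t)) = f (\<lambda>t. c * gderiv I \<phi> t)"
    using p by (intro dual_ae_eq[OF f] RR_gderiv RR_cmult gderiv_cmult RR_Ginf)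
  then show "base_deriv I f (\<lambda>t. c * \<phi> t) = c * base_deriv I f \<phi>"
    using p by (simp add: base_deriv_def dual_cmult[OF f] RR_gderiv)
next
  fix p q assume pq: "p \<in> I" "q \<in> I"
  obtain k C where 1: "C \<ge> 0" "\<And>\<phi>. \<phi> \<in> Rstep I {p..q} \<Longrightarrow> norm (f \<phi>) \<le> C * Gnorm I k \<phi>"
    by (rule dual_bound[OF f pq]) blast
  show "\<exists>k C. \<forall>\<phi>\<in>Rstep I {p..q}. norm (base_deriv I f \<phi>) \<le> C * Gnorm I k \<phi>"
  proof (intro exI ballI)
    fix \<phi> assume p: "\<phi> \<in> Rstep I {p..q}"
    have "norm (base_deriv I f \<phi>) \<le> C * Gnorm I k (gderiv I \<phi>)"
      unfolding base_deriv_def norm_minus_cancel by (intro 1 Rstep_gderiv p) simp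
    also have "\<dots> \<le> C * Gnorm I (Suc k) \<phi>" using p 1(1) by (intro mult_left_mono gderiv_Gnorm) (auto simp: Rstep_iff)
    finally show "norm (base_deriv I f \<phi>) \<le> C * Gnorm I (Suc k) \<phi>" .
  qed
qed

text \<open>Unlike elements of \<open>Ginf I\<close>, these multipliers may be unbounded near the end points of \<open>I\<close>.\<close>

definition Gloc :: "(real \<Rightarrow> complex) set" where
  "Gloc = {u. \<forall>p\<in>I. \<forall>q\<in>I. \<exists>v\<in>Ginf I. \<forall>t\<in>{p..q}. u t = v t}"

lemma Ginf_Gloc: "u \<in> Ginf I \<Longrightarrow> u \<in> Gloc" by (auto simp: Gloc_def)

lemma Gloc_Rstep:
  assumes v: "v \<in> Ginf I" and uv: "\<And>t. t \<in> {p..q} \<Longrightarrow> u t = v t" and f: "\<phi> \<in> Rstep I {p..q}"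
  shows "ae_eq (\<lambda>t. v t * \<phi> t) (\<lambda>t. u t * \<phi> t)" "(\<lambda>t. u t * \<phi> t) \<in> Rstep I {p..q}"
proof -
  have "zero_off {p..q} \<phi>" using f by (simp add: Rstep_iff)
  then show 1: "ae_eq (\<lambda>t. v t * \<phi> t) (\<lambda>t. u t * \<phi> t)"
    unfolding zero_off_def ae_eq_def by (rule eventually_mono) (use uv in force)
  show "(\<lambda>t. u t * \<phi> t) \<in> Rstep I {p..q}" by (rule Rstep_ae_eq[OF Rstep_mult[OF v f] 1])
qed

lemma Gloc_RR:
  assumes "u \<in> Gloc" "\<phi> \<in> RR I" shows "(\<lambda>t. u t * \<phi> t) \<in> RR I"
proof -
  obtain p q where pq: "p \<in> I" "q \<in> I" "p < q" "\<phi> \<in> Rstep I {p..q}" using RR_ex_step[OF assms(2)] .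
  obtain v where v: "v \<in> Ginf I" "\<And>t. t \<in> {p..q} \<Longrightarrow> u t = v t" using assms(1) pq unfolding Gloc_def by blast
  show ?thesis using Gloc_Rstep(2)[OF v pq(4)] Rstep_RR[OF pq(1,2)] by blast
qed

text \<open>On a fixed step \<open>u\<close> coincides with an element of \<open>Ginf I\<close>, so
  \<open>Gnorm_mult\<close> applies although \<open>u\<close> may be unbounded on
  \<open>I\<close>.\<close>

lemma dual_gmult:
  assumes u: "u \<in> Gloc" and f: "f \<in> RR_dual I"
  shows "(\<lambda>\<phi>. f (\<lambda>t. u t * \<phi> t)) \<in> RR_dual I"
proof (rule RR_dualI)
  fix \<phi> \<psi> assume "\<phi> \<in> RR I" "\<psi> \<in> RR I"
  then show "f (\<lambda>t. u t * (\<phi> t + \<psi> t)) = f (\<lambda>t. u t * \<phi> t) + f (\<lambda>t. u t * \<psi> t)"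
    using dual_add[OF f Gloc_RR[OF u] Gloc_RR[OF u]] by (simp add: algebra_simps)
next
  fix c \<phi> assume "\<phi> \<in> RR I"
  then show "f (\<lambda>t. u t * (c * \<phi> t)) = c * f (\<lambda>t. u t * \<phi> t)"
    using dual_cmult[OF f Gloc_RR[OF u], of \<phi> c] by (simp add: algebra_simps)
next
  fix p q assume pq: "p \<in> I" "q \<in> I"
  obtain v where v: "v \<in> Ginf I" "\<And>t. t \<in> {p..q} \<Longrightarrow> u t = v t" using u pq unfolding Gloc_def by blast
  obtain k C where 1: "C \<ge> 0" "\<And>\<phi>. \<phi> \<in> Rstep I {p..q} \<Longrightarrow> norm (f \<phi>) \<le> C * Gnorm I k \<phi>"
    by (rule dual_bound[OF f pq]) blast
  obtain D where D: "D \<ge> 0" "\<And>\<phi>. \<phi> \<in> Ginf I \<Longrightarrow> Gnorm I k (\<lambda>t. v t * \<phi> t) \<le> D * Gnorm I k \<phi>"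
    using Gnorm_mult[OF v(1)] by blast
  show "\<exists>k C. \<forall>\<phi>\<in>Rstep I {p..q}. norm (f (\<lambda>t. u t * \<phi> t)) \<le> C * Gnorm I k \<phi>"
  proof (intro exI ballI)
    fix \<phi> assume p: "\<phi> \<in> Rstep I {p..q}"
    then have g: "\<phi> \<in> Ginf I" by (simp add: Rstep_iff)
    have "norm (f (\<lambda>t. u t * \<phi> t)) \<le> C * Gnorm I k (\<lambda>t. u t * \<phi> t)"
      by (intro 1 Gloc_Rstep(2)[OF v p])
    also have "\<dots> = C * Gnorm I k (\<lambda>t. v t * \<phi> t)"
      using Gnorm_cong[OF Ginf_mult[OF v(1) g] Gloc_Rstep(1)[OF v p]] by simp
    also have "\<dots> \<le> C * (D * Gnorm I k \<phi>)" using 1(1) D(2)[OF g] by (intro mult_left_mono)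
    finally show "norm (f (\<lambda>t. u t * \<phi> t)) \<le> (C * D) * Gnorm I k \<phi>" by (simp add: mult.assoc)
  qed
qed

end

section \<open>One-sided derivatives and primitives\<close>

text \<open>Genuine limits instead of essential ones: this is meant for continuous representatives,
  whose point values make sense. The quotient is multiplied out, so that estimates survive limits
  and subtraction.\<close>

definition one_sided_deriv :: "bool \<Rightarrow> (real \<Rightarrow> complex) \<Rightarrow> real \<Rightarrow> complex \<Rightarrow> bool" where
  "one_sided_deriv \<sigma> K t l \<longleftrightarrow> (\<forall>e>0. \<exists>d>0. \<forall>y\<in>side \<sigma> t d. norm (K y - K t - of_real (y - t) * l) \<le> e * \<bar>y - t\<bar>)"

lemma one_sided_deriv_D:
  assumes "one_sided_deriv \<sigma> K t l" "e > 0"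
  obtains d where "d > 0" "\<And>y. y \<in> side \<sigma> t d \<Longrightarrow> norm (K y - K t - of_real (y - t) * l) \<le> e * \<bar>y - t\<bar>"
  using assms unfolding one_sided_deriv_def by blast

lemma side_ne: "y \<in> side \<sigma> t d \<Longrightarrow> y \<noteq> t"
  by (auto simp: side_def split: if_splits)

lemma one_sided_deriv_tendsto:
  assumes "one_sided_deriv \<sigma> K t l" shows "((\<lambda>s. (K s - K t) / of_real (s - t)) \<longlongrightarrow> l) (ess_at \<sigma> t)"
proof (rule tendstoI)
  fix e :: real assume e: "e > 0"
  then have "e / 2 > 0" by simp
  obtain d where d: "d > 0" "\<And>y. y \<in> side \<sigma> t d \<Longrightarrow> norm (K y - K t - of_real (y - t) * l) \<le> e / 2 * \<bar>y - t\<bar>"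
    by (rule one_sided_deriv_D[OF assms \<open>e / 2 > 0\<close>]) blast
  show "eventually (\<lambda>s. dist ((K s - K t) / of_real (s - t)) l < e) (ess_at \<sigma> t)"
  proof (rule eventually_mono[OF eventually_ess_at_side[OF d(1)]])
    fix s assume s: "s \<in> side \<sigma> t d"
    then have ne: "s \<noteq> t" by (rule side_ne)
    then have "(K s - K t) / of_real (s - t) - l = (K s - K t - of_real (s - t) * l) / of_real (s - t)"
      by (simp add: field_simps)
    then have "norm ((K s - K t) / of_real (s - t) - l) = norm (K s - K t - of_real (s - t) * l) / \<bar>s - t\<bar>"
      by (simp add: norm_divide del: of_real_diff)
    also have "\<dots> \<le> e / 2" using d(2)[OF s] ne by (simp add: pos_divide_le_eq)
    finally show "dist ((K s - K t) / of_real (s - t)) l < e" using e by (simp add: dist_norm)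
  qed
qed

lemma one_sided_deriv_at:
  assumes "\<And>\<sigma>. one_sided_deriv \<sigma> K t (l \<sigma>)" "e > 0"
  obtains d where "d > 0" "\<And>y. \<bar>y - t\<bar> < d \<Longrightarrow> \<exists>\<sigma>. norm (K y - K t - of_real (y - t) * l \<sigma>) \<le> e * \<bar>y - t\<bar>"
proof -
  obtain d1 where d1: "d1 > 0" "\<And>y. y \<in> side True t d1 \<Longrightarrow> norm (K y - K t - of_real (y - t) * l True) \<le> e * \<bar>y - t\<bar>"
    using one_sided_deriv_D[OF assms] by metis
  obtain d2 where d2: "d2 > 0" "\<And>y. y \<in> side False t d2 \<Longrightarrow> norm (K y - K t - of_real (y - t) * l False) \<le> e * \<bar>y - t\<bar>"
    using one_sided_deriv_D[OF assms] by metis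
  show thesis
  proof (rule that[of "min d1 d2"])
    fix y assume y: "\<bar>y - t\<bar> < min d1 d2"
    consider "y = t" | "y \<in> side True t d1" | "y \<in> side False t d2"
      using y by (fastforce simp: side_def abs_if split: if_splits)
    then show "\<exists>\<sigma>. norm (K y - K t - of_real (y - t) * l \<sigma>) \<le> e * \<bar>y - t\<bar>"
      using d1 d2 by cases auto
  qed (use d1 d2 in simp)
qed

lemma one_sided_deriv_isCont:
  assumes "\<And>\<sigma>. one_sided_deriv \<sigma> K t (l \<sigma>)" shows "isCont K t"
proof -
  obtain d where d: "d > 0" "\<And>y. \<bar>y - t\<bar> < d \<Longrightarrow> \<exists>\<sigma>. norm (K y - K t - of_real (y - t) * l \<sigma>) \<le> 1 * \<bar>y - t\<bar>"
    by (rule one_sided_deriv_at[of K t l 1, OF assms]) auto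
  define M where "M = norm (l True) + norm (l False)"
  have "norm (K y - K t) \<le> (1 + M) * \<bar>y - t\<bar>" if yd: "\<bar>y - t\<bar> < d" for y
  proof -
    obtain \<sigma> where s: "norm (K y - K t - of_real (y - t) * l \<sigma>) \<le> 1 * \<bar>y - t\<bar>" using d(2)[OF yd] by blast
    have "norm (l \<sigma>) \<le> M" by (cases \<sigma>) (auto simp: M_def)
    then have "norm (of_real (y - t) * l \<sigma>) \<le> \<bar>y - t\<bar> * M" by (simp add: norm_mult mult_left_mono del: of_real_diff)
    then have "norm (K y - K t - of_real (y - t) * l \<sigma> + of_real (y - t) * l \<sigma>) \<le> 1 * \<bar>y - t\<bar> + \<bar>y - t\<bar> * M"
      using s by (rule_tac norm_triangle_mono)
    then show ?thesis by (simp add: algebra_simps)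
  qed
  then have ev: "eventually (\<lambda>y. norm (K y - K t) \<le> (1 + M) * \<bar>y - t\<bar>) (at t)"
    unfolding eventually_at using d(1) by (auto simp: dist_real_def)
  have "((\<lambda>y. (1 + M) * \<bar>y - t\<bar>) \<longlongrightarrow> (1 + M) * \<bar>t - t\<bar>) (at t)" by (intro tendsto_intros)
  then have "((\<lambda>y. (1 + M) * \<bar>y - t\<bar>) \<longlongrightarrow> 0) (at t)" by simp
  from Lim_null_comparison[OF ev this] have "((\<lambda>y. K y - K t) \<longlongrightarrow> 0) (at t)" .
  then show ?thesis unfolding isCont_def by (rule LIM_zero_cancel)
qed

lemma one_sided_deriv_zero_deriv:
  assumes "\<And>\<sigma>. one_sided_deriv \<sigma> D x 0" shows "(D has_vector_derivative 0) (at x)"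
  unfolding has_vector_derivative_def has_derivative_at_alt
proof (intro conjI allI impI)
  fix e :: real assume e: "e > 0"
  obtain d where d: "d > 0" "\<And>y. \<bar>y - x\<bar> < d \<Longrightarrow> \<exists>\<sigma>::bool. norm (D y - D x - of_real (y - x) * 0) \<le> e * \<bar>y - x\<bar>"
    by (rule one_sided_deriv_at[of D x "\<lambda>_. 0" e, OF assms e]) blast
  then show "\<exists>d>0. \<forall>y. norm (y - x) < d \<longrightarrow> norm (D y - D x - (y - x) *\<^sub>R 0) \<le> e * norm (y - x)"
    by (intro exI[of _ d]) auto
qed (rule bounded_linear_scaleR_left)

lemma one_sided_deriv_diff:
  assumes "one_sided_deriv \<sigma> K t l" "one_sided_deriv \<sigma> K' t l'" shows "one_sided_deriv \<sigma> (\<lambda>x. K x - K' x) t (l - l')"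
  unfolding one_sided_deriv_def
proof (intro allI impI)
  fix e :: real assume "e > 0"
  then have e: "e / 2 > 0" by simp
  obtain d where d: "d > 0" "\<And>y. y \<in> side \<sigma> t d \<Longrightarrow> norm (K y - K t - of_real (y - t) * l) \<le> e / 2 * \<bar>y - t\<bar>"
    by (rule one_sided_deriv_D[OF assms(1) e]) blast
  obtain d' where d': "d' > 0" "\<And>y. y \<in> side \<sigma> t d' \<Longrightarrow> norm (K' y - K' t - of_real (y - t) * l') \<le> e / 2 * \<bar>y - t\<bar>"
    by (rule one_sided_deriv_D[OF assms(2) e]) blast
  show "\<exists>d>0. \<forall>y\<in>side \<sigma> t d. norm (K y - K' y - (K t - K' t) - of_real (y - t) * (l - l')) \<le> e * \<bar>y - t\<bar>"
  proof (intro exI[of _ "min d d'"] conjI ballI)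
    fix y assume "y \<in> side \<sigma> t (min d d')"
    then have y: "y \<in> side \<sigma> t d" "y \<in> side \<sigma> t d'" using side_mono[of "min d d'" d \<sigma> t] side_mono[of "min d d'" d' \<sigma> t] by auto
    have "K y - K' y - (K t - K' t) - of_real (y - t) * (l - l') =
      (K y - K t - of_real (y - t) * l) - (K' y - K' t - of_real (y - t) * l')" by (simp add: algebra_simps)
    also have "norm \<dots> \<le> e / 2 * \<bar>y - t\<bar> + e / 2 * \<bar>y - t\<bar>"
      by (rule order_trans[OF norm_triangle_ineq4 add_mono[OF d(2)[OF y(1)] d'(2)[OF y(2)]]])
    finally show "norm (K y - K' y - (K t - K' t) - of_real (y - t) * (l - l')) \<le> e * \<bar>y - t\<bar>" by simp
  qed (use d d' in simp)
qed

lemma has_integral_near_const: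
  fixes h :: "real \<Rightarrow> complex"
  assumes st: "s \<le> t" and i: "(h has_integral i) {s..t}" and e: "e \<ge> 0"
    and h: "AE z in lebesgue. z \<in> {s<..<t} \<longrightarrow> norm (h z - l) \<le> e"
  shows "norm (i - of_real (t - s) * l) \<le> e * (t - s)"
proof -
  have "((\<lambda>z. h z - l) has_integral (i - (t - s) *\<^sub>R l)) {s..t}"
    using has_integral_diff[OF i has_integral_const_real[of l s t]] st by simp
  then have hi: "((\<lambda>z. h z - l) has_integral (i - of_real (t - s) * l)) {s..t}"
    by (simp only: scaleR_conv_of_real)
  obtain N where N: "N \<in> null_sets lebesgue" "{z \<in> space lebesgue. \<not> (z \<in> {s<..<t} \<longrightarrow> norm (h z - l) \<le> e)} \<subseteq> N"
    using h unfolding eventually_ae_filter by blast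
  have "negligible (N \<union> {s, t})" using N(1) by (simp add: negligible_iff_null_sets[symmetric] negligible_Un)
  then have "((\<lambda>z. if z \<in> N \<union> {s, t} then 0 else h z - l) has_integral (i - of_real (t - s) * l)) {s..t}"
    by (rule has_integral_spike[OF _ _ hi]) auto
  moreover have le: "norm (h z - l) \<le> e" if "z \<in> {s..t} - (N \<union> {s, t})" for z
  proof (rule ccontr)
    assume "\<not> norm (h z - l) \<le> e"
    moreover have "z \<in> {s<..<t}" using that by auto
    ultimately have "z \<in> N" using N(2) by auto
    then show False using that by simp
  qed
  ultimately have "norm (i - of_real (t - s) * l) \<le> e * measure lborel {s..t}"
    by (rule_tac has_integral_bound_real[OF e]) (use le e in auto)
  then show ?thesis using st by simp
qed

context dyn_interval
begin

text \<open>Phrased through integrals over all subintervals, so that \<open>h\<close> matters only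
  up to null sets and may jump.\<close>

definition primitive :: "(real \<Rightarrow> complex) \<Rightarrow> (real \<Rightarrow> complex) \<Rightarrow> bool" where
  "primitive K h \<longleftrightarrow> (\<forall>s\<in>I. \<forall>t\<in>I. s \<le> t \<longrightarrow> (h has_integral (K t - K s)) {s..t})"

lemma primitiveD: "primitive K h \<Longrightarrow> s \<in> I \<Longrightarrow> t \<in> I \<Longrightarrow> s \<le> t \<Longrightarrow> (h has_integral (K t - K s)) {s..t}"
  by (simp add: primitive_def)

lemma I_ball:
  assumes "t \<in> I" obtains d where "d > 0" "\<And>s. \<bar>s - t\<bar> < d \<Longrightarrow> s \<in> I"
proof -
  obtain d where "d > 0" "ball t d \<subseteq> I" using open_I assms openE by blast
  then show thesis by (intro that[of d]) (auto simp: dist_real_def subset_iff abs_minus_commute)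
qed

text \<open>Near \<open>t\<close> on the side \<open>\<sigma>\<close> the values of \<open>h\<close>
  are essentially within \<open>e\<close> of \<open>l\<close>, hence so are their averages. On the
  left the roles of \<open>y\<close> and \<open>t\<close> are exchanged.\<close>

lemma primitive_one_sided_deriv:
  assumes P: "primitive K h" and t: "t \<in> I" and h: "(h \<longlongrightarrow> l) (ess_at \<sigma> t)"
  shows "one_sided_deriv \<sigma> K t l"
  unfolding one_sided_deriv_def
proof (intro allI impI)
  fix e :: real assume e: "e > 0"
  obtain d1 where d1: "d1 > 0" "AE s in lebesgue. s \<in> side \<sigma> t d1 \<longrightarrow> dist (h s) l < e"
    using tendstoD[OF h e] unfolding eventually_ess_at by blast
  obtain d2 where d2: "d2 > 0" "\<And>s. \<bar>s - t\<bar> < d2 \<Longrightarrow> s \<in> I" using I_ball[OF t] by metis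
  have ae: "AE z in lebesgue. z \<in> A \<longrightarrow> norm (h z - l) \<le> e" if "A \<subseteq> side \<sigma> t d1" for A
    using d1(2) by (rule eventually_mono) (use that in \<open>auto simp: dist_norm\<close>)
  show "\<exists>d>0. \<forall>y\<in>side \<sigma> t d. norm (K y - K t - of_real (y - t) * l) \<le> e * \<bar>y - t\<bar>"
  proof (intro exI[of _ "min d1 d2"] conjI ballI)
    fix y assume y: "y \<in> side \<sigma> t (min d1 d2)"
    show "norm (K y - K t - of_real (y - t) * l) \<le> e * \<bar>y - t\<bar>"
    proof (cases \<sigma>)
      case True
      then have y': "t < y" "y < t + d1" "\<bar>y - t\<bar> < d2" using y by (auto simp: side_def)
      have "norm (K y - K t - of_real (y - t) * l) \<le> e * (y - t)"
        by (rule has_integral_near_const[OF _ primitiveD[OF P t d2(2)] _ ae]) (use y' True e in \<open>auto simp: side_def\<close>)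
      then show ?thesis using y' by simp
    next
      case False
      then have y': "y < t" "t - d1 < y" "\<bar>y - t\<bar> < d2" using y by (auto simp: side_def)
      have "norm (K t - K y - of_real (t - y) * l) \<le> e * (t - y)"
        by (rule has_integral_near_const[OF _ primitiveD[OF P d2(2) t] _ ae]) (use y' False e in \<open>auto simp: side_def\<close>)
      moreover have "K t - K y - of_real (t - y) * l = - (K y - K t - of_real (y - t) * l)" by (simp add: algebra_simps)
      ultimately show ?thesis using y' by (simp only: norm_minus_cancel) simp
    qed
  qed (use d1 d2 in simp)
qed

lemma primitive_isCont: "primitive K h \<Longrightarrow> h \<in> GG I \<Longrightarrow> t \<in> I \<Longrightarrow> isCont K t"
  by (rule one_sided_deriv_isCont[of K t "\<lambda>\<sigma>. slim \<sigma> h t"]) (rule primitive_one_sided_deriv[OF _ _ GG_tendsto])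

lemma primitive_is_gderiv:
  assumes P: "primitive K h" and h: "h \<in> GG I" and B: "\<And>t. t \<in> I \<Longrightarrow> norm (K t) \<le> B"
  shows "K \<in> GG I" "is_gderiv I K h"
proof -
  have c: "isCont K t" if "t \<in> I" for t by (rule primitive_isCont[OF P h that])
  then have "K \<in> borel_measurable (lebesgue_on I)"
    by (intro continuous_imp_measurable_on_sets_lebesgue continuous_at_imp_continuous_on) auto
  moreover have "AE t in lebesgue_on I. norm (K t) \<le> B" unfolding AE_I using B by simp
  moreover have "\<exists>l. (K \<longlongrightarrow> l) (ess_at \<sigma> t)" if "t \<in> I" for t \<sigma>
    using tendsto_ess_at_at[OF c[OF that, unfolded isCont_def]] by (rule exI)
  ultimately show "K \<in> GG I" unfolding GG_iff by (intro conjI exI[of _ B] ballI allI)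
  show "is_gderiv I K h" unfolding is_gderiv_iff
    using one_sided_deriv_tendsto[OF primitive_one_sided_deriv[OF P _ GG_tendsto[OF h]]] by (simp add: h slim_continuous[OF c] del: of_real_diff)
qed

lemma AE_negligible: "(AE t in lebesgue_on I. P t) \<Longrightarrow> negligible {t \<in> I. \<not> P t}"
proof -
  assume "AE t in lebesgue_on I. P t"
  then have "\<exists>N\<in>null_sets lebesgue. {z \<in> space lebesgue. \<not> (z \<in> I \<longrightarrow> P z)} \<subseteq> N"
    unfolding AE_I unfolding eventually_ae_filter .
  then obtain N where "N \<in> null_sets lebesgue" "{z \<in> space lebesgue. \<not> (z \<in> I \<longrightarrow> P z)} \<subseteq> N" ..
  then show ?thesis unfolding negligible_iff_null_sets[symmetric] by (elim negligible_subset) auto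
qed

lemma GG_absolutely_integrable:
  assumes h: "h \<in> GG I" and S: "S \<subseteq> I" "S \<in> lmeasurable"
  shows "h absolutely_integrable_on S"
proof -
  obtain B where B: "AE t in lebesgue_on I. norm (h t) \<le> B" using h unfolding GG_iff by blast
  define h' where "h' t = (if norm (h t) \<le> B then h t else 0)" for t
  have "ae_eq h h'" using B unfolding ae_eq_def h'_def by (rule eventually_mono) simp
  then have "h' \<in> GG I" using GG_ae_eq h by blast
  then have "h' \<in> borel_measurable (lebesgue_on S)"
    unfolding GG_iff using measurable_restrict_mono S(1) by blast
  then have "h' absolutely_integrable_on S"
    by (rule measurable_bounded_by_integrable_imp_absolutely_integrable[where g = "\<lambda>_. \<bar>B\<bar>"])
       (use S fmeasurableD integrable_on_const in \<open>auto simp: h'_def\<close>)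
  then show ?thesis
    by (rule absolutely_integrable_spike[OF _ AE_negligible[OF B]]) (use S in \<open>auto simp: h'_def\<close>)
qed

lemma GG_integrable: "h \<in> GG I \<Longrightarrow> s \<in> I \<Longrightarrow> t \<in> I \<Longrightarrow> h integrable_on {s..t}"
  using GG_absolutely_integrable[of h "{s..t}"] Icc_subset_I[of s t] set_lebesgue_integral_eq_integral(1) by auto

lemma primitive_exists:
  assumes h: "h \<in> GG I" and c: "c \<in> I"
  shows "\<exists>K. primitive K h \<and> K c = 0"
proof -
  define K where "K x = (if c \<le> x then integral {c..x} h else - integral {x..c} h)" for x
  have int: "(h has_integral integral {s..t} h) {s..t}" if "s \<in> I" "t \<in> I" for s t
    using GG_integrable[OF h that] by (rule integrable_integral)
  have "primitive K h" unfolding primitive_def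
  proof (intro ballI impI)
    fix s t assume st: "s \<in> I" "t \<in> I" "s \<le> t"
    consider "c \<le> s" | "s < c" "c \<le> t" | "t < c" using st(3) by linarith
    then have "K t - K s = integral {s..t} h"
    proof cases
      case 1
      then show ?thesis using Henstock_Kurzweil_Integration.integral_combine[OF 1 st(3) GG_integrable[OF h c st(2)]] st(3)
        by (simp add: K_def algebra_simps)
    next
      case 2
      then show ?thesis using Henstock_Kurzweil_Integration.integral_combine[of s c t, OF _ _ GG_integrable[OF h st(1,2)]]
        by (simp add: K_def algebra_simps)
    next
      case 3
      then show ?thesis using Henstock_Kurzweil_Integration.integral_combine[of s t c, OF _ _ GG_integrable[OF h st(1) c]] st(3)
        by (simp add: K_def algebra_simps)
    qed
    then show "(h has_integral K t - K s) {s..t}" using int[OF st(1,2)] by simp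
  qed
  moreover have "K c = 0" by (simp add: K_def)
  ultimately show ?thesis by blast
qed

text \<open>The test functions on which all derivatives of a distribution agree. The condition
  concerns \<open>\<phi>\<close> itself; its derivatives may still jump.\<close>

definition no_jump :: "(real \<Rightarrow> complex) \<Rightarrow> bool" where
  "no_jump \<phi> \<longleftrightarrow> (\<forall>t\<in>I. slim True \<phi> t = slim False \<phi> t)"

lemma no_jumpD: "no_jump \<phi> \<Longrightarrow> t \<in> I \<Longrightarrow> slim \<sigma> \<phi> t = slim True \<phi> t"
  by (cases \<sigma>) (auto simp: no_jump_def)

lemma no_jump_jump: "no_jump \<phi> \<longleftrightarrow> (\<forall>t\<in>I. jump t \<phi> = 0)"
  by (simp add: no_jump_def jump_def slim_def)

lemma no_jump_isCont: "(\<And>t. t \<in> I \<Longrightarrow> isCont g t) \<Longrightarrow> no_jump g"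
  by (simp add: no_jump_def slim_continuous)

lemma no_jump_mult: "no_jump g \<Longrightarrow> no_jump h \<Longrightarrow> g \<in> GG I \<Longrightarrow> h \<in> GG I \<Longrightarrow> no_jump (\<lambda>t. g t * h t)"
  by (simp add: no_jump_def slim_mult)

lemma no_jump_ae_eq: "no_jump g \<Longrightarrow> ae_eq g h \<Longrightarrow> no_jump h"
  unfolding no_jump_def using slim_ae_eq_cong by metis

text \<open>The definition controls the difference quotient for almost every \<open>s\<close> only.
  Multiplied out, the estimate extends to every \<open>y\<close> by letting \<open>s\<close> tend to
  \<open>y\<close> from the right, which replaces \<open>g\<close> by
  \<open>slim True g\<close>.\<close>

lemma is_gderiv_one_sided_deriv:
  assumes g: "g \<in> GG I" "is_gderiv I g h" "no_jump g" and t: "t \<in> I"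
  shows "one_sided_deriv \<sigma> (slim True g) t (slim \<sigma> h t)"
  unfolding one_sided_deriv_def
proof (intro allI impI)
  fix e :: real assume e: "e > 0"
  define c l where "c = slim True g t" and "l = slim \<sigma> h t"
  have lim: "((\<lambda>s. (g s - c) / of_real (s - t)) \<longlongrightarrow> l) (ess_at \<sigma> t)"
    using is_gderivD[OF g(2) t, of \<sigma>] no_jumpD[OF g(3) t, of \<sigma>] by (simp only: c_def l_def)
  obtain d1 where d1: "d1 > 0" "AE s in lebesgue. s \<in> side \<sigma> t d1 \<longrightarrow> dist ((g s - c) / of_real (s - t)) l < e"
    using tendstoD[OF lim e] unfolding eventually_ess_at by blast
  obtain d2 where d2: "d2 > 0" "\<And>s. \<bar>s - t\<bar> < d2 \<Longrightarrow> s \<in> I" using I_ball[OF t] by metis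
  show "\<exists>d>0. \<forall>y\<in>side \<sigma> t d. norm (slim True g y - slim True g t - of_real (y - t) * slim \<sigma> h t) \<le> e * \<bar>y - t\<bar>"
  proof (intro exI[of _ "min d1 d2"] conjI ballI)
    fix y assume y: "y \<in> side \<sigma> t (min d1 d2)"
    then have yI: "y \<in> I" by (intro d2(2)) (auto simp: side_def split: if_splits)
    have y1: "y \<in> side \<sigma> t d1" using y side_mono[of "min d1 d2" d1 \<sigma> t] by auto
    obtain r where r: "r > 0" "ball y r \<subseteq> side \<sigma> t d1" using open_side y1 openE by blast
    have "side True y r \<subseteq> ball y r" by (auto simp: side_def dist_real_def)
    then have sub: "side True y r \<subseteq> side \<sigma> t d1" using r(2) by (rule order_trans)
    have "eventually (\<lambda>s. norm (g s - c - of_real (s - t) * l) \<le> e * \<bar>s - t\<bar>) (ess_at True y)"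
      unfolding eventually_ess_at
    proof (intro exI[of _ r] conjI)
      show "AE s in lebesgue. s \<in> side True y r \<longrightarrow> norm (g s - c - of_real (s - t) * l) \<le> e * \<bar>s - t\<bar>"
        using d1(2)
      proof (rule eventually_mono, intro impI)
        fix s assume s1: "s \<in> side \<sigma> t d1 \<longrightarrow> dist ((g s - c) / of_real (s - t)) l < e" and s2: "s \<in> side True y r"
        have s3: "s \<in> side \<sigma> t d1" using s2 sub by blast
        then have ne: "s \<noteq> t" by (rule side_ne)
        have "g s - c - of_real (s - t) * l = of_real (s - t) * ((g s - c) / of_real (s - t) - l)"
          using ne by (simp add: field_simps)
        also have "norm \<dots> = \<bar>s - t\<bar> * norm ((g s - c) / of_real (s - t) - l)"
          by (simp add: norm_mult del: of_real_diff)
        also have "\<dots> \<le> \<bar>s - t\<bar> * e" using s1 s3 by (intro mult_left_mono) (auto simp: dist_norm)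
        finally show "norm (g s - c - of_real (s - t) * l) \<le> e * \<bar>s - t\<bar>" by (simp add: mult.commute)
      qed
    qed (rule r(1))
    moreover have idl: "((\<lambda>s. s) \<longlongrightarrow> y) (ess_at True y)" by (rule tendsto_ess_at_at) (rule tendsto_ident_at)
    have "((\<lambda>s. norm (g s - c - of_real (s - t) * l)) \<longlongrightarrow> norm (slim True g y - c - of_real (y - t) * l)) (ess_at True y)"
      by (intro tendsto_intros GG_tendsto[OF g(1) yI] idl)
    moreover have "((\<lambda>s. e * \<bar>s - t\<bar>) \<longlongrightarrow> e * \<bar>y - t\<bar>) (ess_at True y)" by (intro tendsto_intros idl)
    ultimately have "norm (slim True g y - c - of_real (y - t) * l) \<le> e * \<bar>y - t\<bar>"
      by (intro tendsto_le[OF ess_at_neq_bot]) auto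
    then show "norm (slim True g y - slim True g t - of_real (y - t) * slim \<sigma> h t) \<le> e * \<bar>y - t\<bar>"
      unfolding c_def l_def .
  qed (use d1 d2 in simp)
qed

lemma one_sided_deriv_zero_const:
  assumes D: "\<And>t \<sigma>. t \<in> I \<Longrightarrow> one_sided_deriv \<sigma> D t 0" and st: "s \<in> I" "t \<in> I" shows "D s = D t"
proof -
  have *: "D s = D t" if st: "s \<in> I" "t \<in> I" "s \<le> t" for s t
  proof -
    have "(D has_vector_derivative 0) (at x)" if "x \<in> {s..t}" for x
      using Icc_subset_I[OF st(1,2)] that by (intro one_sided_deriv_zero_deriv D) auto
    then have "((\<lambda>_. 0) has_integral (D t - D s)) {s..t}"
      by (rule fundamental_theorem_of_calculus[OF st(3) has_vector_derivative_at_within])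
    from has_integral_unique[OF this has_integral_0] show ?thesis by simp
  qed
  show ?thesis
  proof (cases "s \<le> t")
    case True then show ?thesis by (rule *[OF st])
  next
    case False then show ?thesis using *[OF st(2,1)] by simp
  qed
qed

text \<open>Compare with a primitive of \<open>h\<close>: the difference has one-sided derivatives
  zero on both sides everywhere, hence is constant. Jumps of \<open>g\<close> would be invisible to
  \<open>h\<close>, and \<open>no_jump g\<close> rules them out.\<close>

lemma primitive_slim:
  assumes g: "g \<in> GG I" "is_gderiv I g h" "no_jump g"
  shows "primitive (slim True g) h"
  unfolding primitive_def
proof (intro ballI impI)
  fix s t assume st: "s \<in> I" "t \<in> I" "s \<le> t"
  have hG: "h \<in> GG I" using g(2) by (rule is_gderiv_GG)
  obtain K where K: "primitive K h" using primitive_exists[OF hG st(1)] by blast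
  have "one_sided_deriv \<sigma> (\<lambda>x. slim True g x - K x) x (slim \<sigma> h x - slim \<sigma> h x)" if "x \<in> I" for x \<sigma>
    by (intro one_sided_deriv_diff is_gderiv_one_sided_deriv g primitive_one_sided_deriv[OF K _ GG_tendsto[OF hG]] that)
  then have "slim True g s - K s = slim True g t - K t"
    using one_sided_deriv_zero_const[of "\<lambda>x. slim True g x - K x" s t] st by simp
  then have "slim True g t - slim True g s = K t - K s" by (simp add: algebra_simps)
  then show "(h has_integral (slim True g t - slim True g s)) {s..t}" using primitiveD[OF K st] by simp
qed

section \<open>Integration from the right end\<close>

text \<open>The sign is opposite to the integral \<open>\<Psi>\<close> of the overview, so that this
  is a primitive of \<open>\<psi>\<close>; a minus sign in \<open>antiderivative\<close> makes up
  for it. The function vanishes to the right of the support of \<open>\<psi>\<close>, but to the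
  left it is a constant that need not be zero, and this is what the ramp has to remove.\<close>

definition tail_int :: "(real \<Rightarrow> complex) \<Rightarrow> real \<Rightarrow> complex" where
  "tail_int \<psi> t = - integral (I \<inter> {t..}) \<psi>"

lemma RR_absolutely_integrable:
  assumes "\<psi> \<in> RR I" "S \<in> sets lebesgue" "S \<subseteq> I" shows "\<psi> absolutely_integrable_on S"
proof -
  obtain p q where pq: "p \<in> I" "q \<in> I" "p < q" "\<psi> \<in> Rstep I {p..q}" using RR_ex_step[OF assms(1)] .
  have "\<psi> absolutely_integrable_on {p..q}"
    using pq Icc_subset_I by (intro GG_absolutely_integrable Ginf_GG) (auto simp: Rstep_iff)
  then have "(\<lambda>x. if x \<in> {p..q} then \<psi> x else 0) absolutely_integrable_on UNIV"
    by (subst absolutely_integrable_restrict_UNIV)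
  then have "(\<lambda>x. if x \<in> {p..q} then \<psi> x else 0) absolutely_integrable_on S"
    by (rule set_integrable_subset) (use assms in auto)
  moreover have "negligible {t \<in> I. \<not> (t \<notin> {p..q} \<longrightarrow> \<psi> t = 0)}"
    using pq(4) by (intro AE_negligible) (simp add: Rstep_iff zero_off_def)
  ultimately show ?thesis by (rule absolutely_integrable_spike) (use assms(3) in auto)
qed

lemma Ici_sets: "I \<inter> {t..} \<in> sets lebesgue"
  by (intro sets.Int I_sets) auto

lemma tail_int_integrable: "\<psi> \<in> RR I \<Longrightarrow> \<psi> integrable_on (I \<inter> {t..})"
  using RR_absolutely_integrable[OF _ Ici_sets] set_lebesgue_integral_eq_integral(1) by blast

lemma tail_int_add: "\<phi> \<in> RR I \<Longrightarrow> \<psi> \<in> RR I \<Longrightarrow> tail_int (\<lambda>t. \<phi> t + \<psi> t) t = tail_int \<phi> t + tail_int \<psi> t"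
  unfolding tail_int_def by (subst Henstock_Kurzweil_Integration.integral_add) (auto intro: tail_int_integrable)

lemma tail_int_cmult: "tail_int (\<lambda>t. c * \<psi> t) t = c * tail_int \<psi> t"
  by (simp add: tail_int_def)

lemma tail_int_primitive:
  assumes \<psi>: "\<psi> \<in> RR I" shows "primitive (tail_int \<psi>) \<psi>"
  unfolding primitive_def
proof (intro ballI impI)
  fix s t assume st: "s \<in> I" "t \<in> I" "s \<le> t"
  have i: "\<psi> integrable_on {s..t}" using \<psi> by (intro GG_integrable Ginf_GG RR_Ginf st)
  have "(\<psi> has_integral (integral {s..t} \<psi> + integral (I \<inter> {t..}) \<psi>)) ({s..t} \<union> (I \<inter> {t..}))"
  proof (rule has_integral_Un)
    have "{s..t} \<inter> (I \<inter> {t..}) \<subseteq> {t}" by auto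
    then show "negligible ({s..t} \<inter> (I \<inter> {t..}))" using negligible_subset negligible_sing by blast
  qed (use i tail_int_integrable[OF \<psi>] in \<open>auto intro: integrable_integral\<close>)
  moreover have "{s..t} \<union> (I \<inter> {t..}) = I \<inter> {s..}" using Icc_subset_I[OF st(1,2)] st(3) by auto
  ultimately have "integral (I \<inter> {s..}) \<psi> = integral {s..t} \<psi> + integral (I \<inter> {t..}) \<psi>"
    by (simp add: integral_unique)
  then have "tail_int \<psi> t - tail_int \<psi> s = integral {s..t} \<psi>" by (simp add: tail_int_def)
  then show "(\<psi> has_integral (tail_int \<psi> t - tail_int \<psi> s)) {s..t}" using integrable_integral[OF i] by simp
qed

lemma Rstep_AE_zero:
  assumes "\<psi> \<in> Rstep I {p..q}" "A \<subseteq> I" "A \<inter> {p..q} = {}"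
  shows "AE z in lebesgue. z \<in> A \<longrightarrow> \<psi> z = 0"
proof -
  have "AE z in lebesgue. z \<in> I \<longrightarrow> z \<notin> {p..q} \<longrightarrow> \<psi> z = 0"
    using assms(1) unfolding Rstep_iff zero_off_def AE_I by blast
  then show ?thesis by (rule eventually_mono) (use assms in blast)
qed

lemma tail_int_zero_right:
  assumes \<psi>: "\<psi> \<in> Rstep I {p..q}" and t: "q \<le> t"
  shows "tail_int \<psi> t = 0"
proof -
  have "AE z in lebesgue_on I. z \<notin> {p..q} \<longrightarrow> \<psi> z = 0" using \<psi> by (simp add: Rstep_iff zero_off_def)
  from AE_negligible[OF this] have N: "negligible ({z \<in> I. \<not> (z \<notin> {p..q} \<longrightarrow> \<psi> z = 0)} \<union> {q})"
    by (simp add: negligible_Un)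
  have "(\<psi> has_integral 0) (I \<inter> {t..})"
    by (rule has_integral_spike[OF N _ has_integral_0]) (use t in auto)
  then show ?thesis by (simp add: tail_int_def integral_unique)
qed

lemma tail_int_bounds:
  assumes \<psi>: "\<psi> \<in> Rstep I {p..q}" and pq: "p \<in> I" "q \<in> I" "p \<le> q" and t: "t \<in> I"
  shows "norm (tail_int \<psi> t) \<le> (q - p) * Gnorm I 0 \<psi>" "t \<le> p \<Longrightarrow> tail_int \<psi> t = tail_int \<psi> p"
proof -
  have R: "\<psi> \<in> RR I" "\<psi> \<in> Ginf I" using \<psi> Rstep_RR[OF pq(1,2)] by (auto simp: Rstep_iff)
  note P = primitiveD[OF tail_int_primitive[OF R(1)]]
  have N: "0 \<le> Gnorm I 0 \<psi>" by (rule Gnorm_nonneg[OF R(2)])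
  have 1: "norm (tail_int \<psi> x) \<le> (q - p) * Gnorm I 0 \<psi>" if x: "x \<in> {p..q}" for x
  proof -
    have xI: "x \<in> I" using Icc_subset_I[OF pq(1,2)] x by auto
    have "AE z in lebesgue. z \<in> I \<longrightarrow> norm (\<psi> z) \<le> Gnorm I 0 \<psi>"
      using Gnorm_AE[OF R(2) le0, of 0] unfolding AE_I by simp
    then have "AE z in lebesgue. z \<in> {x<..<q} \<longrightarrow> norm (\<psi> z - 0) \<le> Gnorm I 0 \<psi>"
      by (rule eventually_mono) (use subsetD[OF Icc_subset_I[OF xI pq(2)]] in auto)
    from has_integral_near_const[OF _ P[OF xI pq(2)] N this] x
    have "norm (tail_int \<psi> x) \<le> Gnorm I 0 \<psi> * (q - x)" by (simp add: tail_int_zero_right[OF \<psi>])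
    also have "\<dots> \<le> Gnorm I 0 \<psi> * (q - p)" using x N by (intro mult_left_mono) auto
    finally show ?thesis by (simp add: mult.commute)
  qed
  have 2: "tail_int \<psi> t = tail_int \<psi> p" if tp: "t \<le> p"
  proof -
    have "AE z in lebesgue. z \<in> {t<..<p} \<longrightarrow> norm (\<psi> z - 0) \<le> 0"
      using Rstep_AE_zero[OF \<psi>, of "{t<..<p}"] Icc_subset_I[OF t pq(1)] by fastforce
    from has_integral_near_const[OF tp P[OF t pq(1) tp] order_refl this] show ?thesis by simp
  qed
  then show "t \<le> p \<Longrightarrow> tail_int \<psi> t = tail_int \<psi> p" .
  consider "t \<le> p" | "t \<in> {p..q}" | "t \<ge> q" by force
  then show "norm (tail_int \<psi> t) \<le> (q - p) * Gnorm I 0 \<psi>"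
  proof cases
    case 1 then show ?thesis using \<open>\<And>x. x \<in> {p..q} \<Longrightarrow> norm (tail_int \<psi> x) \<le> (q - p) * Gnorm I 0 \<psi>\<close>[of p] 2 pq by simp
  next
    case 2 then show ?thesis by (rule 1)
  next
    case 3 then show ?thesis using tail_int_zero_right[OF \<psi> 3] N pq by simp
  qed
qed

lemma tail_int_Ginf:
  assumes "\<psi> \<in> RR I" shows "tail_int \<psi> \<in> Ginf I" "is_gderiv I (tail_int \<psi>) \<psi>" "no_jump (tail_int \<psi>)"
proof -
  obtain p q where pq: "p \<in> I" "q \<in> I" "p < q" "\<psi> \<in> Rstep I {p..q}" using RR_ex_step[OF assms] .
  note P = tail_int_primitive[OF assms]
  have G: "\<psi> \<in> GG I" using assms by (intro Ginf_GG RR_Ginf)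
  note * = primitive_is_gderiv[OF P G tail_int_bounds(1)[OF pq(4,1,2) less_imp_le[OF pq(3)]]]
  show "is_gderiv I (tail_int \<psi>) \<psi>" by (rule *(2))
  show "tail_int \<psi> \<in> Ginf I" by (rule Ginf_I[OF * RR_Ginf[OF assms]])
  show "no_jump (tail_int \<psi>)" by (rule no_jump_isCont) (rule primitive_isCont[OF P G])
qed

text \<open>Integration gains one order: the first derivative is \<open>\<psi>\<close> again, and
  only the sup norm picks up the length of the interval.\<close>

lemma tail_int_Gnorm:
  assumes \<psi>: "\<psi> \<in> Rstep I {p..q}" and pq: "p \<in> I" "q \<in> I" "p \<le> q"
  shows "Gnorm I (Suc k) (tail_int \<psi>) \<le> (q - p + 1) * Gnorm I k \<psi>"
proof -
  have R: "\<psi> \<in> RR I" "\<psi> \<in> Ginf I" using \<psi> Rstep_RR[OF pq(1,2)] by (auto simp: Rstep_iff)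
  have N: "0 \<le> Gnorm I k \<psi>" "Gnorm I 0 \<psi> \<le> Gnorm I k \<psi>" using Gnorm_nonneg[OF R(2)] Gnorm_mono by auto
  have "Gnorm I k (gderiv I (tail_int \<psi>)) = Gnorm I k \<psi>"
    by (intro Gnorm_cong Ginf_gderiv tail_int_Ginf R gderiv_ae_eq)
  moreover have "1 * Gnorm I k \<psi> \<le> (q - p + 1) * Gnorm I k \<psi>" using N pq by (intro mult_right_mono) auto
  moreover have "norm (tail_int \<psi> t) \<le> (q - p + 1) * Gnorm I k \<psi>" if "t \<in> I" for t
  proof -
    have "norm (tail_int \<psi> t) \<le> (q - p) * Gnorm I 0 \<psi>" by (rule tail_int_bounds(1)[OF \<psi> pq that])
    also have "\<dots> \<le> (q - p + 1) * Gnorm I k \<psi>" using N pq Gnorm_nonneg[OF R(2)] by (intro mult_mono) auto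
    finally show ?thesis .
  qed
  then have "AE t in lebesgue_on I. norm (tail_int \<psi> t) \<le> (q - p + 1) * Gnorm I k \<psi>" unfolding AE_I by simp
  ultimately show ?thesis by (simp add: Gnorm_Suc_le[OF tail_int_Ginf(1)[OF R(1)]])
qed

text \<open>Both sides are primitives of the same function and both vanish at a point
  \<open>x\<close> beyond the support of \<open>\<phi>\<close>.\<close>

lemma tail_int_gderiv:
  assumes \<phi>: "\<phi> \<in> RR I" and z: "no_jump \<phi>" and t: "t \<in> I"
  shows "tail_int (gderiv I \<phi>) t = slim True \<phi> t"
proof -
  obtain p q where pq: "p \<in> I" "q \<in> I" "p < q" "\<phi> \<in> Rstep I {p..q}" using RR_ex_step[OF \<phi>] .
  obtain d where d: "d > 0" "\<And>s. \<bar>s - q\<bar> < d \<Longrightarrow> s \<in> I" using I_ball[OF pq(2)] by metis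
  define x where "x = max t (q + d / 2)"
  have x: "x \<in> I" "x > q" "t \<le> x" using t d by (auto simp: x_def max_def)
  have G: "\<phi> \<in> GG I" using \<phi> by (intro Ginf_GG RR_Ginf)
  have 1: "(gderiv I \<phi> has_integral (slim True \<phi> x - slim True \<phi> t)) {t..x}"
    by (intro primitiveD primitive_slim G Ginf_gderiv RR_Ginf \<phi> z t x)
  have 2: "(gderiv I \<phi> has_integral (tail_int (gderiv I \<phi>) x - tail_int (gderiv I \<phi>) t)) {t..x}"
    by (intro primitiveD tail_int_primitive RR_gderiv \<phi> t x)
  have "tail_int (gderiv I \<phi>) x = 0" using x by (intro tail_int_zero_right[OF Rstep_gderiv[OF pq(4)]]) auto
  moreover have "slim True \<phi> x = 0" using pq(4) x by (intro zero_off_slim[of "{p..q}"]) (auto simp: Rstep_iff)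
  ultimately show ?thesis using has_integral_unique[OF 1 2] by simp
qed

lemma tail_int_gderiv_ae_eq: "\<phi> \<in> RR I \<Longrightarrow> no_jump \<phi> \<Longrightarrow> ae_eq (tail_int (gderiv I \<phi>)) \<phi>"
proof -
  assume \<phi>: "\<phi> \<in> RR I" "no_jump \<phi>"
  have "ae_eq (tail_int (gderiv I \<phi>)) (slim True \<phi>)" by (intro ae_eq_I tail_int_gderiv \<phi>)
  moreover have "ae_eq \<phi> (slim True \<phi>)"
    using GG_ae_slim[OF Ginf_GG[OF RR_Ginf[OF \<phi>(1)]], of True] by (simp add: ae_eq_def)
  ultimately show ?thesis using ae_eq_trans ae_eq_sym by blast
qed

end

section \<open>Piecewise polynomials and the jump distributions\<close>

lemma has_vector_derivative_one_sided_deriv: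
  assumes "(f has_vector_derivative f') (at t)" shows "one_sided_deriv \<sigma> f t f'"
  unfolding one_sided_deriv_def
proof (intro allI impI)
  fix e :: real assume e: "e > 0"
  have "(f has_derivative (\<lambda>h. h *\<^sub>R f')) (at t)" using assms by (simp add: has_vector_derivative_def)
  from this[unfolded has_derivative_at_alt, THEN conjunct2, rule_format, OF e]
  obtain d where d: "d > 0" "\<And>y. norm (y - t) < d \<Longrightarrow> norm (f y - f t - (y - t) *\<^sub>R f') \<le> e * norm (y - t)" by blast
  show "\<exists>d>0. \<forall>y\<in>side \<sigma> t d. norm (f y - f t - of_real (y - t) * f') \<le> e * \<bar>y - t\<bar>"
  proof (intro exI[of _ d] conjI ballI)
    fix y assume "y \<in> side \<sigma> t d"
    then have "norm (y - t) < d" by (auto simp: side_def split: if_splits)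
    from d(2)[OF this] show "norm (f y - f t - of_real (y - t) * f') \<le> e * \<bar>y - t\<bar>"
      by (simp only: scaleR_conv_of_real real_norm_def)
  qed (rule d(1))
qed

text \<open>What an indicator function needs in order to have essential one-sided limits at every
  point.\<close>

definition decides :: "real set \<Rightarrow> bool" where
  "decides J \<longleftrightarrow> (\<forall>t \<sigma>. eventually (\<lambda>s. s \<in> J) (ess_at \<sigma> t) \<or> eventually (\<lambda>s. s \<notin> J) (ess_at \<sigma> t))"

lemma decides_Ici: "decides {u..}"
  unfolding decides_def
proof (intro allI)
  fix t \<sigma>
  consider "u < t" | "t < u" | "u = t" by linarith
  then show "eventually (\<lambda>s. s \<in> {u..}) (ess_at \<sigma> t) \<or> eventually (\<lambda>s. s \<notin> {u..}) (ess_at \<sigma> t)"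
  proof cases
    case 1
    then have "eventually (\<lambda>s. s \<in> {u<..} \<and> s \<noteq> t) (ess_at \<sigma> t)" by (intro eventually_ess_at_open) auto
    then have "eventually (\<lambda>s. s \<in> {u..}) (ess_at \<sigma> t)" by (rule eventually_mono) auto
    then show ?thesis ..
  next
    case 2
    then have "eventually (\<lambda>s. s \<in> {..<u} \<and> s \<noteq> t) (ess_at \<sigma> t)" by (intro eventually_ess_at_open) auto
    then have "eventually (\<lambda>s. s \<notin> {u..}) (ess_at \<sigma> t)" by (rule eventually_mono) auto
    then show ?thesis ..
  next
    case 3
    have "eventually (\<lambda>s. s \<in> side \<sigma> t 1) (ess_at \<sigma> t)" by (rule eventually_ess_at_side) simp
    then have "eventually (\<lambda>s. (s \<in> {u..}) = \<sigma>) (ess_at \<sigma> t)"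
      by (rule eventually_mono) (use 3 in \<open>auto simp: side_def split: if_splits\<close>)
    then show ?thesis by (cases \<sigma>) auto
  qed
qed

lemma decides_diff:
  assumes "decides A" "decides B" shows "decides (A - B)"
  unfolding decides_def
proof (intro allI)
  fix t \<sigma>
  have a: "eventually (\<lambda>s. s \<in> A) (ess_at \<sigma> t) \<or> eventually (\<lambda>s. s \<notin> A) (ess_at \<sigma> t)"
    and b: "eventually (\<lambda>s. s \<in> B) (ess_at \<sigma> t) \<or> eventually (\<lambda>s. s \<notin> B) (ess_at \<sigma> t)"
    using assms by (auto simp: decides_def)
  show "eventually (\<lambda>s. s \<in> A - B) (ess_at \<sigma> t) \<or> eventually (\<lambda>s. s \<notin> A - B) (ess_at \<sigma> t)"
  proof (cases "eventually (\<lambda>s. s \<in> A) (ess_at \<sigma> t) \<and> eventually (\<lambda>s. s \<notin> B) (ess_at \<sigma> t)")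
    case True
    then have "eventually (\<lambda>s. s \<in> A - B) (ess_at \<sigma> t)" by (auto elim: eventually_elim2)
    then show ?thesis ..
  next
    case False
    then have "eventually (\<lambda>s. s \<notin> A) (ess_at \<sigma> t) \<or> eventually (\<lambda>s. s \<in> B) (ess_at \<sigma> t)" using a b by blast
    then have "eventually (\<lambda>s. s \<notin> A - B) (ess_at \<sigma> t)" by (auto elim!: eventually_mono)
    then show ?thesis ..
  qed
qed

lemma decides_Ico: "decides {u..<v}"
proof -
  have "{u..<v} = {u..} - {v..}" by auto
  then show ?thesis using decides_diff decides_Ici by metis
qed

definition deriv_chain :: "(nat \<Rightarrow> real \<Rightarrow> complex) \<Rightarrow> bool" where
  "deriv_chain d \<longleftrightarrow> (\<forall>k t. (d k has_vector_derivative d (Suc k) t) (at t))"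

lemma deriv_chainD: "deriv_chain d \<Longrightarrow> (d k has_vector_derivative d (Suc k) t) (at t)"
  by (simp add: deriv_chain_def)

lemma smooth_chain:
  assumes "smooth g"
  obtains d where "d 0 = g" "deriv_chain d"
proof -
  define nx where "nx g = (SOME g'. (\<forall>t. (g has_vector_derivative g' t) (at t)) \<and> smooth g')" for g :: "real \<Rightarrow> complex"
  have nx: "(\<forall>t. (g has_vector_derivative nx g t) (at t)) \<and> smooth (nx g)" if "smooth g" for g
  proof -
    have "\<exists>g'. (\<forall>t. (g has_vector_derivative g' t) (at t)) \<and> smooth g'"
      using that by cases auto
    then show ?thesis
      unfolding nx_def by (rule someI_ex[of "\<lambda>g'. (\<forall>t. (g has_vector_derivative g' t) (at t)) \<and> smooth g'"])
  qed
  have s: "smooth ((nx ^^ k) g)" for k by (induction k) (use assms nx in auto)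
  show thesis by (rule that[of "\<lambda>k. (nx ^^ k) g"]) (use nx[OF s] in \<open>auto simp: deriv_chain_def\<close>)
qed

lemma chain_continuous:
  fixes d :: "nat \<Rightarrow> real \<Rightarrow> complex"
  assumes "deriv_chain d"
  shows "isCont (d k) t" "continuous_on A (d k)"
  using has_vector_derivative_continuous[OF deriv_chainD[OF assms]] by (auto intro: continuous_at_imp_continuous_on)

lemma chain_zero:
  fixes d :: "nat \<Rightarrow> real \<Rightarrow> complex"
  assumes d: "deriv_chain d"
    and z: "\<And>t. t \<in> U \<Longrightarrow> d 0 t = 0" and U: "open U" and t: "t \<in> U"
  shows "d k t = 0"
  using t
proof (induction k arbitrary: t)
  case 0 then show ?case by (rule z)
next
  case (Suc k)
  have "((\<lambda>_. 0) has_vector_derivative d (Suc k) t) (at t)"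
    by (rule has_vector_derivative_transform_within_open[OF deriv_chainD[OF d] U Suc.prems]) (simp add: Suc.IH)
  then show ?case using vector_derivative_unique_at[OF _ has_vector_derivative_const] by blast
qed

lemma poly_antiderivative: "\<exists>Q::complex poly. pderiv Q = P"
proof -
  define Q where "Q = (\<Sum>i\<le>degree P. monom (coeff P i / of_nat (Suc i)) (Suc i))"
  have "pderiv Q = (\<Sum>i\<le>degree P. monom (coeff P i) i)"
    unfolding Q_def higher_pderiv_sum[of 1, simplified]
    by (intro sum.cong refl) (simp add: pderiv_monom del: of_nat_Suc)
  then show ?thesis by (metis poly_as_sum_of_monoms)
qed

text \<open>The higher derivatives are arranged first, and the constant of an antiderivative then
  settles the value itself; no factorials appear.\<close>

lemma poly_with_derivatives:
  "\<exists>T::complex poly. \<forall>i\<le>k. poly ((pderiv ^^ i) T) x = c i"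
proof (induction k arbitrary: c)
  case 0
  show ?case by (rule exI[of _ "[:c 0:]"]) simp
next
  case (Suc k)
  obtain T' where T': "\<forall>i\<le>k. poly ((pderiv ^^ i) T') x = c (Suc i)" using Suc[of "\<lambda>i. c (Suc i)"] by blast
  obtain T where T: "pderiv T = T'" using poly_antiderivative by blast
  define T2 where "T2 = T + [:c 0 - poly T x:]"
  have "pderiv T2 = T'" by (simp add: T2_def T pderiv_add pderiv_pCons)
  then have "poly ((pderiv ^^ i) T2) x = c i" if "i \<le> Suc k" for i
    using that T' by (cases i) (auto simp: T2_def funpow_swap1)
  then show ?case by blast
qed

lemma poly_chain: "deriv_chain (\<lambda>k t. poly ((pderiv ^^ k) T) (complex_of_real t))"
  unfolding deriv_chain_def by (intro allI has_vector_derivative_real_field) (simp add: poly_DERIV)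

section \<open>Cut-off smooth functions and the space \<open>FF I\<close>\<close>

definition restr :: "real set \<Rightarrow> (real \<Rightarrow> complex) \<Rightarrow> real \<Rightarrow> complex" where
  "restr J g t = (if t \<in> J then g t else 0)"

context dyn_interval
begin

text \<open>One-sided derivatives do not see the jump at the boundary of \<open>J\<close>, so the
  derivatives of the smooth function are simply cut off term by term.\<close>

lemma restr_chain:
  assumes d: "deriv_chain d"
    and J: "decides J" "J \<in> sets borel"
    and B: "\<And>k. \<exists>B. \<forall>t\<in>J \<inter> I. norm (d k t) \<le> B"
  shows "is_gderiv I (restr J (d k)) (restr J (d (Suc k)))" "restr J (d k) \<in> GG I"
proof -
  have ev: "\<exists>b. eventually (\<lambda>s. (s \<in> J) = b) (ess_at \<sigma> t)" for \<sigma> t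
  proof (cases "eventually (\<lambda>s. s \<in> J) (ess_at \<sigma> t)")
    case True then show ?thesis by (intro exI[of _ True]) simp
  next
    case False
    then have "eventually (\<lambda>s. s \<notin> J) (ess_at \<sigma> t)" using J(1) unfolding decides_def by blast
    then show ?thesis by (intro exI[of _ False]) simp
  qed
  have lim: "(restr J (d k) \<longlongrightarrow> (if b then d k t else 0)) (ess_at \<sigma> t)"
    if b: "eventually (\<lambda>s. (s \<in> J) = b) (ess_at \<sigma> t)" for k t \<sigma> b
  proof -
    have "((\<lambda>s. if b then d k s else 0) \<longlongrightarrow> (if b then d k t else 0)) (ess_at \<sigma> t)"
      using chain_continuous(1)[OF d, where k = k and t = t] by (intro tendsto_ess_at_at) (auto simp: isCont_def)
    moreover have "eventually (\<lambda>s. restr J (d k) s = (if b then d k s else 0)) (ess_at \<sigma> t)"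
      using b by (rule eventually_mono) (auto simp: restr_def)
    ultimately show ?thesis using tendsto_cong by fastforce
  qed
  show GG: "restr J (d k) \<in> GG I" for k
    unfolding GG_iff
  proof (intro conjI ballI allI)
    have "d k \<in> borel_measurable borel" using chain_continuous(2)[OF d] by (rule borel_measurable_continuous_onI)
    then have "restr J (d k) \<in> borel_measurable borel"
      unfolding restr_def by (rule measurable_If_set) (use J(2) in auto)
    then have "restr J (d k) \<in> borel_measurable lebesgue" by (simp add: measurable_completion)
    then show "restr J (d k) \<in> borel_measurable (lebesgue_on I)" by (rule measurable_restrict_space1)
    obtain B where B: "\<forall>t\<in>J \<inter> I. norm (d k t) \<le> B" using B by blast
    have "AE t in lebesgue_on I. norm (restr J (d k) t) \<le> \<bar>B\<bar>"
      unfolding AE_I using B by (intro AE_I2) (force simp: restr_def)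
    then show "\<exists>B. AE t in lebesgue_on I. norm (restr J (d k) t) \<le> B" ..
    fix t \<sigma>
    show "\<exists>l. (restr J (d k) \<longlongrightarrow> l) (ess_at \<sigma> t)" using ev lim by blast
  qed
  show "is_gderiv I (restr J (d k)) (restr J (d (Suc k)))"
    unfolding is_gderiv_iff
  proof (intro conjI ballI allI GG)
    fix t \<sigma> assume "t \<in> I"
    obtain b where b: "eventually (\<lambda>s. (s \<in> J) = b) (ess_at \<sigma> t)" using ev by blast
    have 1: "slim \<sigma> (restr J (d k)) t = (if b then d k t else 0)"
      "slim \<sigma> (restr J (d (Suc k))) t = (if b then d (Suc k) t else 0)"
      by (intro slim_ae_eq lim b)+
    have A: "((\<lambda>s. (if b then (d k s - d k t) / of_real (s - t) else 0)) \<longlongrightarrow> (if b then d (Suc k) t else 0)) (ess_at \<sigma> t)"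
      using one_sided_deriv_tendsto[OF has_vector_derivative_one_sided_deriv[OF deriv_chainD[OF d, of k t]], of \<sigma>] by (simp del: of_real_diff)
    have "eventually (\<lambda>s. (restr J (d k) s - slim \<sigma> (restr J (d k)) t) / of_real (s - t) =
        (if b then (d k s - d k t) / of_real (s - t) else 0)) (ess_at \<sigma> t)"
      using b by (rule eventually_mono) (auto simp: restr_def 1)
    from tendsto_cong[OF this] A
    show "((\<lambda>s. (restr J (d k) s - slim \<sigma> (restr J (d k)) t) / of_real (s - t)) \<longlongrightarrow> slim \<sigma> (restr J (d (Suc k))) t) (ess_at \<sigma> t)"
      unfolding 1 by (simp only:)
  qed
qed

lemma restr_Ginf:
  assumes d: "deriv_chain d"
    and J: "decides J" "J \<in> sets borel"
    and B: "\<And>k. \<exists>B. \<forall>t\<in>J \<inter> I. norm (d k t) \<le> B"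
  shows "restr J (d 0) \<in> Ginf I" "ae_eq (gderivs I k (restr J (d 0))) (restr J (d k))"
proof -
  note c = restr_chain[OF d J B]
  show "restr J (d 0) \<in> Ginf I" "ae_eq (gderivs I k (restr J (d 0))) (restr J (d k))"
    using gderivs_chain[of "\<lambda>k. restr J (d k)"] c by auto
qed

lemma continuous_bounded_Icc:
  fixes d :: "real \<Rightarrow> complex"
  assumes "continuous_on {u..v} d" shows "\<exists>B. \<forall>t\<in>{u..v}. norm (d t) \<le> B"
  using compact_imp_bounded[OF compact_continuous_image[OF assms compact_Icc]] by (simp add: bounded_iff)

lemma restr_const_Ginf: "decides J \<Longrightarrow> J \<in> sets borel \<Longrightarrow> restr J (\<lambda>_. c) \<in> Ginf I"
  using restr_Ginf(1)[of "\<lambda>k _. if k = 0 then c else 0" J] by (auto simp: deriv_chain_def)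

definition ramp :: "real \<Rightarrow> real \<Rightarrow> real \<Rightarrow> complex" where
  "ramp c c' = (SOME \<eta>. \<eta> \<in> Ginf I \<and> no_jump \<eta> \<and> (\<forall>t\<le>c. \<eta> t = 0) \<and> (\<forall>t\<ge>c'. \<eta> t = 1))"

text \<open>The derivatives of one minus a cutoff are constant outside \<open>{c..c'}\<close>. They
  are therefore bounded on all of \<open>I\<close>, as \<open>Ginf I\<close> demands, even if
  \<open>I\<close> is unbounded.\<close>

lemma ramp:
  assumes "c < c'"
  shows "ramp c c' \<in> Ginf I" "no_jump (ramp c c')" "t \<le> c \<Longrightarrow> ramp c c' t = 0" "t \<ge> c' \<Longrightarrow> ramp c c' t = 1"
proof -
  obtain \<kappa> where k: "smooth \<kappa>" "\<forall>t\<le>c. \<kappa> t = 1" "\<forall>t\<ge>c'. \<kappa> t = 0" using smooth_cutoff[OF assms] by blast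
  have "smooth (\<lambda>t. 1 + (- 1) * \<kappa> t)"
    using smooth_add[OF smooth_poly[of 1] smooth_mult[OF smooth_poly[of "[:-1:]"] k(1)]] by simp
  then obtain d where d: "d 0 = (\<lambda>t. 1 + (- 1) * \<kappa> t)" "deriv_chain d"
    by (rule smooth_chain)
  have one: "d i t = (if i = 0 then 1 else 0)" if "t > c'" for i t
  proof (cases i)
    case (Suc j)
    have dd: "deriv_chain (\<lambda>k t. d k t - (if k = 0 then 1 else 0))"
      unfolding deriv_chain_def using has_vector_derivative_diff[OF deriv_chainD[OF d(2)] has_vector_derivative_const] by simp
    have "d i t - (if i = 0 then 1 else 0) = 0"
      by (rule chain_zero[of "\<lambda>k t. d k t - (if k = 0 then 1 else 0)" "{c'<..}", OF dd]) (use that k d(1) in auto)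
    then show ?thesis by simp
  qed (use that k d(1) in simp)
  have zero: "d i t = 0" if "t < c" for i t
    by (rule chain_zero[of d "{..<c}", OF d(2)]) (use that k d(1) in auto)
  have B: "\<exists>B. \<forall>t\<in>UNIV \<inter> I. norm (d i t) \<le> B" for i
  proof -
    obtain B where B: "\<forall>t\<in>{c..c'}. norm (d i t) \<le> B"
      using continuous_bounded_Icc[OF chain_continuous(2)[OF d(2)]] by blast
    have "norm (d i t) \<le> \<bar>B\<bar> + 1" for t
    proof -
      consider "t < c" | "t \<in> {c..c'}" | "t > c'" by force
      then show ?thesis using zero[of t i] one[of t i] B by cases force+
    qed
    then show ?thesis by blast
  qed
  have dU: "decides UNIV" by (simp add: decides_def)
  have "restr UNIV (d 0) \<in> Ginf I" by (rule restr_Ginf(1)[OF d(2) dU _ B]) simp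
  then have 1: "d 0 \<in> Ginf I" by (simp add: restr_def[abs_def])
  have 2: "no_jump (d 0)" by (rule no_jump_isCont) (rule chain_continuous(1)[OF d(2)])
  have "d 0 \<in> Ginf I \<and> no_jump (d 0) \<and> (\<forall>t\<le>c. d 0 t = 0) \<and> (\<forall>t\<ge>c'. d 0 t = 1)"
    using 1 2 k d(1) by simp
  then have "ramp c c' \<in> Ginf I \<and> no_jump (ramp c c') \<and> (\<forall>t\<le>c. ramp c c' t = 0) \<and> (\<forall>t\<ge>c'. ramp c c' t = 1)"
    unfolding ramp_def
    by (rule someI[of "\<lambda>\<eta>. \<eta> \<in> Ginf I \<and> no_jump \<eta> \<and> (\<forall>t\<le>c. \<eta> t = 0) \<and> (\<forall>t\<ge>c'. \<eta> t = 1)"])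
  then show "ramp c c' \<in> Ginf I" "no_jump (ramp c c')" "t \<le> c \<Longrightarrow> ramp c c' t = 0" "t \<ge> c' \<Longrightarrow> ramp c c' t = 1" by auto
qed

text \<open>The truncated power at \<open>u\<close> is the prototype of an element of
  \<open>FFk I j\<close>, since only its \<open>j\<close>-th derivative jumps there. The cutoff
  keeps it bounded when \<open>I\<close> is unbounded to the right and is not felt near
  \<open>u\<close>.\<close>

lemma FFk_restr_power:
  assumes \<kappa>: "smooth \<kappa>" "\<And>t. t \<le> p \<Longrightarrow> \<kappa> t = 1" "\<And>t. t \<ge> q \<Longrightarrow> \<kappa> t = 0" and u: "u < p"
  shows "restr {u..} (\<lambda>t. of_real (t - u) ^ j * \<kappa> t) \<in> FFk I j"
proof -
  define g where "g t = of_real (t - u) ^ j * \<kappa> t" for t :: real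
  have "smooth (\<lambda>t. poly ([:- of_real u, 1:] ^ j) (of_real t) * \<kappa> t)" by (intro smooth_mult smooth_poly \<kappa>)
  then have "smooth g" by (simp add: g_def[abs_def] poly_power)
  then obtain d where d: "d 0 = g" "deriv_chain d" by (rule smooth_chain)
  \<comment> \<open>The falling factorial is written as a quotient of naturals, which is exact here.
    At \<open>t = u\<close> the formula is zero for every \<open>i\<close> other than
    \<open>j\<close>.\<close>
  have near: "d i t = (if i \<le> j then of_nat (fact j div fact (j - i)) * of_real (t - u) ^ (j - i) else 0)" if "t < p" for i t
    using that
  proof (induction i arbitrary: t)
    case 0 then show ?case using \<kappa>(2) by (simp add: d(1) g_def)
  next
    case (Suc i)
    define R where "R t = (if i \<le> j then of_nat (fact j div fact (j - i)) * of_real (t - u) ^ (j - i) else 0::complex)" for t :: real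
    define R' where "R' = (if Suc i \<le> j then of_nat (fact j div fact (j - Suc i)) * of_real (t - u) ^ (j - Suc i) else 0::complex)"
    have "(R has_vector_derivative d (Suc i) t) (at t)"
      by (rule has_vector_derivative_transform_within_open[OF deriv_chainD[OF d(2)], of "{..<p}"]) (use Suc in \<open>auto simp: R_def\<close>)
    moreover have "(R has_vector_derivative R') (at t)"
    proof (cases "Suc i \<le> j")
      case True
      then have ji: "j - i = Suc (j - Suc i)" by simp
      have "fact j div fact (j - i) * (j - i) = (fact j div fact (j - Suc i) :: nat)"
      proof -
        have "fact (j - i) dvd (fact j :: nat)" by (rule fact_dvd) simp
        then obtain r where r: "fact j = fact (j - i) * (r::nat)" by blast
        moreover have "fact (j - i) = (j - i) * (fact (j - Suc i) :: nat)"
          unfolding ji by (simp only: fact_Suc of_nat_id)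
        ultimately have f2: "fact j = fact (j - Suc i) * (r * (j - i))" using r by (simp only: mult_ac)
        have "fact j div fact (j - i) = r" unfolding r by (rule nonzero_mult_div_cancel_left) simp
        moreover have "fact j div fact (j - Suc i) = r * (j - i)" unfolding f2 by (rule nonzero_mult_div_cancel_left) simp
        ultimately show ?thesis by simp
      qed
      then have e: "of_nat (fact j div fact (j - Suc i)) = (of_nat (fact j div fact (j - i)) * of_nat (j - i) :: complex)"
        by (metis of_nat_mult)
      have "((\<lambda>x. (of_real x - of_real u) ^ (j - i)) has_vector_derivative (of_nat (j - i) * (of_real t - of_real u) ^ (j - Suc i) :: complex)) (at t)"
        by (rule has_vector_derivative_real_field) (auto intro!: derivative_eq_intros)
      from has_vector_derivative_mult_right[OF this, of "of_nat (fact j div fact (j - i))"]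
      show ?thesis unfolding R_def R'_def using True e by (simp add: mult.assoc)
    next
      case False
      then have "R = (\<lambda>_. if i \<le> j then of_nat (fact j div fact (j - i)) else 0)" by (intro ext) (auto simp: R_def)
      then show ?thesis using False by (simp add: R'_def)
    qed
    ultimately have "d (Suc i) t = R'" by (rule vector_derivative_unique_at)
    then show ?case by (simp add: R'_def)
  qed
  have far: "d i t = 0" if "t > q" for i t
    by (rule chain_zero[of d "{q<..}", OF d(2)]) (use that \<kappa>(3) d(1) in \<open>auto simp: g_def\<close>)
  have bd: "\<exists>B. \<forall>t\<ge>u. norm (d i t) \<le> B" for i
  proof -
    obtain B where B: "\<forall>t\<in>{u..q}. norm (d i t) \<le> B" using continuous_bounded_Icc[OF chain_continuous(2)[OF d(2)]] by blast
    have "norm (d i t) \<le> \<bar>B\<bar>" if "t \<ge> u" for t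
      using far[of t i] bspec[OF B, of t] that by (cases "t > q") auto
    then show ?thesis by blast
  qed
  have B: "\<exists>B. \<forall>t\<in>{u..} \<inter> I. norm (d i t) \<le> B" for i using bd[of i] by auto
  note c = restr_Ginf[OF d(2) decides_Ici _ B, simplified]
  have AE: "AE t in lebesgue_on I. gderivs I i (restr {u..} (d 0)) t = restr {u..} (d i) t" for i
    using c(2) by (simp add: ae_eq_def)
  have cu: "isCont (restr {u..} (d i)) t" if "t \<noteq> u" for i t
  proof (cases "t > u")
    case True
    then have "eventually (\<lambda>s. s \<in> {u<..}) (nhds t)" by (intro eventually_nhds_in_open) auto
    then have "eventually (\<lambda>s. restr {u..} (d i) s = d i s) (nhds t)" by (rule eventually_mono) (auto simp: restr_def)
    then show ?thesis using isCont_cong chain_continuous(1)[OF d(2), where k = i and t = t] by blast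
  next
    case False
    then have "eventually (\<lambda>s. s \<in> {..<u}) (nhds t)" using that by (intro eventually_nhds_in_open) auto
    then have "eventually (\<lambda>s. restr {u..} (d i) s = 0) (nhds t)" by (rule eventually_mono) (auto simp: restr_def)
    then show ?thesis using isCont_cong[of "restr {u..} (d i)" "\<lambda>_. 0" t] by simp
  qed
  have cc: "continuous_on I (restr {u..} (d i))" if "i \<noteq> j" for i
  proof -
    have "d i u = 0" using near[OF u, of i] that by auto
    \<comment> \<open>Because \<open>d i\<close> vanishes at \<open>u\<close>, cutting it off there
      is composition with the continuous function \<open>max t u\<close>.\<close>
    then have "restr {u..} (d i) = (\<lambda>t. d i (max t u))" by (intro ext) (auto simp: restr_def max_def)
    then show ?thesis
      by (simp add: continuous_on_compose2[OF chain_continuous(2)[OF d(2), of UNIV]] continuous_intros)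
  qed
  have "bdd_continuous I (gderivs I i (restr {u..} (d 0)))" if "i \<noteq> j" for i
    unfolding bdd_continuous_def
  proof (intro exI conjI)
    show "AE t in lebesgue_on I. gderivs I i (restr {u..} (d 0)) t = restr {u..} (d i) t" by (rule AE)
    obtain B where "\<forall>t\<ge>u. norm (d i t) \<le> B" using bd by blast
    then have "norm (restr {u..} (d i) t) \<le> \<bar>B\<bar>" for t by (force simp: restr_def)
    then show "bounded (restr {u..} (d i) ` I)" unfolding bounded_iff by blast
  qed (rule cc[OF that])
  moreover have "pw_continuous I (gderivs I j (restr {u..} (d 0)))"
    unfolding pw_continuous_def
  proof (intro exI conjI allI impI)
    show "AE t in lebesgue_on I. gderivs I j (restr {u..} (d 0)) t = restr {u..} (d j) t" by (rule AE)
    fix K :: "real set"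
    have "{t \<in> K. \<not> isCont (restr {u..} (d j)) t} \<subseteq> {u}" using cu by blast
    then show "finite {t \<in> K. \<not> isCont (restr {u..} (d j)) t}" by (rule finite_subset) simp
  qed
  ultimately show ?thesis using c(1) by (simp add: FFk_def d(1) g_def[abs_def])
qed

lemma FF_base: "h \<in> FFk I k \<Longrightarrow> (\<lambda>t. c * h t) \<in> FF I"
  unfolding FF_def by (intro CollectI exI[of _ 1] exI[of _ "\<lambda>_. c"] exI[of _ "\<lambda>_. h"]) auto

lemma FF_E:
  assumes "g \<in> FF I"
  obtains N :: nat and c h where "\<forall>i<N. h i \<in> (\<Union>k. FFk I k)" "g = (\<lambda>t. \<Sum>i<N. c i * h i t)"
proof -
  have "\<exists>(N::nat) c h. (\<forall>i<N. h i \<in> (\<Union>k. FFk I k)) \<and> g = (\<lambda>t. \<Sum>i<N. c i * h i t)"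
    using assms unfolding FF_def mem_Collect_eq .
  then show thesis by (elim exE conjE) (rule that)
qed

lemma FF_zero: "(\<lambda>_. 0) \<in> FF I"
  unfolding FF_def by (intro CollectI exI[of _ 0]) auto

lemma FF_add:
  assumes "g \<in> FF I" "h \<in> FF I" shows "(\<lambda>t. g t + h t) \<in> FF I"
proof -
  obtain N c G where g: "\<forall>i<N. G i \<in> (\<Union>k. FFk I k)" "g = (\<lambda>t. \<Sum>i<(N::nat). c i * G i t)" using assms(1) by (rule FF_E)
  obtain M c' H where h: "\<forall>i<M. H i \<in> (\<Union>k. FFk I k)" "h = (\<lambda>t. \<Sum>i<(M::nat). c' i * H i t)" using assms(2) by (rule FF_E)
  define C where "C i = (if i < N then c i else c' (i - N))" for i :: nat
  define W where "W i = (if i < N then G i else H (i - N))" for i :: nat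
  have sp: "{..<N + M} = {..<N} \<union> {N..<N + M}" "{..<N} \<inter> {N..<N + M} = {}" by auto
  have "(\<Sum>i<N + M. C i * W i t) = g t + h t" for t
  proof -
    have "(\<Sum>i<N + M. C i * W i t) = (\<Sum>i<N. C i * W i t) + (\<Sum>i=N..<N + M. C i * W i t)"
      unfolding sp(1) by (rule sum.union_disjoint) (use sp(2) in auto)
    also have "(\<Sum>i=N..<N + M. C i * W i t) = (\<Sum>i<M. C (i + N) * W (i + N) t)"
      using sum.shift_bounds_nat_ivl[of "\<lambda>i. C i * W i t" 0 N M] by (simp add: lessThan_atLeast0 add.commute)
    finally show ?thesis by (simp add: C_def W_def g(2) h(2))
  qed
  moreover have "W i \<in> (\<Union>k. FFk I k)" if "i < N + M" for i
    using that g(1) h(1) by (cases "i < N") (auto simp: W_def)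
  ultimately show ?thesis unfolding FF_def by (intro CollectI exI[of _ "N + M"] exI[of _ C] exI[of _ W]) auto
qed

lemma FF_sum: "(\<And>i. i \<in> S \<Longrightarrow> g i \<in> FF I) \<Longrightarrow> (\<lambda>t. \<Sum>i\<in>S. g i t) \<in> FF I"
  by (induction S rule: infinite_finite_induct) (auto simp: FF_zero FF_add)

text \<open>Expanding the polynomial about \<open>u\<close> writes the cut function as a linear
  combination of truncated powers.\<close>

lemma FF_restr_poly:
  assumes \<kappa>: "smooth \<kappa>" "\<And>t. t \<le> p \<Longrightarrow> \<kappa> t = 1" "\<And>t. t \<ge> q \<Longrightarrow> \<kappa> t = 0" and u: "u < p"
  shows "restr {u..} (\<lambda>t. c * poly A (of_real t) * \<kappa> t) \<in> FF I"
proof -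
  define B where "B = pcompose A [:of_real u, 1:]"
  have "poly A (of_real t) = (\<Sum>j\<le>degree B. coeff B j * of_real (t - u) ^ j)" for t :: real
    using poly_altdef[of B "of_real (t - u)"] by (simp add: B_def poly_pcompose)
  then have "restr {u..} (\<lambda>t. c * poly A (of_real t) * \<kappa> t) =
      (\<lambda>t. \<Sum>j\<le>degree B. (c * coeff B j) * restr {u..} (\<lambda>t. of_real (t - u) ^ j * \<kappa> t) t)"
    by (intro ext) (simp add: restr_def sum_distrib_left sum_distrib_right mult_ac del: of_real_diff)
  then show ?thesis
    by (simp only:) (intro FF_sum FF_base[OF FFk_restr_power[OF \<kappa> u]])
qed

end

section \<open>Piecewise polynomials, their primitives and approximation by them\<close>

text \<open>Piecewise polynomials are coded by lists of triples \<open>(u, v, T)\<close>, standing for the polynomial \<open>T\<close> on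
  \<open>[u, v)\<close>; \<open>pw_poly L i\<close> is the \<open>i\<close>-th derivative.\<close>

definition pw_poly :: "(real \<times> real \<times> complex poly) list \<Rightarrow> nat \<Rightarrow> real \<Rightarrow> complex" where
  "pw_poly L i t = (\<Sum>(u, v, T)\<leftarrow>L. restr {u..<v} (\<lambda>t. poly ((pderiv ^^ i) T) (of_real t)) t)"

definition inside :: "real \<Rightarrow> real \<Rightarrow> (real \<times> real \<times> complex poly) list \<Rightarrow> bool" where
  "inside p q L \<longleftrightarrow> (\<forall>(u, v, T)\<in>set L. p \<le> u \<and> u \<le> v \<and> v \<le> q)"

lemma pw_poly_Nil [simp]: "pw_poly [] i = (\<lambda>_. 0)"
  by (simp add: pw_poly_def fun_eq_iff)

lemma pw_poly_Cons: "pw_poly ((u, v, T) # L) i = (\<lambda>t. restr {u..<v} (\<lambda>t. poly ((pderiv ^^ i) T) (of_real t)) t + pw_poly L i t)"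
  by (simp add: pw_poly_def fun_eq_iff)

lemma pw_poly_append: "pw_poly (L @ M) i t = pw_poly L i t + pw_poly M i t"
  by (simp add: pw_poly_def)

lemma inside_Cons: "inside p q ((u, v, T) # L) \<longleftrightarrow> p \<le> u \<and> u \<le> v \<and> v \<le> q \<and> inside p q L"
  by (auto simp: inside_def)

lemma inside_mono: "inside p q L \<Longrightarrow> p' \<le> p \<Longrightarrow> q \<le> q' \<Longrightarrow> inside p' q' L"
  by (fastforce simp: inside_def)

lemma pw_poly_outside: "inside p q L \<Longrightarrow> t < p \<or> q \<le> t \<Longrightarrow> pw_poly L i t = 0"
proof (induction L)
  case (Cons x L)
  then show ?case by (cases x) (auto simp: pw_poly_Cons inside_Cons restr_def)
qed simp

definition antid :: "complex poly \<Rightarrow> complex poly" where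
  "antid T = (SOME Q. pderiv Q = T)"

lemma pderiv_antid: "pderiv (antid T) = T"
  unfolding antid_def by (rule someI_ex[OF poly_antiderivative])

text \<open>The antiderivative of \<open>T\<close> that vanishes at \<open>u\<close>, so that
  cutting it off at \<open>u\<close> leaves a continuous function.\<close>

definition ramp_poly :: "real \<Rightarrow> complex poly \<Rightarrow> complex poly" where
  "ramp_poly u T = antid T - [:poly (antid T) (of_real u):]"

lemma restr_ramp_poly:
  "restr {u..} (\<lambda>t. poly (ramp_poly u T) (of_real t)) = (\<lambda>t. poly (antid T) (of_real (max t u)) - poly (antid T) (of_real u))"
  by (auto simp: restr_def ramp_poly_def max_def fun_eq_iff)

lemma restr_ramp_poly_left: "t \<le> u \<Longrightarrow> restr {u..} (\<lambda>t. poly (ramp_poly u T) (of_real t)) t = 0"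
  unfolding restr_ramp_poly by simp

text \<open>The primitive of a piece on \<open>[u, v)\<close> is a ramp starting at \<open>u\<close>
  minus a ramp starting at \<open>v\<close>. Both are polynomials cut to a half-line, the shape that
  \<open>FF_restr_poly\<close> accepts; to the right of \<open>v\<close> their difference is
  constant.\<close>

lemma piece_primitive:
  fixes T :: "complex poly"
  defines "R \<equiv> \<lambda>u v t. restr {u..} (\<lambda>t. poly (ramp_poly u T) (of_real t)) t - restr {v..} (\<lambda>t. poly (ramp_poly v T) (of_real t)) t"
  assumes uv: "u \<le> v" and st: "s \<le> t"
  shows "(restr {u..<v} (\<lambda>t. poly T (of_real t)) has_integral (R u v t - R u v s)) {s..t}"
proof (rule fundamental_theorem_of_calculus_interior_strong[where S = "{u, v}"])
  show "continuous_on {s..t} (R u v)"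
    unfolding R_def restr_ramp_poly by (intro continuous_intros)
  fix x assume x: "x \<in> {s<..<t} - {u, v}"
  define A where "A x = poly (antid T) (complex_of_real x)" for x
  have A: "(A has_vector_derivative poly T (of_real x)) (at x)" for x
    unfolding A_def[abs_def] by (rule has_vector_derivative_real_field) (metis poly_DERIV pderiv_antid)
  have Rx: "R u v x = A (max x u) - A u - (A (max x v) - A v)" for x
    by (simp add: R_def restr_ramp_poly A_def)
  consider "x < u" | "u < x" "x < v" | "v < x" using x uv by force
  then show "(R u v has_vector_derivative restr {u..<v} (\<lambda>t. poly T (of_real t)) x) (at x)"
  proof cases
    case 1
    have "(R u v has_vector_derivative 0) (at x)"
      by (rule has_vector_derivative_transform_within_open[of "\<lambda>_. 0" _ _ "{..<u}"]) (use 1 uv in \<open>auto simp: Rx\<close>)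
    then show ?thesis using 1 by (simp add: restr_def)
  next
    case 2
    have "((\<lambda>x. A x - A u) has_vector_derivative poly T (of_real x)) (at x)"
      using has_vector_derivative_diff[OF A has_vector_derivative_const] by simp
    then have "(R u v has_vector_derivative poly T (of_real x)) (at x)"
      by (rule has_vector_derivative_transform_within_open[of _ _ _ "{u<..<v}"]) (use 2 in \<open>auto simp: Rx\<close>)
    then show ?thesis using 2 by (simp add: restr_def)
  next
    case 3
    have "((\<lambda>x. A v - A u) has_vector_derivative 0) (at x)" by simp
    then have "(R u v has_vector_derivative 0) (at x)"
      by (rule has_vector_derivative_transform_within_open[of _ _ _ "{v<..}"]) (use 3 uv in \<open>auto simp: Rx\<close>)
    then show ?thesis using 3 by (simp add: restr_def)
  qed
qed (use st in auto)

context dyn_interval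
begin

lemma gderivs_add: "g \<in> Ginf I \<Longrightarrow> h \<in> Ginf I \<Longrightarrow> ae_eq (gderivs I k (\<lambda>t. g t + h t)) (\<lambda>t. gderivs I k g t + gderivs I k h t)"
proof (induction k)
  case (Suc k)
  then have "ae_eq (gderiv I (gderivs I k (\<lambda>t. g t + h t))) (gderiv I (\<lambda>t. gderivs I k g t + gderivs I k h t))"
    by (intro gderiv_cong Ginf_gderivs Ginf_add) auto
  then show ?case using Suc ae_eq_trans gderiv_add Ginf_gderivs unfolding gderivs_Suc' by blast
qed simp

lemma gderivs_diff:
  assumes "g \<in> Ginf I" "h \<in> Ginf I"
  shows "ae_eq (gderivs I k (\<lambda>t. g t - h t)) (\<lambda>t. gderivs I k g t - gderivs I k h t)"
proof -
  have 1: "ae_eq (gderivs I k (\<lambda>t. g t + - 1 * h t)) (\<lambda>t. gderivs I k g t + gderivs I k (\<lambda>t. - 1 * h t) t)"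
    by (intro gderivs_add Ginf_cmult assms)
  have 2: "ae_eq (\<lambda>t. gderivs I k g t + gderivs I k (\<lambda>t. - 1 * h t) t) (\<lambda>t. gderivs I k g t + - 1 * gderivs I k h t)"
    by (intro ae_eq_add ae_eq_refl gderivs_cmult assms)
  show ?thesis using ae_eq_trans[OF 1 2] by simp
qed

lemma pw_poly_chain: "is_gderiv I (pw_poly L i) (pw_poly L (Suc i)) \<and> pw_poly L i \<in> GG I"
proof (induction L)
  case Nil then show ?case using is_gderiv_const by simp
next
  case (Cons x L)
  obtain u v T where x: "x = (u, v, T)" by (cases x)
  have B: "\<exists>B. \<forall>t\<in>{u..<v} \<inter> I. norm (poly ((pderiv ^^ k) T) (complex_of_real t)) \<le> B" for k
    using continuous_bounded_Icc[OF chain_continuous(2)[OF poly_chain[of T]], of u v k] by fastforce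
  note c = restr_chain[OF poly_chain[of T] decides_Ico _ B]
  show ?case unfolding x pw_poly_Cons
    by (intro conjI is_gderiv_add GG_add c Cons[THEN conjunct1] Cons[THEN conjunct2]) auto
qed

lemma pw_poly_Ginf: "pw_poly L 0 \<in> Ginf I" "ae_eq (gderivs I i (pw_poly L 0)) (pw_poly L i)"
  using gderivs_chain[of "pw_poly L"] pw_poly_chain by blast+

lemma pw_poly_Rstep: "inside p q L \<Longrightarrow> pw_poly L 0 \<in> Rstep I {p..q}"
  unfolding Rstep_iff using pw_poly_Ginf(1) pw_poly_outside by (auto intro!: zero_off_I)

lemma gderivs_Rstep: "\<phi> \<in> Rstep I K \<Longrightarrow> closed K \<Longrightarrow> gderivs I i \<phi> \<in> Rstep I K"
  by (induction i) (auto simp: gderivs_Suc' Rstep_gderiv)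

lemma AE_not_eq: "AE t in lebesgue. t \<noteq> (c::real)"
proof -
  have "{c} \<in> null_sets lebesgue" using negligible_sing negligible_iff_null_sets by blast
  then show ?thesis using AE_iff_null_sets[of "{c}" lebesgue] by auto
qed

text \<open>Outside \<open>{p..q}\<close> both functions and all their derivatives vanish, so an
  estimate on the open interval controls the norm over \<open>I\<close>.\<close>

lemma Gnorm_pw_poly_le:
  assumes \<psi>: "\<psi> \<in> Rstep I {p..q}" and L: "inside p q L" and e: "e \<ge> 0"
    and ae: "AE t in lebesgue. t \<in> {p<..<q} \<longrightarrow> (\<forall>i\<le>k. norm (pw_poly L i t - gderivs I i \<psi> t) \<le> e)"
  shows "Gnorm I k (\<lambda>t. pw_poly L 0 t - \<psi> t) \<le> e"
proof -
  have G: "\<psi> \<in> Ginf I" using \<psi> by (simp add: Rstep_iff)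
  have "AE t in lebesgue_on I. norm (gderivs I i (\<lambda>t. pw_poly L 0 t - \<psi> t) t) \<le> e" if i: "i \<le> k" for i
  proof -
    have 1: "AE t in lebesgue. t \<in> I \<longrightarrow> gderivs I i (\<lambda>t. pw_poly L 0 t - \<psi> t) t = gderivs I i (pw_poly L 0) t - gderivs I i \<psi> t"
      using gderivs_diff[OF pw_poly_Ginf(1) G] unfolding ae_eq_def AE_I .
    have 2: "AE t in lebesgue. t \<in> I \<longrightarrow> gderivs I i (pw_poly L 0) t = pw_poly L i t"
      using pw_poly_Ginf(2) unfolding ae_eq_def AE_I .
    have 3: "AE t in lebesgue. t \<in> I \<longrightarrow> t \<notin> {p..q} \<longrightarrow> gderivs I i \<psi> t = 0"
      using gderivs_Rstep[OF \<psi>] unfolding Rstep_iff zero_off_def AE_I by simp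
    show ?thesis unfolding AE_I using 1 2 3 ae AE_not_eq[of p] AE_not_eq[of q]
    proof eventually_elim
      case (elim t)
      show ?case
      proof
        assume t: "t \<in> I"
        consider "t \<in> {p<..<q}" | "t \<notin> {p..q}" using elim(5,6) by force
        then show "norm (gderivs I i (\<lambda>t. pw_poly L 0 t - \<psi> t) t) \<le> e"
        proof cases
          case 1 then show ?thesis using elim t i by simp
        next
          case 2
          then have "pw_poly L i t = 0" using pw_poly_outside[OF L, of t i] by auto
          then show ?thesis using elim t 2 e by simp
        qed
      qed
    qed
  qed
  then show ?thesis using Gnorm_le_iff[OF Ginf_diff[OF pw_poly_Ginf(1) G]] by blast
qed

text \<open>At each \<open>x\<close> two polynomials match the left and the right limits of all
  derivatives up to order \<open>k\<close>. Closeness near \<open>x\<close> then comes from equal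
  limits, for each order by itself, and the induction rule \<open>Bolzano\<close> supplies the
  compactness.\<close>

lemma piecewise_Taylor_approx:
  assumes \<psi>: "\<psi> \<in> Ginf I" and pq: "p \<in> I" "q \<in> I" "p \<le> q" and e: "e > 0"
  shows "\<exists>L. inside p q L \<and> (AE t in lebesgue. t \<in> {p<..<q} \<longrightarrow> (\<forall>i\<le>k. norm (pw_poly L i t - gderivs I i \<psi> t) \<le> e))"
  using pq(3)
proof (induction p q rule: Bolzano)
  case (trans a b c)
  obtain L where L: "inside a b L" "AE t in lebesgue. t \<in> {a<..<b} \<longrightarrow> (\<forall>i\<le>k. norm (pw_poly L i t - gderivs I i \<psi> t) \<le> e)"
    using trans(1) by blast
  obtain M where M: "inside b c M" "AE t in lebesgue. t \<in> {b<..<c} \<longrightarrow> (\<forall>i\<le>k. norm (pw_poly M i t - gderivs I i \<psi> t) \<le> e)"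
    using trans(2) by blast
  have "inside a c (L @ M)"
    using inside_mono[OF L(1), of a c] inside_mono[OF M(1), of a c] trans(3,4) by (auto simp: inside_def)
  moreover have "AE t in lebesgue. t \<in> {a<..<c} \<longrightarrow> (\<forall>i\<le>k. norm (pw_poly (L @ M) i t - gderivs I i \<psi> t) \<le> e)"
    using L(2) M(2) AE_not_eq[of b]
  proof eventually_elim
    case (elim t)
    show ?case
    proof
      assume t: "t \<in> {a<..<c}"
      show "\<forall>i\<le>k. norm (pw_poly (L @ M) i t - gderivs I i \<psi> t) \<le> e"
      proof (cases "t < b")
        case True
        then have "pw_poly M i t = 0" for i using pw_poly_outside[OF M(1)] by blast
        then show ?thesis using elim(1) t True by (simp add: pw_poly_append)
      next
        case False
        then have "pw_poly L i t = 0" for i using pw_poly_outside[OF L(1)] by force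
        then show ?thesis using elim(2,3) t False by (simp add: pw_poly_append)
      qed
    qed
  qed
  ultimately show ?case by blast
next
  case (local x)
  then have xI: "x \<in> I" using Icc_subset_I[OF pq(1,2)] by auto
  have "\<exists>T. \<forall>i\<le>k. poly ((pderiv ^^ i) T) (of_real x) = slim \<sigma> (gderivs I i \<psi>) x" for \<sigma>
    by (rule poly_with_derivatives)
  then have "\<exists>T. \<forall>\<sigma>. \<forall>i\<le>k. poly ((pderiv ^^ i) (T \<sigma>)) (of_real x) = slim \<sigma> (gderivs I i \<psi>) x"
    by (intro choice allI)
  then obtain T where T: "\<And>\<sigma> i. i \<le> k \<Longrightarrow> poly ((pderiv ^^ i) (T \<sigma>)) (of_real x) = slim \<sigma> (gderivs I i \<psi>) x" by blast
  have "\<exists>d>0. AE s in lebesgue. s \<in> side \<sigma> x d \<longrightarrow> (\<forall>i\<in>{..k}. norm (poly ((pderiv ^^ i) (T \<sigma>)) (of_real s) - gderivs I i \<psi> s) \<le> e)" for \<sigma>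
    unfolding eventually_ess_at[symmetric]
  proof (rule eventually_ball_finite, simp, rule ballI)
    fix i assume i: "i \<in> {..k}"
    have "((\<lambda>s. poly ((pderiv ^^ i) (T \<sigma>)) (of_real s)) \<longlongrightarrow> poly ((pderiv ^^ i) (T \<sigma>)) (of_real x)) (at x)"
      using chain_continuous(1)[OF poly_chain[of "T \<sigma>"], where k = i and t = x] by (simp add: isCont_def)
    then have "((\<lambda>s. poly ((pderiv ^^ i) (T \<sigma>)) (of_real s) - gderivs I i \<psi> s) \<longlongrightarrow>
       poly ((pderiv ^^ i) (T \<sigma>)) (of_real x) - slim \<sigma> (gderivs I i \<psi>) x) (ess_at \<sigma> x)"
      by (intro tendsto_diff tendsto_ess_at_at GG_tendsto[OF Ginf_GG[OF Ginf_gderivs[OF \<psi>]] xI])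
    then have "((\<lambda>s. poly ((pderiv ^^ i) (T \<sigma>)) (of_real s) - gderivs I i \<psi> s) \<longlongrightarrow> 0) (ess_at \<sigma> x)" using T i by simp
    from tendstoD[OF this e]
    show "eventually (\<lambda>s. norm (poly ((pderiv ^^ i) (T \<sigma>)) (of_real s) - gderivs I i \<psi> s) \<le> e) (ess_at \<sigma> x)"
      by (rule eventually_mono) (simp add: dist_norm)
  qed
  then have "\<exists>d. \<forall>\<sigma>. d \<sigma> > 0 \<and> (AE s in lebesgue. s \<in> side \<sigma> x (d \<sigma>) \<longrightarrow>
      (\<forall>i\<in>{..k}. norm (poly ((pderiv ^^ i) (T \<sigma>)) (of_real s) - gderivs I i \<psi> s) \<le> e))"
    by (intro choice allI)
  then obtain d where d: "\<And>\<sigma>. d \<sigma> > 0" "\<And>\<sigma>. AE s in lebesgue. s \<in> side \<sigma> x (d \<sigma>) \<longrightarrow>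
      (\<forall>i\<in>{..k}. norm (poly ((pderiv ^^ i) (T \<sigma>)) (of_real s) - gderivs I i \<psi> s) \<le> e)" by blast
  show ?case
  proof (intro exI[of _ "min (d True) (d False)"] conjI allI impI)
    fix a b assume ab: "a \<le> x \<and> x \<le> b \<and> b - a < min (d True) (d False)"
    define L where "L = [(a, x, T False), (x, b, T True)]"
    have "inside a b L" using ab by (simp add: L_def inside_def)
    moreover have "AE t in lebesgue. t \<in> {a<..<b} \<longrightarrow> (\<forall>i\<le>k. norm (pw_poly L i t - gderivs I i \<psi> t) \<le> e)"
      using d(2)[of True] d(2)[of False] AE_not_eq[of x]
    proof eventually_elim
      case (elim t)
      show ?case
      proof (intro impI allI)
        fix i assume t: "t \<in> {a<..<b}" and i: "i \<le> k"
        show "norm (pw_poly L i t - gderivs I i \<psi> t) \<le> e"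
        proof (cases "t < x")
          case True
          then have "t \<in> side False x (d False)" using t ab by (auto simp: side_def)
          then show ?thesis using elim(2) i True t by (simp add: L_def pw_poly_def restr_def)
        next
          case False
          then have "t \<in> side True x (d True)" using t ab elim(3) by (auto simp: side_def)
          then show ?thesis using elim(1) i False t by (simp add: L_def pw_poly_def restr_def)
        qed
      qed
    qed
    ultimately show "\<exists>L. inside a b L \<and> (AE t in lebesgue. t \<in> {a<..<b} \<longrightarrow> (\<forall>i\<le>k. norm (pw_poly L i t - gderivs I i \<psi> t) \<le> e))"
      by blast
  qed (use d(1) in simp)
qed

lemma pw_poly_primitive:
  defines "R \<equiv> \<lambda>L t. (\<Sum>(u, v, T)\<leftarrow>L. restr {u..} (\<lambda>t. poly (ramp_poly u T) (of_real t)) t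
       - restr {v..} (\<lambda>t. poly (ramp_poly v T) (complex_of_real t)) t)"
  assumes L: "inside p q L" and st: "s \<le> t"
  shows "(pw_poly L 0 has_integral (R L t - R L s)) {s..t}"
  using L
proof (induction L)
  case Nil then show ?case by (simp add: R_def)
next
  case (Cons x L)
  obtain u v T where x: "x = (u, v, T)" by (cases x)
  have uv: "u \<le> v" and L: "inside p q L" using Cons.prems by (auto simp: x inside_Cons)
  show ?case
    using has_integral_add[OF piece_primitive[OF uv st, of T] Cons.IH[OF L]]
    unfolding x pw_poly_Cons by (simp add: R_def algebra_simps)
qed

text \<open>By \<open>z\<close> the total integral is zero, so integration from the right agrees
  with the sum of ramps, which starts with zero on the left. The cutoff acts beyond
  \<open>q + 1\<close>, where this sum already vanishes on \<open>I\<close>: it leaves the sum alone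
  but makes every single ramp bounded.\<close>

lemma tail_int_pw_poly_FF:
  assumes pq: "p \<in> I" "q \<in> I" "p < q" and L: "inside p q L" and z: "tail_int (pw_poly L 0) p = 0"
  shows "\<exists>\<Phi>\<in>FF I. ae_eq (tail_int (pw_poly L 0)) \<Phi>"
proof -
  define R where "R L t = (\<Sum>(u, v, T)\<leftarrow>L. restr {u..} (\<lambda>t. poly (ramp_poly u T) (of_real t)) t
       - restr {v..} (\<lambda>t. poly (ramp_poly v T) (complex_of_real t)) t)" for L and t :: real
  have RR: "pw_poly L 0 \<in> RR I" using pw_poly_Rstep[OF L] Rstep_RR[OF pq(1,2)] by blast
  have R0: "R L t = 0" if "t \<le> p" "inside p q L" for L t
    using that(2)
  proof (induction L)
    case (Cons x L)
    obtain u v T where x: "x = (u, v, T)" by (cases x)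
    have "t \<le> u" "t \<le> v" using Cons.prems that(1) by (auto simp: x inside_Cons)
    then show ?case using Cons by (simp add: x R_def inside_Cons restr_ramp_poly_left)
  qed (simp add: R_def)
  have JR: "tail_int (pw_poly L 0) t = R L t" if t: "t \<in> I" for t
  proof (cases "p \<le> t")
    case True
    have "(pw_poly L 0 has_integral (tail_int (pw_poly L 0) t - tail_int (pw_poly L 0) p)) {p..t}" by (intro primitiveD tail_int_primitive RR pq t True)
    from has_integral_unique[OF this pw_poly_primitive[OF L True, folded R_def]] show ?thesis
      using z R0[OF order_refl L] by simp
  next
    case False
    then show ?thesis using tail_int_bounds(2)[OF pw_poly_Rstep[OF L] pq(1,2) less_imp_le[OF pq(3)] t] z R0[OF _ L, of t] by simp
  qed
  obtain \<kappa> where k: "smooth \<kappa>" "\<And>t. t \<le> q + 1 \<Longrightarrow> \<kappa> t = 1" "\<And>t. t \<ge> q + 2 \<Longrightarrow> \<kappa> t = 0"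
    using smooth_cutoff[of "q + 1" "q + 2"] by auto
  have FF: "(\<lambda>t. R L t * \<kappa> t) \<in> FF I" if "inside p q L" for L
    using that
  proof (induction L)
    case Nil then show ?case by (simp add: R_def FF_zero)
  next
    case (Cons x L)
    obtain u v T where x: "x = (u, v, T)" by (cases x)
    have uv: "u < q + 1" "v < q + 1" "inside p q L" using Cons.prems by (auto simp: x inside_Cons)
    have "(\<lambda>t. (restr {u..} (\<lambda>t. 1 * poly (ramp_poly u T) (of_real t) * \<kappa> t) t
         + restr {v..} (\<lambda>t. (- 1) * poly (ramp_poly v T) (of_real t) * \<kappa> t) t) + R L t * \<kappa> t) \<in> FF I"
      by (intro FF_add FF_restr_poly[OF k uv(1)] FF_restr_poly[OF k uv(2)] Cons.IH uv(3))
    moreover have "(\<lambda>t. (restr {u..} (\<lambda>t. 1 * poly (ramp_poly u T) (of_real t) * \<kappa> t) t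
         + restr {v..} (\<lambda>t. (- 1) * poly (ramp_poly v T) (of_real t) * \<kappa> t) t) + R L t * \<kappa> t) = (\<lambda>t. R (x # L) t * \<kappa> t)"
      by (auto simp: fun_eq_iff x R_def restr_def algebra_simps)
    ultimately show ?case by simp
  qed
  have "ae_eq (tail_int (pw_poly L 0)) (\<lambda>t. R L t * \<kappa> t)"
  proof (rule ae_eq_I)
    fix t assume t: "t \<in> I"
    show "tail_int (pw_poly L 0) t = R L t * \<kappa> t"
    proof (cases "t \<le> q + 1")
      case True then show ?thesis using JR[OF t] k(2) by simp
    next
      case False
      then have "tail_int (pw_poly L 0) t = 0" by (intro tail_int_zero_right[OF pw_poly_Rstep[OF L]]) simp
      then show ?thesis using JR[OF t] by simp
    qed
  qed
  then show ?thesis using FF[OF L] by blast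
qed

text \<open>On the representative in \<open>FF I\<close> the sum that describes \<open>d\<close> is
  empty.\<close>

lemma jump_dist_no_jump_FF:
  assumes d: "d \<in> jump_dists I" and \<Phi>: "\<Phi> \<in> RR I" "no_jump \<Phi>" "\<Phi>' \<in> FF I" "ae_eq \<Phi> \<Phi>'"
  shows "d \<Phi> = 0"
proof -
  have D: "d \<in> RR_dual I" using d by (simp add: jump_dists_def)
  have R: "\<Phi>' \<in> RR I" by (rule RR_ae_eq[OF \<Phi>(1,4)])
  then have "\<Phi>' \<in> RRF I" using \<Phi>(3) by (simp add: RRF_def)
  then obtain c where c: "d \<Phi>' = (\<Sum>t | t \<in> I \<and> jump t \<Phi>' \<noteq> 0. c t * jump t \<Phi>')"
    using d unfolding jump_dists_def by blast
  have "{t. t \<in> I \<and> jump t \<Phi>' \<noteq> 0} = {}" using no_jump_ae_eq[OF \<Phi>(2,4)] by (auto simp: no_jump_jump)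
  then have "d \<Phi>' = 0" using c by simp
  then show ?thesis using dual_ae_eq[OF D \<Phi>(1,4)] by simp
qed

text \<open>The derivative of \<open>\<phi>\<close> is approximated by piecewise polynomials of integral zero; their antiderivatives lie in
  \<open>FF I\<close>, where \<open>d\<close> is known, and continuity of \<open>d\<close> does the rest.\<close>

lemma jump_dist_no_jump:
  assumes d: "d \<in> jump_dists I" and \<phi>: "\<phi> \<in> RR I" "no_jump \<phi>"
  shows "d \<phi> = 0"
proof -
  have D: "d \<in> RR_dual I" using d by (simp add: jump_dists_def)
  obtain p0 q0 where pq0: "p0 \<in> I" "q0 \<in> I" "p0 < q0" "\<phi> \<in> Rstep I {p0..q0}" using RR_ex_step[OF \<phi>(1)] .
  obtain r where r: "r > 0" "\<And>s. \<bar>s - p0\<bar> < r \<Longrightarrow> s \<in> I" using I_ball[OF pq0(1)] by metis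
  \<comment> \<open>Moving the left end away from the support makes \<open>\<phi>\<close>, and with
    it \<open>tail_int\<close> of its derivative, vanish at \<open>p\<close>.\<close>
  define p q where "p = p0 - r / 2" and "q = q0"
  have pq: "p \<in> I" "q \<in> I" "p < q" using r pq0 by (auto simp: p_def q_def)
  have \<phi>s: "\<phi> \<in> Rstep I {p..q}" by (rule Rstep_mono[OF pq0(4)]) (use r in \<open>auto simp: p_def q_def\<close>)
  define \<psi> where "\<psi> = gderiv I \<phi>"
  have \<psi>: "\<psi> \<in> Rstep I {p..q}" unfolding \<psi>_def by (rule Rstep_gderiv[OF \<phi>s]) simp
  have \<psi>R: "\<psi> \<in> RR I" "\<psi> \<in> Ginf I" using \<psi> Rstep_RR[OF pq(1,2)] by (auto simp: Rstep_iff)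
  have "slim True \<phi> p = 0" using pq0(4) pq(1) r by (intro zero_off_slim[of "{p0..q0}"]) (auto simp: Rstep_iff p_def)
  then have Jp: "tail_int \<psi> p = 0" using tail_int_gderiv[OF \<phi> pq(1)] by (simp add: \<psi>_def)
  obtain k C where C: "C \<ge> 0" "\<And>\<phi>. \<phi> \<in> Rstep I {p..q} \<Longrightarrow> norm (d \<phi>) \<le> C * Gnorm I k \<phi>"
    by (rule dual_bound[OF D pq(1,2)]) blast
  have est: "norm (d \<phi>) \<le> C * ((q - p + 1) * (2 * e))" if e: "e > 0" for e
  proof -
    obtain L where L: "inside p q L" and Lae: "AE t in lebesgue. t \<in> {p<..<q} \<longrightarrow> (\<forall>i\<le>k. norm (pw_poly L i t - gderivs I i \<psi> t) \<le> e)"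
      using piecewise_Taylor_approx[OF \<psi>R(2) pq(1,2) less_imp_le[OF pq(3)] e] by blast
    have LR: "pw_poly L 0 \<in> RR I" using pw_poly_Rstep[OF L] Rstep_RR[OF pq(1,2)] by blast
    \<comment> \<open>\<open>- c\<close> is the total integral of the approximation; it has to be
      corrected to zero before an antiderivative with compact support exists.\<close>
    define c where "c = tail_int (pw_poly L 0) p"
    have dS: "(\<lambda>t. pw_poly L 0 t - \<psi> t) \<in> Rstep I {p..q}"
      using Rstep_add[OF pw_poly_Rstep[OF L] Rstep_mult[OF Ginf_const[of "- 1"] \<psi>]] by simp
    have "c = tail_int (pw_poly L 0) p + - 1 * tail_int \<psi> p" by (simp add: c_def Jp)
    also have "\<dots> = tail_int (\<lambda>t. pw_poly L 0 t + - 1 * \<psi> t) p"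
      by (simp only: tail_int_add[OF LR RR_cmult[OF \<psi>R(1)]] tail_int_cmult)
    also have "norm \<dots> \<le> (q - p) * Gnorm I 0 (\<lambda>t. pw_poly L 0 t - \<psi> t)"
      using tail_int_bounds(1)[OF dS pq(1,2) less_imp_le[OF pq(3)] pq(1)] by simp
    also have "\<dots> \<le> (q - p) * e"
      by (intro mult_left_mono order_trans[OF Gnorm_mono Gnorm_pw_poly_le[OF \<psi> L _ Lae]]) (use e pq in auto)
    finally have cb: "norm c \<le> (q - p) * e" .
    \<comment> \<open>A constant density on \<open>[p, q)\<close> with integral \<open>c\<close>
      restores integral zero. By the bound for \<open>c\<close> it is no larger than the error
      \<open>e\<close> already made, whence the \<open>2 * e\<close> below.\<close>
    define \<beta> where "\<beta> = c / of_real (q - p)"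
    have \<beta>: "norm \<beta> \<le> e" using cb pq by (simp add: \<beta>_def norm_divide pos_divide_le_eq mult.commute del: of_real_diff)
    define L' where "L' = (p, q, [:\<beta>:]) # L"
    have L': "inside p q L'" using L pq by (simp add: L'_def inside_Cons)
    have "AE t in lebesgue. t \<in> {p<..<q} \<longrightarrow> (\<forall>i\<le>k. norm (pw_poly L' i t - gderivs I i \<psi> t) \<le> 2 * e)"
      using Lae
    proof (rule eventually_mono, intro impI allI)
      fix t i assume 1: "t \<in> {p<..<q} \<longrightarrow> (\<forall>i\<le>k. norm (pw_poly L i t - gderivs I i \<psi> t) \<le> e)" and t: "t \<in> {p<..<q}" and i: "i \<le> k"
      have n1: "norm (poly ((pderiv ^^ i) [:\<beta>:]) (of_real t)) \<le> e"
        using \<beta> e by (cases i) (auto simp: funpow_swap1 pderiv_pCons)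
      have n2: "norm (pw_poly L i t - gderivs I i \<psi> t) \<le> e" using 1 t i by blast
      have "pw_poly L' i t - gderivs I i \<psi> t = poly ((pderiv ^^ i) [:\<beta>:]) (of_real t) + (pw_poly L i t - gderivs I i \<psi> t)"
        using t by (simp add: L'_def pw_poly_Cons restr_def)
      then show "norm (pw_poly L' i t - gderivs I i \<psi> t) \<le> 2 * e"
        using norm_triangle_mono[OF n1 n2] by (simp only: mult_2)
    qed
    then have N: "Gnorm I k (\<lambda>t. pw_poly L' 0 t - \<psi> t) \<le> 2 * e" by (intro Gnorm_pw_poly_le[OF \<psi> L']) (use e in auto)
    have L'S: "pw_poly L' 0 \<in> Rstep I {p..q}" by (rule pw_poly_Rstep[OF L'])
    have L'R: "pw_poly L' 0 \<in> RR I" using L'S Rstep_RR[OF pq(1,2)] by blast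
    define P where "P = pw_poly [(p, q, [:\<beta>:])] 0"
    have PR: "P \<in> RR I" using pw_poly_Rstep[of p q "[(p, q, [:\<beta>:])]"] Rstep_RR[OF pq(1,2)] pq by (auto simp: P_def inside_def)
    have "tail_int P p = - c"
    proof -
      have "(P has_integral (tail_int P q - tail_int P p)) {p..q}" by (intro primitiveD tail_int_primitive PR pq less_imp_le)
      moreover have "((\<lambda>_. \<beta>) has_integral (q - p) *\<^sub>R \<beta>) {p..q}" using has_integral_const_real[of \<beta> p q] pq by simp
      then have "(P has_integral (q - p) *\<^sub>R \<beta>) {p..q}"
        by (rule has_integral_spike[OF negligible_sing[of q], rotated]) (auto simp: P_def pw_poly_Cons restr_def)
      ultimately have "tail_int P q - tail_int P p = (q - p) *\<^sub>R \<beta>" by (rule has_integral_unique)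
      moreover have "tail_int P q = 0" unfolding P_def by (rule tail_int_zero_right[OF pw_poly_Rstep[of p q]]) (use pq in \<open>auto simp: inside_def\<close>)
      moreover have "(q - p) *\<^sub>R \<beta> = c" using pq by (simp add: \<beta>_def scaleR_conv_of_real del: of_real_diff)
      ultimately show ?thesis by (simp add: minus_equation_iff)
    qed
    moreover have "tail_int (pw_poly L' 0) p = tail_int P p + tail_int (pw_poly L 0) p"
      using tail_int_add[OF PR LR, of p] by (simp add: P_def L'_def pw_poly_Cons)
    ultimately have z: "tail_int (pw_poly L' 0) p = 0" by (simp add: c_def)
    define \<Phi> where "\<Phi> = tail_int (pw_poly L' 0)"
    have \<Phi>G: "\<Phi> \<in> Ginf I" "no_jump \<Phi>" unfolding \<Phi>_def by (rule tail_int_Ginf[OF L'R])+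
    have "\<Phi> t = 0" if "t \<in> I" "t \<notin> {p..q}" for t
    proof (cases "t < p")
      case True
      then show ?thesis using tail_int_bounds(2)[OF L'S pq(1,2) less_imp_le[OF pq(3)] that(1)] z by (simp add: \<Phi>_def)
    next
      case False
      then show ?thesis using tail_int_zero_right[OF L'S, of t] that by (simp add: \<Phi>_def)
    qed
    then have \<Phi>S: "\<Phi> \<in> Rstep I {p..q}" unfolding Rstep_iff using \<Phi>G(1) by (auto intro: zero_off_I)
    then have \<Phi>R: "\<Phi> \<in> RR I" using Rstep_RR[OF pq(1,2)] by blast
    obtain \<Phi>' where "\<Phi>' \<in> FF I" "ae_eq \<Phi> \<Phi>'" using tail_int_pw_poly_FF[OF pq L' z] unfolding \<Phi>_def by blast
    then have d0: "d \<Phi> = 0" by (rule jump_dist_no_jump_FF[OF d \<Phi>R \<Phi>G(2)])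
    define \<theta> where "\<theta> t = pw_poly L' 0 t - \<psi> t" for t
    have \<theta>S: "\<theta> \<in> Rstep I {p..q}"
      using Rstep_add[OF L'S Rstep_mult[OF Ginf_const[of "- 1"] \<psi>]] by (simp add: \<theta>_def[abs_def])
    have \<theta>R: "\<theta> \<in> RR I" using \<theta>S Rstep_RR[OF pq(1,2)] by blast
    have J\<theta>: "tail_int \<theta> t = \<Phi> t - tail_int \<psi> t" for t
      using tail_int_add[OF L'R RR_cmult[OF \<psi>R(1)], of "- 1" t] tail_int_cmult[of "- 1" \<psi> t]
      by (simp add: \<theta>_def[abs_def] \<Phi>_def)
    have "ae_eq (tail_int \<theta>) (\<lambda>t. \<Phi> t - \<phi> t)"
      using tail_int_gderiv_ae_eq[OF \<phi>] unfolding ae_eq_def J\<theta> \<psi>_def by (rule eventually_mono) simp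
    then have "Gnorm I k (\<lambda>t. \<Phi> t - \<phi> t) = Gnorm I k (tail_int \<theta>)" by (rule Gnorm_cong[OF tail_int_Ginf(1)[OF \<theta>R], symmetric])
    also have "\<dots> \<le> Gnorm I (Suc k) (tail_int \<theta>)" by (rule Gnorm_mono) simp
    also have "\<dots> \<le> (q - p + 1) * Gnorm I k \<theta>" by (rule tail_int_Gnorm[OF \<theta>S pq(1,2) less_imp_le[OF pq(3)]])
    also have "\<dots> \<le> (q - p + 1) * (2 * e)" using N pq unfolding \<theta>_def[abs_def] by (intro mult_left_mono) auto
    finally have G: "Gnorm I k (\<lambda>t. \<Phi> t - \<phi> t) \<le> (q - p + 1) * (2 * e)" .
    have S: "(\<lambda>t. \<Phi> t - \<phi> t) \<in> Rstep I {p..q}"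
      using Rstep_add[OF \<Phi>S Rstep_mult[OF Ginf_const[of "- 1"] \<phi>s]] by simp
    have "norm (d \<phi>) = norm (d (\<lambda>t. \<Phi> t - \<phi> t))" by (simp add: dual_diff[OF D \<Phi>R \<phi>(1)] d0)
    also have "\<dots> \<le> C * Gnorm I k (\<lambda>t. \<Phi> t - \<phi> t)" by (rule C(2)[OF S])
    also have "\<dots> \<le> C * ((q - p + 1) * (2 * e))" by (rule mult_left_mono[OF G C(1)])
    finally show ?thesis .
  qed
  have "norm (d \<phi>) \<le> 0"
  proof (rule field_le_epsilon)
    fix e :: real assume e: "e > 0"
    \<comment> \<open>\<open>est\<close> is linear in \<open>e\<close>; dividing by \<open>M\<close>
      normalises it, and the \<open>+ 1\<close> keeps \<open>M\<close> positive when
      \<open>C = 0\<close>.\<close>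
    define M where "M = C * (q - p + 1) * 2 + 1"
    have M: "M > 0" using C(1) pq by (auto simp: M_def intro!: add_nonneg_pos mult_nonneg_nonneg)
    have "norm (d \<phi>) \<le> C * ((q - p + 1) * (2 * (e / M)))" by (rule est) (use e M in simp)
    also have "\<dots> = (M - 1) / M * e" by (simp add: M_def)
    also have "\<dots> \<le> 1 * e" using M e by (intro mult_right_mono) (auto simp: field_simps)
    finally show "norm (d \<phi>) \<le> 0 + e" by simp
  qed
  then show ?thesis by simp
qed

section \<open>Test functions with jumps\<close>

text \<open>A sawtooth: from the value \<open>1\<close> at \<open>t\<close> it descends linearly to
  \<open>0\<close> at \<open>v\<close>, where it joins the zero function continuously.\<close>

lemma unit_jump:
  assumes t: "t \<in> I"
  obtains b where "b \<in> RR I" "jump t b = 1" "\<And>s. s \<in> I \<Longrightarrow> s \<noteq> t \<Longrightarrow> jump s b = 0"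
proof -
  obtain d where d: "d > 0" "\<And>s. \<bar>s - t\<bar> < d \<Longrightarrow> s \<in> I" using I_ball[OF t] by metis
  define v where "v = t + d / 2"
  have v: "v > t" "v \<in> I" using d by (auto simp: v_def)
  define T where "T = [:complex_of_real (v / (v - t)), of_real (- 1 / (v - t)):]"
  have T: "poly T (of_real s) = of_real ((v - s) / (v - t))" for s
    by (simp add: T_def diff_divide_distrib)
  define b where "b = restr {t..<v} (\<lambda>s. poly T (of_real s))"
  have bl: "b = pw_poly [(t, v, T)] 0" by (simp add: b_def pw_poly_Cons fun_eq_iff)
  have R: "b \<in> RR I" unfolding bl using pw_poly_Rstep[of t v] Rstep_RR[OF t v(2)] v(1) by (auto simp: inside_def)
  have right: "b s = of_real (max 0 ((v - s) / (v - t)))" if "s \<ge> t" for s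
    using that v(1) by (auto simp: b_def restr_def T max_def divide_le_0_iff not_le field_simps)
  have left: "b s = 0" if "s < t" for s using that by (simp add: b_def restr_def)
  have cont: "isCont (\<lambda>s. complex_of_real (max 0 ((v - s) / (v - t)))) s" for s
    using v(1) by (intro continuous_intros) auto
  have "slim True b t = of_real (max 0 ((v - t) / (v - t)))"
  proof -
    have "eventually (\<lambda>s. b s = of_real (max 0 ((v - s) / (v - t)))) (ess_at True t)"
      by (rule eventually_mono[OF eventually_ess_at_side[of 1]]) (auto simp: side_def right)
    then have "slim True b t = slim True (\<lambda>s. complex_of_real (max 0 ((v - s) / (v - t)))) t" by (rule slim_cong)
    then show ?thesis using slim_continuous[OF cont] by simp
  qed
  then have s1: "slim True b t = 1" using v(1) by simp
  have "eventually (\<lambda>s. b s = 0) (ess_at False t)"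
    by (rule eventually_mono[OF eventually_ess_at_side[of 1]]) (auto simp: side_def left)
  then have s2: "slim False b t = 0" using slim_cong[of b "\<lambda>_. 0"] by simp
  have "jump s b = 0" if "s \<noteq> t" for s
  proof (cases "s > t")
    case True
    have "eventually (\<lambda>s. b s = of_real (max 0 ((v - s) / (v - t)))) (ess_at \<sigma> s)" for \<sigma>
      by (rule eventually_mono[OF eventually_ess_at_open[of "{t<..}"]]) (use True right in auto)
    then have "slim \<sigma> b s = of_real (max 0 ((v - s) / (v - t)))" for \<sigma>
      using slim_cong slim_continuous[OF cont] by metis
    then show ?thesis by (simp add: jump_def slim_def[symmetric] flip: slim_def) (metis slim_def)
  next
    case False
    have "eventually (\<lambda>s. b s = 0) (ess_at \<sigma> s)" for \<sigma>
      by (rule eventually_mono[OF eventually_ess_at_open[of "{..<t}"]]) (use False that left in auto)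
    then have "slim \<sigma> b s = 0" for \<sigma> using slim_cong[of b "\<lambda>_. 0"] by simp
    from this[of True] this[of False] show ?thesis by (simp add: jump_def slim_def)
  qed
  then show thesis using that[OF R] s1 s2 by (simp add: jump_def slim_def)
qed

lemma jump_slim: "jump t g = slim True g t - slim False g t"
  by (simp add: jump_def slim_def)

text \<open>Only \<open>k = 0\<close> leaves room for jumps of the function itself; for other
  \<open>k\<close> the discontinuities are those of a derivative.\<close>

lemma FFk_finite_jumps:
  assumes h: "h \<in> FFk I k" and pq: "p \<in> I" "q \<in> I"
  shows "finite {t \<in> {p..q}. jump t h \<noteq> 0}"
proof -
  have j: "jump t h = 0" if "AE t in lebesgue_on I. h t = h' t" "isCont h' t" "t \<in> I" for h' t
    using slim_ae_eq_cong[of h h' t] slim_continuous[OF that(2)] that(1,3) by (simp add: jump_slim ae_eq_def)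
  have sub: "{p..q} \<subseteq> I" by (rule Icc_subset_I[OF pq])
  show ?thesis
  proof (cases "k = 0")
    case True
    then have "pw_continuous I h" using h by (simp add: FFk_def)
    then obtain h' where h': "AE t in lebesgue_on I. h t = h' t" "finite {t \<in> {p..q}. \<not> isCont h' t}"
      unfolding pw_continuous_def using sub compact_Icc by blast
    have "{t \<in> {p..q}. jump t h \<noteq> 0} \<subseteq> {t \<in> {p..q}. \<not> isCont h' t}" using j[OF h'(1)] sub by blast
    then show ?thesis using h'(2) finite_subset by blast
  next
    case False
    then have "bdd_continuous I (gderivs I 0 h)" using h unfolding FFk_def by (simp del: gderivs_0)
    then obtain h' where h': "AE t in lebesgue_on I. h t = h' t" "continuous_on I h'"
      unfolding bdd_continuous_def by auto
    have "isCont h' t" if "t \<in> I" for t using h'(2) open_I that continuous_on_eq_continuous_at by blast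
    then have "{t \<in> {p..q}. jump t h \<noteq> 0} = {}" using j[OF h'(1)] sub by blast
    then show ?thesis by (simp only: finite.emptyI)
  qed
qed

lemma FF_finite_jumps:
  assumes "\<phi> \<in> FF I" "p \<in> I" "q \<in> I" shows "finite {t \<in> {p..q}. jump t \<phi> \<noteq> 0}"
proof -
  obtain N :: nat and c h where h: "\<forall>i<N. h i \<in> (\<Union>k. FFk I k)" "\<phi> = (\<lambda>t. \<Sum>i<N. c i * h i t)" using assms(1) by (rule FF_E)
  have G: "h i \<in> GG I" if "i < N" for i using h(1) that by (auto simp: FFk_def intro: Ginf_GG)
  have "slim \<sigma> \<phi> t = (\<Sum>i<N. c i * slim \<sigma> (h i) t)" if "t \<in> I" for t \<sigma>
    unfolding h(2) by (intro slim_ae_eq tendsto_intros GG_tendsto[OF G that]) simp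
  then have "jump t \<phi> = (\<Sum>i<N. c i * jump t (h i))" if "t \<in> I" for t
    using that by (simp add: jump_slim sum_subtractf algebra_simps)
  note j = this
  have "{t \<in> {p..q}. jump t \<phi> \<noteq> 0} \<subseteq> (\<Union>i<N. {t \<in> {p..q}. jump t (h i) \<noteq> 0})"
  proof
    fix t assume t: "t \<in> {t \<in> {p..q}. jump t \<phi> \<noteq> 0}"
    then have "t \<in> I" "jump t \<phi> \<noteq> 0" using Icc_subset_I[OF assms(2,3)] by blast+
    then have "(\<Sum>i<N. c i * jump t (h i)) \<noteq> 0" using j[of t] by metis
    then obtain i where "i \<in> {..<N}" "c i * jump t (h i) \<noteq> 0" by (rule sum.not_neutral_contains_not_neutral)
    then show "t \<in> (\<Union>i<N. {t \<in> {p..q}. jump t (h i) \<noteq> 0})"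
      using t by (intro UN_I[of i] CollectI conjI) auto
  qed
  moreover have "finite (\<Union>i<N. {t \<in> {p..q}. jump t (h i) \<noteq> 0})"
  proof (rule finite_UN_I)
    fix i assume "i \<in> {..<N}"
    then obtain k where "h i \<in> FFk I k" using h(1) by blast
    then show "finite {t \<in> {p..q}. jump t (h i) \<noteq> 0}" by (rule FFk_finite_jumps[OF _ assms(2,3)])
  qed simp
  ultimately show ?thesis by (rule finite_subset)
qed

text \<open>The coefficient of the jump at \<open>t\<close> is the value of \<open>d\<close> at a test function whose only jump is a unit jump at \<open>t\<close>.\<close>

lemma jump_distI:
  assumes d: "d \<in> RR_dual I" and z: "\<And>\<phi>. \<phi> \<in> RR I \<Longrightarrow> no_jump \<phi> \<Longrightarrow> d \<phi> = 0"
  shows "d \<in> jump_dists I"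
proof -
  have "\<forall>t\<in>I. \<exists>b. b \<in> RR I \<and> jump t b = 1 \<and> (\<forall>s\<in>I. s \<noteq> t \<longrightarrow> jump s b = 0)"
  proof
    fix t assume "t \<in> I"
    then obtain b where "b \<in> RR I" "jump t b = 1" "\<And>s. s \<in> I \<Longrightarrow> s \<noteq> t \<Longrightarrow> jump s b = 0" by (rule unit_jump) blast
    then show "\<exists>b. b \<in> RR I \<and> jump t b = 1 \<and> (\<forall>s\<in>I. s \<noteq> t \<longrightarrow> jump s b = 0)"
      by (intro exI[of _ b] conjI ballI impI)
  qed
  from bchoice[OF this] obtain b where bb: "\<forall>t\<in>I. b t \<in> RR I \<and> jump t (b t) = 1 \<and> (\<forall>s\<in>I. s \<noteq> t \<longrightarrow> jump s (b t) = 0)" ..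
  have b: "b t \<in> RR I" "jump t (b t) = 1" "\<And>s. s \<in> I \<Longrightarrow> s \<noteq> t \<Longrightarrow> jump s (b t) = 0" if "t \<in> I" for t
    using bspec[OF bb that] by simp_all
  have "d \<phi> = (\<Sum>t | t \<in> I \<and> jump t \<phi> \<noteq> 0. d (b t) * jump t \<phi>)" if "\<phi> \<in> RRF I" for \<phi>
  proof -
    have \<phi>: "\<phi> \<in> RR I" "\<phi> \<in> FF I" using that by (auto simp: RRF_def)
    obtain p q where pq: "p \<in> I" "q \<in> I" "p < q" "\<phi> \<in> Rstep I {p..q}" using RR_ex_step[OF \<phi>(1)] .
    define D where "D = {t. t \<in> I \<and> jump t \<phi> \<noteq> 0}"
    have "jump t \<phi> = 0" if "t \<in> I" "t \<notin> {p..q}" for t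
      using zero_off_slim[of "{p..q}" \<phi> t] pq(4) that by (simp add: jump_slim Rstep_iff)
    then have "D \<subseteq> {t \<in> {p..q}. jump t \<phi> \<noteq> 0}" by (auto simp: D_def)
    then have fin: "finite D" using FF_finite_jumps[OF \<phi>(2) pq(1,2)] finite_subset by blast
    \<comment> \<open>Subtracting the jumps leaves a test function on which \<open>d\<close>
      vanishes by \<open>z\<close>; the remaining finite sum is the required formula.\<close>
    define \<theta> where "\<theta> t = \<phi> t - (\<Sum>s\<in>D. jump s \<phi> * b s t)" for t
    have bD: "(\<lambda>t. \<Sum>s\<in>D. jump s \<phi> * b s t) \<in> RR I" by (intro RR_sum RR_cmult b) (simp add: D_def)
    have \<theta>: "\<theta> \<in> RR I" unfolding \<theta>_def[abs_def] by (intro RR_diff \<phi> bD)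
    have sl: "slim \<sigma> \<theta> t = slim \<sigma> \<phi> t - (\<Sum>s\<in>D. jump s \<phi> * slim \<sigma> (b s) t)" if "t \<in> I" for t \<sigma>
    proof (rule slim_ae_eq)
      have "(b s \<longlongrightarrow> slim \<sigma> (b s) t) (ess_at \<sigma> t)" if "s \<in> D" for s
        using that \<open>t \<in> I\<close> by (intro GG_tendsto[OF Ginf_GG[OF RR_Ginf[OF b(1)]]]) (simp_all add: D_def)
      then show "(\<theta> \<longlongrightarrow> slim \<sigma> \<phi> t - (\<Sum>s\<in>D. jump s \<phi> * slim \<sigma> (b s) t)) (ess_at \<sigma> t)"
        unfolding \<theta>_def[abs_def] using GG_tendsto[OF Ginf_GG[OF RR_Ginf[OF \<phi>(1)]] \<open>t \<in> I\<close>] by (intro tendsto_intros) auto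
    qed
    have "jump t \<theta> = 0" if t: "t \<in> I" for t
    proof -
      have "jump t \<theta> = jump t \<phi> - (\<Sum>s\<in>D. jump s \<phi> * jump t (b s))"
        unfolding jump_slim[of t] sl[OF t] right_diff_distrib sum_subtractf by (simp only: diff_diff_eq2 diff_diff_eq) simp
      also have "(\<Sum>s\<in>D. jump s \<phi> * jump t (b s)) = (\<Sum>s\<in>D. if s = t then jump s \<phi> else 0)"
        using b(2,3) t by (intro sum.cong refl) (auto simp: D_def)
      also have "\<dots> = jump t \<phi>" using fin t by (simp add: D_def)
      finally show ?thesis by simp
    qed
    then have "d \<theta> = 0" by (intro z \<theta>) (simp add: no_jump_jump)
    moreover have "d \<theta> = d \<phi> - (\<Sum>s\<in>D. d (\<lambda>t. jump s \<phi> * b s t))"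
      unfolding \<theta>_def[abs_def] dual_diff[OF d \<phi>(1) bD] by (subst dual_sum[OF d]) (auto simp: D_def intro: RR_cmult b)
    moreover have "(\<Sum>s\<in>D. d (\<lambda>t. jump s \<phi> * b s t)) = (\<Sum>s\<in>D. d (b s) * jump s \<phi>)"
      by (intro sum.cong refl) (simp add: dual_cmult[OF d] b D_def mult.commute)
    ultimately show ?thesis by (simp add: D_def)
  qed
  then show ?thesis unfolding jump_dists_def using d by (intro CollectI conjI exI[of _ "\<lambda>t. d (b t)"]) auto
qed

section \<open>First order systems for distributions\<close>

text \<open>Membership in the dual is part of the notion, so the closure lemmas carry continuity
  along. On test functions with jumps nothing ties \<open>h\<close> to \<open>w\<close>.\<close>

definition weak_deriv :: "functional \<Rightarrow> functional \<Rightarrow> bool" where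
  "weak_deriv w h \<longleftrightarrow> w \<in> RR_dual I \<and> h \<in> RR_dual I \<and> (\<forall>\<phi>\<in>RR I. no_jump \<phi> \<longrightarrow> h \<phi> = - w (gderiv I \<phi>))"

text \<open>Exchanges the multivalued derivative for an equation on fewer test functions; from here
  on \<open>jump_dists\<close> does not return.\<close>

lemma derivs_iff:
  assumes w: "w \<in> RR_dual I" shows "h \<in> derivs I w \<longleftrightarrow> weak_deriv w h"
proof
  assume "h \<in> derivs I w"
  then obtain d where h: "h \<in> RR_dual I" "d \<in> jump_dists I" "\<And>\<phi>. \<phi> \<in> RR I \<Longrightarrow> h \<phi> = base_deriv I w \<phi> + d \<phi>"
    unfolding derivs_def by blast
  then show "weak_deriv w h" unfolding weak_deriv_def using w jump_dist_no_jump[OF h(2)] by (simp add: base_deriv_def)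
next
  assume D: "weak_deriv w h"
  define d where "d \<phi> = h \<phi> - base_deriv I w \<phi>" for \<phi>
  have h: "h \<in> RR_dual I" using D by (simp add: weak_deriv_def)
  have "d \<in> jump_dists I"
  proof (rule jump_distI)
    show "d \<in> RR_dual I" unfolding d_def[abs_def] by (intro dual_minus h dual_base_deriv w)
    show "\<And>\<phi>. \<phi> \<in> RR I \<Longrightarrow> no_jump \<phi> \<Longrightarrow> d \<phi> = 0" using D by (simp add: d_def weak_deriv_def base_deriv_def)
  qed
  then show "h \<in> derivs I w" unfolding derivs_def using h by (auto simp: d_def intro!: bexI[of _ d])
qed

definition null_before :: "real \<Rightarrow> functional \<Rightarrow> bool" where
  "null_before t0 f \<longleftrightarrow> (\<forall>\<phi>\<in>RR I. gsupp I \<phi> \<subseteq> {..<t0} \<longrightarrow> f \<phi> = 0)"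

text \<open>A compact support inside \<open>{..<t0}\<close> has a largest point, which leaves a gap
  before \<open>t0\<close>. Ramps and cut-off coefficients are placed in such gaps.\<close>

lemma null_before_iff: "null_before t0 f \<longleftrightarrow> (\<forall>c<t0. \<forall>\<phi>\<in>RR I. zero_off {..c} \<phi> \<longrightarrow> f \<phi> = 0)"
proof
  assume v: "null_before t0 f"
  show "\<forall>c<t0. \<forall>\<phi>\<in>RR I. zero_off {..c} \<phi> \<longrightarrow> f \<phi> = 0"
  proof (intro allI impI ballI)
    fix c \<phi> assume c: "c < t0" and \<phi>: "\<phi> \<in> RR I" "zero_off {..c} \<phi>"
    have "gsupp I \<phi> \<subseteq> {..c}" using \<phi> by (subst gsupp_subset_iff) (auto intro: Ginf_GG RR_Ginf)
    then have "gsupp I \<phi> \<subseteq> {..<t0}" using c by auto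
    then show "f \<phi> = 0" using v \<phi>(1) by (simp add: null_before_def)
  qed
next
  assume v: "\<forall>c<t0. \<forall>\<phi>\<in>RR I. zero_off {..c} \<phi> \<longrightarrow> f \<phi> = 0"
  show "null_before t0 f" unfolding null_before_def
  proof (intro ballI impI)
    fix \<phi> assume \<phi>: "\<phi> \<in> RR I" and s: "gsupp I \<phi> \<subseteq> {..<t0}"
    have "\<exists>c<t0. gsupp I \<phi> \<subseteq> {..c}"
    proof (cases "gsupp I \<phi> = {}")
      case True then show ?thesis by (intro exI[of _ "t0 - 1"]) auto
    next
      case False
      have "compact (gsupp I \<phi>)" using \<phi> by (simp add: RR_def)
      from compact_attains_sup[OF this False] obtain c where "c \<in> gsupp I \<phi>" "\<forall>t\<in>gsupp I \<phi>. t \<le> c" by blast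
      then show ?thesis using s by (intro exI[of _ c]) auto
    qed
    then obtain c where c: "c < t0" "gsupp I \<phi> \<subseteq> {..c}" by blast
    then have "zero_off {..c} \<phi>" using gsupp_subset_iff[of \<phi> "{..c}"] \<phi> by (auto intro: Ginf_GG RR_Ginf)
    then show "f \<phi> = 0" using v c \<phi> by blast
  qed
qed

lemma null_beforeD: "null_before t0 f \<Longrightarrow> c < t0 \<Longrightarrow> \<phi> \<in> RR I \<Longrightarrow> zero_off {..c} \<phi> \<Longrightarrow> f \<phi> = 0"
  unfolding null_before_iff by blast

text \<open>The tool by which ramps and cut-off coefficients are inserted and removed.\<close>

lemma null_before_agree:
  assumes "null_before t0 f" "f \<in> RR_dual I" "c < t0" "\<phi> \<in> RR I" "\<psi> \<in> RR I" "zero_off {..c} (\<lambda>t. \<phi> t - \<psi> t)"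
  shows "f \<phi> = f \<psi>"
  using null_beforeD[OF assms(1,3) RR_diff[OF assms(4,5)] assms(6)] dual_diff[OF assms(2,4,5)] by simp

lemma null_before_sum: "(\<And>i. i \<in> S \<Longrightarrow> null_before t0 (f i)) \<Longrightarrow> null_before t0 (\<lambda>\<phi>. \<Sum>i\<in>S. f i \<phi>)"
  by (simp add: null_before_def)

lemma null_before_mult:
  assumes "null_before t0 f" "u \<in> Gloc" shows "null_before t0 (\<lambda>\<phi>. f (\<lambda>t. u t * \<phi> t))"
  unfolding null_before_iff
proof (intro allI impI ballI)
  fix c \<phi> assume "c < t0" "\<phi> \<in> RR I" "zero_off {..c} \<phi>"
  then show "f (\<lambda>t. u t * \<phi> t) = 0" by (intro null_beforeD[OF assms(1) _ Gloc_RR[OF assms(2)]] zero_off_mult)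
qed

lemma zero_off_Int: "zero_off K \<phi> \<Longrightarrow> zero_off L \<phi> \<Longrightarrow> zero_off (K \<inter> L) \<phi>"
  unfolding zero_off_def by (erule (1) eventually_elim2) auto

text \<open>The ramp removes the constant left tail, so that the integral becomes a test function.
  Its step depends only on \<open>c\<close> and on the step of \<open>\<psi>\<close>, as continuity
  of the antiderivative requires.\<close>

lemma ramp_tail_int:
  assumes cc: "c < c'" "c \<in> I" and \<psi>: "\<psi> \<in> Rstep I {p..q}" and pq: "p \<in> I" "q \<in> I" "p \<le> q"
  shows "(\<lambda>t. ramp c c' t * tail_int \<psi> t) \<in> Rstep I {min p c..max q c}"
    "no_jump (\<lambda>t. ramp c c' t * tail_int \<psi> t)" "zero_off {..c'} (\<lambda>t. ramp c c' t * tail_int \<psi> t - tail_int \<psi> t)"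
    "zero_off {..q} (\<lambda>t. ramp c c' t * tail_int \<psi> t)"
proof -
  note \<eta> = ramp[OF cc(1)]
  have R: "\<psi> \<in> RR I" using \<psi> Rstep_RR[OF pq(1,2)] by blast
  note J = tail_int_Ginf[OF R]
  show "no_jump (\<lambda>t. ramp c c' t * tail_int \<psi> t)" by (intro no_jump_mult \<eta> J Ginf_GG)
  show z: "zero_off {..q} (\<lambda>t. ramp c c' t * tail_int \<psi> t)"
    by (rule zero_off_I) (use tail_int_zero_right[OF \<psi>] in auto)
  have "zero_off {c..} (\<lambda>t. ramp c c' t * tail_int \<psi> t)"
    by (rule zero_off_I) (use \<eta>(3) in auto)
  from zero_off_Int[OF this z] have "zero_off {min p c..max q c} (\<lambda>t. ramp c c' t * tail_int \<psi> t)"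
    by (rule zero_off_mono) auto
  then show "(\<lambda>t. ramp c c' t * tail_int \<psi> t) \<in> Rstep I {min p c..max q c}"
    by (simp add: Rstep_iff Ginf_mult \<eta>(1) J(1))
  show "zero_off {..c'} (\<lambda>t. ramp c c' t * tail_int \<psi> t - tail_int \<psi> t)"
    by (rule zero_off_I) (use \<eta>(4) in auto)
qed

lemma min_max_I: "p \<in> I \<Longrightarrow> c \<in> I \<Longrightarrow> min p c \<in> I" "p \<in> I \<Longrightarrow> c \<in> I \<Longrightarrow> max p c \<in> I"
  by (auto simp: min_def max_def)

text \<open>The integrated function is the compactly supported test function without jumps whose derivative agrees with \<open>\<psi>\<close>
  to the right of \<open>c'\<close>, where alone \<open>w\<close> is supported.\<close>

lemma weak_deriv_representation:
  assumes D: "weak_deriv w h" and v: "null_before t0 w" and cc: "c < c'" "c' < t0" "c \<in> I" and \<psi>: "\<psi> \<in> RR I"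
  shows "w \<psi> = - h (\<lambda>t. ramp c c' t * tail_int \<psi> t)"
proof -
  obtain p q where pq: "p \<in> I" "q \<in> I" "p < q" "\<psi> \<in> Rstep I {p..q}" using RR_ex_step[OF \<psi>] .
  define \<phi> where "\<phi> t = ramp c c' t * tail_int \<psi> t" for t
  note rJ = ramp_tail_int[OF cc(1,3) pq(4,1,2) less_imp_le[OF pq(3)], folded \<phi>_def]
  have \<phi>: "\<phi> \<in> RR I"
    using rJ(1) Rstep_RR[of "min p c" "max q c"] min_max_I pq cc(3) by (auto simp: \<phi>_def[abs_def])
  note J = tail_int_Ginf[OF \<psi>]
  have w: "w \<in> RR_dual I" using D by (simp add: weak_deriv_def)
  have "(\<lambda>t. \<phi> t - tail_int \<psi> t) \<in> Rstep I {..c'}"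
    using rJ(3) Ginf_diff[OF RR_Ginf[OF \<phi>] J(1)] by (simp add: Rstep_iff)
  then have "gderiv I (\<lambda>t. \<phi> t - tail_int \<psi> t) \<in> Rstep I {..c'}" by (rule Rstep_gderiv) simp
  then have z: "zero_off {..c'} (gderiv I (\<lambda>t. \<phi> t - tail_int \<psi> t))" by (simp add: Rstep_iff)
  have "ae_eq (gderivs I 1 (\<lambda>t. \<phi> t - tail_int \<psi> t)) (\<lambda>t. gderivs I 1 \<phi> t - gderivs I 1 (tail_int \<psi>) t)"
    by (rule gderivs_diff[OF RR_Ginf[OF \<phi>] J(1)])
  then have 1: "ae_eq (gderiv I (\<lambda>t. \<phi> t - tail_int \<psi> t)) (\<lambda>t. gderiv I \<phi> t - gderiv I (tail_int \<psi>) t)"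
    by (simp add: gderivs_def)
  have "ae_eq (gderiv I (tail_int \<psi>)) \<psi>" by (rule gderiv_ae_eq[OF J(2)])
  with 1 have "ae_eq (gderiv I (\<lambda>t. \<phi> t - tail_int \<psi> t)) (\<lambda>t. gderiv I \<phi> t - \<psi> t)"
    unfolding ae_eq_def by eventually_elim simp
  then have "zero_off {..c'} (\<lambda>t. gderiv I \<phi> t - \<psi> t)" by (rule zero_off_ae_eq[OF z])
  then have "w (gderiv I \<phi>) = w \<psi>" by (rule null_before_agree[OF v w cc(2) RR_gderiv[OF \<phi>] \<psi>])
  moreover have "h \<phi> = - w (gderiv I \<phi>)"
    using D \<phi> rJ(2) unfolding weak_deriv_def \<phi>_def[abs_def] by blast
  ultimately show ?thesis unfolding \<phi>_def[abs_def] by simp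
qed

text \<open>For \<open>\<phi>\<close> without jumps, integrating \<open>gderiv I \<phi>\<close>
  gives \<open>\<phi>\<close> back, and the ramp is invisible to \<open>h\<close>. Vanishing before
  \<open>t0\<close> passes from \<open>h\<close> to \<open>w\<close> because integration from the
  right does not extend a support to the right.\<close>

lemma antiderivative:
  assumes h: "h \<in> RR_dual I" and v: "null_before t0 h" and cc: "c < c'" "c' < t0" "c \<in> I"
  defines "w \<equiv> \<lambda>\<psi>. - h (\<lambda>t. ramp c c' t * tail_int \<psi> t)"
  shows "weak_deriv w h" "null_before t0 w"
proof -
  have RJ: "(\<lambda>t. ramp c c' t * tail_int \<psi> t) \<in> RR I" if \<psi>: "\<psi> \<in> RR I" for \<psi>
  proof -
    obtain p q where pq: "p \<in> I" "q \<in> I" "p < q" "\<psi> \<in> Rstep I {p..q}" using RR_ex_step[OF \<psi>] .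
    show ?thesis using ramp_tail_int(1)[OF cc(1,3) pq(4,1,2) less_imp_le[OF pq(3)]]
        Rstep_RR[of "min p c" "max q c"] min_max_I pq cc(3) by auto
  qed
  have w: "w \<in> RR_dual I"
  proof (rule RR_dualI)
    fix \<phi> \<psi> assume p: "\<phi> \<in> RR I" "\<psi> \<in> RR I"
    show "w (\<lambda>t. \<phi> t + \<psi> t) = w \<phi> + w \<psi>"
      unfolding w_def using dual_add[OF h RJ[OF p(1)] RJ[OF p(2)]] by (simp add: tail_int_add[OF p] algebra_simps)
  next
    fix k \<phi> assume p: "\<phi> \<in> RR I"
    show "w (\<lambda>t. k * \<phi> t) = k * w \<phi>"
      unfolding w_def using dual_cmult[OF h RJ[OF p], of k] by (simp add: tail_int_cmult algebra_simps)
  next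
    fix p q assume pq0: "p \<in> I" "q \<in> I"
    define P Q where "P = min p c" and "Q = max q c"
    have PQ: "P \<in> I" "Q \<in> I" "P \<le> Q" using pq0 cc(3) by (auto simp: P_def Q_def min_def max_def)
    obtain k C where C: "C \<ge> 0" "\<And>\<phi>. \<phi> \<in> Rstep I {P..Q} \<Longrightarrow> norm (h \<phi>) \<le> C * Gnorm I k \<phi>"
      by (rule dual_bound[OF h PQ(1,2)]) blast
    obtain D where D: "D \<ge> 0" "\<And>\<phi>. \<phi> \<in> Ginf I \<Longrightarrow> Gnorm I k (\<lambda>t. ramp c c' t * \<phi> t) \<le> D * Gnorm I k \<phi>"
      using Gnorm_mult[OF ramp(1)[OF cc(1)]] by blast
    show "\<exists>k C. \<forall>\<phi>\<in>Rstep I {p..q}. norm (w \<phi>) \<le> C * Gnorm I k \<phi>"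
    proof (intro exI ballI)
      fix \<psi> assume "\<psi> \<in> Rstep I {p..q}"
      then have \<psi>: "\<psi> \<in> Rstep I {P..Q}" by (rule Rstep_mono) (auto simp: P_def Q_def)
      have R: "\<psi> \<in> RR I" using \<psi> Rstep_RR[OF PQ(1,2)] by blast
      have "(\<lambda>t. ramp c c' t * tail_int \<psi> t) \<in> Rstep I {P..Q}"
        using ramp_tail_int(1)[OF cc(1,3) \<psi> PQ] by (simp add: P_def Q_def)
      then have "norm (w \<psi>) \<le> C * Gnorm I k (\<lambda>t. ramp c c' t * tail_int \<psi> t)" unfolding w_def norm_minus_cancel by (rule C(2))
      also have "\<dots> \<le> C * (D * Gnorm I (Suc k) (tail_int \<psi>))"
        using C(1) D(1) by (intro mult_left_mono order_trans[OF D(2)[OF tail_int_Ginf(1)[OF R]]] Gnorm_mono) auto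
      also have "\<dots> \<le> C * (D * ((Q - P + 1) * Gnorm I k \<psi>))"
        using C(1) D(1) by (intro mult_left_mono tail_int_Gnorm[OF \<psi> PQ])
      finally show "norm (w \<psi>) \<le> (C * D * (Q - P + 1)) * Gnorm I k \<psi>" by (simp add: mult.assoc)
    qed
  qed
  show "null_before t0 w" unfolding null_before_iff
  proof (intro allI impI ballI)
    fix d \<psi> assume d: "d < t0" and \<psi>: "\<psi> \<in> RR I" "zero_off {..d} \<psi>"
    obtain p q where pq: "p \<in> I" "q \<in> I" "p < q" "\<psi> \<in> Rstep I {p..q}" using RR_ex_step[OF \<psi>(1)] .
    have \<psi>': "\<psi> \<in> Ginf I" "zero_off {p..q} \<psi>" using pq(4) by (simp_all add: Rstep_iff)
    have "{p..q} \<inter> {..d} \<subseteq> {p..d}" by auto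
    from zero_off_mono[OF zero_off_Int[OF \<psi>'(2) \<psi>(2)] this] have "\<psi> \<in> Rstep I {p..d}" using \<psi>'(1) by (simp add: Rstep_iff)
    then have "zero_off {..d} (\<lambda>t. ramp c c' t * tail_int \<psi> t)" by (intro zero_off_I) (use tail_int_zero_right in auto)
    from null_beforeD[OF v d RJ[OF \<psi>(1)] this] show "w \<psi> = 0" by (simp add: w_def)
  qed
  have "h \<phi> = - w (gderiv I \<phi>)" if \<phi>: "\<phi> \<in> RR I" "no_jump \<phi>" for \<phi>
  proof -
    have "ae_eq (\<lambda>t. ramp c c' t * tail_int (gderiv I \<phi>) t) (\<lambda>t. ramp c c' t * \<phi> t)"
      by (intro ae_eq_mult ae_eq_refl tail_int_gderiv_ae_eq \<phi>)
    then have "h (\<lambda>t. ramp c c' t * tail_int (gderiv I \<phi>) t) = h (\<lambda>t. ramp c c' t * \<phi> t)"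
      by (intro dual_ae_eq[OF h] RJ RR_gderiv \<phi>)
    moreover have "zero_off {..c'} (\<lambda>t. ramp c c' t * \<phi> t - \<phi> t)" by (rule zero_off_I) (use ramp(4)[OF cc(1)] in auto)
    then have "h (\<lambda>t. ramp c c' t * \<phi> t) = h \<phi>"
      by (rule null_before_agree[OF v h cc(2) RR_mult[OF ramp(1)[OF cc(1)] \<phi>(1)] \<phi>(1)])
    ultimately show ?thesis by (simp add: w_def)
  qed
  then show "weak_deriv w h" using w h by (simp add: weak_deriv_def)
qed

section \<open>Multipliers without jumps and fundamental matrices\<close>

text \<open>\<open>u\<close> and \<open>u'\<close> may be unbounded on \<open>I\<close>, so the
  rules for \<open>is_gderiv\<close> do not apply to them; the product rule is recorded through its
  effect on test functions. Preservation of \<open>no_jump\<close> is demanded because weak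
  derivatives say something on this class only.\<close>

definition mult_deriv :: "(real \<Rightarrow> complex) \<Rightarrow> (real \<Rightarrow> complex) \<Rightarrow> bool" where
  "mult_deriv u u' \<longleftrightarrow> u \<in> Gloc \<and> u' \<in> Gloc \<and>
     (\<forall>\<phi>\<in>RR I. no_jump \<phi> \<longrightarrow> no_jump (\<lambda>t. u t * \<phi> t) \<and>
        ae_eq (gderiv I (\<lambda>t. u t * \<phi> t)) (\<lambda>t. u' t * \<phi> t + u t * gderiv I \<phi> t))"

lemma weak_deriv_mult:
  assumes D: "weak_deriv w h" and u: "mult_deriv u u'"
  shows "weak_deriv (\<lambda>\<phi>. w (\<lambda>t. u t * \<phi> t)) (\<lambda>\<phi>. w (\<lambda>t. u' t * \<phi> t) + h (\<lambda>t. u t * \<phi> t))"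
proof -
  have wh: "w \<in> RR_dual I" "h \<in> RR_dual I" using D by (auto simp: weak_deriv_def)
  have G: "u \<in> Gloc" "u' \<in> Gloc" using u by (auto simp: mult_deriv_def)
  have "w (\<lambda>t. u' t * \<phi> t) + h (\<lambda>t. u t * \<phi> t) = - w (\<lambda>t. u t * gderiv I \<phi> t)" if \<phi>: "\<phi> \<in> RR I" "no_jump \<phi>" for \<phi>
  proof -
    have z: "no_jump (\<lambda>t. u t * \<phi> t)" and e: "ae_eq (gderiv I (\<lambda>t. u t * \<phi> t)) (\<lambda>t. u' t * \<phi> t + u t * gderiv I \<phi> t)"
      using u \<phi> by (auto simp: mult_deriv_def)
    have R: "(\<lambda>t. u t * \<phi> t) \<in> RR I" by (rule Gloc_RR[OF G(1) \<phi>(1)])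
    have "h (\<lambda>t. u t * \<phi> t) = - w (gderiv I (\<lambda>t. u t * \<phi> t))" using D R z by (simp add: weak_deriv_def)
    also have "w (gderiv I (\<lambda>t. u t * \<phi> t)) = w (\<lambda>t. u' t * \<phi> t + u t * gderiv I \<phi> t)"
      by (rule dual_ae_eq[OF wh(1) RR_gderiv[OF R] e])
    also have "\<dots> = w (\<lambda>t. u' t * \<phi> t) + w (\<lambda>t. u t * gderiv I \<phi> t)"
      by (intro dual_add wh Gloc_RR G \<phi> RR_gderiv)
    finally show ?thesis by simp
  qed
  then show ?thesis unfolding weak_deriv_def using wh G by (auto intro!: dual_plus dual_gmult)
qed

lemma weak_deriv_sum: "(\<And>i. i \<in> S \<Longrightarrow> weak_deriv (w i) (h i)) \<Longrightarrow> weak_deriv (\<lambda>\<phi>. \<Sum>i\<in>S. w i \<phi>) (\<lambda>\<phi>. \<Sum>i\<in>S. h i \<phi>)"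
  unfolding weak_deriv_def by (auto intro!: dual_finsum simp: sum_negf[symmetric] intro!: sum.cong)

lemma weak_deriv_cong:
  assumes D: "weak_deriv w h" and e: "\<And>\<phi>. \<phi> \<in> RR I \<Longrightarrow> w \<phi> = w' \<phi>" "\<And>\<phi>. \<phi> \<in> RR I \<Longrightarrow> h \<phi> = h' \<phi>"
  shows "weak_deriv w' h'"
  unfolding weak_deriv_def
proof (intro conjI ballI impI)
  show "w' \<in> RR_dual I" using D e dual_cong unfolding weak_deriv_def by blast
  show "h' \<in> RR_dual I" using D e dual_cong unfolding weak_deriv_def by blast
  show "h' \<phi> = - w' (gderiv I \<phi>)" if "\<phi> \<in> RR I" "no_jump \<phi>" for \<phi>
    using D that e(2)[OF that(1)] e(1)[OF RR_gderiv[OF that(1)]] by (simp add: weak_deriv_def)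
qed

lemma Gloc_mult: assumes "u \<in> Gloc" "v \<in> Gloc" shows "(\<lambda>t. u t * v t) \<in> Gloc"
  unfolding Gloc_def
proof (intro CollectI ballI)
  fix p q assume pq: "p \<in> I" "q \<in> I"
  obtain u' v' where "u' \<in> Ginf I" "\<forall>t\<in>{p..q}. u t = u' t" "v' \<in> Ginf I" "\<forall>t\<in>{p..q}. v t = v' t"
    using assms pq unfolding Gloc_def by blast
  then show "\<exists>w\<in>Ginf I. \<forall>t\<in>{p..q}. u t * v t = w t"
    by (intro bexI[of _ "\<lambda>t. u' t * v' t"] Ginf_mult) simp_all
qed

lemma Gloc_add: assumes "u \<in> Gloc" "v \<in> Gloc" shows "(\<lambda>t. u t + v t) \<in> Gloc"
  unfolding Gloc_def
proof (intro CollectI ballI)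
  fix p q assume pq: "p \<in> I" "q \<in> I"
  obtain u' v' where "u' \<in> Ginf I" "\<forall>t\<in>{p..q}. u t = u' t" "v' \<in> Ginf I" "\<forall>t\<in>{p..q}. v t = v' t"
    using assms pq unfolding Gloc_def by blast
  then show "\<exists>w\<in>Ginf I. \<forall>t\<in>{p..q}. u t + v t = w t"
    by (intro bexI[of _ "\<lambda>t. u' t + v' t"] Ginf_add) simp_all
qed

lemma Gloc_sum: "(\<And>i. i \<in> S \<Longrightarrow> u i \<in> Gloc) \<Longrightarrow> (\<lambda>t. \<Sum>i\<in>S. u i t) \<in> Gloc"
  by (induction S rule: infinite_finite_induct) (auto intro: Gloc_add Ginf_Gloc)

lemma restr_Ginf_mult: "decides J \<Longrightarrow> J \<in> sets borel \<Longrightarrow> g \<in> Ginf I \<Longrightarrow> restr J g \<in> Ginf I"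
proof -
  assume J: "decides J" "J \<in> sets borel" "g \<in> Ginf I"
  have "restr J g = (\<lambda>t. restr J (\<lambda>_. 1) t * g t)" by (auto simp: restr_def fun_eq_iff)
  then show ?thesis using Ginf_mult[OF restr_const_Ginf[OF J(1,2), of 1] J(3)] by simp
qed

lemma is_gderiv_sum:
  "(\<And>i. i \<in> S \<Longrightarrow> g i \<in> GG I \<and> is_gderiv I (g i) (h i)) \<Longrightarrow>
    (\<lambda>t. \<Sum>i\<in>S. g i t) \<in> GG I \<and> is_gderiv I (\<lambda>t. \<Sum>i\<in>S. g i t) (\<lambda>t. \<Sum>i\<in>S. h i t)"
  by (induction S rule: infinite_finite_induct) (auto intro: GG_add is_gderiv_add is_gderiv_const)

lemma GG_sum: "(\<And>i. i \<in> S \<Longrightarrow> g i \<in> GG I) \<Longrightarrow> (\<lambda>t. \<Sum>i\<in>S. g i t) \<in> GG I"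
  by (induction S rule: infinite_finite_induct) (auto intro: GG_add)

lemma isCont_bounded_GG:
  assumes "\<And>t. t \<in> I \<Longrightarrow> isCont g t" "\<And>t. t \<in> I \<Longrightarrow> norm (g t) \<le> B"
  shows "g \<in> GG I"
  unfolding GG_iff
proof (intro conjI ballI allI)
  show "g \<in> borel_measurable (lebesgue_on I)"
    using assms(1) by (intro continuous_imp_measurable_on_sets_lebesgue continuous_at_imp_continuous_on) auto
  show "\<exists>B. AE t in lebesgue_on I. norm (g t) \<le> B" unfolding AE_I using assms(2) by (intro exI[of _ B]) simp
  fix t \<sigma> assume "t \<in> I"
  from tendsto_ess_at_at[OF assms(1)[OF this, unfolded isCont_def]] show "\<exists>l. (g \<longlongrightarrow> l) (ess_at \<sigma> t)" by (rule exI)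
qed

lemma zero_off_ae_eq_mult:
  assumes "zero_off K \<phi>" "\<And>t. t \<in> K \<Longrightarrow> f t = g t" shows "ae_eq (\<lambda>t. f t * \<phi> t) (\<lambda>t. g t * \<phi> t)"
  using assms(1) unfolding zero_off_def ae_eq_def
  by (rule eventually_mono) (use assms(2) in fastforce)

lemma larger_point:
  assumes "p \<in> I" "q \<in> I" obtains r where "r \<in> I" "p < r" "q < r"
proof -
  have m: "max p q \<in> I" using assms by (simp add: max_def)
  obtain d where d: "d > 0" "\<And>s. \<bar>s - max p q\<bar> < d \<Longrightarrow> s \<in> I" using I_ball[OF m] by metis
  show thesis by (rule that[of "max p q + d / 2"]) (use d in auto)
qed

text \<open>Solutions of \<open>u' = B u\<close> to the right of \<open>c\<close>, extended constantly to the left of \<open>c\<close>: for \<open>t < c\<close> the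
  integral over the empty set \<open>{c..t}\<close> vanishes.\<close>

definition lin_sol :: "'s set \<Rightarrow> ('s \<Rightarrow> 's \<Rightarrow> real \<Rightarrow> complex) \<Rightarrow> real \<Rightarrow> ('s \<Rightarrow> complex) \<Rightarrow> ('s \<Rightarrow> real \<Rightarrow> complex) \<Rightarrow> bool" where
  "lin_sol S B c x u \<longleftrightarrow> (\<forall>s\<in>S. (\<forall>t\<in>I. isCont (u s) t) \<and>
     (\<forall>t\<in>I. u s t = x s + integral {c..t} (\<lambda>z. \<Sum>r\<in>S. B s r z * u r z)))"

definition bdd_coeffs :: "'s set \<Rightarrow> ('s \<Rightarrow> 's \<Rightarrow> real \<Rightarrow> complex) \<Rightarrow> real \<Rightarrow> bool" where
  "bdd_coeffs S B M \<longleftrightarrow> finite S \<and> (\<forall>s\<in>S. \<forall>r\<in>S. B s r \<in> Ginf I \<and> (\<forall>t\<in>I. norm (B s r t) \<le> M))"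

lemma coeff_absolutely_integrable:
  assumes B: "bdd_coeffs S B M" and sr: "s \<in> S" "r \<in> S" and cq: "c \<in> I" "q \<in> I" and w: "continuous_on {c..q} w"
  shows "(\<lambda>t. B s r t * w t) absolutely_integrable_on {c..q}"
proof (rule bounded_measurable_mult_continuous_absolutely_integrable[OF _ _ w])
  have "B s r \<in> borel_measurable (lebesgue_on I)" using B sr Ginf_GG[of "B s r"] by (auto simp: bdd_coeffs_def GG_iff)
  then show "B s r \<in> borel_measurable (lebesgue_on {c..q})" by (rule measurable_restrict_mono[OF _ Icc_subset_I[OF cq]])
  show "norm (B s r t) \<le> M" if "t \<in> {c..q}" for t
    using B sr subsetD[OF Icc_subset_I[OF cq] that] by (simp add: bdd_coeffs_def)
qed

text \<open>The Volterra solution is continuous to the right of \<open>c\<close>; being constant to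
  the left, it equals its composition with \<open>max t c\<close>, which gives continuity on all of
  \<open>I\<close>.\<close>

lemma lin_sol_exists:
  assumes B: "bdd_coeffs S B M" and c: "c \<in> I" shows "\<exists>u. lin_sol S B c x u"
proof -
  have S: "finite S" using B by (simp add: bdd_coeffs_def)
  have "\<exists>u. \<forall>s\<in>S. (\<forall>q\<in>I. continuous_on {c..q} (u s)) \<and>
     (\<forall>t\<in>I. u s t = (\<lambda>s t. x s) s t + integral {c..t} (\<lambda>z. \<Sum>r\<in>S. B s r z * u r z))"
  proof (rule linear_Volterra_solution[OF S, where M = M])
    show "{c..t} \<subseteq> I" if "t \<in> I" for t by (rule Icc_subset_I[OF c that])
    show "B s r \<in> borel_measurable (lebesgue_on {c..q})" if "s \<in> S" "r \<in> S" "q \<in> I" for s r q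
    proof -
      have "B s r \<in> borel_measurable (lebesgue_on I)" using B that Ginf_GG[of "B s r"] by (auto simp: bdd_coeffs_def GG_iff)
      then show ?thesis by (rule measurable_restrict_mono[OF _ Icc_subset_I[OF c that(3)]])
    qed
    show "norm (B s r t) \<le> M" if "s \<in> S" "r \<in> S" "t \<in> I" for s r t using B that by (simp add: bdd_coeffs_def)
  qed (rule continuous_on_const)
  then obtain u where u: "\<And>s q. s \<in> S \<Longrightarrow> q \<in> I \<Longrightarrow> continuous_on {c..q} (u s)"
     "\<And>s t. s \<in> S \<Longrightarrow> t \<in> I \<Longrightarrow> u s t = x s + integral {c..t} (\<lambda>z. \<Sum>r\<in>S. B s r z * u r z)" by auto
  have left: "u s t = u s (max t c)" if "s \<in> S" "t \<in> I" for s t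
    using u(2)[OF that] u(2)[OF that(1) c] that(2) by (cases "t < c") (auto simp: max_def)
  have "isCont (u s) t" if s: "s \<in> S" and t: "t \<in> I" for s t
  proof -
    obtain q where q: "q \<in> I" "t < q" "c < q" using larger_point[OF t c] .
    have cm: "continuous_on ({..<q} \<inter> I) (\<lambda>t. u s (max t c))"
      by (rule continuous_on_compose2[OF u(1)[OF s q(1)]]) (use q in \<open>auto intro!: continuous_intros\<close>)
    have "continuous_on ({..<q} \<inter> I) (u s)"
      using cm by (rule continuous_on_eq) (use left[OF s] in auto)
    moreover have "open ({..<q} \<inter> I)" using open_I by (intro open_Int) auto
    ultimately show ?thesis using continuous_on_eq_continuous_at q(2) t by blast
  qed
  then show ?thesis using u(2) unfolding lin_sol_def by blast
qed

lemma lin_sol_cong: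
  assumes u: "lin_sol S B c x u" and s: "s \<in> S" and c: "c \<in> I" and t: "t \<in> I"
  shows "t \<le> c \<Longrightarrow> u s t = x s"
  using u s t by (cases "t < c") (auto simp: lin_sol_def)

lemma lin_sol_has_integral:
  assumes B: "bdd_coeffs S B M" and u: "lin_sol S B c x u" and s: "s \<in> S" and c: "c \<in> I"
    and pq: "c \<le> p" "p \<le> q" "q \<in> I"
  shows "((\<lambda>z. \<Sum>r\<in>S. B s r z * u r z) has_integral (u s q - u s p)) {p..q}"
proof -
  define F where "F z = (\<Sum>r\<in>S. B s r z * u r z)" for z
  have pI: "p \<in> I" using ivl_I[OF c pq(3)] pq by simp
  have S: "finite S" using B by (simp add: bdd_coeffs_def)
  have cu: "continuous_on {c..q} (u r)" if "r \<in> S" for r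
    using u that subsetD[OF Icc_subset_I[OF c pq(3)]] by (intro continuous_at_imp_continuous_on) (auto simp: lin_sol_def)
  have i: "F integrable_on {c..q}" unfolding F_def
    using coeff_absolutely_integrable[OF B s _ c pq(3) cu] S
    by (intro integrable_sum) (auto simp: absolutely_integrable_on_def)
  have "integral {c..p} F + integral {p..q} F = integral {c..q} F"
    by (rule Henstock_Kurzweil_Integration.integral_combine[OF pq(1,2) i])
  moreover have "u s t = x s + integral {c..t} F" if "t \<in> I" for t
    using u s that unfolding lin_sol_def F_def[abs_def] by blast
  ultimately have "integral {p..q} F = u s q - u s p" using pI pq(3) by (simp add: algebra_simps)
  moreover have "F integrable_on {p..q}" by (rule integrable_on_subinterval[OF i]) (use pq in auto)
  ultimately show ?thesis unfolding F_def[symmetric] using integrable_integral by metis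
qed

text \<open>Freezing a solution at \<open>q\<close> makes it bounded, hence an element of \<open>Ginf I\<close>.\<close>

lemma lin_sol_stopped:
  assumes B: "bdd_coeffs S B M" and u: "lin_sol S B c x u" and c: "c \<in> I" and q: "q \<in> I" "c < q"
  defines "v \<equiv> \<lambda>s t. u s (min t q)"
  defines "h \<equiv> \<lambda>s t. \<Sum>r\<in>S. restr {c..<q} (B s r) t * v r t"
  assumes s: "s \<in> S"
  shows "v s \<in> Ginf I" "is_gderiv I (v s) (h s)" "no_jump (v s)"
proof -
  have S: "finite S" using B by (simp add: bdd_coeffs_def)
  have cont: "isCont (v s) t" if s: "s \<in> S" and t: "t \<in> I" for s t
  proof -
    have "isCont (\<lambda>t. min t q) t" by (intro continuous_intros)
    moreover have "isCont (u s) (min t q)" using u s t q by (simp add: lin_sol_def min_def)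
    ultimately show ?thesis unfolding v_def by (rule isCont_o2)
  qed
  have bdd: "\<exists>K. \<forall>t\<in>I. norm (v s t) \<le> K" if s: "s \<in> S" for s
  proof -
    have "continuous_on {c..q} (u s)"
      using u s subsetD[OF Icc_subset_I[OF c q(1)]] by (intro continuous_at_imp_continuous_on) (auto simp: lin_sol_def)
    then obtain K where K: "\<forall>t\<in>{c..q}. norm (u s t) \<le> K" using continuous_bounded_Icc by blast
    have "norm (v s t) \<le> K" if t: "t \<in> I" for t
    proof (cases "t < c")
      case True
      then have "v s t = u s c" using lin_sol_cong[OF u s c t] lin_sol_cong[OF u s c c] q(2) by (simp add: v_def)
      then show ?thesis using K q(2) by simp
    next
      case False
      then show ?thesis using K q(2) by (simp add: v_def)
    qed
    then show ?thesis by blast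
  qed
  have vG: "v s \<in> GG I" if "s \<in> S" for s using isCont_bounded_GG cont bdd that by meson
  have C: "restr {c..<q} (B s r) \<in> Ginf I" if "s \<in> S" "r \<in> S" for s r
    using B that by (intro restr_Ginf_mult decides_Ico) (auto simp: bdd_coeffs_def)
  have hG: "h s \<in> GG I" if "s \<in> S" for s
    unfolding h_def using that by (intro GG_sum GG_mult vG Ginf_GG[OF C])
  have P: "primitive (v s) (h s)" if s: "s \<in> S" for s
    unfolding primitive_def
  proof (intro ballI impI)
    fix a b assume ab: "a \<in> I" "b \<in> I" "a \<le> b"
    \<comment> \<open>The derivative of the stopped function lives on \<open>[c, q)\<close> only, so
      the interval of integration is clamped to \<open>{c..q}\<close>.\<close>
    define a' b' where "a' = min (max a c) q" and "b' = min (max b c) q"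
    have a'b': "c \<le> a'" "a' \<le> b'" "b' \<in> I" using ab c q by (auto simp: a'_def b'_def min_def max_def)
    define F where "F z = (\<Sum>r\<in>S. B s r z * u r z)" for z
    have va: "v s t = u s (min (max t c) q)" if t: "t \<in> I" for t
      using lin_sol_cong[OF u s c t] lin_sol_cong[OF u s c c] q(2) by (cases "t < c") (auto simp: v_def max_def)
    have "(F has_integral (u s b' - u s a')) {a'..b'}"
      unfolding F_def by (rule lin_sol_has_integral[OF B u s c a'b'])
    then have "((\<lambda>z. if z \<in> {a'..b'} then F z else 0) has_integral (v s b - v s a)) UNIV"
      unfolding has_integral_restrict_UNIV using va ab by (simp add: a'_def b'_def)
    then have "((\<lambda>z. if z \<in> {a..b} then h s z else 0) has_integral (v s b - v s a)) UNIV"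
    proof (rule has_integral_spike[rotated 2])
      show "negligible {c, q}" by simp
      fix z assume z: "z \<in> UNIV - {c, q}"
      have hF: "h s z = (if c < z \<and> z < q then F z else 0)"
        using z by (auto simp: h_def F_def restr_def v_def)
      show "(if z \<in> {a..b} then h s z else 0) = (if z \<in> {a'..b'} then F z else 0)"
        using z q(2) ab(3) unfolding hF a'_def b'_def by (auto simp: min_def max_def split: if_splits)
    qed
    then show "(h s has_integral (v s b - v s a)) {a..b}" unfolding has_integral_restrict_UNIV .
  qed
  have D: "is_gderiv I (v s) (h s)" if s: "s \<in> S" for s
  proof -
    obtain K where "\<And>t. t \<in> I \<Longrightarrow> norm (v s t) \<le> K" using bdd[OF s] by blast
    then show ?thesis by (rule primitive_is_gderiv(2)[OF P[OF s] hG[OF s]])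
  qed
  show "is_gderiv I (v s) (h s)" by (rule D[OF s])
  show "no_jump (v s)" by (rule no_jump_isCont) (rule cont[OF s])
  show "v s \<in> Ginf I"
  \<comment> \<open>The closed class consists of combinations of the \<open>v r\<close> with
    coefficients in \<open>Ginf I\<close>: the derivative of each \<open>v r\<close> is such a
    combination, so differentiation changes the coefficients only.\<close>
  proof (rule Ginf_coinduct[where X = "\<lambda>g. \<exists>a. (\<forall>r\<in>S. a r \<in> Ginf I) \<and> g = (\<lambda>t. \<Sum>r\<in>S. a r t * v r t)"])
    have "(\<Sum>r\<in>S. (if r = s then 1 else 0) * v r t) = v s t" for t
      using S s by (simp add: if_distrib[of "\<lambda>x. x * _"] cong: if_cong)
    then show "\<exists>a. (\<forall>r\<in>S. a r \<in> Ginf I) \<and> v s = (\<lambda>t. \<Sum>r\<in>S. a r t * v r t)"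
      by (intro exI[of _ "\<lambda>r _. if r = s then 1 else 0"]) auto
    fix g assume "\<exists>a. (\<forall>r\<in>S. a r \<in> Ginf I) \<and> g = (\<lambda>t. \<Sum>r\<in>S. a r t * v r t)"
    then obtain a where a: "\<And>r. r \<in> S \<Longrightarrow> a r \<in> Ginf I" "g = (\<lambda>t. \<Sum>r\<in>S. a r t * v r t)" by blast
    have 1: "(\<lambda>t. a r t * v r t) \<in> GG I \<and> is_gderiv I (\<lambda>t. a r t * v r t) (\<lambda>t. gderiv I (a r) t * v r t + a r t * h r t)"
      if "r \<in> S" for r
      using that by (intro conjI GG_mult is_gderiv_mult Ginf_gderiv(2) Ginf_GG a vG D)
    define a' where "a' r t = gderiv I (a r) t + (\<Sum>p\<in>S. a p t * restr {c..<q} (B p r) t)" for r t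
    have a': "a' r \<in> Ginf I" if "r \<in> S" for r
      unfolding a'_def using that by (intro Ginf_add Ginf_gderiv Ginf_sum Ginf_mult a C)
    have "(\<Sum>r\<in>S. gderiv I (a r) t * v r t + a r t * h r t) = (\<Sum>r\<in>S. a' r t * v r t)" for t
    proof -
      have "(\<Sum>r\<in>S. a r t * h r t) = (\<Sum>r\<in>S. \<Sum>p\<in>S. a r t * restr {c..<q} (B r p) t * v p t)"
        by (simp add: h_def sum_distrib_left mult.assoc)
      also have "\<dots> = (\<Sum>p\<in>S. \<Sum>r\<in>S. a r t * restr {c..<q} (B r p) t * v p t)" by (rule sum.swap)
      finally show ?thesis by (simp add: a'_def sum.distrib distrib_right sum_distrib_right)
    qed
    then have e: "(\<lambda>t. \<Sum>r\<in>S. gderiv I (a r) t * v r t + a r t * h r t) = (\<lambda>t. \<Sum>r\<in>S. a' r t * v r t)" by blast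
    from is_gderiv_sum[of S "\<lambda>r t. a r t * v r t" "\<lambda>r t. gderiv I (a r) t * v r t + a r t * h r t", OF 1]
    have "g \<in> GG I" "is_gderiv I g (\<lambda>t. \<Sum>r\<in>S. a' r t * v r t)" unfolding a(2) e by blast+
    then show "g \<in> GG I \<and> (\<exists>h. is_gderiv I g h \<and> (\<exists>a. (\<forall>r\<in>S. a r \<in> Ginf I) \<and> h = (\<lambda>t. \<Sum>r\<in>S. a r t * v r t)))"
      using a' by (intro conjI exI[of _ "\<lambda>t. \<Sum>r\<in>S. a' r t * v r t"] exI[of _ a']) auto
  qed
qed

text \<open>For a test function supported in \<open>{p..q}\<close> the solution may be stopped at a
  later point \<open>r\<close>. The stopped function lies in \<open>Ginf I\<close>, where the
  product rule is known, and agrees with the solution on the support.\<close>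

lemma lin_sol_mult_deriv:
  assumes B: "bdd_coeffs S B M" and u: "lin_sol S B c x u" and c: "c \<in> I" and s: "s \<in> S"
  shows "mult_deriv (u s) (\<lambda>t. \<Sum>r\<in>S. restr {c..} (B s r) t * u r t)"
proof -
  have S: "finite S" using B by (simp add: bdd_coeffs_def)
  have G: "u s \<in> Gloc" if s: "s \<in> S" for s
    unfolding Gloc_def
  proof (intro CollectI ballI)
    fix p q assume pq: "p \<in> I" "q \<in> I"
    obtain r where r: "r \<in> I" "q < r" "c < r" using larger_point[OF pq(2) c] .
    show "\<exists>v\<in>Ginf I. \<forall>t\<in>{p..q}. u s t = v t"
      by (rule bexI[OF _ lin_sol_stopped(1)[OF B u c r(1,3) s]]) (use r in auto)
  qed
  have G': "(\<lambda>t. \<Sum>r\<in>S. restr {c..} (B s r) t * u r t) \<in> Gloc"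
    using B s by (intro Gloc_sum Gloc_mult G Ginf_Gloc restr_Ginf_mult decides_Ici) (auto simp: bdd_coeffs_def)
  have "no_jump (\<lambda>t. u s t * \<phi> t) \<and> ae_eq (gderiv I (\<lambda>t. u s t * \<phi> t))
       (\<lambda>t. (\<Sum>r\<in>S. restr {c..} (B s r) t * u r t) * \<phi> t + u s t * gderiv I \<phi> t)"
    if \<phi>: "\<phi> \<in> RR I" "no_jump \<phi>" for \<phi>
  proof -
    obtain p q where pq: "p \<in> I" "q \<in> I" "p < q" "\<phi> \<in> Rstep I {p..q}" using RR_ex_step[OF \<phi>(1)] .
    obtain r where r: "r \<in> I" "q < r" "c < r" using larger_point[OF pq(2) c] .
    define v where "v s t = u s (min t r)" for s t
    define h where "h s t = (\<Sum>p\<in>S. restr {c..<r} (B s p) t * v p t)" for s t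
    have v: "v s \<in> Ginf I" "is_gderiv I (v s) (h s)" "no_jump (v s)"
      using lin_sol_stopped[OF B u c r(1,3) s] unfolding v_def[abs_def] h_def[abs_def] .
    have vu: "v s t = u s t" if "t \<in> {p..q}" for s t using that r by (simp add: v_def)
    have hu: "h s t = (\<Sum>r\<in>S. restr {c..} (B s r) t * u r t)" if "t \<in> {p..q}" for t
      using that r unfolding h_def by (intro sum.cong refl) (auto simp: restr_def vu)
    have z: "zero_off {p..q} \<phi>" using pq(4) by (simp add: Rstep_iff)
    have z': "zero_off {p..q} (gderiv I \<phi>)" using Rstep_gderiv[OF pq(4)] by (simp add: Rstep_iff)
    have e: "ae_eq (\<lambda>t. v s t * \<phi> t) (\<lambda>t. u s t * \<phi> t)" by (rule zero_off_ae_eq_mult[OF z vu])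
    note \<phi>G = RR_Ginf[OF \<phi>(1)]
    have "no_jump (\<lambda>t. v s t * \<phi> t)" by (intro no_jump_mult v \<phi> Ginf_GG \<phi>G)
    then have 1: "no_jump (\<lambda>t. u s t * \<phi> t)" by (rule no_jump_ae_eq[OF _ e])
    have "ae_eq (gderiv I (\<lambda>t. v s t * \<phi> t)) (gderiv I (\<lambda>t. u s t * \<phi> t))" by (rule gderiv_cong[OF Ginf_mult[OF v(1) \<phi>G] e])
    moreover have "ae_eq (gderiv I (\<lambda>t. v s t * \<phi> t)) (\<lambda>t. h s t * \<phi> t + v s t * gderiv I \<phi> t)"
      by (intro gderiv_ae_eq is_gderiv_mult v Ginf_GG \<phi>G Ginf_gderiv)
    moreover have "ae_eq (\<lambda>t. h s t * \<phi> t + v s t * gderiv I \<phi> t)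
        (\<lambda>t. (\<Sum>r\<in>S. restr {c..} (B s r) t * u r t) * \<phi> t + u s t * gderiv I \<phi> t)"
      by (intro ae_eq_add zero_off_ae_eq_mult[OF z hu] zero_off_ae_eq_mult[OF z' vu])
    ultimately have "ae_eq (gderiv I (\<lambda>t. u s t * \<phi> t)) (\<lambda>t. (\<Sum>r\<in>S. restr {c..} (B s r) t * u r t) * \<phi> t + u s t * gderiv I \<phi> t)"
      using ae_eq_trans ae_eq_sym by blast
    then show ?thesis using 1 by blast
  qed
  then show ?thesis unfolding mult_deriv_def using G[OF s] G' by blast
qed

text \<open>The columns of \<open>V\<close> start from unit vectors, and the rows of
  \<open>U\<close> solve the adjoint system, whose matrix is minus the transpose of
  \<open>B\<close>. The defect \<open>D\<close> of \<open>V U\<close> from the identity satisfies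
  the integrated form of \<open>D' = B D - D B\<close> and starts at zero, so Gronwall's inequality
  makes it vanish.\<close>

lemma fundamental_matrices:
  assumes B: "bdd_coeffs S B M" and c: "c \<in> I"
  obtains V U where
    "\<And>s r. s \<in> S \<Longrightarrow> r \<in> S \<Longrightarrow> mult_deriv (V s r) (\<lambda>t. \<Sum>q\<in>S. restr {c..} (B s q) t * V q r t)"
    "\<And>s r. s \<in> S \<Longrightarrow> r \<in> S \<Longrightarrow> mult_deriv (U s r) (\<lambda>t. \<Sum>q\<in>S. restr {c..} (\<lambda>t. - B q r t) t * U s q t)"
    "\<And>s r t. s \<in> S \<Longrightarrow> r \<in> S \<Longrightarrow> t \<in> I \<Longrightarrow> (\<Sum>q\<in>S. V s q t * U q r t) = (if s = r then 1 else 0)"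
proof -
  have S: "finite S" using B by (simp add: bdd_coeffs_def)
  define BT where "BT s r t = - B r s t" for s r t
  have BT: "bdd_coeffs S BT M"
    using B Ginf_cmult[of _ "- 1"] unfolding bdd_coeffs_def BT_def[abs_def] by auto
  define \<delta> :: "'a \<Rightarrow> 'a \<Rightarrow> complex" where "\<delta> s r = (if s = r then 1 else 0)" for s r
  have "\<exists>V. \<forall>r. lin_sol S B c (\<lambda>s. \<delta> s r) (V r)" by (intro choice allI lin_sol_exists[OF B c])
  then obtain V where V: "\<And>r. lin_sol S B c (\<lambda>s. \<delta> s r) (V r)" by blast
  have "\<exists>U. \<forall>s. lin_sol S BT c (\<lambda>r. \<delta> s r) (U s)" by (intro choice allI lin_sol_exists[OF BT c])
  then obtain U where U: "\<And>s. lin_sol S BT c (\<lambda>r. \<delta> s r) (U s)" by blast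
  \<comment> \<open>Inside the proof the column index of \<open>V\<close> comes first:
    \<open>V q s\<close> is the entry in row \<open>s\<close> and column \<open>q\<close>.\<close>
  define W where "W s r t = (\<Sum>q\<in>S. V q s t * U q r t)" for s r t
  define D where "D s r t = W s r t - \<delta> s r" for s r t
  have contV: "isCont (V q s) t" and contU: "isCont (U q s) t" if "s \<in> S" "t \<in> I" for q s t
    using V U that by (auto simp: lin_sol_def)
  have Dc: "D s r t = 0" if "s \<in> S" "r \<in> S" "t \<in> I" "t \<le> c" for s r t
  proof -
    have "V q s t = \<delta> s q" "U q r t = \<delta> q r" for q
      using lin_sol_cong[OF V that(1) c that(3,4)] lin_sol_cong[OF U that(2) c that(3,4)] by auto
    then have "W s r t = (\<Sum>q\<in>S. if q = s then \<delta> q r else 0)" unfolding W_def by (intro sum.cong refl) (auto simp: \<delta>_def)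
    then show ?thesis using S that(1) by (simp add: D_def)
  qed
  have Dint: "((\<lambda>z. (\<Sum>p\<in>S. B s p z * D p r z) - (\<Sum>p\<in>S. D s p z * B p r z)) has_integral D s r t) {c..t}"
    if s: "s \<in> S" and r: "r \<in> S" and t: "t \<in> I" "c \<le> t" for s r t
  proof -
    have cu: "continuous_on {c..t} (V q p)" "continuous_on {c..t} (U q p)" if "p \<in> S" for q p
      using contV contU that subsetD[OF Icc_subset_I[OF c t(1)]] by (auto intro!: continuous_at_imp_continuous_on)
    have "((\<lambda>z. (\<Sum>p\<in>S. B s p z * V q p z) * U q r z + V q s z * (\<Sum>p\<in>S. BT r p z * U q p z))
        has_integral (V q s t * U q r t - V q s c * U q r c)) {c..t}" for q
    proof (rule integration_by_parts_indefinite[OF t(2)])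
      show "(\<lambda>z. \<Sum>p\<in>S. B s p z * V q p z) absolutely_integrable_on {c..t}"
        by (intro absolutely_integrable_sum S coeff_absolutely_integrable[OF B s _ c t(1)] cu)
      show "(\<lambda>z. \<Sum>p\<in>S. BT r p z * U q p z) absolutely_integrable_on {c..t}"
        by (intro absolutely_integrable_sum S coeff_absolutely_integrable[OF BT r _ c t(1)] cu)
      fix z assume "z \<in> {c..t}"
      then have "z \<in> I" using Icc_subset_I[OF c t(1)] by blast
      then show "V q s z = \<delta> s q + integral {c..z} (\<lambda>z. \<Sum>p\<in>S. B s p z * V q p z)"
        "U q r z = \<delta> q r + integral {c..z} (\<lambda>z. \<Sum>p\<in>S. BT r p z * U q p z)"
        using V[of q] U[of q] s r by (auto simp: lin_sol_def)
    qed
    then have "((\<lambda>z. \<Sum>q\<in>S. (\<Sum>p\<in>S. B s p z * V q p z) * U q r z + V q s z * (\<Sum>p\<in>S. BT r p z * U q p z))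
        has_integral (\<Sum>q\<in>S. V q s t * U q r t - V q s c * U q r c)) {c..t}"
      by (intro has_integral_sum S)
    moreover have "(\<Sum>q\<in>S. V q s t * U q r t - V q s c * U q r c) = D s r t"
      using Dc[OF s r c] by (simp add: sum_subtractf W_def[symmetric] D_def)
    moreover have "(\<Sum>q\<in>S. (\<Sum>p\<in>S. B s p z * V q p z) * U q r z + V q s z * (\<Sum>p\<in>S. BT r p z * U q p z))
        = (\<Sum>p\<in>S. B s p z * D p r z) - (\<Sum>p\<in>S. D s p z * B p r z)" for z
    proof -
      have "(\<Sum>q\<in>S. (\<Sum>p\<in>S. B s p z * V q p z) * U q r z) = (\<Sum>q\<in>S. \<Sum>p\<in>S. B s p z * (V q p z * U q r z))"
        by (simp add: sum_distrib_right mult.assoc)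
      also have "\<dots> = (\<Sum>p\<in>S. \<Sum>q\<in>S. B s p z * (V q p z * U q r z))" by (rule sum.swap)
      also have "\<dots> = (\<Sum>p\<in>S. B s p z * W p r z)" by (simp add: W_def sum_distrib_left)
      finally have 1: "(\<Sum>q\<in>S. (\<Sum>p\<in>S. B s p z * V q p z) * U q r z) = (\<Sum>p\<in>S. B s p z * W p r z)" .
      have "(\<Sum>q\<in>S. V q s z * (\<Sum>p\<in>S. BT r p z * U q p z)) = (\<Sum>q\<in>S. \<Sum>p\<in>S. - (V q s z * U q p z * B p r z))"
        by (simp add: sum_distrib_left BT_def mult_ac)
      also have "\<dots> = (\<Sum>p\<in>S. \<Sum>q\<in>S. - (V q s z * U q p z * B p r z))" by (rule sum.swap)
      also have "\<dots> = - (\<Sum>p\<in>S. W s p z * B p r z)" by (simp add: W_def sum_distrib_right sum_negf)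
      finally have 2: "(\<Sum>q\<in>S. V q s z * (\<Sum>p\<in>S. BT r p z * U q p z)) = - (\<Sum>p\<in>S. W s p z * B p r z)" .
      have "(\<Sum>p\<in>S. B s p z * D p r z) = (\<Sum>p\<in>S. B s p z * W p r z) - (\<Sum>p\<in>S. B s p z * \<delta> p r)"
        by (simp add: D_def algebra_simps sum_subtractf)
      moreover have "(\<Sum>p\<in>S. B s p z * \<delta> p r) = B s r z"
        using S r by (simp add: \<delta>_def if_distrib[of "\<lambda>x. _ * x"] cong: if_cong)
      moreover have "(\<Sum>p\<in>S. D s p z * B p r z) = (\<Sum>p\<in>S. W s p z * B p r z) - (\<Sum>p\<in>S. \<delta> s p * B p r z)"
        by (simp add: D_def algebra_simps sum_subtractf)
      moreover have "(\<Sum>p\<in>S. \<delta> s p * B p r z) = B s r z"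
        using S s by (simp add: \<delta>_def if_distrib[of "\<lambda>x. x * _"] cong: if_cong)
      ultimately show ?thesis using 1 2 by (simp add: sum.distrib)
    qed
    ultimately show ?thesis by simp
  qed
  define e where "e t = (\<Sum>s\<in>S. \<Sum>r\<in>S. norm (D s r t))" for t
  \<comment> \<open>Each of the \<open>card S * card S\<close> entries of \<open>D\<close>
    contributes two sums of \<open>card S\<close> terms, and every term is at most
    \<open>\<bar>M\<bar> * e t\<close>.\<close>
  define N where "N = \<bar>M\<bar> * (2 * real (card S) ^ 3)"
  have e0: "e t \<le> 0" if t: "t \<in> I" "c \<le> t" for t
  proof (rule gronwall_zero[where e = e and c = c and q = t and L = N])
    show "t \<in> {c..t}" using t by simp
    have cD: "continuous_on {c..t} (D s r)" if "s \<in> S" "r \<in> S" for s r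
      unfolding D_def W_def using contV[OF that(1)] contU[OF that(2)] subsetD[OF Icc_subset_I[OF c t(1)]]
      by (intro continuous_intros continuous_at_imp_continuous_on) auto
    show ce: "continuous_on {c..t} e" unfolding e_def by (intro continuous_intros cD)
    show "N \<ge> 0" by (simp add: N_def)
    fix z assume z: "z \<in> {c..t}"
    then have zI: "z \<in> I" "c \<le> z" using Icc_subset_I[OF c t(1)] by auto
    have ei: "e integrable_on {c..z}"
      by (intro integrable_continuous_real continuous_on_subset[OF ce]) (use z in auto)
    have D1: "norm (D s r z) \<le> integral {c..z} (\<lambda>y. \<bar>M\<bar> * (2 * real (card S) * e y))" if s: "s \<in> S" and r: "r \<in> S" for s r
    proof -
      have "norm (integral {c..z} (\<lambda>y. (\<Sum>p\<in>S. B s p y * D p r y) - (\<Sum>p\<in>S. D s p y * B p r y)))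
         \<le> integral {c..z} (\<lambda>y. \<bar>M\<bar> * (2 * real (card S) * e y))"
      proof (rule integral_norm_bound_integral)
        show "(\<lambda>y. (\<Sum>p\<in>S. B s p y * D p r y) - (\<Sum>p\<in>S. D s p y * B p r y)) integrable_on {c..z}"
          using Dint[OF s r zI] by blast
        show "(\<lambda>y. \<bar>M\<bar> * (2 * real (card S) * e y)) integrable_on {c..z}"
          using ei by (intro integrable_on_mult_right)
        fix y assume "y \<in> {c..z}"
        then have yI: "y \<in> I" using Icc_subset_I[OF c zI(1)] by blast
        have De: "norm (D s r y) \<le> e y" if "s \<in> S" "r \<in> S" for s r
        proof -
          have "norm (D s r y) \<le> (\<Sum>r\<in>S. norm (D s r y))" using that S by (intro member_le_sum) auto
          also have "\<dots> \<le> e y" unfolding e_def using that S by (intro member_le_sum) (auto intro: sum_nonneg)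
          finally show ?thesis .
        qed
        have Bb: "norm (B s r y) \<le> \<bar>M\<bar>" if "s \<in> S" "r \<in> S" for s r
          using B that yI by (force simp: bdd_coeffs_def)
        have "norm (\<Sum>p\<in>S. B s p y * D p r y) \<le> (\<Sum>p\<in>S. \<bar>M\<bar> * e y)"
          by (rule sum_norm_le) (auto simp: norm_mult intro!: mult_mono Bb De s r)
        moreover have "norm (\<Sum>p\<in>S. D s p y * B p r y) \<le> (\<Sum>p\<in>S. e y * \<bar>M\<bar>)"
          by (rule sum_norm_le) (auto simp: norm_mult intro!: mult_mono Bb De s r order_trans[OF norm_ge_zero De])
        ultimately have "norm ((\<Sum>p\<in>S. B s p y * D p r y) - (\<Sum>p\<in>S. D s p y * B p r y)) \<le> (\<Sum>p\<in>S. \<bar>M\<bar> * e y) + (\<Sum>p\<in>S. e y * \<bar>M\<bar>)"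
          by (rule order_trans[OF norm_triangle_ineq4 add_mono])
        then show "norm ((\<Sum>p\<in>S. B s p y * D p r y) - (\<Sum>p\<in>S. D s p y * B p r y)) \<le> \<bar>M\<bar> * (2 * real (card S) * e y)"
          by (simp add: algebra_simps)
      qed
      then show ?thesis using integral_unique[OF Dint[OF s r zI]] by simp
    qed
    have "e z \<le> (\<Sum>s\<in>S. \<Sum>r\<in>S. integral {c..z} (\<lambda>y. \<bar>M\<bar> * (2 * real (card S) * e y)))"
      unfolding e_def[of z] by (intro sum_mono D1)
    also have "\<dots> = N * integral {c..z} e" by (simp add: N_def power3_eq_cube mult_ac)
    finally show "e z \<le> N * integral {c..z} e" .
  qed
  have D0: "D s r t = 0" if s: "s \<in> S" and r: "r \<in> S" and t: "t \<in> I" for s r t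
  proof (cases "t \<le> c")
    case True then show ?thesis by (rule Dc[OF s r t])
  next
    case False
    then have "e t \<le> 0" by (intro e0 t) simp
    then have "e t = 0" unfolding e_def by (intro antisym sum_nonneg) auto
    then have "(\<Sum>r\<in>S. norm (D s r t)) = 0" unfolding e_def using S s
      by (subst (asm) sum_nonneg_eq_0_iff) (auto intro: sum_nonneg)
    then show ?thesis using S r by (subst (asm) sum_nonneg_eq_0_iff) auto
  qed
  show thesis
  proof (rule that[of "\<lambda>s r. V r s" "\<lambda>s r. U s r"])
    fix s r assume sr: "s \<in> S" "r \<in> S"
    show "mult_deriv (V r s) (\<lambda>t. \<Sum>q\<in>S. restr {c..} (B s q) t * V r q t)" by (rule lin_sol_mult_deriv[OF B V c sr(1)])
    show "mult_deriv (U s r) (\<lambda>t. \<Sum>q\<in>S. restr {c..} (\<lambda>t. - B q r t) t * U s q t)"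
      using lin_sol_mult_deriv[OF BT U c sr(2), of s] unfolding BT_def[abs_def] .
  next
    fix s r t assume "s \<in> S" "r \<in> S" "t \<in> I"
    from D0[OF this] show "(\<Sum>q\<in>S. V q s t * U q r t) = (if s = r then 1 else 0)"
      by (simp add: D_def W_def \<delta>_def)
  qed
qed

section \<open>Existence and uniqueness for systems of distributions\<close>

definition dist_system :: "'s set \<Rightarrow> ('s \<Rightarrow> 's \<Rightarrow> real \<Rightarrow> complex) \<Rightarrow> ('s \<Rightarrow> functional) \<Rightarrow> real \<Rightarrow> ('s \<Rightarrow> functional) \<Rightarrow> bool" where
  "dist_system S B G t0 y \<longleftrightarrow> (\<forall>s\<in>S. null_before t0 (y s) \<and>
     weak_deriv (y s) (\<lambda>\<phi>. (\<Sum>r\<in>S. y r (\<lambda>t. B s r t * \<phi> t)) + G s \<phi>))"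

lemma left_points:
  assumes "t0 \<in> I" obtains c c' where "c \<in> I" "c < c'" "c' < t0"
proof -
  obtain d where d: "d > 0" "\<And>s. \<bar>s - t0\<bar> < d \<Longrightarrow> s \<in> I" using I_ball[OF assms] by metis
  show thesis by (rule that[of "t0 - d / 2" "t0 - d / 4"]) (use d in auto)
qed

lemma null_before_restr:
  assumes f: "f \<in> RR_dual I" "null_before t0 f" and c: "c < t0" and B: "B \<in> Ginf I" and \<phi>: "\<phi> \<in> RR I"
  shows "f (\<lambda>t. restr {c..} B t * \<phi> t) = f (\<lambda>t. B t * \<phi> t)"
proof (rule null_before_agree[OF f(2,1) c])
  show "zero_off {..c} (\<lambda>t. restr {c..} B t * \<phi> t - B t * \<phi> t)" by (rule zero_off_I) (auto simp: restr_def)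
qed (auto intro!: RR_mult restr_Ginf_mult decides_Ici B \<phi>)

lemma dual_Gloc_sum:
  assumes f: "f \<in> RR_dual I" and u: "\<And>i. i \<in> S \<Longrightarrow> u i \<in> Gloc" and \<phi>: "\<phi> \<in> RR I"
  shows "f (\<lambda>t. (\<Sum>i\<in>S. u i t) * \<phi> t) = (\<Sum>i\<in>S. f (\<lambda>t. u i t * \<phi> t))"
  using dual_sum[OF f, of S "\<lambda>i t. u i t * \<phi> t"] Gloc_RR[OF u \<phi>] by (simp add: sum_distrib_right)

text \<open>The identity \<open>V U = 1\<close> carried over to distributions. It has two uses:
  recovering a solution from \<open>U y\<close>, and recovering the right-hand side from
  \<open>U G\<close>.\<close>

lemma matrix_identity_sum:
  assumes S: "finite S" and y: "\<And>q. q \<in> S \<Longrightarrow> y q \<in> RR_dual I" and \<phi>: "\<phi> \<in> RR I" and s: "s \<in> S"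
    and G: "\<And>r q. r \<in> S \<Longrightarrow> q \<in> S \<Longrightarrow> V r q \<in> Gloc" "\<And>r q. r \<in> S \<Longrightarrow> q \<in> S \<Longrightarrow> U r q \<in> Gloc"
    and VU: "\<And>s r t. s \<in> S \<Longrightarrow> r \<in> S \<Longrightarrow> t \<in> I \<Longrightarrow> (\<Sum>q\<in>S. V s q t * U q r t) = (if s = r then 1 else 0)"
  shows "(\<Sum>r\<in>S. \<Sum>q\<in>S. y q (\<lambda>t. U r q t * (V s r t * \<phi> t))) = y s \<phi>"
proof -
  have "(\<Sum>r\<in>S. \<Sum>q\<in>S. y q (\<lambda>t. U r q t * (V s r t * \<phi> t))) = (\<Sum>q\<in>S. \<Sum>r\<in>S. y q (\<lambda>t. V s r t * U r q t * \<phi> t))"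
    by (subst sum.swap) (simp add: mult_ac)
  also have "\<dots> = (\<Sum>q\<in>S. y q (\<lambda>t. (\<Sum>r\<in>S. V s r t * U r q t) * \<phi> t))"
    by (intro sum.cong refl dual_Gloc_sum[symmetric] y \<phi> Gloc_mult G s)
  also have "\<dots> = (\<Sum>q\<in>S. if q = s then y s \<phi> else 0)"
  proof (rule sum.cong[OF refl])
    fix q assume q: "q \<in> S"
    have "ae_eq (\<lambda>t. (\<Sum>r\<in>S. V s r t * U r q t) * \<phi> t) (\<lambda>t. (if s = q then 1 else 0) * \<phi> t)"
      by (rule ae_eq_I) (simp only: VU[OF s q])
    moreover have "(\<lambda>t. (\<Sum>r\<in>S. V s r t * U r q t) * \<phi> t) \<in> RR I"
      by (auto intro!: Gloc_RR Gloc_sum Gloc_mult G s q \<phi>)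
    ultimately have "y q (\<lambda>t. (\<Sum>r\<in>S. V s r t * U r q t) * \<phi> t) = y q (\<lambda>t. (if s = q then 1 else 0) * \<phi> t)"
      by (intro dual_ae_eq[OF y[OF q]])
    then show "y q (\<lambda>t. (\<Sum>r\<in>S. V s r t * U r q t) * \<phi> t) = (if q = s then y s \<phi> else 0)"
      using dual_zero[OF y[OF q]] by auto
  qed
  also have "\<dots> = y s \<phi>" using S s by simp
  finally show ?thesis .
qed

text \<open>In \<open>w = U y\<close> the terms with \<open>B\<close> cancel, so \<open>U G\<close>
  is a derivative of \<open>w\<close> and \<open>w\<close> must be the explicit antiderivative
  \<open>W\<close>. Hence \<open>y = V W\<close>, which proves uniqueness; differentiating
  \<open>V W\<close> in turn shows that it solves the system.\<close>

theorem dist_system_solution: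
  assumes B: "bdd_coeffs S B M" and t0: "t0 \<in> I"
    and G: "\<And>s. s \<in> S \<Longrightarrow> G s \<in> RR_dual I" "\<And>s. s \<in> S \<Longrightarrow> null_before t0 (G s)"
  shows "\<exists>y. dist_system S B G t0 y"
    and "dist_system S B G t0 y \<Longrightarrow> dist_system S B G t0 y' \<Longrightarrow> s \<in> S \<Longrightarrow> \<psi> \<in> RR I \<Longrightarrow> y s \<psi> = y' s \<psi>"
proof -
  \<comment> \<open>The coefficients are cut off at \<open>c\<close>, and the ramp climbs between
    \<open>c\<close> and \<open>c'\<close>. Both points lie before \<open>t0\<close>, so neither
    modification is visible to the distributions involved.\<close>
  obtain c c' where c: "c \<in> I" "c < c'" "c' < t0" using left_points[OF t0] .
  have ct: "c < t0" using c by simp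
  have S: "finite S" and BG: "\<And>s r. s \<in> S \<Longrightarrow> r \<in> S \<Longrightarrow> B s r \<in> Ginf I" using B by (auto simp: bdd_coeffs_def)
  have BG': "(\<lambda>t. - B s r t) \<in> Ginf I" if "s \<in> S" "r \<in> S" for s r using Ginf_cmult[OF BG[OF that], of "- 1"] by simp
  obtain V U where V: "\<And>s r. s \<in> S \<Longrightarrow> r \<in> S \<Longrightarrow> mult_deriv (V s r) (\<lambda>t. \<Sum>q\<in>S. restr {c..} (B s q) t * V q r t)"
    and U: "\<And>s r. s \<in> S \<Longrightarrow> r \<in> S \<Longrightarrow> mult_deriv (U s r) (\<lambda>t. \<Sum>q\<in>S. restr {c..} (\<lambda>t. - B q r t) t * U s q t)"
    and VU: "\<And>s r t. s \<in> S \<Longrightarrow> r \<in> S \<Longrightarrow> t \<in> I \<Longrightarrow> (\<Sum>q\<in>S. V s q t * U q r t) = (if s = r then 1 else 0)"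
    by (rule fundamental_matrices[OF B c(1)]) blast
  have VG: "V s r \<in> Gloc" and UG: "U s r \<in> Gloc" if "s \<in> S" "r \<in> S" for s r
    using V[OF that] U[OF that] by (auto simp: mult_deriv_def)
  have cG: "restr {c..} (B s r) \<in> Gloc" "restr {c..} (\<lambda>t. - B s r t) \<in> Gloc" if "s \<in> S" "r \<in> S" for s r
    by (intro Ginf_Gloc restr_Ginf_mult decides_Ici BG BG' that; simp)+
  define H where "H s \<phi> = (\<Sum>r\<in>S. G r (\<lambda>t. U s r t * \<phi> t))" for s \<phi>
  have HD: "H s \<in> RR_dual I" "null_before t0 (H s)" if "s \<in> S" for s
    unfolding H_def using that by (auto intro!: dual_finsum dual_gmult null_before_sum null_before_mult UG G)
  define W where "W s \<psi> = - H s (\<lambda>t. ramp c c' t * tail_int \<psi> t)" for s \<psi>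
  have WD: "weak_deriv (W s) (H s)" "null_before t0 (W s)" if "s \<in> S" for s
    unfolding W_def using antiderivative[OF HD[OF that] c(2,3,1)] by auto
  have WR: "W s \<in> RR_dual I" if "s \<in> S" for s using WD(1)[OF that] by (simp add: weak_deriv_def)
  have rep: "y s \<psi> = (\<Sum>r\<in>S. W r (\<lambda>t. V s r t * \<psi> t))"
    if y: "dist_system S B G t0 y" and s: "s \<in> S" and \<psi>: "\<psi> \<in> RR I" for y s \<psi>
  proof -
    have yD: "weak_deriv (y r) (\<lambda>\<phi>. (\<Sum>q\<in>S. y q (\<lambda>t. B r q t * \<phi> t)) + G r \<phi>)" and yv: "null_before t0 (y r)" if "r \<in> S" for r
      using y that by (auto simp: dist_system_def)
    have yR: "y r \<in> RR_dual I" if "r \<in> S" for r using yD[OF that] by (simp add: weak_deriv_def)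
    define w where "w s \<phi> = (\<Sum>r\<in>S. y r (\<lambda>t. U s r t * \<phi> t))" for s \<phi>
    have wD: "weak_deriv (w s) (H s)" if s: "s \<in> S" for s
    proof (rule weak_deriv_cong)
      show "weak_deriv (\<lambda>\<phi>. \<Sum>r\<in>S. y r (\<lambda>t. U s r t * \<phi> t))
        (\<lambda>\<phi>. \<Sum>r\<in>S. y r (\<lambda>t. (\<Sum>q\<in>S. restr {c..} (\<lambda>t. - B q r t) t * U s q t) * \<phi> t) +
            ((\<Sum>q\<in>S. y q (\<lambda>t. B r q t * (U s r t * \<phi> t))) + G r (\<lambda>t. U s r t * \<phi> t)))"
        by (intro weak_deriv_sum weak_deriv_mult yD U s)
      fix \<phi> assume \<phi>: "\<phi> \<in> RR I"
      have U\<phi>: "(\<lambda>t. U s r t * \<phi> t) \<in> RR I" if "r \<in> S" for r by (rule Gloc_RR[OF UG[OF s that] \<phi>])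
      have 1: "y r (\<lambda>t. (\<Sum>q\<in>S. restr {c..} (\<lambda>t. - B q r t) t * U s q t) * \<phi> t) =
          (\<Sum>q\<in>S. - y r (\<lambda>t. B q r t * (U s q t * \<phi> t)))" if r: "r \<in> S" for r
      proof -
        have "y r (\<lambda>t. (\<Sum>q\<in>S. restr {c..} (\<lambda>t. - B q r t) t * U s q t) * \<phi> t) =
          (\<Sum>q\<in>S. y r (\<lambda>t. restr {c..} (\<lambda>t. - B q r t) t * U s q t * \<phi> t))"
          by (rule dual_Gloc_sum) (auto intro!: yR r \<phi> Gloc_mult cG UG s)
        also have "\<dots> = (\<Sum>q\<in>S. - y r (\<lambda>t. B q r t * (U s q t * \<phi> t)))"
        proof (rule sum.cong[OF refl])
          fix q assume q: "q \<in> S"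
          have "y r (\<lambda>t. restr {c..} (\<lambda>t. - B q r t) t * (U s q t * \<phi> t)) = y r (\<lambda>t. - B q r t * (U s q t * \<phi> t))"
            by (rule null_before_restr[OF yR[OF r] yv[OF r] ct BG'[OF q r] U\<phi>[OF q]])
          also have "\<dots> = - y r (\<lambda>t. B q r t * (U s q t * \<phi> t))"
            using dual_cmult[OF yR[OF r] RR_mult[OF BG[OF q r] U\<phi>[OF q]], of "- 1"] by simp
          finally show "y r (\<lambda>t. restr {c..} (\<lambda>t. - B q r t) t * U s q t * \<phi> t) = - y r (\<lambda>t. B q r t * (U s q t * \<phi> t))"
            by (simp add: mult.assoc)
        qed
        finally show ?thesis .
      qed
      have "(\<Sum>r\<in>S. y r (\<lambda>t. (\<Sum>q\<in>S. restr {c..} (\<lambda>t. - B q r t) t * U s q t) * \<phi> t) +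
            ((\<Sum>q\<in>S. y q (\<lambda>t. B r q t * (U s r t * \<phi> t))) + G r (\<lambda>t. U s r t * \<phi> t)))
         = (\<Sum>r\<in>S. (\<Sum>q\<in>S. - y r (\<lambda>t. B q r t * (U s q t * \<phi> t)))) +
           (\<Sum>r\<in>S. \<Sum>q\<in>S. y q (\<lambda>t. B r q t * (U s r t * \<phi> t))) + H s \<phi>"
        by (simp add: 1 sum.distrib H_def add.assoc)
      also have "(\<Sum>r\<in>S. (\<Sum>q\<in>S. - y r (\<lambda>t. B q r t * (U s q t * \<phi> t)))) =
          - (\<Sum>r\<in>S. \<Sum>q\<in>S. y q (\<lambda>t. B r q t * (U s r t * \<phi> t)))"
        by (subst sum.swap) (simp add: sum_negf)
      finally show "(\<Sum>r\<in>S. y r (\<lambda>t. (\<Sum>q\<in>S. restr {c..} (\<lambda>t. - B q r t) t * U s q t) * \<phi> t) +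
            ((\<Sum>q\<in>S. y q (\<lambda>t. B r q t * (U s r t * \<phi> t))) + G r (\<lambda>t. U s r t * \<phi> t))) = H s \<phi>"
        by simp
    qed (simp add: w_def)
    have wv: "null_before t0 (w s)" if "s \<in> S" for s
      unfolding w_def using that by (intro null_before_sum null_before_mult yv UG)
    have wW: "w r \<phi> = W r \<phi>" if "r \<in> S" "\<phi> \<in> RR I" for r \<phi>
      unfolding W_def by (rule weak_deriv_representation[OF wD[OF that(1)] wv[OF that(1)] c(2,3,1) that(2)])
    have "y s \<psi> = (\<Sum>r\<in>S. \<Sum>q\<in>S. y q (\<lambda>t. U r q t * (V s r t * \<psi> t)))"
      by (rule matrix_identity_sum[OF S yR \<psi> s VG UG VU, symmetric])
    also have "\<dots> = (\<Sum>r\<in>S. w r (\<lambda>t. V s r t * \<psi> t))" by (simp add: w_def)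
    also have "\<dots> = (\<Sum>r\<in>S. W r (\<lambda>t. V s r t * \<psi> t))" by (intro sum.cong refl wW Gloc_RR VG s \<psi>)
    finally show ?thesis .
  qed
  show "y s \<psi> = y' s \<psi>" if "dist_system S B G t0 y" "dist_system S B G t0 y'" "s \<in> S" "\<psi> \<in> RR I"
    using rep[OF that(1,3,4)] rep[OF that(2,3,4)] by simp
  define y where "y s \<psi> = (\<Sum>r\<in>S. W r (\<lambda>t. V s r t * \<psi> t))" for s \<psi>
  have yR: "y s \<in> RR_dual I" "null_before t0 (y s)" if "s \<in> S" for s
    unfolding y_def using that by (auto intro!: dual_finsum dual_gmult null_before_sum null_before_mult VG WR WD)
  have "weak_deriv (y s) (\<lambda>\<phi>. (\<Sum>r\<in>S. y r (\<lambda>t. B s r t * \<phi> t)) + G s \<phi>)" if s: "s \<in> S" for s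
  proof (rule weak_deriv_cong)
    show "weak_deriv (\<lambda>\<phi>. \<Sum>r\<in>S. W r (\<lambda>t. V s r t * \<phi> t))
       (\<lambda>\<phi>. \<Sum>r\<in>S. W r (\<lambda>t. (\<Sum>q\<in>S. restr {c..} (B s q) t * V q r t) * \<phi> t) + H r (\<lambda>t. V s r t * \<phi> t))"
      by (intro weak_deriv_sum weak_deriv_mult WD V s)
    fix \<phi> assume \<phi>: "\<phi> \<in> RR I"
    have "(\<Sum>r\<in>S. W r (\<lambda>t. (\<Sum>q\<in>S. restr {c..} (B s q) t * V q r t) * \<phi> t)) =
        (\<Sum>r\<in>S. \<Sum>q\<in>S. W r (\<lambda>t. restr {c..} (B s q) t * V q r t * \<phi> t))"
      by (intro sum.cong refl dual_Gloc_sum WR \<phi> Gloc_mult cG VG s)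
    also have "\<dots> = (\<Sum>q\<in>S. y q (\<lambda>t. restr {c..} (B s q) t * \<phi> t))"
      by (subst sum.swap) (simp add: y_def mult_ac)
    also have "\<dots> = (\<Sum>q\<in>S. y q (\<lambda>t. B s q t * \<phi> t))"
      by (intro sum.cong refl null_before_restr[OF _ _ ct] yR BG s \<phi>)
    finally have 1: "(\<Sum>r\<in>S. W r (\<lambda>t. (\<Sum>q\<in>S. restr {c..} (B s q) t * V q r t) * \<phi> t)) = (\<Sum>q\<in>S. y q (\<lambda>t. B s q t * \<phi> t))" .
    have "(\<Sum>r\<in>S. H r (\<lambda>t. V s r t * \<phi> t)) = G s \<phi>"
      unfolding H_def by (rule matrix_identity_sum[OF S G(1) \<phi> s VG UG VU])
    with 1 show "(\<Sum>r\<in>S. W r (\<lambda>t. (\<Sum>q\<in>S. restr {c..} (B s q) t * V q r t) * \<phi> t) + H r (\<lambda>t. V s r t * \<phi> t)) =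
        (\<Sum>r\<in>S. y r (\<lambda>t. B s r t * \<phi> t)) + G s \<phi>" by (simp add: sum.distrib)
  qed (simp add: y_def)
  then have "dist_system S B G t0 y" unfolding dist_system_def using yR by blast
  then show "\<exists>y. dist_system S B G t0 y" by (rule exI[where x = y])
qed

end

lemma sum_functional_apply: "(\<Sum>i\<in>S. (f i :: functional)) \<phi> = (\<Sum>i\<in>S. f i \<phi>)"
  by (induction S rule: infinite_finite_induct) auto

context dyn_interval
begin

section \<open>Reduction of the Cauchy problem to a first order system\<close>

text \<open>The Volterra equation needs coefficients which are bounded everywhere, not only almost everywhere.\<close>

definition ae_bounded :: "(real \<Rightarrow> complex) \<Rightarrow> real \<Rightarrow> complex" where
  "ae_bounded g t = (if norm (g t) \<le> Gnorm I 0 g then g t else 0)"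

lemma ae_bounded:
  assumes g: "g \<in> Ginf I"
  shows "ae_eq g (ae_bounded g)" "ae_bounded g \<in> Ginf I" "norm (ae_bounded g t) \<le> Gnorm I 0 g"
proof -
  show e: "ae_eq g (ae_bounded g)"
    using Gnorm_AE[OF g le0, of 0] unfolding ae_eq_def ae_bounded_def by (rule eventually_mono) simp
  show "ae_bounded g \<in> Ginf I" by (rule Ginf_ae_eq[OF g e])
  show "norm (ae_bounded g t) \<le> Gnorm I 0 g" using Gnorm_nonneg[OF g] by (simp add: ae_bounded_def)
qed

lemma dual_ae_bounded:
  assumes "f \<in> RR_dual I" "g \<in> Ginf I" "\<phi> \<in> RR I" shows "f (\<lambda>t. g t * \<phi> t) = f (\<lambda>t. ae_bounded g t * \<phi> t)"
  by (rule dual_ae_eq[OF assms(1) RR_mult[OF assms(2,3)] ae_eq_mult[OF ae_bounded(1)[OF assms(2)] ae_eq_refl]])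

lemma delta_slim: "delta I t0 k \<alpha> \<phi> = (-1) ^ k * (\<alpha> * slim True (gderivs I k \<phi>) t0 + (1 - \<alpha>) * slim False (gderivs I k \<phi>) t0)"
  by (simp add: delta_def slim_def)

lemma delta_dual:
  assumes t0: "t0 \<in> I" shows "delta I t0 k \<alpha> \<in> RR_dual I"
proof (rule RR_dualI)
  fix \<phi> \<psi> assume "\<phi> \<in> RR I" "\<psi> \<in> RR I"
  then have g: "\<phi> \<in> Ginf I" "\<psi> \<in> Ginf I" by (auto intro: RR_Ginf)
  have "slim \<sigma> (gderivs I k (\<lambda>t. \<phi> t + \<psi> t)) t0 = slim \<sigma> (gderivs I k \<phi>) t0 + slim \<sigma> (gderivs I k \<psi>) t0" for \<sigma>
    using slim_ae_eq_cong[OF gderivs_add[OF g] t0] slim_add[OF Ginf_GG[OF Ginf_gderivs[OF g(1)]] Ginf_GG[OF Ginf_gderivs[OF g(2)]] t0]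
    by simp
  then show "delta I t0 k \<alpha> (\<lambda>t. \<phi> t + \<psi> t) = delta I t0 k \<alpha> \<phi> + delta I t0 k \<alpha> \<psi>"
    by (simp add: delta_slim algebra_simps)
next
  fix c \<phi> assume "\<phi> \<in> RR I"
  then have g: "\<phi> \<in> Ginf I" by (rule RR_Ginf)
  have "slim \<sigma> (gderivs I k (\<lambda>t. c * \<phi> t)) t0 = c * slim \<sigma> (gderivs I k \<phi>) t0" for \<sigma>
    using slim_ae_eq_cong[OF gderivs_cmult[OF g] t0] slim_mult[OF GG_const Ginf_GG[OF Ginf_gderivs[OF g]] t0] by simp
  then show "delta I t0 k \<alpha> (\<lambda>t. c * \<phi> t) = c * delta I t0 k \<alpha> \<phi>"
    by (simp add: delta_slim algebra_simps)
next
  fix p q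
  show "\<exists>k' C. \<forall>\<phi>\<in>Rstep I {p..q}. norm (delta I t0 k \<alpha> \<phi>) \<le> C * Gnorm I k' \<phi>"
  proof (intro exI ballI)
    fix \<phi> assume "\<phi> \<in> Rstep I {p..q}"
    then have g: "\<phi> \<in> Ginf I" by (simp add: Rstep_iff)
    have s: "norm (slim \<sigma> (gderivs I k \<phi>) t0) \<le> Gnorm I k \<phi>" for \<sigma>
      by (rule slim_norm_le[OF Ginf_GG[OF Ginf_gderivs[OF g]] t0 Gnorm_AE[OF g order_refl]])
    have "norm (delta I t0 k \<alpha> \<phi>) \<le> norm \<alpha> * Gnorm I k \<phi> + norm (1 - \<alpha>) * Gnorm I k \<phi>"
      unfolding delta_slim norm_mult norm_power
      by (auto simp: norm_mult intro!: norm_triangle_mono mult_left_mono s)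
    then show "norm (delta I t0 k \<alpha> \<phi>) \<le> (norm \<alpha> + norm (1 - \<alpha>)) * Gnorm I k \<phi>" by (simp add: algebra_simps)
  qed
qed

lemma null_before_delta:
  assumes t0: "t0 \<in> I" shows "null_before t0 (delta I t0 k \<alpha>)"
  unfolding null_before_iff
proof (intro allI impI ballI)
  fix c \<phi> assume c: "c < t0" and \<phi>: "\<phi> \<in> RR I" "zero_off {..c} \<phi>"
  have "\<phi> \<in> Rstep I {..c}" using \<phi> by (simp add: Rstep_iff RR_Ginf)
  then have "zero_off {..c} (gderivs I k \<phi>)" using gderivs_Rstep[of \<phi> "{..c}"] by (simp add: Rstep_iff)
  then have "slim \<sigma> (gderivs I k \<phi>) t0 = 0" for \<sigma> using t0 c by (intro zero_off_slim[of "{..c}"]) auto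
  then show "delta I t0 k \<alpha> \<phi> = 0" by (simp add: delta_slim)
qed

text \<open>The required identity holds by definition even on test functions with jumps, with
  \<open>\<alpha>\<close> unchanged.\<close>

lemma weak_deriv_delta: "t0 \<in> I \<Longrightarrow> weak_deriv (delta I t0 k \<alpha>) (delta I t0 (Suc k) \<alpha>)"
  unfolding weak_deriv_def by (auto simp: delta_dual delta_def gderivs_Suc)

text \<open>Here \<open>\<alpha>\<close> drops out: the two one-sided values agree and their weights
  add up to one.\<close>

lemma delta_no_jump: "t0 \<in> I \<Longrightarrow> no_jump \<phi> \<Longrightarrow> delta I t0 0 \<alpha> \<phi> = slim True \<phi> t0"
  by (simp add: delta_slim no_jump_def algebra_simps)

text \<open>A derivative may be altered at will on test functions with jumps as long as it stays
  continuous. This is how one value of \<open>\<alpha>\<close> is exchanged for another.\<close>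

lemma weak_deriv_change:
  assumes "weak_deriv w h" "h' \<in> RR_dual I" "\<And>\<phi>. \<phi> \<in> RR I \<Longrightarrow> no_jump \<phi> \<Longrightarrow> h \<phi> = h' \<phi>" shows "weak_deriv w h'"
  using assms unfolding weak_deriv_def by auto

lemma weak_deriv_scale: "weak_deriv w h \<Longrightarrow> weak_deriv (\<lambda>\<phi>. c * w \<phi>) (\<lambda>\<phi>. c * h \<phi>)"
  unfolding weak_deriv_def by (auto intro: dual_scale)

lemma weak_deriv_plus: "weak_deriv w h \<Longrightarrow> weak_deriv w' h' \<Longrightarrow> weak_deriv (\<lambda>\<phi>. w \<phi> + w' \<phi>) (\<lambda>\<phi>. h \<phi> + h' \<phi>)"
  unfolding weak_deriv_def by (auto intro: dual_plus)

definition dsum :: "(nat \<Rightarrow> complex) \<Rightarrow> real \<Rightarrow> complex \<Rightarrow> nat \<Rightarrow> functional" where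
  "dsum x t0 \<alpha> k \<phi> = (\<Sum>l<k. x l * delta I t0 (k - l - 1) \<alpha> \<phi>)"

text \<open>Differentiation raises every order by one. The one term of the next sum that does not
  arise in this way is \<open>l = k\<close>, a plain delta; it becomes the source in the rows of
  level \<open>k\<close> of the first order system.\<close>

lemma dsum:
  assumes t0: "t0 \<in> I"
  shows "dsum x t0 \<alpha> k \<in> RR_dual I" "null_before t0 (dsum x t0 \<alpha> k)"
    "weak_deriv (dsum x t0 \<alpha> k) (\<lambda>\<phi>. dsum x t0 \<alpha> (Suc k) \<phi> - x k * delta I t0 0 \<alpha> \<phi>)"
proof -
  show "dsum x t0 \<alpha> k \<in> RR_dual I" unfolding dsum_def[abs_def] by (intro dual_finsum dual_scale delta_dual t0)
  show "null_before t0 (dsum x t0 \<alpha> k)" using null_before_delta[OF t0] unfolding null_before_def dsum_def by simp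
  have "weak_deriv (\<lambda>\<phi>. \<Sum>l<k. x l * delta I t0 (k - l - 1) \<alpha> \<phi>) (\<lambda>\<phi>. \<Sum>l<k. x l * delta I t0 (Suc (k - l - 1)) \<alpha> \<phi>)"
    by (intro weak_deriv_sum weak_deriv_scale weak_deriv_delta t0)
  moreover have "(\<Sum>l<k. x l * delta I t0 (Suc (k - l - 1)) \<alpha> \<phi>) = dsum x t0 \<alpha> (Suc k) \<phi> - x k * delta I t0 0 \<alpha> \<phi>" for \<phi>
    unfolding dsum_def by (auto intro!: sum.cong simp: Suc_diff_Suc)
  ultimately show "weak_deriv (dsum x t0 \<alpha> k) (\<lambda>\<phi>. dsum x t0 \<alpha> (Suc k) \<phi> - x k * delta I t0 0 \<alpha> \<phi>)"
    by (simp add: dsum_def[abs_def])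
qed

text \<open>The unknowns of the first order system are indexed by pairs \<open>(k, p)\<close>: the \<open>p\<close>-th entry of a fixed column of the
  \<open>k\<close>-th derivative.\<close>

definition comp_coeff :: "nat \<Rightarrow> (nat \<Rightarrow> real \<Rightarrow> complex ^ 'n ^ 'n) \<Rightarrow> nat \<times> 'n \<Rightarrow> nat \<times> 'n::finite \<Rightarrow> real \<Rightarrow> complex" where
  "comp_coeff m A s r = (if Suc (fst s) < m then (\<lambda>_. if r = (Suc (fst s), snd s) then 1 else 0)
     else ae_bounded (\<lambda>t. A (fst r) t $ snd s $ snd r))"

text \<open>The last argument of \<open>delta\<close> is the parameter \<open>\<alpha>\<close>,
  frozen at \<open>0\<close>; the system therefore does not mention \<open>\<alpha>\<close>. The
  delta in each row acts as the impulse that produces the initial value.\<close>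

definition comp_rhs :: "nat \<Rightarrow> (nat \<Rightarrow> complex ^ 'n ^ 'n) \<Rightarrow> real \<Rightarrow> 'n dist_mat \<Rightarrow> 'n \<Rightarrow> nat \<times> 'n::finite \<Rightarrow> functional" where
  "comp_rhs m X t0 F j s \<phi> = X (fst s) $ snd s $ j * delta I t0 0 0 \<phi> + (if Suc (fst s) < m then 0 else (F $ snd s $ j) \<phi>)"

lemma comp_coeff_bdd:
  fixes A :: "nat \<Rightarrow> real \<Rightarrow> complex ^ 'n ^ 'n::finite"
  assumes A: "\<And>k. k < m \<Longrightarrow> A k \<in> Ginf_mat I"
  shows "\<exists>M. bdd_coeffs ({..<m} \<times> UNIV) (comp_coeff m A) M"
proof -
  define S where "S = {..<m} \<times> (UNIV :: 'n set)"
  have S: "finite S" by (simp add: S_def)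
  have AG: "(\<lambda>t. A k t $ p $ q) \<in> Ginf I" if "k < m" for k p q using A[OF that] by (simp add: Ginf_mat_def)
  \<comment> \<open>The summand \<open>1\<close> covers the unit entries in the upper rows.\<close>
  define M where "M = 1 + (\<Sum>s\<in>S. \<Sum>r\<in>S. Gnorm I 0 (\<lambda>t. A (fst r) t $ snd s $ snd r))"
  have N: "Gnorm I 0 (\<lambda>t. A (fst r) t $ snd s $ snd r) \<ge> 0" if "r \<in> S" for r s
    using that by (intro Gnorm_nonneg AG) (auto simp: S_def)
  have "norm (comp_coeff m A s r t) \<le> M" if sr: "s \<in> S" "r \<in> S" for s r t
  proof -
    have "Gnorm I 0 (\<lambda>t. A (fst r) t $ snd s $ snd r) \<le> (\<Sum>r\<in>S. Gnorm I 0 (\<lambda>t. A (fst r) t $ snd s $ snd r))"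
      using sr S N by (intro member_le_sum) auto
    also have "\<dots> \<le> (\<Sum>s\<in>S. \<Sum>r\<in>S. Gnorm I 0 (\<lambda>t. A (fst r) t $ snd s $ snd r))"
      using sr S N by (intro member_le_sum[where f = "\<lambda>s. \<Sum>r\<in>S. Gnorm I 0 (\<lambda>t. A (fst r) t $ snd s $ snd r)"]) (auto intro: sum_nonneg)
    finally have "Gnorm I 0 (\<lambda>t. A (fst r) t $ snd s $ snd r) \<le> M" and "1 \<le> M"
      using N by (auto simp: M_def intro!: sum_nonneg)
    then show ?thesis
      using ae_bounded(3)[OF AG[of "fst r" "snd s" "snd r"], of t] sr by (auto simp: comp_coeff_def S_def)
  qed
  moreover have "comp_coeff m A s r \<in> Ginf I" if "r \<in> S" for s r
    using that by (auto simp: comp_coeff_def S_def intro!: ae_bounded AG)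
  ultimately have "bdd_coeffs S (comp_coeff m A) M" using S by (auto simp: bdd_coeffs_def)
  then show ?thesis unfolding S_def by blast
qed

lemma comp_sum_shift:
  assumes k: "Suc k < m" and y: "\<And>s. s \<in> {..<m} \<times> UNIV \<Longrightarrow> y s \<in> RR_dual I"
  shows "(\<Sum>r\<in>{..<m} \<times> UNIV. y r (\<lambda>t. comp_coeff m A (k, p) r t * \<phi> t)) = y (Suc k, p) \<phi>"
proof -
  have "(\<Sum>r\<in>{..<m} \<times> UNIV. y r (\<lambda>t. comp_coeff m A (k, p) r t * \<phi> t)) = (\<Sum>r\<in>{..<m} \<times> UNIV. if r = (Suc k, p) then y r \<phi> else 0)"
    using k by (intro sum.cong refl) (auto simp: comp_coeff_def dual_zero[OF y])
  then show ?thesis using k by simp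
qed

lemma comp_sum_last:
  fixes A :: "nat \<Rightarrow> real \<Rightarrow> complex ^ 'n ^ 'n::finite"
  assumes k: "\<not> Suc k < m" and y: "\<And>s. s \<in> {..<m} \<times> UNIV \<Longrightarrow> y s \<in> RR_dual I"
    and A: "\<And>k. k < m \<Longrightarrow> A k \<in> Ginf_mat I" and \<phi>: "\<phi> \<in> RR I"
  shows "(\<Sum>r\<in>{..<m} \<times> UNIV. y r (\<lambda>t. comp_coeff m A (k, p) r t * \<phi> t)) =
    (\<Sum>l<m. \<Sum>q\<in>UNIV. y (l, q) (\<lambda>t. A l t $ p $ q * \<phi> t))"
  unfolding sum.cartesian_product
proof (rule sum.cong[OF refl])
  fix r :: "nat \<times> 'n" assume "r \<in> {..<m} \<times> UNIV"
  then obtain l q where r: "r = (l, q)" and l: "l \<in> {..<m}" by auto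
  then have "(\<lambda>t. A l t $ p $ q) \<in> Ginf I" using A by (auto simp: Ginf_mat_def)
  from dual_ae_bounded[OF y this \<phi>, of "(l, q)"] l k
  show "y r (\<lambda>t. comp_coeff m A (k, p) r t * \<phi> t) = (case r of (l, q) \<Rightarrow> y (l, q) (\<lambda>t. A l t $ p $ q * \<phi> t))"
    by (simp add: comp_coeff_def r)
qed

lemma comp_rhs_dual:
  assumes t0: "t0 \<in> I" and F: "F \<in> RR_dual_mat I" "vanishes_before I t0 F"
  shows "comp_rhs m X t0 F j s \<in> RR_dual I" "null_before t0 (comp_rhs m X t0 F j s)"
proof -
  have "F $ snd s $ j \<in> RR_dual I" using F(1) by (simp add: RR_dual_mat_def)
  then show "comp_rhs m X t0 F j s \<in> RR_dual I"
    unfolding comp_rhs_def[abs_def] by (cases "Suc (fst s) < m") (auto intro!: dual_plus dual_scale delta_dual t0)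
  show "null_before t0 (comp_rhs m X t0 F j s)"
    using null_before_delta[OF t0] F(2) unfolding null_before_def vanishes_before_def comp_rhs_def by simp
qed

lemma comp_op_dual:
  assumes t0: "t0 \<in> I" and F: "F \<in> RR_dual_mat I" "vanishes_before I t0 F"
    and A: "\<And>k. k < m \<Longrightarrow> A k \<in> Ginf_mat I" and y: "\<And>s. s \<in> {..<m} \<times> UNIV \<Longrightarrow> y s \<in> RR_dual I"
  shows "(\<lambda>\<phi>. (\<Sum>r\<in>{..<m} \<times> UNIV. y r (\<lambda>t. comp_coeff m A s r t * \<phi> t)) + comp_rhs m X t0 F j s \<phi>) \<in> RR_dual I"
proof -
  have "comp_coeff m A s r \<in> Gloc" if "r \<in> {..<m} \<times> UNIV" for r
    using that A by (auto simp: comp_coeff_def Ginf_mat_def intro!: Ginf_Gloc ae_bounded)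
  then show ?thesis by (intro dual_plus dual_finsum dual_gmult comp_rhs_dual[OF t0 F] y)
qed

text \<open>Subtracting \<open>dsum\<close> from the derivatives of \<open>Z\<close> removes all
  deltas of positive order. The delta of order zero that remains does not depend on
  \<open>\<alpha>\<close> on test functions without jumps, so its parameter can be set to
  \<open>0\<close>.\<close>

lemma cauchy_to_system:
  assumes t0: "t0 \<in> I" and F: "F \<in> RR_dual_mat I" "vanishes_before I t0 F"
    and A: "\<And>k. k < m \<Longrightarrow> A k \<in> Ginf_mat I"
    and Z: "cauchy_solution I m A t0 X F \<alpha> Z"
  shows "\<exists>y. dist_system ({..<m} \<times> UNIV) (comp_coeff m A) (comp_rhs m X t0 F j) t0 y \<and> (\<forall>p \<phi>. y (0, p) \<phi> = (Z $ p $ j) \<phi>)"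
proof -
  obtain Zd where Z0: "Zd 0 = Z" and Zd: "\<And>k. k < m \<Longrightarrow> Zd (Suc k) \<in> derivs_mat I (Zd k)"
    and eq: "dist_mat_eq I (Zd m - (\<Sum>j<m. const_mult_dist (X j) (delta I t0 (m - j - 1) \<alpha>))
             - (\<Sum>k<m. gmult_mat (A k) (Zd k - (\<Sum>j<k. const_mult_dist (X j) (delta I t0 (k - j - 1) \<alpha>))))) F"
    and vb: "\<And>k. k < m \<Longrightarrow> vanishes_before I t0 (Zd k)" and ZR: "Z \<in> RR_dual_mat I"
    using Z unfolding cauchy_solution_def by blast
  define y where "y s \<phi> = (Zd (fst s) $ snd s $ j) \<phi> - dsum (\<lambda>l. X l $ snd s $ j) t0 \<alpha> (fst s) \<phi>" for s \<phi>
  have ZdR: "Zd k $ p $ q \<in> RR_dual I" if "k \<le> m" for k p q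
  proof (cases k)
    case 0 then show ?thesis using ZR Z0 by (simp add: RR_dual_mat_def)
  next
    case (Suc l) then show ?thesis using Zd[of l] that by (auto simp: derivs_mat_def derivs_def)
  qed
  have yR: "y s \<in> RR_dual I" if "fst s \<le> m" for s
    unfolding y_def[abs_def] by (intro dual_minus ZdR that dsum(1) t0)
  have eq': "(Zd m $ p $ j) \<phi> = dsum (\<lambda>l. X l $ p $ j) t0 \<alpha> m \<phi>
      + (\<Sum>k<m. \<Sum>q\<in>UNIV. y (k, q) (\<lambda>t. A k t $ p $ q * \<phi> t)) + (F $ p $ j) \<phi>" if "\<phi> \<in> RR I" for p \<phi>
  proof -
    have "((Zd m - (\<Sum>j<m. const_mult_dist (X j) (delta I t0 (m - j - 1) \<alpha>))
             - (\<Sum>k<m. gmult_mat (A k) (Zd k - (\<Sum>j<k. const_mult_dist (X j) (delta I t0 (k - j - 1) \<alpha>))))) $ p $ j) \<phi> = (F $ p $ j) \<phi>"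
      using eq that by (simp add: dist_mat_eq_def)
    then show ?thesis
      by (simp add: sum_functional_apply const_mult_dist_def gmult_mat_def gmult_def dsum_def y_def times_fun_def algebra_simps)
  qed
  have "null_before t0 (y s) \<and> weak_deriv (y s) (\<lambda>\<phi>. (\<Sum>r\<in>{..<m} \<times> UNIV. y r (\<lambda>t. comp_coeff m A s r t * \<phi> t)) + comp_rhs m X t0 F j s \<phi>)"
    if s: "s \<in> {..<m} \<times> UNIV" for s
  proof
    obtain k p where kp: "s = (k, p)" "k < m" using s by auto
    have "null_before t0 (Zd k $ p $ j)" using vb[OF kp(2)] by (simp add: null_before_def vanishes_before_def)
    then show "null_before t0 (y s)" using dsum(2)[OF t0] unfolding null_before_def y_def kp(1) by simp
    have "Zd (Suc k) $ p $ j \<in> derivs I (Zd k $ p $ j)" using Zd[OF kp(2)] by (simp add: derivs_mat_def)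
    then have 1: "weak_deriv (Zd k $ p $ j) (Zd (Suc k) $ p $ j)" using derivs_iff[OF ZdR] kp(2) by simp
    have "weak_deriv (\<lambda>\<phi>. (Zd k $ p $ j) \<phi> + - 1 * dsum (\<lambda>l. X l $ p $ j) t0 \<alpha> k \<phi>)
        (\<lambda>\<phi>. (Zd (Suc k) $ p $ j) \<phi> + - 1 * (dsum (\<lambda>l. X l $ p $ j) t0 \<alpha> (Suc k) \<phi> - X k $ p $ j * delta I t0 0 \<alpha> \<phi>))"
      by (intro weak_deriv_plus weak_deriv_scale 1 dsum(3) t0)
    then have D: "weak_deriv (y s) (\<lambda>\<phi>. (Zd (Suc k) $ p $ j) \<phi> + - 1 * (dsum (\<lambda>l. X l $ p $ j) t0 \<alpha> (Suc k) \<phi> - X k $ p $ j * delta I t0 0 \<alpha> \<phi>))"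
      by (simp add: y_def[abs_def] kp(1))
    show "weak_deriv (y s) (\<lambda>\<phi>. (\<Sum>r\<in>{..<m} \<times> UNIV. y r (\<lambda>t. comp_coeff m A s r t * \<phi> t)) + comp_rhs m X t0 F j s \<phi>)"
    proof (rule weak_deriv_change[OF D])
      show "(\<lambda>\<phi>. (\<Sum>r\<in>{..<m} \<times> UNIV. y r (\<lambda>t. comp_coeff m A s r t * \<phi> t)) + comp_rhs m X t0 F j s \<phi>) \<in> RR_dual I"
        by (rule comp_op_dual[OF t0 F A yR]) auto
      fix \<phi> assume \<phi>: "\<phi> \<in> RR I" "no_jump \<phi>"
      have d: "delta I t0 0 \<alpha> \<phi> = delta I t0 0 0 \<phi>" using delta_no_jump[OF t0 \<phi>(2)] by simp
      show "(Zd (Suc k) $ p $ j) \<phi> + - 1 * (dsum (\<lambda>l. X l $ p $ j) t0 \<alpha> (Suc k) \<phi> - X k $ p $ j * delta I t0 0 \<alpha> \<phi>) =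
         (\<Sum>r\<in>{..<m} \<times> UNIV. y r (\<lambda>t. comp_coeff m A s r t * \<phi> t)) + comp_rhs m X t0 F j s \<phi>"
      proof (cases "Suc k < m")
        case True
        have "(\<Sum>r\<in>{..<m} \<times> UNIV. y r (\<lambda>t. comp_coeff m A s r t * \<phi> t)) = y (Suc k, p) \<phi>"
          unfolding kp(1) by (rule comp_sum_shift[OF True yR]) auto
        then show ?thesis using True d by (simp add: kp(1) comp_rhs_def y_def)
      next
        case False
        then have m: "m = Suc k" using kp(2) by simp
        have "(\<Sum>r\<in>{..<m} \<times> UNIV. y r (\<lambda>t. comp_coeff m A s r t * \<phi> t)) = (\<Sum>l<m. \<Sum>q\<in>UNIV. y (l, q) (\<lambda>t. A l t $ p $ q * \<phi> t))"
          unfolding kp(1) by (rule comp_sum_last[OF False yR A \<phi>(1)]) auto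
        then show ?thesis using False d eq'[OF \<phi>(1), of p] by (simp add: kp(1) comp_rhs_def m[symmetric])
      qed
    qed
  qed
  then have "dist_system ({..<m} \<times> UNIV) (comp_coeff m A) (comp_rhs m X t0 F j) t0 y" unfolding dist_system_def by blast
  then show ?thesis by (intro exI[of _ y]) (simp add: y_def dsum_def Z0)
qed

text \<open>The same \<open>y\<close> works for every \<open>\<alpha>\<close>. The
  \<open>m\<close>-th derivative is read off the equation, by way of \<open>top\<close>, and so the
  equation holds on all test functions; that it is a derivative of its predecessor is a matter of
  test functions without jumps.\<close>

lemma system_to_cauchy:
  fixes A :: "nat \<Rightarrow> real \<Rightarrow> complex ^ 'n ^ 'n::finite"
  assumes t0: "t0 \<in> I" and F: "F \<in> RR_dual_mat I" "vanishes_before I t0 F"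
    and A: "\<And>k. k < m \<Longrightarrow> A k \<in> Ginf_mat I" and m: "m \<ge> 1"
    and y: "\<And>j. dist_system ({..<m} \<times> UNIV) (comp_coeff m A) (comp_rhs m X t0 F j) t0 (y j)"
  shows "cauchy_solution I m A t0 X F \<alpha> (\<chi> p j. y j (0, p))"
proof -
  have yD: "weak_deriv (y j s) (\<lambda>\<phi>. (\<Sum>r\<in>{..<m} \<times> UNIV. y j r (\<lambda>t. comp_coeff m A s r t * \<phi> t)) + comp_rhs m X t0 F j s \<phi>)"
    and yv: "null_before t0 (y j s)" if "fst s < m" for j s
    using y[of j] that unfolding dist_system_def by (cases s; auto)+
  have yR: "y j s \<in> RR_dual I" if "fst s < m" for j s using yD[OF that] by (simp add: weak_deriv_def)
  define top where "top p j \<phi> = (\<Sum>k<m. \<Sum>q\<in>UNIV. y j (k, q) (\<lambda>t. A k t $ p $ q * \<phi> t)) + (F $ p $ j) \<phi>" for p j \<phi>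
  define Y where "Y k p j \<phi> = (if k < m then y j (k, p) \<phi> else top p j \<phi>)" for k p j \<phi>
  define Zd :: "nat \<Rightarrow> 'n dist_mat" where
    "Zd k = (\<chi> p j. (\<lambda>\<phi>. Y k p j \<phi> + dsum (\<lambda>l. X l $ p $ j) t0 \<alpha> k \<phi>))" for k
  have topR: "top p j \<in> RR_dual I" for p j
  proof -
    have "F $ p $ j \<in> RR_dual I" using F(1) by (simp add: RR_dual_mat_def)
    moreover have "(\<lambda>t. A k t $ p $ q) \<in> Gloc" if "k < m" for k q using A[OF that] by (auto simp: Ginf_mat_def intro: Ginf_Gloc)
    ultimately show ?thesis unfolding top_def[abs_def] by (auto intro!: dual_plus dual_finsum dual_gmult yR)
  qed
  have YR: "Y k p j \<in> RR_dual I" for k p j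
    using yR[of "(k, p)" j] topR[of p j] by (cases "k < m") (simp_all add: Y_def[abs_def])
  have ZdR: "Zd k $ p $ j \<in> RR_dual I" for k p j
    unfolding Zd_def by (simp, intro dual_plus YR dsum(1) t0)
  have Z0: "Zd 0 = (\<chi> p j. y j (0, p))" using m by (simp add: Zd_def Y_def dsum_def vec_eq_iff)
  have "weak_deriv (Zd k $ p $ j) (Zd (Suc k) $ p $ j)" if k: "k < m" for k p j
  proof -
    have "weak_deriv (\<lambda>\<phi>. Y k p j \<phi> + dsum (\<lambda>l. X l $ p $ j) t0 \<alpha> k \<phi>)
      (\<lambda>\<phi>. ((\<Sum>r\<in>{..<m} \<times> UNIV. y j r (\<lambda>t. comp_coeff m A (k, p) r t * \<phi> t)) + comp_rhs m X t0 F j (k, p) \<phi>)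
          + (dsum (\<lambda>l. X l $ p $ j) t0 \<alpha> (Suc k) \<phi> - X k $ p $ j * delta I t0 0 \<alpha> \<phi>))"
      using yD[of "(k, p)" j] k by (intro weak_deriv_plus dsum(3) t0) (simp add: Y_def[abs_def])
    then have D: "weak_deriv (Zd k $ p $ j) (\<lambda>\<phi>. ((\<Sum>r\<in>{..<m} \<times> UNIV. y j r (\<lambda>t. comp_coeff m A (k, p) r t * \<phi> t)) + comp_rhs m X t0 F j (k, p) \<phi>)
          + (dsum (\<lambda>l. X l $ p $ j) t0 \<alpha> (Suc k) \<phi> - X k $ p $ j * delta I t0 0 \<alpha> \<phi>))"
      by (simp add: Zd_def)
    show ?thesis
    proof (rule weak_deriv_change[OF D ZdR])
      fix \<phi> assume \<phi>: "\<phi> \<in> RR I" "no_jump \<phi>"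
      have d: "delta I t0 0 \<alpha> \<phi> = delta I t0 0 0 \<phi>" using delta_no_jump[OF t0 \<phi>(2)] by simp
      have "(\<Sum>r\<in>{..<m} \<times> UNIV. y j r (\<lambda>t. comp_coeff m A (k, p) r t * \<phi> t)) + comp_rhs m X t0 F j (k, p) \<phi>
          = Y (Suc k) p j \<phi> + X k $ p $ j * delta I t0 0 \<alpha> \<phi>"
      proof (cases "Suc k < m")
        case True
        have "(\<Sum>r\<in>{..<m} \<times> UNIV. y j r (\<lambda>t. comp_coeff m A (k, p) r t * \<phi> t)) = y j (Suc k, p) \<phi>"
          by (rule comp_sum_shift[OF True yR]) auto
        then show ?thesis using True d by (simp add: comp_rhs_def Y_def)
      next
        case False
        have "(\<Sum>r\<in>{..<m} \<times> UNIV. y j r (\<lambda>t. comp_coeff m A (k, p) r t * \<phi> t)) = (\<Sum>l<m. \<Sum>q\<in>UNIV. y j (l, q) (\<lambda>t. A l t $ p $ q * \<phi> t))"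
          by (rule comp_sum_last[OF False yR A \<phi>(1)]) auto
        then show ?thesis using False d by (simp add: comp_rhs_def Y_def top_def)
      qed
      then show "((\<Sum>r\<in>{..<m} \<times> UNIV. y j r (\<lambda>t. comp_coeff m A (k, p) r t * \<phi> t)) + comp_rhs m X t0 F j (k, p) \<phi>)
          + (dsum (\<lambda>l. X l $ p $ j) t0 \<alpha> (Suc k) \<phi> - X k $ p $ j * delta I t0 0 \<alpha> \<phi>) = (Zd (Suc k) $ p $ j) \<phi>"
        by (simp add: Zd_def)
    qed
  qed
  then have "Zd (Suc k) \<in> derivs_mat I (Zd k)" if "k < m" for k
    using derivs_iff[OF ZdR] that by (simp add: derivs_mat_def)
  moreover have "vanishes_before I t0 (Zd k)" if "k < m" for k
    using yv[of "(k, _)"] dsum(2)[OF t0] that unfolding vanishes_before_def null_before_def Zd_def Y_def by simp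
  moreover have "dist_mat_eq I (Zd m - (\<Sum>j<m. const_mult_dist (X j) (delta I t0 (m - j - 1) \<alpha>))
             - (\<Sum>k<m. gmult_mat (A k) (Zd k - (\<Sum>j<k. const_mult_dist (X j) (delta I t0 (k - j - 1) \<alpha>))))) F"
    unfolding dist_mat_eq_def
    by (simp add: sum_functional_apply const_mult_dist_def gmult_mat_def gmult_def Zd_def dsum_def Y_def top_def times_fun_def)
  moreover have "(\<chi> p j. y j (0, p)) \<in> RR_dual_mat I" using ZdR[of 0] unfolding Z0[symmetric] RR_dual_mat_def by blast
  ultimately show ?thesis unfolding cauchy_solution_def using Z0 by (intro conjI exI[of _ Zd]) auto
qed

text \<open>The system does not involve \<open>\<alpha>\<close>, so the matrix assembled from its
  solutions is fixed before \<open>\<alpha>\<close> is chosen. Each column \<open>j\<close> has its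
  own system with the same coefficients.\<close>

theorem cauchy_solution_ex_unique:
  assumes t0: "t0 \<in> I" and F: "F \<in> RR_dual_mat I" "vanishes_before I t0 F"
    and A: "\<And>k. k < m \<Longrightarrow> A k \<in> Ginf_mat I" and m: "m \<ge> 1"
  shows "\<exists>Z. \<forall>\<alpha>. cauchy_solution I m A t0 X F \<alpha> Z \<and>
    (\<forall>W. cauchy_solution I m A t0 X F \<alpha> W \<longrightarrow> dist_mat_eq I W Z)"
proof -
  obtain M where B: "bdd_coeffs ({..<m} \<times> UNIV) (comp_coeff m A) M" using comp_coeff_bdd[of m A, OF A] by blast
  note sol = dist_system_solution[OF B t0 comp_rhs_dual[OF t0 F]]
  have "\<exists>y. \<forall>j. dist_system ({..<m} \<times> UNIV) (comp_coeff m A) (comp_rhs m X t0 F j) t0 (y j)"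
    by (intro choice allI sol(1))
  then obtain y where y: "\<And>j. dist_system ({..<m} \<times> UNIV) (comp_coeff m A) (comp_rhs m X t0 F j) t0 (y j)" by blast
  show ?thesis
  proof (intro exI allI conjI impI)
    show "cauchy_solution I m A t0 X F \<alpha> (\<chi> p j. y j (0, p))" for \<alpha> by (rule system_to_cauchy[OF t0 F A m y])
    fix \<alpha> W assume W: "cauchy_solution I m A t0 X F \<alpha> W"
    show "dist_mat_eq I W (\<chi> p j. y j (0, p))" unfolding dist_mat_eq_def
    proof (intro allI ballI)
      fix p j \<phi> assume \<phi>: "\<phi> \<in> RR I"
      obtain w where w: "dist_system ({..<m} \<times> UNIV) (comp_coeff m A) (comp_rhs m X t0 F j) t0 w" "\<forall>p \<phi>. w (0, p) \<phi> = (W $ p $ j) \<phi>"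
        using cauchy_to_system[OF t0 F A W] by blast
      show "(W $ p $ j) \<phi> = ((\<chi> p j. y j (0, p)) $ p $ j) \<phi>"
        using sol(2)[OF w(1) y _ \<phi>, of "(0, p)"] w(2) m by simp
    qed
  qed
qed

end

section \<open>Regular right-hand sides and the ordinary problem\<close>

lemma AE_zero_integral_extend:
  fixes g :: "real \<Rightarrow> 'a::euclidean_space"
  assumes g: "g absolutely_integrable_on K" and KS: "K \<subseteq> S" and S: "S \<in> sets lebesgue"
    and z: "AE t in lebesgue. t \<in> S - K \<longrightarrow> g t = 0"
  shows "g absolutely_integrable_on S" "integral S g = integral K g"
proof -
  define h where "h t = (if t \<in> K then g t else 0)" for t
  have "h absolutely_integrable_on UNIV" using g by (simp add: h_def[abs_def] absolutely_integrable_restrict_UNIV)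
  then have h: "h absolutely_integrable_on S" by (rule set_integrable_subset) (use S in auto)
  define N where "N = {t. \<not> (t \<in> S - K \<longrightarrow> g t = 0)}"
  have N: "negligible N"
    using z by (auto simp: N_def eventually_ae_filter negligible_iff_null_sets[symmetric] elim: negligible_subset)
  have e: "\<And>t. t \<in> S - N \<Longrightarrow> g t = h t" by (auto simp: h_def N_def)
  show "g absolutely_integrable_on S" by (rule absolutely_integrable_spike[OF h N e])
  have "integral S g = integral S h" by (rule integral_spike[OF N]) (simp add: e)
  also have "\<dots> = integral K g" using KS by (simp add: h_def[abs_def] integral_restrict_Int Int_absorb2)
  finally show "integral S g = integral K g" .
qed

context dyn_interval
begin

lemma Ginf_mult_absolutely_integrable:
  assumes f: "f absolutely_integrable_on S" and \<phi>: "\<phi> \<in> Ginf I" and S: "S \<subseteq> I" "S \<in> sets lebesgue"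
  shows "(\<lambda>t. f t * ae_bounded \<phi> t) absolutely_integrable_on S" "(\<lambda>t. f t * \<phi> t) absolutely_integrable_on S"
    "integral S (\<lambda>t. f t * \<phi> t) = integral S (\<lambda>t. f t * ae_bounded \<phi> t)"
proof -
  have N: "negligible {t \<in> I. \<not> \<phi> t = ae_bounded \<phi> t}" by (rule AE_negligible) (use ae_bounded(1)[OF \<phi>] in \<open>simp add: ae_eq_def\<close>)
  have e: "f t * \<phi> t = f t * ae_bounded \<phi> t" if "t \<in> S - {t \<in> I. \<not> \<phi> t = ae_bounded \<phi> t}" for t using that S by auto
  have m: "ae_bounded \<phi> \<in> borel_measurable (lebesgue_on S)"
    by (rule measurable_restrict_mono[OF _ S(1)]) (use Ginf_GG[OF ae_bounded(2)[OF \<phi>]] in \<open>simp add: GG_iff\<close>)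
  have "bounded (ae_bounded \<phi> ` S)" by (rule boundedI[of _ "Gnorm I 0 \<phi>"]) (use ae_bounded(3)[OF \<phi>] in auto)
  from absolutely_integrable_bounded_measurable_product[OF bilinear_times m S(2) this f]
  show 1: "(\<lambda>t. f t * ae_bounded \<phi> t) absolutely_integrable_on S" by (simp add: mult.commute)
  show "(\<lambda>t. f t * \<phi> t) absolutely_integrable_on S" by (rule absolutely_integrable_spike[OF 1 N e])
  show "integral S (\<lambda>t. f t * \<phi> t) = integral S (\<lambda>t. f t * ae_bounded \<phi> t)" by (rule integral_spike[OF N]) (simp add: e)
qed

text \<open>The regular distribution of \<open>w\<close> extended by zero to the left of
  \<open>t0\<close>.\<close>

definition right_dist :: "real \<Rightarrow> (real \<Rightarrow> complex) \<Rightarrow> functional" where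
  "right_dist t0 w \<phi> = integral (I \<inter> {t0..}) (\<lambda>t. w t * \<phi> t)"

text \<open>Summability reaches up to \<open>t0\<close> itself, because test functions need not
  vanish near \<open>t0\<close>.\<close>

definition right_summable :: "real \<Rightarrow> (real \<Rightarrow> complex) \<Rightarrow> bool" where
  "right_summable t0 w \<longleftrightarrow> (\<forall>q\<in>I. w absolutely_integrable_on {t0..q})"

lemma right_dist_eq:
  assumes w: "right_summable t0 w" and t0: "t0 \<in> I" and \<phi>: "\<phi> \<in> Rstep I {p..q}" and r: "r \<in> I" "q \<le> r"
  shows "(\<lambda>t. w t * \<phi> t) absolutely_integrable_on {t0..r}"
    "(\<lambda>t. w t * \<phi> t) absolutely_integrable_on I \<inter> {t0..}" "right_dist t0 w \<phi> = integral {t0..r} (\<lambda>t. w t * \<phi> t)"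
proof -
  have sub: "{t0..r} \<subseteq> I" by (rule Icc_subset_I[OF t0 r(1)])
  show 1: "(\<lambda>t. w t * \<phi> t) absolutely_integrable_on {t0..r}"
    by (rule Ginf_mult_absolutely_integrable) (use w r \<phi> sub in \<open>auto simp: right_summable_def Rstep_iff\<close>)
  have "AE z in lebesgue. z \<in> I \<inter> {t0..} - {t0..r} \<longrightarrow> \<phi> z = 0"
    by (rule Rstep_AE_zero[OF \<phi>]) (use r in auto)
  then have "AE z in lebesgue. z \<in> I \<inter> {t0..} - {t0..r} \<longrightarrow> w z * \<phi> z = 0" by (rule eventually_mono) simp
  note e = AE_zero_integral_extend[OF 1 _ Ici_sets this]
  show "(\<lambda>t. w t * \<phi> t) absolutely_integrable_on I \<inter> {t0..}" by (rule e(1)) (use sub in auto)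
  show "right_dist t0 w \<phi> = integral {t0..r} (\<lambda>t. w t * \<phi> t)" unfolding right_dist_def by (rule e(2)) (use sub in auto)
qed

lemma right_dist_dual:
  assumes w: "right_summable t0 w" and t0: "t0 \<in> I" shows "right_dist t0 w \<in> RR_dual I" "null_before t0 (right_dist t0 w)"
proof -
  have i: "(\<lambda>t. w t * \<phi> t) integrable_on I \<inter> {t0..}" if \<phi>: "\<phi> \<in> RR I" for \<phi>
    by (rule RR_ex_step[OF \<phi>]) (metis right_dist_eq(2)[OF w t0] order_refl set_lebesgue_integral_eq_integral(1))
  show "right_dist t0 w \<in> RR_dual I"
  proof (rule RR_dualI)
    fix \<phi> \<psi> assume "\<phi> \<in> RR I" "\<psi> \<in> RR I"
    then show "right_dist t0 w (\<lambda>t. \<phi> t + \<psi> t) = right_dist t0 w \<phi> + right_dist t0 w \<psi>"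
      unfolding right_dist_def by (simp add: distrib_left integral_add i)
  next
    fix c \<phi> assume "\<phi> \<in> RR I"
    show "right_dist t0 w (\<lambda>t. c * \<phi> t) = c * right_dist t0 w \<phi>"
      unfolding right_dist_def by (simp add: mult.left_commute)
  next
    fix p q assume pq: "p \<in> I" "q \<in> I"
    have wq: "w absolutely_integrable_on {t0..q}" using w pq by (simp add: right_summable_def)
    have "norm (right_dist t0 w \<phi>) \<le> integral {t0..q} (\<lambda>t. norm (w t)) * Gnorm I 0 \<phi>" if \<phi>: "\<phi> \<in> Rstep I {p..q}" for \<phi>
    proof -
      have \<phi>': "\<phi> \<in> Ginf I" using \<phi> by (simp add: Rstep_iff)
      note m = Ginf_mult_absolutely_integrable[OF wq \<phi>' Icc_subset_I[OF t0 pq(2)]]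
      have "norm (right_dist t0 w \<phi>) = norm (integral {t0..q} (\<lambda>t. w t * ae_bounded \<phi> t))"
        using right_dist_eq(3)[OF w t0 \<phi> pq(2) order_refl] m(3) by simp
      also have "\<dots> \<le> integral {t0..q} (\<lambda>t. norm (w t) * Gnorm I 0 \<phi>)"
      proof (rule integral_norm_bound_integral)
        show "(\<lambda>t. w t * ae_bounded \<phi> t) integrable_on {t0..q}" using m(1) by (simp add: set_lebesgue_integral_eq_integral(1))
        show "(\<lambda>t. norm (w t) * Gnorm I 0 \<phi>) integrable_on {t0..q}"
          by (intro integrable_on_mult_left) (use wq in \<open>simp add: absolutely_integrable_on_def\<close>)
        show "norm (w t * ae_bounded \<phi> t) \<le> norm (w t) * Gnorm I 0 \<phi>" for t
          using ae_bounded(3)[OF \<phi>', of t] by (simp add: norm_mult mult_left_mono)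
      qed
      finally show ?thesis by simp
    qed
    then show "\<exists>k C. \<forall>\<phi>\<in>Rstep I {p..q}. norm (right_dist t0 w \<phi>) \<le> C * Gnorm I k \<phi>" by blast
  qed
  show "null_before t0 (right_dist t0 w)" unfolding null_before_iff
  proof (intro allI impI ballI)
    fix c \<phi> assume c: "c < t0" and \<phi>: "\<phi> \<in> RR I" "zero_off {..c} \<phi>"
    from \<phi>(2) have "AE z in lebesgue. z \<in> I \<inter> {t0..} - {} \<longrightarrow> w z * \<phi> z = 0"
      unfolding zero_off_def AE_I by (rule eventually_mono) (use c in auto)
    from AE_zero_integral_extend(2)[OF _ _ Ici_sets this] show "right_dist t0 w \<phi> = 0"
      by (simp add: right_dist_def)
  qed
qed

section \<open>Integral equations and the distributions they define\<close>

text \<open>The ordinary problem as an integral equation from \<open>t0\<close> on: the initial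
  values are built in, and neither the coefficients nor \<open>f\<close> have to be
  continuous.\<close>

definition integral_system where
  "integral_system S B f x t0 w \<longleftrightarrow> (\<forall>s\<in>S. right_summable t0 (f s) \<and> (\<forall>q\<in>I. continuous_on {t0..q} (w s)) \<and>
     (\<forall>t\<in>I. t0 \<le> t \<longrightarrow> w s t = x s + integral {t0..t} (\<lambda>z. (\<Sum>r\<in>S. B s r z * w r z) + f s z)))"

lemma integral_system_rhs:
  assumes B: "bdd_coeffs S B M" and t0: "t0 \<in> I" and s: "s \<in> S" and q: "q \<in> I"
    and w: "\<And>r. r \<in> S \<Longrightarrow> continuous_on {t0..q} (w r)" and f: "right_summable t0 (f s)"
  shows "(\<lambda>z. (\<Sum>r\<in>S. B s r z * w r z) + f s z) absolutely_integrable_on {t0..q}"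
proof (intro set_integral_add(1) absolutely_integrable_sum)
  show "finite S" using B by (simp add: bdd_coeffs_def)
  show "f s absolutely_integrable_on {t0..q}" using f q by (simp add: right_summable_def)
  show "(\<lambda>z. B s r z * w r z) absolutely_integrable_on {t0..q}" if "r \<in> S" for r
    by (rule coeff_absolutely_integrable[OF B s that t0 q w[OF that]])
qed

text \<open>The boundary term at \<open>t0\<close> is the origin of the delta: extension by zero
  gives \<open>w\<close> the jump \<open>x\<close>, which contributes \<open>x\<close> times the
  value of \<open>\<phi>\<close> at \<open>t0\<close>. The other boundary term, at \<open>Q\<close>,
  lies beyond the support of \<open>\<phi>\<close>.\<close>

lemma integral_system_by_parts:
  assumes h: "right_summable t0 h" and w: "right_summable t0 w" and t0: "t0 \<in> I" and \<phi>: "\<phi> \<in> RR I" "no_jump \<phi>"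
    and eq: "\<And>t. t \<in> I \<Longrightarrow> t0 \<le> t \<Longrightarrow> w t = x + integral {t0..t} h"
  shows "right_dist t0 h \<phi> + x * slim True \<phi> t0 = - right_dist t0 w (gderiv I \<phi>)"
proof -
  obtain p q where pq: "p \<in> I" "q \<in> I" and \<phi>R: "\<phi> \<in> Rstep I {p..q}" using RR_ex_step[OF \<phi>(1)] by metis
  obtain Q where Q: "Q \<in> I" "q < Q" "t0 < Q" using larger_point[OF pq(2) t0] by metis
  have \<phi>G: "\<phi> \<in> Ginf I" and \<phi>z: "zero_off {p..q} \<phi>" using \<phi>R by (simp_all add: Rstep_iff)
  define v where "v = slim True \<phi>"
  have P: "primitive v (gderiv I \<phi>)" unfolding v_def by (rule primitive_slim[OF Ginf_GG[OF \<phi>G] Ginf_gderiv(2)[OF \<phi>G] \<phi>(2)])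
  have vQ: "v Q = 0" unfolding v_def by (rule zero_off_slim[OF \<phi>z]) (use Q in auto)
  have sub: "{t0..Q} \<subseteq> I" by (rule Icc_subset_I[OF t0 Q(1)])
  have dR: "gderiv I \<phi> \<in> Rstep I {p..q}" by (rule Rstep_gderiv[OF \<phi>R]) simp
  have h2: "gderiv I \<phi> absolutely_integrable_on {t0..Q}"
    by (rule GG_absolutely_integrable[OF Ginf_GG sub]) (use dR in \<open>auto simp: Rstep_iff\<close>)
  have "((\<lambda>t. h t * v t + w t * gderiv I \<phi> t) has_integral (w Q * v Q - w t0 * v t0)) {t0..Q}"
  proof (rule integration_by_parts_indefinite[OF _ _ h2])
    show "t0 \<le> Q" using Q by simp
    show "h absolutely_integrable_on {t0..Q}" using h Q by (simp add: right_summable_def)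
    show "w t = x + integral {t0..t} h" if "t \<in> {t0..Q}" for t using eq[of t] that sub by auto
    show "v t = v t0 + integral {t0..t} (gderiv I \<phi>)" if "t \<in> {t0..Q}" for t
    proof -
      have "t \<in> I" using that sub by blast
      then have "integral {t0..t} (gderiv I \<phi>) = v t - v t0" using primitiveD[OF P t0 _ ] that by (intro integral_unique) auto
      then show ?thesis by simp
    qed
  qed
  moreover have N: "negligible {t \<in> I. \<not> \<phi> t = v t}"
    by (rule AE_negligible) (use GG_ae_slim[OF Ginf_GG[OF \<phi>G], of True] in \<open>simp add: v_def\<close>)
  ultimately have "((\<lambda>t. h t * \<phi> t + w t * gderiv I \<phi> t) has_integral (w Q * v Q - w t0 * v t0)) {t0..Q}"
    by (elim has_integral_spike[OF N, rotated]) (use sub in auto)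
  then have "integral {t0..Q} (\<lambda>t. h t * \<phi> t + w t * gderiv I \<phi> t) = - x * v t0"
    using eq[OF t0] vQ by (simp add: integral_unique)
  moreover have "integral {t0..Q} (\<lambda>t. h t * \<phi> t + w t * gderiv I \<phi> t) = right_dist t0 h \<phi> + right_dist t0 w (gderiv I \<phi>)"
    using right_dist_eq[OF h t0 \<phi>R Q(1)] right_dist_eq[OF w t0 dR Q(1)] Q
    by (simp add: integral_add set_lebesgue_integral_eq_integral(1))
  ultimately show ?thesis by (simp add: v_def algebra_simps eq_neg_iff_add_eq_0)
qed

lemma integral_system_dist_system:
  assumes B: "bdd_coeffs S B M" and t0: "t0 \<in> I" and w: "integral_system S B f x t0 w"
    and G: "\<And>s. s \<in> S \<Longrightarrow> G s \<in> RR_dual I"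
      "\<And>s \<phi>. s \<in> S \<Longrightarrow> \<phi> \<in> RR I \<Longrightarrow> G s \<phi> = x s * delta I t0 0 0 \<phi> + right_dist t0 (f s) \<phi>"
  shows "dist_system S B G t0 (\<lambda>s. right_dist t0 (w s))"
proof -
  have S: "finite S" using B by (simp add: bdd_coeffs_def)
  have ws: "right_summable t0 (w s)" if "s \<in> S" for s
    using w that by (auto simp: integral_system_def right_summable_def absolutely_integrable_continuous_real)
  have fs: "right_summable t0 (f s)" if "s \<in> S" for s using w that by (simp add: integral_system_def)
  have BG: "B s r \<in> Ginf I" if "s \<in> S" "r \<in> S" for s r using B that by (simp add: bdd_coeffs_def)
  define h where "h s z = (\<Sum>r\<in>S. B s r z * w r z) + f s z" for s z
  have hs: "right_summable t0 (h s)" if "s \<in> S" for s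
    unfolding right_summable_def h_def[abs_def]
    by (intro ballI integral_system_rhs[OF B t0 that]) (use w that in \<open>auto simp: integral_system_def\<close>)
  have Dh: "(\<Sum>r\<in>S. right_dist t0 (w r) (\<lambda>t. B s r t * \<phi> t)) + right_dist t0 (f s) \<phi> = right_dist t0 (h s) \<phi>"
    if s: "s \<in> S" and \<phi>: "\<phi> \<in> RR I" for s \<phi>
  proof -
    obtain p q where pq: "p \<in> I" "q \<in> I" and \<phi>R: "\<phi> \<in> Rstep I {p..q}" using RR_ex_step[OF \<phi>] by metis
    have BR: "(\<lambda>t. B s r t * \<phi> t) \<in> Rstep I {p..q}" if "r \<in> S" for r by (rule Rstep_mult[OF BG[OF s that] \<phi>R])
    note e = right_dist_eq[OF ws t0 BR pq(2) order_refl] and ef = right_dist_eq[OF fs[OF s] t0 \<phi>R pq(2) order_refl]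
      and eh = right_dist_eq[OF hs[OF s] t0 \<phi>R pq(2) order_refl]
    have i: "(\<lambda>t. w r t * (B s r t * \<phi> t)) integrable_on {t0..q}" if "r \<in> S" for r
      using e(1)[OF that that] by (rule set_lebesgue_integral_eq_integral(1))
    have "integral {t0..q} (\<lambda>t. h s t * \<phi> t) = integral {t0..q} (\<lambda>t. (\<Sum>r\<in>S. w r t * (B s r t * \<phi> t)) + f s t * \<phi> t)"
      by (simp add: h_def algebra_simps sum_distrib_left)
    also have "\<dots> = (\<Sum>r\<in>S. integral {t0..q} (\<lambda>t. w r t * (B s r t * \<phi> t))) + integral {t0..q} (\<lambda>t. f s t * \<phi> t)"
      by (simp add: integral_add integral_sum integrable_sum S i set_lebesgue_integral_eq_integral(1)[OF ef(1)])
    finally show ?thesis using e(3) ef(3) eh(3) by simp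
  qed
  show ?thesis unfolding dist_system_def weak_deriv_def
  proof (intro ballI conjI impI)
    fix s assume s: "s \<in> S"
    show "null_before t0 (right_dist t0 (w s))" "right_dist t0 (w s) \<in> RR_dual I" by (intro right_dist_dual ws s t0)+
    show "(\<lambda>\<phi>. (\<Sum>r\<in>S. right_dist t0 (w r) (\<lambda>t. B s r t * \<phi> t)) + G s \<phi>) \<in> RR_dual I"
      by (intro dual_plus dual_finsum dual_gmult Ginf_Gloc right_dist_dual ws t0 G BG s)
    fix \<phi> assume \<phi>: "\<phi> \<in> RR I" "no_jump \<phi>"
    have "right_dist t0 (h s) \<phi> + x s * slim True \<phi> t0 = - right_dist t0 (w s) (gderiv I \<phi>)"
      by (rule integral_system_by_parts[OF hs[OF s] ws[OF s] t0 \<phi>]) (use w s in \<open>simp add: integral_system_def h_def[abs_def]\<close>)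
    moreover have "(\<Sum>r\<in>S. right_dist t0 (w r) (\<lambda>t. B s r t * \<phi> t)) + G s \<phi> =
        ((\<Sum>r\<in>S. right_dist t0 (w r) (\<lambda>t. B s r t * \<phi> t)) + right_dist t0 (f s) \<phi>) + x s * slim True \<phi> t0"
      by (simp add: G(2)[OF s \<phi>(1)] delta_no_jump[OF t0 \<phi>(2)])
    ultimately show "(\<Sum>r\<in>S. right_dist t0 (w r) (\<lambda>t. B s r t * \<phi> t)) + G s \<phi> = - right_dist t0 (w s) (gderiv I \<phi>)"
      by (simp only: Dh[OF s \<phi>(1)])
  qed
qed

text \<open>That \<open>F\<close> vanishes before \<open>t0\<close> is known through test functions
  only. As test functions may jump, \<open>\<phi>\<close> can be cut at any \<open>d\<close> between
  \<open>p\<close> and \<open>t0\<close> without changing \<open>F \<phi>\<close>; letting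
  \<open>d\<close> tend to \<open>t0\<close> shows that the integral before \<open>t0\<close>
  contributes nothing.\<close>

lemma regular_null_before_right_dist:
  assumes g: "locally_summable I g" and F: "F \<in> RR_dual I" "null_before t0 F" and t0: "t0 \<in> I"
    and eq: "\<And>\<phi>. \<phi> \<in> RR I \<Longrightarrow> F \<phi> = regular_dist I g \<phi>" and \<phi>: "\<phi> \<in> RR I"
  shows "right_summable t0 g" "F \<phi> = right_dist t0 g \<phi>"
proof -
  have gK: "g absolutely_integrable_on {s..t}" if "s \<in> I" "t \<in> I" for s t
    using g Icc_subset_I[OF that] by (simp add: locally_summable_def)
  show rs: "right_summable t0 g" by (simp add: right_summable_def gK t0)
  obtain p0 q0 where pq0: "p0 \<in> I" "q0 \<in> I" "\<phi> \<in> Rstep I {p0..q0}" using RR_ex_step[OF \<phi>] by metis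
  obtain c c' where "c \<in> I" "c < c'" "c' < t0" using left_points[OF t0] .
  then have "min p0 c \<in> I \<and> min p0 c < t0 \<and> min p0 c \<le> p0" using min_max_I(1)[OF pq0(1), of c] by simp
  then obtain p where p: "p \<in> I" "p < t0" "p \<le> p0" by blast
  obtain q where q: "q \<in> I" "q0 \<le> q" "t0 < q" using larger_point[OF pq0(2) t0] by (metis less_imp_le)
  have \<phi>R: "\<phi> \<in> Rstep I {p..q}" by (rule Rstep_mono[OF pq0(3) p(3) q(2)])
  have sub: "{p..q} \<subseteq> I" by (rule Icc_subset_I[OF p(1) q(1)])
  have F_eq: "F \<psi> = integral {p..q} (\<lambda>t. g t * \<psi> t)" if \<psi>: "\<psi> \<in> Rstep I {p..q}" for \<psi>
  proof -
    have 1: "(\<lambda>t. g t * \<psi> t) absolutely_integrable_on {p..q}"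
      by (rule Ginf_mult_absolutely_integrable[OF gK]) (use p q \<psi> sub in \<open>auto simp: Rstep_iff\<close>)
    have "AE z in lebesgue. z \<in> I - {p..q} \<longrightarrow> \<psi> z = 0" by (rule Rstep_AE_zero[OF \<psi>]) auto
    then have "AE z in lebesgue. z \<in> I - {p..q} \<longrightarrow> g z * \<psi> z = 0" by (rule eventually_mono) simp
    note e = AE_zero_integral_extend[OF 1 sub I_sets this]
    have "F \<psi> = regular_dist I g \<psi>" using Rstep_RR[OF p(1) q(1)] \<psi> by (intro eq) auto
    also have "\<dots> = integral I (\<lambda>t. g t * \<psi> t)"
      unfolding regular_dist_def by (rule set_lebesgue_integral_eq_integral(2)[OF e(1)])
    finally show ?thesis using e(2) by simp
  qed
  define h where "h t = g t * \<phi> t" for t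
  have "h absolutely_integrable_on {p..q}" unfolding h_def[abs_def]
    by (rule Ginf_mult_absolutely_integrable[OF gK]) (use p q \<phi>R sub in \<open>auto simp: Rstep_iff\<close>)
  then have h: "h integrable_on {p..q}" by (rule set_lebesgue_integral_eq_integral(1))
  have zero: "integral {p..d} h = 0" if d: "p < d" "d < t0" for d
  proof -
    have cR: "restr {d..} \<phi> \<in> Rstep I {p..q}" unfolding Rstep_iff
    proof
      show "restr {d..} \<phi> \<in> Ginf I" by (rule restr_Ginf_mult) (use \<phi>R in \<open>auto intro: decides_Ici simp: Rstep_iff\<close>)
      show "zero_off {p..q} (restr {d..} \<phi>)" using \<phi>R unfolding Rstep_iff zero_off_def restr_def by (auto elim: eventually_mono)
    qed
    have "F \<phi> = F (restr {d..} \<phi>)"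
      by (rule null_before_agree[OF F(2,1) d(2)]) (use Rstep_RR[OF p(1) q(1)] cR \<phi> in \<open>auto intro!: zero_off_I simp: restr_def split: if_splits\<close>)
    also have "\<dots> = integral {p..q} (\<lambda>t. if t \<in> {d..} then h t else 0)"
      unfolding F_eq[OF cR] by (rule arg_cong[where f = "integral _"]) (auto simp: restr_def h_def)
    also have "\<dots> = integral {d..q} h"
    proof -
      have "{d..} \<inter> {p..q} = {d..q}" using d by auto
      then show ?thesis by (simp only: integral_restrict_Int)
    qed
    finally have "integral {p..q} h = integral {d..q} h" using F_eq[OF \<phi>R] by (simp add: h_def[abs_def])
    moreover have "integral {p..d} h + integral {d..q} h = integral {p..q} h"
      by (rule Henstock_Kurzweil_Integration.integral_combine[OF _ _ h]) (use d q in auto)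
    ultimately show ?thesis by simp
  qed
  have "integral {p..t0} h = 0"
  proof (rule continuous_constant_on_closure[of "{p<..<t0}" "\<lambda>d. integral {p..d} h"])
    have "continuous_on {p..t0} (\<lambda>d. integral {p..d} h)"
      by (rule indefinite_integral_continuous_1) (rule integrable_on_subinterval[OF h], use q in auto)
    then show "continuous_on (closure {p<..<t0}) (\<lambda>d. integral {p..d} h)" using p by simp
  qed (use zero p in auto)
  moreover have "integral {p..t0} h + integral {t0..q} h = integral {p..q} h"
    by (rule Henstock_Kurzweil_Integration.integral_combine[OF _ _ h]) (use p q in auto)
  ultimately show "F \<phi> = right_dist t0 g \<phi>"
    using F_eq[OF \<phi>R] right_dist_eq(3)[OF rs t0 \<phi>R q(1)] by (simp add: h_def[abs_def])
qed

definition last_row :: "nat \<Rightarrow> (real \<Rightarrow> complex ^ 'n ^ 'n) \<Rightarrow> 'n \<Rightarrow> nat \<times> 'n::finite \<Rightarrow> real \<Rightarrow> complex" where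
  "last_row m f j s = (if Suc (fst s) < m then (\<lambda>_. 0) else (\<lambda>t. f t $ snd s $ j))"

lemma comp_rhs_regular:
  assumes t0: "t0 \<in> I" and F: "F \<in> RR_dual_mat I" "vanishes_before I t0 F" and f: "regular_mat I f F"
  shows "right_summable t0 (last_row m f j s)"
    "\<phi> \<in> RR I \<Longrightarrow> comp_rhs m X t0 F j s \<phi> = X (fst s) $ snd s $ j * delta I t0 0 0 \<phi> + right_dist t0 (last_row m f j s) \<phi>"
proof -
  have ls: "locally_summable I (\<lambda>t. f t $ snd s $ j)" using f by (simp add: regular_mat_def)
  have Fs: "F $ snd s $ j \<in> RR_dual I" "null_before t0 (F $ snd s $ j)"
    using F by (simp_all add: RR_dual_mat_def vanishes_before_def null_before_def)
  have eq: "(F $ snd s $ j) \<phi> = regular_dist I (\<lambda>t. f t $ snd s $ j) \<phi>" if "\<phi> \<in> RR I" for \<phi>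
    using f that by (simp add: regular_mat_def)
  note r = regular_null_before_right_dist[OF ls Fs t0 eq]
  show "right_summable t0 (last_row m f j s)"
    using r(1)[OF _ RR_zero] by (simp add: last_row_def right_summable_def)
  show "\<phi> \<in> RR I \<Longrightarrow> comp_rhs m X t0 F j s \<phi> = X (fst s) $ snd s $ j * delta I t0 0 0 \<phi> + right_dist t0 (last_row m f j s) \<phi>"
    using r(2) by (simp add: comp_rhs_def last_row_def right_dist_def)
qed

lemma integral_system_cauchy:
  fixes X :: "nat \<Rightarrow> complex ^ 'n ^ 'n::finite"
  assumes t0: "t0 \<in> I" and F: "F \<in> RR_dual_mat I" "vanishes_before I t0 F" and f: "regular_mat I f F"
    and A: "\<And>k. k < m \<Longrightarrow> A k \<in> Ginf_mat I" and m: "m \<ge> 1"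
    and w: "integral_system ({..<m} \<times> UNIV) (comp_coeff m A) (last_row m f j) (\<lambda>s. X (fst s) $ snd s $ j) t0 w"
    and Z: "cauchy_solution I m A t0 X F \<alpha> Z" and \<phi>: "\<phi> \<in> RR I"
  shows "(Z $ p $ j) \<phi> = right_dist t0 (w (0, p)) \<phi>"
proof -
  obtain M where B: "bdd_coeffs ({..<m} \<times> UNIV) (comp_coeff m A) M" using comp_coeff_bdd[of m A, OF A] by blast
  have d: "dist_system ({..<m} \<times> UNIV) (comp_coeff m A) (comp_rhs m X t0 F j) t0 (\<lambda>s. right_dist t0 (w s))"
    by (rule integral_system_dist_system[OF B t0 w]) (rule comp_rhs_dual(1)[OF t0 F], rule comp_rhs_regular(2)[OF t0 F f])
  obtain y where y: "dist_system ({..<m} \<times> UNIV) (comp_coeff m A) (comp_rhs m X t0 F j) t0 y" "\<forall>p \<phi>. y (0, p) \<phi> = (Z $ p $ j) \<phi>"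
    using cauchy_to_system[OF t0 F A Z] by blast
  show ?thesis
    using dist_system_solution(2)[OF B t0 comp_rhs_dual[OF t0 F] y(1) d _ \<phi>, of "(0, p)"] y(2) m by simp
qed

text \<open>The integral of the forcing term is continuous and goes into the free term of the
  Volterra equation; the kernel stays bounded although \<open>f\<close> is only summable.\<close>

lemma integral_system_exists:
  assumes B: "bdd_coeffs S B M" and t0: "t0 \<in> I" and f: "\<And>s. s \<in> S \<Longrightarrow> right_summable t0 (f s)"
  shows "\<exists>w. integral_system S B f x t0 w"
proof -
  have fi: "f s integrable_on {t0..q}" if "s \<in> S" "q \<in> I" for s q
    using f[OF that(1)] that(2) by (simp add: right_summable_def set_lebesgue_integral_eq_integral(1))
  have "\<exists>u. \<forall>s\<in>S. (\<forall>q\<in>I. continuous_on {t0..q} (u s)) \<and>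
     (\<forall>t\<in>I. u s t = (x s + integral {t0..t} (f s)) + integral {t0..t} (\<lambda>z. \<Sum>r\<in>S. B s r z * u r z))"
  proof (rule linear_Volterra_solution[where M = M])
    show "finite S" using B by (simp add: bdd_coeffs_def)
    show "{t0..t} \<subseteq> I" if "t \<in> I" for t by (rule Icc_subset_I[OF t0 that])
    show "norm (B s r t) \<le> M" if "s \<in> S" "r \<in> S" "t \<in> I" for s r t using B that by (simp add: bdd_coeffs_def)
    show "B s r \<in> borel_measurable (lebesgue_on {t0..q})" if "s \<in> S" "r \<in> S" "q \<in> I" for s r q
      by (rule measurable_restrict_mono[OF _ Icc_subset_I[OF t0 that(3)]])
         (use B that Ginf_GG[of "B s r"] in \<open>auto simp: bdd_coeffs_def GG_iff\<close>)
    show "continuous_on {t0..q} (\<lambda>t. x s + integral {t0..t} (f s))" if "s \<in> S" "q \<in> I" for s q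
      by (intro continuous_intros indefinite_integral_continuous_1 fi that)
  qed
  then obtain u where u: "\<And>s q. s \<in> S \<Longrightarrow> q \<in> I \<Longrightarrow> continuous_on {t0..q} (u s)"
     and eq: "\<And>s t. s \<in> S \<Longrightarrow> t \<in> I \<Longrightarrow> u s t = (x s + integral {t0..t} (f s)) + integral {t0..t} (\<lambda>z. \<Sum>r\<in>S. B s r z * u r z)"
    by blast
  have "integral_system S B f x t0 u" unfolding integral_system_def
  proof (intro ballI conjI impI f u)
    fix s t assume s: "s \<in> S" and t: "t \<in> I" "t0 \<le> t"
    have "(\<lambda>z. \<Sum>r\<in>S. B s r z * u r z) integrable_on {t0..t}"
      by (intro integrable_sum set_lebesgue_integral_eq_integral(1) coeff_absolutely_integrable[OF B s _ t0 t(1)] u t)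
         (use B in \<open>simp_all add: bdd_coeffs_def\<close>)
    then show "u s t = x s + integral {t0..t} (\<lambda>z. (\<Sum>r\<in>S. B s r z * u r z) + f s z)"
      using eq[OF s t(1)] by (simp add: integral_add fi s t)
  qed
  then show ?thesis by blast
qed

end

section \<open>Absolute continuity and derivatives of matrix functions\<close>

lemma abs_continuous_on_subset: "abs_continuous_on T f \<Longrightarrow> S \<subseteq> T \<Longrightarrow> abs_continuous_on S f"
  unfolding abs_continuous_on_def by (meson subset_trans)

text \<open>Absolute continuity is tested on divisions that consist of a single interval.\<close>

lemma abs_continuous_on_continuous_on:
  fixes f :: "real \<Rightarrow> 'a::real_normed_vector"
  assumes f: "abs_continuous_on {a..b} f" shows "continuous_on {a..b} f"
  unfolding continuous_on_iff
proof (intro ballI allI impI)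
  fix x e :: real assume x: "x \<in> {a..b}" and e: "e > 0"
  obtain d where d: "d > 0" "\<And>\<D>. \<D> division_of \<Union>\<D> \<and> \<Union>\<D> \<subseteq> {a..b}
     \<and> (\<Sum>K\<in>\<D>. Sup K - Inf K) < d \<Longrightarrow> (\<Sum>K\<in>\<D>. norm (f (Sup K) - f (Inf K))) < e"
    using f[unfolded abs_continuous_on_def, THEN spec, THEN mp, OF e] by blast
  have *: "norm (f v - f u) < e" if "u \<in> {a..b}" "v \<in> {a..b}" "u \<le> v" "v - u < d" for u v
  proof -
    have "{{u..v}} division_of \<Union>{{u..v}}" using division_of_self[of u v] that by (simp add: cbox_interval)
    then show ?thesis using d(2)[of "{{u..v}}"] that by simp
  qed
  show "\<exists>d>0. \<forall>x'\<in>{a..b}. dist x' x < d \<longrightarrow> dist (f x') (f x) < e"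
  proof (intro exI[of _ d] conjI ballI impI d(1))
    fix x' assume x': "x' \<in> {a..b}" "dist x' x < d"
    show "dist (f x') (f x) < e"
    proof (cases "x \<le> x'")
      case True then show ?thesis using *[OF x x'(1)] x' by (simp add: dist_norm)
    next
      case False then show ?thesis using *[OF x'(1) x] x' by (simp add: dist_norm norm_minus_commute)
    qed
  qed
qed

lemma abs_continuous_on_nth:
  assumes "abs_continuous_on S f" shows "abs_continuous_on S (\<lambda>t. f t $ i)"
  unfolding abs_continuous_on_def
proof (intro allI impI)
  fix e :: real assume e: "e > 0"
  obtain d where d: "d > 0" "\<And>\<D>. \<D> division_of \<Union>\<D> \<and> \<Union>\<D> \<subseteq> S
     \<and> (\<Sum>K\<in>\<D>. Sup K - Inf K) < d \<Longrightarrow> (\<Sum>K\<in>\<D>. norm (f (Sup K) - f (Inf K))) < e"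
    using assms[unfolded abs_continuous_on_def, THEN spec, THEN mp, OF e] by blast
  have "(\<Sum>K\<in>\<D>. norm (f (Sup K) $ i - f (Inf K) $ i)) \<le> (\<Sum>K\<in>\<D>. norm (f (Sup K) - f (Inf K)))" for \<D>
    unfolding vector_minus_component[symmetric] by (intro sum_mono Finite_Cartesian_Product.norm_nth_le)
  then show "\<exists>d>0. \<forall>\<D>. \<D> division_of \<Union>\<D> \<and> \<Union>\<D> \<subseteq> S \<and> (\<Sum>K\<in>\<D>. Sup K - Inf K) < d \<longrightarrow>
      (\<Sum>K\<in>\<D>. norm (f (Sup K) $ i - f (Inf K) $ i)) < e"
    by (intro exI[of _ d] conjI d(1) allI impI) (rule le_less_trans[OF _ d(2)])
qed

lemma abs_continuous_on_vec:
  fixes f :: "real \<Rightarrow> 'a::real_normed_vector ^ 'n::finite"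
  assumes "\<And>i. abs_continuous_on S (\<lambda>t. f t $ i)" shows "abs_continuous_on S f"
  unfolding abs_continuous_on_def
proof (intro allI impI)
  fix e :: real assume e: "e > 0"
  define e' where "e' = e / real CARD('n)"
  have e': "e' > 0" using e by (simp add: e'_def)
  have "\<exists>d>0. \<forall>\<D>. \<D> division_of \<Union>\<D> \<and> \<Union>\<D> \<subseteq> S
     \<and> (\<Sum>K\<in>\<D>. Sup K - Inf K) < d \<longrightarrow> (\<Sum>K\<in>\<D>. norm (f (Sup K) $ i - f (Inf K) $ i)) < e'" for i
    by (rule assms[unfolded abs_continuous_on_def, THEN spec, THEN mp, OF e'])
  then have "\<exists>d. \<forall>i. d i > 0 \<and> (\<forall>\<D>. \<D> division_of \<Union>\<D> \<and> \<Union>\<D> \<subseteq> S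
     \<and> (\<Sum>K\<in>\<D>. Sup K - Inf K) < d i \<longrightarrow> (\<Sum>K\<in>\<D>. norm (f (Sup K) $ i - f (Inf K) $ i)) < e')"
    by (intro choice allI)
  then obtain d where d: "\<And>i. d i > 0" "\<And>i \<D>. \<D> division_of \<Union>\<D> \<and> \<Union>\<D> \<subseteq> S
     \<and> (\<Sum>K\<in>\<D>. Sup K - Inf K) < d i \<Longrightarrow> (\<Sum>K\<in>\<D>. norm (f (Sup K) $ i - f (Inf K) $ i)) < e'" by blast
  show "\<exists>d>0. \<forall>\<D>. \<D> division_of \<Union>\<D> \<and> \<Union>\<D> \<subseteq> S \<and> (\<Sum>K\<in>\<D>. Sup K - Inf K) < d \<longrightarrow>
      (\<Sum>K\<in>\<D>. norm (f (Sup K) - f (Inf K))) < e"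
  proof (intro exI[of _ "Min (range d)"] conjI allI impI)
    show "Min (range d) > 0" using d(1) by simp
    fix \<D> :: "real set set"
    assume *: "\<D> division_of \<Union>\<D> \<and> \<Union>\<D> \<subseteq> S \<and> (\<Sum>K\<in>\<D>. Sup K - Inf K) < Min (range d)"
    have "(\<Sum>K\<in>\<D>. norm (f (Sup K) - f (Inf K))) \<le> (\<Sum>K\<in>\<D>. \<Sum>i\<in>UNIV. norm (f (Sup K) $ i - f (Inf K) $ i))"
      unfolding norm_vec_def vector_minus_component[symmetric] by (intro sum_mono L2_set_le_sum) simp
    also have "\<dots> = (\<Sum>i\<in>UNIV. \<Sum>K\<in>\<D>. norm (f (Sup K) $ i - f (Inf K) $ i))" by (rule sum.swap)
    also have "\<dots> < (\<Sum>i\<in>(UNIV :: 'n set). e')"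
    proof (rule sum_strict_mono)
      fix i :: 'n
      have "Min (range d) \<le> d i" by simp
      then show "(\<Sum>K\<in>\<D>. norm (f (Sup K) $ i - f (Inf K) $ i)) < e'" using * by (intro d(2)[of _ i]) linarith
    qed auto
    also have "\<dots> = e" by (simp add: e'_def)
    finally show "(\<Sum>K\<in>\<D>. norm (f (Sup K) - f (Inf K))) < e" .
  qed
qed

lemma has_vector_derivative_vec:
  fixes f :: "real \<Rightarrow> 'a::real_normed_vector ^ 'n::finite"
  assumes "\<And>i. ((\<lambda>t. f t $ i) has_vector_derivative f' $ i) F"
  shows "(f has_vector_derivative f') F"
  unfolding has_vector_derivative_def has_derivative_def
proof
  show "bounded_linear (\<lambda>x. x *\<^sub>R f')" by (rule bounded_linear_scaleR_left)
  show "((\<lambda>y. (f y - f (Lim F (\<lambda>x. x)) - (y - Lim F (\<lambda>x. x)) *\<^sub>R f') /\<^sub>R norm (y - Lim F (\<lambda>x. x))) \<longlongrightarrow> 0) F"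
  proof (rule vec_tendstoI)
    fix i
    have "((\<lambda>y. (f y $ i - f (Lim F (\<lambda>x. x)) $ i - (y - Lim F (\<lambda>x. x)) *\<^sub>R f' $ i) /\<^sub>R norm (y - Lim F (\<lambda>x. x))) \<longlongrightarrow> 0) F"
      using assms[of i] by (simp only: has_vector_derivative_def has_derivative_def)
    then show "((\<lambda>y. ((f y - f (Lim F (\<lambda>x. x)) - (y - Lim F (\<lambda>x. x)) *\<^sub>R f') /\<^sub>R norm (y - Lim F (\<lambda>x. x))) $ i) \<longlongrightarrow> 0 $ i) F"
      by simp
  qed
qed

lemma has_vector_derivative_nth: "(f has_vector_derivative f') F \<Longrightarrow> ((\<lambda>t. f t $ i) has_vector_derivative f' $ i) F"
  by (rule bounded_linear.has_vector_derivative[OF bounded_linear_vec_nth])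

lemma AE_lebesgue_iff_negligible: "(AE t in lebesgue. P t) \<longleftrightarrow> negligible {t. \<not> P t}"
  by (auto simp: eventually_ae_filter negligible_iff_null_sets[symmetric] elim: negligible_subset)

lemma AE_lebesgue_on_iff_negligible:
  "S \<in> sets lebesgue \<Longrightarrow> (AE t in lebesgue_on S. P t) \<longleftrightarrow> negligible {t \<in> S. \<not> P t}"
  by (simp add: AE_restrict_space_iff AE_lebesgue_iff_negligible)

context dyn_interval
begin

lemma comp_coeff_shift: "Suc k < m \<Longrightarrow> (\<Sum>r\<in>{..<m} \<times> UNIV. comp_coeff m A (k, p) r t * w r) = w (Suc k, p)"
  by (simp add: comp_coeff_def if_distrib[of "\<lambda>x. x * _"] if_distrib[of "\<lambda>f. f t"] cong: if_cong)

lemma comp_coeff_last: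
  assumes "\<not> Suc k < m" and A: "\<And>l p q. l < m \<Longrightarrow> A l t $ p $ q = ae_bounded (\<lambda>t. A l t $ p $ q) t"
  shows "(\<Sum>r\<in>{..<m} \<times> UNIV. comp_coeff m A (k, p) r t * w r) = (\<Sum>l<m. \<Sum>q\<in>UNIV. A l t $ p $ q * w (l, q))"
  unfolding sum.cartesian_product by (rule sum.cong) (use assms in \<open>auto simp: comp_coeff_def A[symmetric]\<close>)

text \<open>The first order system contains the bounded representatives, the ordinary problem the
  coefficients themselves; off this null set the two agree.\<close>

lemma coefficients_bounded_AE:
  fixes m :: nat
  assumes A: "\<And>k. k < m \<Longrightarrow> A k \<in> Ginf_mat I"
  shows "negligible {t \<in> I. \<exists>k<m. \<exists>p q. A k t $ p $ q \<noteq> ae_bounded (\<lambda>t. A k t $ p $ q) t}"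
proof (rule negligible_subset)
  show "negligible (\<Union>i\<in>{..<m} \<times> UNIV \<times> UNIV. {t \<in> I. \<not> A (fst i) t $ fst (snd i) $ snd (snd i) = ae_bounded (\<lambda>t. A (fst i) t $ fst (snd i) $ snd (snd i)) t})"
  proof (rule negligible_Union)
    fix N assume "N \<in> (\<lambda>i. {t \<in> I. \<not> A (fst i) t $ fst (snd i) $ snd (snd i) = ae_bounded (\<lambda>t. A (fst i) t $ fst (snd i) $ snd (snd i)) t}) ` ({..<m} \<times> UNIV \<times> UNIV)"
    then obtain k p q where k: "k < m" and N: "N = {t \<in> I. \<not> A k t $ p $ q = ae_bounded (\<lambda>t. A k t $ p $ q) t}" by auto
    have "(\<lambda>t. A k t $ p $ q) \<in> Ginf I" using A[OF k] by (simp add: Ginf_mat_def)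
    from ae_bounded(1)[OF this] show "negligible N" unfolding N ae_eq_def by (rule AE_negligible)
  qed (intro finite_imageI finite_cartesian_product, simp_all)
qed (auto, metis lessThan_iff)

section \<open>The ordinary Cauchy problem and its comparison with the distributional one\<close>

text \<open>The columns of the integral system are assembled into matrices. Below the top order the
  integrand is continuous, so the derivative exists everywhere; at the top order Lebesgue's theorem
  gives it almost everywhere.\<close>

lemma ordinary_solution_exists:
  fixes X :: "nat \<Rightarrow> complex ^ 'n ^ 'n::finite"
  assumes t0: "t0 \<in> I" and A: "\<And>k. k < m \<Longrightarrow> A k \<in> Ginf_mat I" and m: "m \<ge> 1"
    and f: "\<And>j s. right_summable t0 (last_row m f j s)" and E: "einterval (ereal t0) b = I \<inter> {t0<..}"
  shows "\<exists>x. ordinary_solution b m A t0 X f x"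
proof -
  let ?S = "{..<m} \<times> (UNIV :: 'n set)"
  obtain M where B: "bdd_coeffs ?S (comp_coeff m A) M" using comp_coeff_bdd[of m A, OF A] by blast
  have "\<exists>w. \<forall>j. integral_system ?S (comp_coeff m A) (last_row m f j) (\<lambda>s. X (fst s) $ snd s $ j) t0 (w j)"
    by (intro choice allI integral_system_exists[OF B t0] f)
  then obtain w where w: "\<And>j. integral_system ?S (comp_coeff m A) (last_row m f j) (\<lambda>s. X (fst s) $ snd s $ j) t0 (w j)"
    by blast
  define h where "h j s z = (\<Sum>r\<in>?S. comp_coeff m A s r z * w j r z) + last_row m f j s z" for j s z
  have wc: "continuous_on {t0..q} (w j (k, p))" if "k < m" "q \<in> I" for j k p q
    using w[of j] that by (simp add: integral_system_def)
  have we: "w j (k, p) t = X k $ p $ j + integral {t0..t} (h j (k, p))" if "k < m" "t \<in> I" "t0 \<le> t" for j k p t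
    using w[of j] that by (simp add: integral_system_def h_def[abs_def])
  have hi: "h j (k, p) absolutely_integrable_on {t0..q}" if "k < m" "q \<in> I" for j k p q
    unfolding h_def[abs_def] by (rule integral_system_rhs[OF B t0]) (use that wc f in auto)
  have h_shift: "h j (k, p) z = w j (Suc k, p) z" if "Suc k < m" for j k p z
    using that by (simp add: h_def comp_coeff_shift last_row_def)
  define Y where "Y k t = (\<chi> p j. w j (k, p) t)" for k t
  \<comment> \<open>\<open>y m\<close> is defined by the equation, so the equation holds at every
    point and exceptional points arise only from the differentiability of
    \<open>y (m - 1)\<close>.\<close>
  define y where "y k = (if k < m then Y k else (\<lambda>t. (\<Sum>l<m. A l t ** Y l t) + f t))" for k
  have y_nth: "y k t $ p $ j = w j (k, p) t" if "k < m" for k t p j using that by (simp add: y_def Y_def)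
  have right_point: "\<exists>q\<in>I. t < q" if "t \<in> I" for t using larger_point[OF that that] by metis
  let ?k = "m - 1"
  have k: "?k < m" "\<not> Suc ?k < m" using m by auto
  have deriv_eq: "((\<lambda>t. w j (k, p) t) has_vector_derivative h j (k, p) t) (at t)"
    if D: "((\<lambda>t. integral {t0..t} (h j (k, p))) has_vector_derivative h j (k, p) t) (at t)" and k: "k < m" and t: "t \<in> I" "t0 < t"
    for j k p t
  proof -
    obtain q where q: "q \<in> I" "t < q" using right_point[OF t(1)] by blast
    have "((\<lambda>t. X k $ p $ j + integral {t0..t} (h j (k, p))) has_vector_derivative 0 + h j (k, p) t) (at t)"
      by (intro has_vector_derivative_add D has_vector_derivative_const)
    then have "((\<lambda>t. X k $ p $ j + integral {t0..t} (h j (k, p))) has_vector_derivative h j (k, p) t) (at t)" by simp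
    then show ?thesis
    proof (rule has_vector_derivative_transform_within_open)
      show "open {t0<..<q}" "t \<in> {t0<..<q}" using q t by auto
      show "X k $ p $ j + integral {t0..z} (h j (k, p)) = w j (k, p) z" if "z \<in> {t0<..<q}" for z
        using we[OF k, of z] subsetD[OF Icc_subset_I[OF t0 q(1)], of z] that by simp
    qed
  qed
  have d1: "(y k has_vector_derivative y (Suc k) t) (at t)" if k: "Suc k < m" and t: "t \<in> einterval (ereal t0) b" for k t
  proof (intro has_vector_derivative_vec)
    fix p j
    have t': "t \<in> I" "t0 < t" using t E by auto
    obtain q where q: "q \<in> I" "t < q" using right_point[OF t'(1)] by blast
    have "continuous_on {t0..q} (w j (Suc k, p))" by (rule wc[OF k q(1)])
    then have "continuous_on {t0..q} (h j (k, p))" using h_shift[OF k] by (simp cong: continuous_on_cong)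
    from integral_has_vector_derivative[OF this, of t]
    have "((\<lambda>u. integral {t0..u} (h j (k, p))) has_vector_derivative h j (k, p) t) (at t)"
      using t' q by (simp add: at_within_Icc_at)
    from deriv_eq[OF this _ t'] k
    show "((\<lambda>t. y k t $ p $ j) has_vector_derivative y (Suc k) t $ p $ j) (at t)"
      by (simp add: y_nth h_shift)
  qed
  have d2: "abs_continuous_on {c..d} (y ?k)" if cd: "{c..d} \<subseteq> einterval (ereal t0) b" for c d
  proof (intro abs_continuous_on_vec)
    fix p j
    \<comment> \<open>If \<open>{c..d}\<close> is empty, \<open>d\<close> need not lie in
      \<open>I\<close>, and \<open>t0\<close> takes its place.\<close>
    define q where "q = (if c \<le> d then d else t0)"
    have q: "q \<in> I" "{c..d} \<subseteq> {t0..q}" using cd E t0 by (auto simp: q_def)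
    have "abs_continuous_on {t0..q} (w j (?k, p))"
      by (rule abs_continuous_on_indefinite_integral[OF hi[OF k(1) q(1)]])
         (use we[OF k(1)] subsetD[OF Icc_subset_I[OF t0 q(1)]] in auto)
    then show "abs_continuous_on {c..d} (\<lambda>t. y ?k t $ p $ j)"
      unfolding y_nth[OF k(1)] by (rule abs_continuous_on_subset[OF _ q(2)])
  qed
  have Esets: "einterval (ereal t0) b \<in> sets lebesgue" by simp
  have d3: "AE t in lebesgue_on (einterval (ereal t0) b). (y ?k has_vector_derivative y m t) (at t) \<and>
      y m t - (\<Sum>k<m. A k t ** y k t) = f t"
    unfolding AE_lebesgue_on_iff_negligible[OF Esets]
  proof (rule negligible_subset)
    let ?N = "\<lambda>q j p. {x \<in> {t0<..<q}. \<not> ((\<lambda>t. integral {t0..t} (h j (?k, p))) has_vector_derivative h j (?k, p) x) (at x)}"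
    let ?A = "{t \<in> I. \<exists>k<m. \<exists>p q. A k t $ p $ q \<noteq> ae_bounded (\<lambda>t. A k t $ p $ q) t}"
    \<comment> \<open>Differentiability almost everywhere is known on the intervals
      \<open>{t0<..<q}\<close>; countably many of them, with rational \<open>q\<close>, cover the
      part of \<open>I\<close> to the right of \<open>t0\<close>.\<close>
    let ?R = "\<Union>i\<in>(I \<inter> \<rat>) \<times> UNIV \<times> UNIV. ?N (fst i) (fst (snd i)) (snd (snd i))"
    have "negligible ?R"
    proof (rule negligible_countable_Union)
      have "countable (I \<inter> \<rat>)" using countable_rat by (rule countable_subset[rotated]) simp
      then show "countable ((\<lambda>i. ?N (fst i) (fst (snd i)) (snd (snd i))) ` ((I \<inter> \<rat>) \<times> UNIV \<times> UNIV))"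
        by (intro countable_image countable_SIGMA uncountable_def[THEN iffD1]) auto
      fix N assume "N \<in> (\<lambda>i. ?N (fst i) (fst (snd i)) (snd (snd i))) ` ((I \<inter> \<rat>) \<times> UNIV \<times> UNIV)"
      then obtain q j p where N: "N = ?N q j p" and q: "q \<in> I" by auto
      show "negligible N" unfolding N
        by (rule indefinite_integral_has_vector_derivative_AE) (rule set_lebesgue_integral_eq_integral(1)[OF hi[OF k(1) q]])
    qed
    then show "negligible (?R \<union> ?A)" using coefficients_bounded_AE[OF A] by (rule negligible_Un)
    show "{t \<in> einterval (ereal t0) b. \<not> ((y ?k has_vector_derivative y m t) (at t) \<and>
      y m t - (\<Sum>k<m. A k t ** y k t) = f t)} \<subseteq> ?R \<union> ?A"
    proof
      fix t assume "t \<in> {t \<in> einterval (ereal t0) b. \<not> ((y ?k has_vector_derivative y m t) (at t) \<and>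
        y m t - (\<Sum>k<m. A k t ** y k t) = f t)}"
      then have t: "t \<in> I" "t0 < t" and nt: "\<not> ((y ?k has_vector_derivative y m t) (at t) \<and>
        y m t - (\<Sum>k<m. A k t ** y k t) = f t)" using E by auto
      have eq: "y m t - (\<Sum>k<m. A k t ** y k t) = f t" by (simp add: y_def)
      show "t \<in> ?R \<union> ?A"
      proof (rule ccontr)
        assume n: "t \<notin> ?R \<union> ?A"
        obtain q' where q': "q' \<in> I" "t < q'" using right_point[OF t(1)] by blast
        obtain q where q: "q \<in> \<rat>" "t < q" "q < q'" using Rats_dense_in_real[OF q'(2)] by blast
        have qI: "q \<in> I" by (rule ivl_I[OF t(1) q'(1)]) (use q in auto)
        have "(y ?k has_vector_derivative y m t) (at t)"
        proof (intro has_vector_derivative_vec)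
          fix p j
          have "t \<notin> ?N q j p"
          proof
            assume "t \<in> ?N q j p"
            then have "t \<in> ?R" using q qI by (intro UN_I[of "(q, j, p)"]) auto
            then show False using n by blast
          qed
          then have D: "((\<lambda>t. integral {t0..t} (h j (?k, p))) has_vector_derivative h j (?k, p) t) (at t)"
            using t q by simp
          have "h j (?k, p) t = (\<Sum>l<m. \<Sum>q\<in>UNIV. A l t $ p $ q * w j (l, q) t) + f t $ p $ j"
            unfolding h_def using n t k(2) by (subst comp_coeff_last) (auto simp: last_row_def)
          also have "\<dots> = y m t $ p $ j" by (simp add: y_def Y_def matrix_matrix_mult_def)
          finally show "((\<lambda>t. y ?k t $ p $ j) has_vector_derivative y m t $ p $ j) (at t)"
            using deriv_eq[OF D k(1) t] by (simp only: y_nth[OF k(1)])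
        qed
        then show False using nt eq by blast
      qed
    qed
  qed
  have d4: "(y k \<longlongrightarrow> X k) (at_right t0)" if k: "k < m" for k
  proof (intro vec_tendstoI)
    fix p j
    obtain q where q: "q \<in> I" "t0 < q" using right_point[OF t0] by blast
    have "(w j (k, p) \<longlongrightarrow> w j (k, p) t0) (at_right t0)" by (rule continuous_on_Icc_at_rightD[OF wc[OF k q(1)] q(2)])
    then show "((\<lambda>t. y k t $ p $ j) \<longlongrightarrow> X k $ p $ j) (at_right t0)" using we[OF k t0, of j p] by (simp add: y_nth[OF k])
  qed
  have "ordinary_solution b m A t0 X f (y 0)" unfolding ordinary_solution_def
  proof (intro exI[of _ y] conjI allI impI ballI)
    show "AE t in lebesgue_on (einterval (ereal t0) b). (y ?k has_vector_derivative y m t) (at t) \<and>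
      y m t - (\<Sum>k<m. A k t ** y k t) = f t" by (rule d3)
  qed (blast intro: d1 d2 d4)+
  then show ?thesis by blast
qed

text \<open>The regularity of an ordinary solution is available only on compact subintervals of the
  open interval, so the integral equation is first proved from \<open>c > t0\<close>. The limits
  \<open>X k\<close> make \<open>w\<close> continuous at \<open>t0\<close>, and then
  \<open>c\<close> can tend to \<open>t0\<close>.\<close>

lemma ordinary_solution_integral_system:
  fixes X :: "nat \<Rightarrow> complex ^ 'n ^ 'n::finite"
  assumes t0: "t0 \<in> I" and A: "\<And>k. k < m \<Longrightarrow> A k \<in> Ginf_mat I" and m: "m \<ge> 1"
    and f: "\<And>j s. right_summable t0 (last_row m f j s)" and E: "einterval (ereal t0) b = I \<inter> {t0<..}"
    and x: "ordinary_solution b m A t0 X f x"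
  shows "\<exists>w. integral_system ({..<m} \<times> UNIV) (comp_coeff m A) (last_row m f j) (\<lambda>s. X (fst s) $ snd s $ j) t0 w
    \<and> (\<forall>p. \<forall>t>t0. w (0, p) t = x t $ p $ j)"
proof -
  let ?S = "{..<m} \<times> (UNIV :: 'n set)" and ?k = "m - 1" and ?E = "einterval (ereal t0) b"
  have k: "?k < m" "\<not> Suc ?k < m" using m by auto
  obtain M where B: "bdd_coeffs ?S (comp_coeff m A) M" using comp_coeff_bdd[of m A, OF A] by blast
  obtain y where y0: "y 0 = x"
    and d1: "\<And>k t. Suc k < m \<Longrightarrow> t \<in> ?E \<Longrightarrow> (y k has_vector_derivative y (Suc k) t) (at t)"
    and d2: "\<And>c d. {c..d} \<subseteq> ?E \<Longrightarrow> abs_continuous_on {c..d} (y ?k)"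
    and d3: "AE t in lebesgue_on ?E. (y ?k has_vector_derivative y m t) (at t) \<and> y m t - (\<Sum>k<m. A k t ** y k t) = f t"
    and d4: "\<And>k. k < m \<Longrightarrow> (y k \<longlongrightarrow> X k) (at_right t0)"
    using x unfolding ordinary_solution_def by blast
  define w where "w s t = (if t \<le> t0 then X (fst s) $ snd s $ j else y (fst s) t $ snd s $ j)" for s t
  define h where "h s z = (\<Sum>r\<in>?S. comp_coeff m A s r z * w r z) + last_row m f j s z" for s z
  have sub: "{c..d} \<subseteq> ?E" if "t0 < c" "d \<in> I" for c d
    unfolding E using ivl_I[OF t0 that(2)] that by auto
  have yc: "continuous_on {c..d} (\<lambda>t. y k t $ p $ j)" if k': "k < m" and cd: "t0 < c" "d \<in> I" for k p c d
  proof (cases "Suc k < m")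
    case True
    have "isCont (\<lambda>t. y k t $ p $ j) t" if "t \<in> {c..d}" for t
    proof -
      have "t \<in> ?E" using that sub[OF cd] by blast
      from has_vector_derivative_continuous[OF d1[OF True this]] show ?thesis by (intro isCont_vec_nth)
    qed
    then show ?thesis by (intro continuous_at_imp_continuous_on ballI)
  next
    case False
    then have "k = ?k" using k' by simp
    then show ?thesis using abs_continuous_on_continuous_on[OF d2[OF sub[OF cd]]] by (auto intro!: continuous_intros)
  qed
  have wc: "continuous_on {t0..q} (w s)" if s: "s \<in> ?S" and q: "q \<in> I" for s q
  proof (cases "t0 < q")
    case False
    then have "{t0..q} \<subseteq> {t0}" by auto
    then show ?thesis by (rule continuous_on_subset[rotated]) simp
  next
    case True
    have "(w s \<longlongrightarrow> X (fst s) $ snd s $ j) (at_right t0)"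
    proof (rule Lim_transform_eventually)
      show "((\<lambda>t. y (fst s) t $ snd s $ j) \<longlongrightarrow> X (fst s) $ snd s $ j) (at_right t0)"
        by (intro tendsto_vec_nth d4) (use s in auto)
      show "\<forall>\<^sub>F t in at_right t0. y (fst s) t $ snd s $ j = w s t"
        using eventually_at_right_less by (rule eventually_mono) (simp add: w_def)
    qed
    moreover have "w s t0 = X (fst s) $ snd s $ j" by (simp add: w_def)
    moreover have "w s \<midarrow>t\<rightarrow> w s t" if t: "t0 < t" "t \<le> q" for t
    proof -
      have tI: "t \<in> I" by (rule ivl_I[OF t0 q]) (use t in auto)
      obtain r where r: "r \<in> I" "t < r" using larger_point[OF tI tI] by metis
      have "continuous_on {(t0 + t) / 2..r} (\<lambda>t. y (fst s) t $ snd s $ j)" by (rule yc) (use s t r in auto)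
      then have c: "isCont (\<lambda>t. y (fst s) t $ snd s $ j) t" by (rule continuous_on_interior) (use t r in auto)
      have ev: "\<forall>\<^sub>F u in nhds t. y (fst s) u $ snd s $ j = w s u"
        using eventually_nhds_in_open[of "{t0<..}" t] t by (auto elim!: eventually_mono simp: w_def)
      from isCont_cong[OF ev] c show ?thesis by (simp add: isCont_def)
    qed
    ultimately show ?thesis using True by (intro continuous_on_IccI) (auto intro: tendsto_within_subset)
  qed
  have hi: "h s absolutely_integrable_on {t0..q}" if "s \<in> ?S" "q \<in> I" for s q
    unfolding h_def[abs_def] by (rule integral_system_rhs[OF B t0]) (use that wc f in auto)
  define N where "N = {t \<in> ?E. \<not> ((y ?k has_vector_derivative y m t) (at t) \<and> y m t - (\<Sum>k<m. A k t ** y k t) = f t)}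
    \<union> {t \<in> I. \<exists>k<m. \<exists>p q. A k t $ p $ q \<noteq> ae_bounded (\<lambda>t. A k t $ p $ q) t}"
  have Esets: "?E \<in> sets lebesgue" by simp
  have N: "negligible N" unfolding N_def
    by (rule negligible_Un[OF d3[unfolded AE_lebesgue_on_iff_negligible[OF Esets]] coefficients_bounded_AE[OF A]])
  have N': "((\<lambda>t. y ?k t $ p $ j) has_vector_derivative h (?k, p) t) (at t)" if t: "t \<in> ?E" "t \<notin> N" for t p
  proof -
    have d: "(y ?k has_vector_derivative y m t) (at t)" "y m t = (\<Sum>k<m. A k t ** y k t) + f t"
      using t by (auto simp: N_def algebra_simps)
    have t': "t \<in> I" "t0 < t" using t E by auto
    have "h (?k, p) t = (\<Sum>l<m. \<Sum>q\<in>UNIV. A l t $ p $ q * w (l, q) t) + f t $ p $ j"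
      unfolding h_def using t(2) t' k(2) by (subst comp_coeff_last) (auto simp: last_row_def N_def)
    also have "\<dots> = y m t $ p $ j" using t' by (simp add: d(2) w_def matrix_matrix_mult_def)
    finally show ?thesis using has_vector_derivative_nth[OF has_vector_derivative_nth[OF d(1)], where i1 = p and i = j] by simp
  qed
  have step: "(h s has_integral w s t - w s c) {c..t}" if s: "s \<in> ?S" and ct: "t0 < c" "c \<le> t" "t \<in> I" for s c t
  proof -
    obtain l p where lp: "s = (l, p)" and l: "l < m" using s by auto
    have cE: "{c..t} \<subseteq> ?E" by (rule sub[OF ct(1,3)])
    have "(h s has_integral y l t $ p $ j - y l c $ p $ j) {c..t}"
    proof (cases "Suc l < m")
      case True
      have "((\<lambda>z. y (Suc l) z $ p $ j) has_integral y l t $ p $ j - y l c $ p $ j) {c..t}"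
      proof (rule fundamental_theorem_of_calculus[OF ct(2)])
        fix z assume "z \<in> {c..t}"
        then have "(y l has_vector_derivative y (Suc l) z) (at z)" using cE by (intro d1 True) auto
        then show "((\<lambda>z. y l z $ p $ j) has_vector_derivative y (Suc l) z $ p $ j) (at z within {c..t})"
          by (intro has_vector_derivative_nth) (rule has_vector_derivative_at_within)
      qed
      then show ?thesis
        by (rule has_integral_eq[rotated]) (use ct True in \<open>auto simp: lp h_def comp_coeff_shift last_row_def w_def\<close>)
    next
      case False
      then have l': "l = ?k" using l by simp
      show ?thesis unfolding lp l'
      proof (rule abs_continuous_on_has_integral_deriv[OF _ ct(2) N])
        show "abs_continuous_on {c..t} (\<lambda>z. y ?k z $ p $ j)" by (intro abs_continuous_on_nth d2 cE)
        show "((\<lambda>z. y ?k z $ p $ j) has_vector_derivative h (?k, p) z) (at z within {c..t})" if "z \<in> {c..t} - N" for z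
          by (rule has_vector_derivative_at_within[OF N']) (use that cE in auto)
      qed
    qed
    then show ?thesis using ct by (simp add: w_def lp)
  qed
  have "integral_system ?S (comp_coeff m A) (last_row m f j) (\<lambda>s. X (fst s) $ snd s $ j) t0 w"
    unfolding integral_system_def
  proof (intro ballI conjI impI f wc)
    fix s t assume s: "s \<in> ?S" and t: "t \<in> I" "t0 \<le> t"
    have hI: "h s integrable_on {t0..t}" using hi[OF s t(1)] by (rule set_lebesgue_integral_eq_integral(1))
    have "w s t = X (fst s) $ snd s $ j + integral {t0..t} (h s)"
    proof (cases "t = t0")
      case True then show ?thesis by (simp add: w_def)
    next
      case False
      then have tt: "t0 < t" using t by simp
      have "w s t0 - integral {t0..t0} (h s) = w s t - integral {t0..t} (h s)"
      proof (rule continuous_constant_on_closure[of "{t0<..<t}" "\<lambda>c. w s c - integral {t0..c} (h s)"])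
        have "continuous_on {t0..t} (\<lambda>c. w s c - integral {t0..c} (h s))"
          by (intro continuous_on_diff wc s t indefinite_integral_continuous_1 hI)
        then show "continuous_on (closure {t0<..<t}) (\<lambda>c. w s c - integral {t0..c} (h s))" using tt by simp
        fix c assume c: "c \<in> {t0<..<t}"
        have "integral {t0..c} (h s) + integral {c..t} (h s) = integral {t0..t} (h s)"
          by (rule Henstock_Kurzweil_Integration.integral_combine[OF _ _ hI]) (use c in auto)
        moreover have "integral {c..t} (h s) = w s t - w s c" using step[OF s, of c t] c t by (auto intro: integral_unique)
        ultimately show "w s c - integral {t0..c} (h s) = w s t - integral {t0..t} (h s)" by (simp add: algebra_simps)
      qed (use tt in auto)
      then show ?thesis by (simp add: w_def algebra_simps)
    qed
    then show "w s t = X (fst s) $ snd s $ j + integral {t0..t} (\<lambda>z. (\<Sum>r\<in>?S. comp_coeff m A s r z * w r z) + last_row m f j s z)"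
      by (simp add: h_def[abs_def])
  qed
  moreover have "\<forall>p. \<forall>t>t0. w (0, p) t = x t $ p $ j" by (simp add: w_def y0)
  ultimately show ?thesis by blast
qed

lemma right_dist_regular_dist:
  assumes w: "right_summable t0 w" and t0: "t0 \<in> I" and \<phi>: "\<phi> \<in> RR I" and x: "\<And>t. t0 < t \<Longrightarrow> w t = x t"
  shows "right_dist t0 w \<phi> = regular_dist (I \<inter> {t0<..}) x \<phi>"
proof -
  obtain p q where pq: "p \<in> I" "q \<in> I" "\<phi> \<in> Rstep I {p..q}" using RR_ex_step[OF \<phi>] by metis
  have sets: "I \<inter> {t0<..} \<in> sets lebesgue" by (intro sets.Int I_sets) auto
  have i: "(\<lambda>t. w t * \<phi> t) absolutely_integrable_on I \<inter> {t0<..}"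
    by (rule set_integrable_subset[OF right_dist_eq(2)[OF w t0 pq(3,2) order_refl] sets]) auto
  have "regular_dist (I \<inter> {t0<..}) x \<phi> = (LINT t:I \<inter> {t0<..}|lebesgue. w t * \<phi> t)"
    unfolding regular_dist_def by (rule set_lebesgue_integral_cong[OF sets]) (simp add: x)
  also have "\<dots> = integral (I \<inter> {t0<..}) (\<lambda>t. w t * \<phi> t)" by (rule set_lebesgue_integral_eq_integral(2)[OF i])
  also have "\<dots> = right_dist t0 w \<phi>" unfolding right_dist_def
    by (rule integral_spike_set; rule negligible_subset[of "{t0}"]) auto
  finally show ?thesis ..
qed

text \<open>Uniqueness for systems of distributions does the comparison, column by column; what
  remains is to match the gauge integral over \<open>I \<inter> {t0..}\<close> with the Lebesgue
  integral over the open half.\<close>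

lemma cauchy_solution_coincides_after:
  fixes X :: "nat \<Rightarrow> complex ^ 'n ^ 'n::finite"
  assumes t0: "t0 \<in> I" and F: "F \<in> RR_dual_mat I" "vanishes_before I t0 F" and f: "regular_mat I f F"
    and A: "\<And>k. k < m \<Longrightarrow> A k \<in> Ginf_mat I" and m: "m \<ge> 1" and E: "einterval (ereal t0) b = I \<inter> {t0<..}"
    and Z: "cauchy_solution I m A t0 X F \<alpha> Z" and x: "ordinary_solution b m A t0 X f x"
  shows "coincides_after I t0 Z x"
  unfolding coincides_after_def
proof (intro allI ballI impI)
  fix i j \<phi> assume \<phi>: "\<phi> \<in> RR I"
  obtain w where w: "integral_system ({..<m} \<times> UNIV) (comp_coeff m A) (last_row m f j) (\<lambda>s. X (fst s) $ snd s $ j) t0 w"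
    and wx: "\<forall>p. \<forall>t>t0. w (0, p) t = x t $ p $ j"
    using ordinary_solution_integral_system[OF t0 A m comp_rhs_regular(1)[OF t0 F f] E x] by blast
  have "right_summable t0 (w (0, i))"
    using w m by (auto simp: integral_system_def right_summable_def absolutely_integrable_continuous_real)
  from right_dist_regular_dist[OF this t0 \<phi>, of "\<lambda>t. x t $ i $ j"] wx
  show "(Z $ i $ j) \<phi> = regular_dist (I \<inter> {t0<..}) (\<lambda>t. x t $ i $ j) \<phi>"
    using integral_system_cauchy[OF t0 F f A m w Z \<phi>] by simp
qed

end

text \<open>In the first claim the order of the quantifiers is the point: one \<open>Z\<close>
  serves every \<open>\<alpha>\<close> and is unique for each of them. In the second, the existence
  of an ordinary solution is included so that the coincidence is not vacuous.\<close>

theorem theorem3p4: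
  fixes a b :: ereal and I :: "real set" and m :: nat
    and A :: "nat \<Rightarrow> real \<Rightarrow> complex ^ 'n ^ 'n::finite"
    and t0 :: real
    and X :: "nat \<Rightarrow> complex ^ 'n ^ 'n"
    and F :: "'n dist_mat"
  assumes "I = einterval a b"
    and "m \<ge> 1"
    and "\<And>k. k < m \<Longrightarrow> A k \<in> Ginf_mat I"
    and "t0 \<in> I"
    and "F \<in> RR_dual_mat I"
    and "vanishes_before I t0 F"
  shows "(\<exists>Z. \<forall>\<alpha>. cauchy_solution I m A t0 X F \<alpha> Z
               \<and> (\<forall>W. cauchy_solution I m A t0 X F \<alpha> W \<longrightarrow> dist_mat_eq I W Z))
       \<and> (\<forall>f. regular_mat I f F \<longrightarrow>
           (\<exists>x. ordinary_solution b m A t0 X f x)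
           \<and> (\<forall>\<alpha> Z x. cauchy_solution I m A t0 X F \<alpha> Z \<longrightarrow> ordinary_solution b m A t0 X f x
                \<longrightarrow> coincides_after I t0 Z x))"
proof -
  interpret dyn_interval I
  proof
    show "open I" using assms(1) by simp
    show "I \<noteq> {}" using assms(4) by blast
    show "y \<in> I" if "x \<in> I" "z \<in> I" "x \<le> y" "y \<le> z" for x y z
    proof -
      have "a < ereal x" "ereal x \<le> ereal y" "ereal y \<le> ereal z" "ereal z < b"
        using that by (simp_all add: assms(1) einterval_iff)
      then have "a < ereal y" "ereal y < b" by (meson less_le_trans le_less_trans)+
      then show ?thesis by (simp add: assms(1) einterval_iff)
    qed
  qed
  have "a < ereal t0" using assms(4) by (simp add: assms(1) einterval_iff)
  then have "a < ereal x" if "t0 < x" for x using that less_trans[of a "ereal t0" "ereal x"] by simp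
  then have E: "einterval (ereal t0) b = I \<inter> {t0<..}" by (auto simp: assms(1) einterval_iff)
  note t0 = assms(4) and F = assms(5,6) and A = assms(3) and m = assms(2)
  show ?thesis
  proof (intro conjI allI impI)
    show "\<exists>Z. \<forall>\<alpha>. cauchy_solution I m A t0 X F \<alpha> Z \<and> (\<forall>W. cauchy_solution I m A t0 X F \<alpha> W \<longrightarrow> dist_mat_eq I W Z)"
      by (rule cauchy_solution_ex_unique[OF t0 F A m])
    fix f assume f: "regular_mat I f F"
    show "\<exists>x. ordinary_solution b m A t0 X f x"
      by (rule ordinary_solution_exists[OF t0 A m comp_rhs_regular(1)[OF t0 F f] E])
    show "coincides_after I t0 Z x"
      if "cauchy_solution I m A t0 X F \<alpha> Z" "ordinary_solution b m A t0 X f x" for \<alpha> Z x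
      by (rule cauchy_solution_coincides_after[OF t0 F f A m E that])
  qed
qed

end
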